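(* (Embedding formula for the field.) Let $H=\partial_y+ik\theta_{\rm in}$. Then on $\mathcal{R}$ $$H[u](x,y,\nu_* )=H[u_{\rm sc}](x,y,\nu_* )=\sum_{n=-\infty}^{\infty}e^{-ikx_n\theta_{\rm in}^2/2}\,V_{1-n}(\theta_{\rm in})\,w_n(x,y,\nu_* ),\qquad \nu=1,2.$$
   Context: Let $0<b<a$ and let $k\in\mathbb{C}$ with $\operatorname{Re}k>0$ and (small) $\operatorname{Im}k>0$. Put $x_{2n}=an$, $x_{2n+1}=an+b$ for $n\in\mathbb{Z}$. Let $\mathcal{R}$ be the two-sheeted branched surface over the $(x,y)$-plane with branch points of order 2 at $(x_n,0)$, $n\in\mathbb{Z}$. Cut $\mathcal{R}$ along the half-lines $x=x_n$, $y<0$, into two sheets denoted $1_*$ and $2_*$; a function on $\mathcal{R}$ is written $f(x,y,\nu_* )$, $\nu=1,2$. Crossing a cut exchanges the sheets: continuity on $\mathcal{R}$ means $f(x_n+0,y,\nu_* )=f(x_n-0,y,(3-\nu)_* )$ for $y<0$, while $f(\cdot,\cdot,\nu_* )$ is continuous across $x=x_n$, $y>0$. The parabolic operator is $L=\partial_x+(2ik)^{-1}\partial_y^2$, and its Green's function on the plane is $G(x,y)=\sqrt{\frac{k}{2\pi i x}}\,e^{iky^2/(2x)}$ for $x>0$ (principal root), $G=0$ for $x<0$. Diffraction problem. Let $\theta_{\rm in}\in\mathbb{C}$, $\operatorname{Re}\theta_{\rm in}>0$, be such that $k\theta_{\rm in}^2$ is real and positive (so $\operatorname{Im}(k\theta_{\rm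 in})>0$). Put $\psi_n=\sqrt{\theta_{\rm in}^2+4\pi n/(ka)}$ with the branch for which $\operatorname{Im}(k\psi_n)>0$ (it is assumed that no $\psi_n$ vanishes). The incident wave, present only in the upper half-plane $y>0$ of sheet $1_*$, is $u_{\rm in}=e^{-ikx\theta_{\rm in}^2/2-ik\theta_{\rm in}y}$. The total field $u$ is the solution of $L[u]=0$ on $\mathcal{R}$ which is continuous on $\mathcal{R}$ (except at the branch points), bounded near the branch points, satisfies the Floquet property $u(x+a,y,\nu_* )=e^{-ika\theta_{\rm in}^2/2}u(x,y,\nu_* )$, and is such that the scattered field $u_{\rm sc}$ (equal to $u-u_{\rm in}$ in the upper half-plane of sheet $1_*$ and to $u$ elsewhere) tends to $0$ as $|y|\to\infty$. ($H[u_{\rm sc}]$ is computed separately in the upper and lower half-planes of the sheets.) Edge Green's functions. $w_n(x,y,\nu_* )$, $n\in\mathbb{Z}$, is the field on $\mathcal{R}$ satisfying $L[w_n](x,y,\nu_* )=(-1)^{\nu-1}\delta(x-(x_n+0))\delta(y)$ and vanishing for $x<x_n$. Explicitly: $w_n(x,y,2_* )=-w_n(x,y,1_* )$; $w_n(x,y,1_* )=0$ for $x<x_n$; $w_n(x,y,1_* )=G(x-x_n,y)$ for $x_n<x<x_{n+1}$; and for $m>n$, $x_m<x<x_{m+1}$, $w_n(x,y,1_* )=\int_{-\infty}^\infty w_n(x_m+0,y',1_* )G(x-x_m,y-y')\,dy'$, where $w_n(x_m+0,y',1_* )=\operatorname{sign}(y')\,w_n(x_m-0,y',1_* )$. Directivities.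 $V_n(\theta)$ is defined for $\theta>0$ by $w_n(x,y,1_* )=V_n\!\left(\frac{y}{x-x_n}\right)G(x-x_n,y)+o(G(x-x_n,y))$ in $y>0$; at complex arguments $\theta$ (with $\operatorname{Im}(k\theta)>0$) it is given by its integral representation $$V_n(\theta)=1+2\sum_{m=n+1}^{\infty}e^{ik(x_m-x_n)\theta^2/2}\int_{-\infty}^{0}w_n(x_m+0,y,1_* )e^{-ik\theta y}\,dy.$$ *)

theory Defs
  imports "HOL-Analysis.Analysis"
begin

text \<open>
  A function on the branched surface is given by its values f x y \<nu> on the two cut sheets
  \<nu> = 1, 2.  On a cut (x = x_n, y < 0) the value f x y \<nu> stands for the right-hand one,
  i.e. for f(x_n + 0, y, \<nu>).  Values at branch points and for other \<nu> are
  irrelevant.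
\<close>

type_synonym field = "real \<Rightarrow> real \<Rightarrow> nat \<Rightarrow> complex"

definition edge :: "real \<Rightarrow> real \<Rightarrow> int \<Rightarrow> real" where
  "edge a b n = a * real_of_int (n div 2) + (if even n then 0 else b)"

definition branch_points :: "real \<Rightarrow> real \<Rightarrow> (real \<times> real) set" where
  "branch_points a b = {(edge a b n, 0) | n. True}"

text \<open>
  Charts of the surface.  The n-th pair of charts lives over the strip between x_(n-1) and
  x_(n+1), slit along y = 0 to the left of the branch point (x_n, 0) inclusive.  Points are
  labelled by the sheet \<nu> on which they lie to the right of x_n, so for y < 0 the sheet to the
  left of x_n is 3 - \<nu>.  These charts cover the whole surface without the branch points.
\<close>

definition chart_domain :: "real \<Rightarrow> real \<Rightarrow> int \<Rightarrow> (real \<times> real) set" where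
  "chart_domain a b n =
     {(x, y). edge a b (n - 1) < x \<and> x < edge a b (n + 1) \<and> \<not> (y = 0 \<and> x \<le> edge a b n)}"

definition in_chart ::
    "real \<Rightarrow> real \<Rightarrow> field \<Rightarrow> int \<Rightarrow> nat \<Rightarrow> real \<Rightarrow> real \<Rightarrow> complex" where
  "in_chart a b f n \<nu> x y = (if x < edge a b n \<and> y < 0 then f x y (3 - \<nu>) else f x y \<nu>)"

definition dx :: "(real \<Rightarrow> real \<Rightarrow> complex) \<Rightarrow> real \<Rightarrow> real \<Rightarrow> complex" where
  "dx F x y = vector_derivative (\<lambda>s. F s y) (at x)"

definition dy :: "(real \<Rightarrow> real \<Rightarrow> complex) \<Rightarrow> real \<Rightarrow> real \<Rightarrow> complex" where
  "dy F x y = vector_derivative (\<lambda>t. F x t) (at y)"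

definition parabolic :: "complex \<Rightarrow> (real \<Rightarrow> real \<Rightarrow> complex) \<Rightarrow> real \<Rightarrow> real \<Rightarrow> complex" where
  "parabolic k F x y = dx F x y + dy (dy F) x y / (2 * \<i> * k)"

definition classical_solution_on ::
    "complex \<Rightarrow> (real \<times> real) set \<Rightarrow> (real \<Rightarrow> real \<Rightarrow> complex) \<Rightarrow> bool" where
  "classical_solution_on k D F \<longleftrightarrow>
     (\<forall>(x, y)\<in>D. (\<lambda>s. F s y) differentiable (at x) \<and> (\<lambda>t. F x t) differentiable (at y) \<and>
        (\<lambda>t. dy F x t) differentiable (at y)) \<and>
     continuous_on D (\<lambda>(x, y). dx F x y) \<and>
     continuous_on D (\<lambda>(x, y). dy F x y) \<and>
     continuous_on D (\<lambda>(x, y). dy (dy F) x y) \<and>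
     (\<forall>(x, y)\<in>D. parabolic k F x y = 0)"

definition continuous_on_surface :: "real \<Rightarrow> real \<Rightarrow> field \<Rightarrow> bool" where
  "continuous_on_surface a b f \<longleftrightarrow>
     (\<forall>n. \<forall>\<nu>\<in>{1, 2}. continuous_on (chart_domain a b n) (\<lambda>(x, y). in_chart a b f n \<nu> x y))"

definition solves_on_surface :: "real \<Rightarrow> real \<Rightarrow> complex \<Rightarrow> field \<Rightarrow> bool" where
  "solves_on_surface a b k f \<longleftrightarrow>
     (\<forall>n. \<forall>\<nu>\<in>{1, 2}. classical_solution_on k (chart_domain a b n) (in_chart a b f n \<nu>))"

definition bounded_near_branch_points :: "real \<Rightarrow> real \<Rightarrow> field \<Rightarrow> bool" where
  "bounded_near_branch_points a b f \<longleftrightarrow>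
     (\<forall>p\<in>branch_points a b. \<exists>r>0. \<exists>B. \<forall>x y. \<forall>\<nu>\<in>{1, 2}.
        dist (x, y) p < r \<and> (x, y) \<noteq> p \<longrightarrow> norm (f x y \<nu>) \<le> B)"

definition floquet :: "real \<Rightarrow> real \<Rightarrow> complex \<Rightarrow> complex \<Rightarrow> field \<Rightarrow> bool" where
  "floquet a b k \<theta> f \<longleftrightarrow>
     (\<forall>x y. \<forall>\<nu>\<in>{1, 2}. (x, y) \<notin> branch_points a b \<longrightarrow>
        f (x + a) y \<nu> = exp (- \<i> * k * of_real a * \<theta>\<^sup>2 / 2) * f x y \<nu>)"

definition u_inc :: "complex \<Rightarrow> complex \<Rightarrow> field" where
  "u_inc k \<theta> x y \<nu> =
     (if \<nu> = 1 \<and> y > 0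
      then exp (- \<i> * k * of_real x * \<theta>\<^sup>2 / 2 - \<i> * k * \<theta> * of_real y) else 0)"

definition scattered :: "complex \<Rightarrow> complex \<Rightarrow> field \<Rightarrow> field" where
  "scattered k \<theta> u x y \<nu> = u x y \<nu> - u_inc k \<theta> x y \<nu>"

text \<open>
  Decay as y tends to plus or minus infinity is read uniformly in x.  By the Floquet property, whose
  multiplier has modulus 1 when k * theta^2 is real, this is uniformity over one period.
\<close>

definition decays :: "real \<Rightarrow> real \<Rightarrow> field \<Rightarrow> bool" where
  "decays a b f \<longleftrightarrow>
     (\<forall>\<epsilon>>0. \<exists>Y. \<forall>x y. \<forall>\<nu>\<in>{1, 2}. \<bar>y\<bar> > Y \<and> (x, y) \<notin> branch_points a b \<longrightarrow> norm (f x y \<nu>) < \<epsilon>)"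

definition total_field :: "real \<Rightarrow> real \<Rightarrow> complex \<Rightarrow> complex \<Rightarrow> field \<Rightarrow> bool" where
  "total_field a b k \<theta> u \<longleftrightarrow>
     continuous_on_surface a b u \<and> solves_on_surface a b k u \<and>
     bounded_near_branch_points a b u \<and> floquet a b k \<theta> u \<and>
     decays a b (scattered k \<theta> u)"

text \<open>
  The square root with Im (k * psi) > 0.  The second alternative of the conditional also covers
  a vanishing radicand, where psi is 0.
\<close>

definition psi :: "real \<Rightarrow> complex \<Rightarrow> complex \<Rightarrow> int \<Rightarrow> complex" where
  "psi a k \<theta> n =
     (let s = csqrt (\<theta>\<^sup>2 + 4 * of_real pi * of_int n / (k * of_real a))
      in if Im (k * s) > 0 then s else - s)"

definition green :: "complex \<Rightarrow> real \<Rightarrow> real \<Rightarrow> complex" where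
  "green k x y =
     (if x > 0
      then csqrt (k / (2 * of_real pi * \<i> * of_real x))
           * exp (\<i> * k * (of_real y)\<^sup>2 / (2 * of_real x))
      else 0)"

text \<open>
  strip_field n j is the formula for w_n on sheet 1 over x_(n+j) < x < x_(n+j+1).  The formula
  is continuous up to the right end of the strip, so its value there is the left-hand limit
  w_n(x_(n+j+1) - 0, y).
\<close>

primrec strip_field ::
    "real \<Rightarrow> real \<Rightarrow> complex \<Rightarrow> int \<Rightarrow> nat \<Rightarrow> real \<Rightarrow> real \<Rightarrow> complex" where
  "strip_field a b k n 0 x y = green k (x - edge a b n) y"
| "strip_field a b k n (Suc j) x y =
     (LINT y'|lborel. of_real (sgn y') * strip_field a b k n j (edge a b (n + int j + 1)) y'
        * green k (x - edge a b (n + int j + 1)) (y - y'))"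

text \<open>
  edge_trace n j y is w_n(x_(n+j) + 0, y, 1); for j = 0 this right-hand limit vanishes for all
  y \<noteq> 0.
\<close>

definition edge_trace ::
    "real \<Rightarrow> real \<Rightarrow> complex \<Rightarrow> int \<Rightarrow> nat \<Rightarrow> real \<Rightarrow> complex" where
  "edge_trace a b k n j y =
     (case j of 0 \<Rightarrow> 0
      | Suc i \<Rightarrow> of_real (sgn y) * strip_field a b k n i (edge a b (n + int j)) y)"

definition strip_of :: "real \<Rightarrow> real \<Rightarrow> real \<Rightarrow> int" where
  "strip_of a b x = (THE m. edge a b m \<le> x \<and> x < edge a b (m + 1))"

definition edge_green :: "real \<Rightarrow> real \<Rightarrow> complex \<Rightarrow> int \<Rightarrow> field" where
  "edge_green a b k n x y \<nu> = (- 1) ^ (\<nu> - 1) *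
     (if x < edge a b n then 0
      else let m = strip_of a b x; j = nat (m - n)
           in if x = edge a b m then edge_trace a b k n j y else strip_field a b k n j x y)"

definition directivity :: "real \<Rightarrow> real \<Rightarrow> complex \<Rightarrow> int \<Rightarrow> complex \<Rightarrow> complex" where
  "directivity a b k n \<theta> = 1 + 2 * (\<Sum>j.
     let m = n + 1 + int j
     in exp (\<i> * k * of_real (edge a b m - edge a b n) * \<theta>\<^sup>2 / 2)
        * (LINT y:{..0}|lborel. edge_green a b k n (edge a b m) y 1 * exp (- \<i> * k * \<theta> * of_real y)))"

definition H_op :: "complex \<Rightarrow> complex \<Rightarrow> field \<Rightarrow> field" where
  "H_op k \<theta> f x y \<nu> = dy (\<lambda>x y. f x y \<nu>) x y + \<i> * k * \<theta> * f x y \<nu>"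

text \<open>
  Doubly infinite series in the ordinary sense: both ends of the range of summation tend to
  infinity independently.
\<close>

definition sums_bilateral :: "(int \<Rightarrow> complex) \<Rightarrow> complex \<Rightarrow> bool" where
  "sums_bilateral t s \<longleftrightarrow>
     ((\<lambda>(M, N). \<Sum>n\<in>{- int M..int N}. t n) \<longlongrightarrow> s) (sequentially \<times>\<^sub>F sequentially)"

end

theory Submission
  imports Defs "HOL-Probability.Sinc_Integral"
begin

text \<open>
  Write V for one of the two combinations u(.,1) + u(.,2) and u(.,1) - u(.,2) of the values on
  the two sheets. Both solve the parabolic equation off the cuts and, with \<sigma> = 1 for the
  even and \<sigma> = -1 for the odd one, both are multiplied by \<sigma> when an edge is passed
  at y < 0. A solution on a strip between neighbouring edges is the convolution of its left
  trace with the Green's function (\<open>parabolic_representation\<close>), so V is determined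
  by its traces f_n(y) = V(x_n - 0, y), which satisfy f_(n+1) = G * (s f_n), where s(y) = 1 for
  y > 0 and s(y) = \<sigma> for y < 0. The surface is thereby replaced by a recursion for
  functions on the line.

  The operator H commutes with convolution. Since it annihilates the incident wave, it may be
  applied to the trace minus the incident wave, which decays exponentially
  (\<open>half_plane_decay\<close>, \<open>trace_decay\<close>); here the hypothesis that no
  psi_n vanishes enters. Passing an edge multiplies the trace by s, and differentiation of the
  resulting jump at y = 0 produces the point source (1 - \<sigma>) f_n(0) \<delta>(y)
  (\<open>H_conv\<close>). Hence H V is a superposition of fields radiated by point sources at
  the edges, that is of edge Green's functions, plus what arrives from the far left
  (\<open>h_expansion\<close>).

  What arrives from the far left vanishes. By the Floquet property the data far to the left are,
  up to a unimodular factor, fixed exponentially decaying functions, and propagation over many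
  strips tends weakly to 0 (\<open>propagation_tendsto_weakly_0\<close>). The reason for the
  latter is dissipation: as Im k > 0, each strip reduces the L2 norm by a weighted mean square
  of all differences F(y) - F(y') of the propagated function F (\<open>conv_energy\<close>).
  These losses have a finite sum, so that F has asymptotically no differences left while its L2
  norm stays bounded. Consequently H V = 0 for the even combination, and H V is the sum of 2
  f_n(0) w_n for the odd one, and H u is, up to sign, half of the latter on each sheet.

  It remains to compute the amplitudes f_n(0). The reflection x \<rightarrow> b - x maps the
  edge n to the edge 1 - n (\<open>edge_reflect\<close>), so the Green's function w_(1-n), read
  from right to left, solves the adjoint problem with source at the edge n. Hence its pairing
  with the traces f_m, m < n, does not depend on m and equals f_n(0) (\<open>pairing_f\<close>).
  In this pairing the scattered part of the trace contributes nothing in the limit m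
  \<rightarrow> -\<infinity>, again by weak decay, whereas the incident wave loses at every edge
  twice the integral of its product with w_(1-n) over y < 0 (\<open>pairing_e\<close>). These
  integrals are the terms of the series for V_(1-n)(\<theta>) (\<open>directivity_eq\<close>).
\<close>

section \<open>Exponentially weighted functions and convolution\<close>

text \<open>
  The rate c may have either sign: traces minus the incident wave decay, while the incident wave
  itself has the rate -Im (k \<theta>) < 0. Both have to be convolved and paired with Gaussians.
\<close>

definition edecay :: "real \<Rightarrow> (real \<Rightarrow> complex) \<Rightarrow> bool" where
  "edecay c f \<longleftrightarrow> f \<in> borel_measurable borel \<and> (\<exists>C. \<forall>y. norm (f y) \<le> C * exp (- c * \<bar>y\<bar>))"

lemma edecayI:
  "f \<in> borel_measurable borel \<Longrightarrow> (\<And>y. norm (f y) \<le> C * exp (- c * \<bar>y\<bar>)) \<Longrightarrow> edecay c f"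
  unfolding edecay_def by blast

lemma edecay_measurable [measurable_dest]: "edecay c f \<Longrightarrow> f \<in> borel_measurable borel"
  unfolding edecay_def by blast

lemma edecayE:
  assumes "edecay c f"
  obtains C where "C > 0" "\<And>y. norm (f y) \<le> C * exp (- c * \<bar>y\<bar>)"
proof -
  from assms obtain C where C: "\<And>y. norm (f y) \<le> C * exp (- c * \<bar>y\<bar>)"
    unfolding edecay_def by blast
  have "norm (f y) \<le> (\<bar>C\<bar> + 1) * exp (- c * \<bar>y\<bar>)" for y
    using C[of y] by (rule order_trans) (auto intro!: mult_right_mono)
  with that[of "\<bar>C\<bar> + 1"] show thesis by force
qed

lemma edecay_mult:
  assumes "edecay c f" "edecay d g"
  shows "edecay (c + d) (\<lambda>y. f y * g y)"
proof -
  obtain C where C: "C > 0" "\<And>y. norm (f y) \<le> C * exp (- c * \<bar>y\<bar>)" using assms(1) by (rule edecayE) blast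
  obtain D where D: "D > 0" "\<And>y. norm (g y) \<le> D * exp (- d * \<bar>y\<bar>)" using assms(2) by (rule edecayE) blast
  have [measurable]: "f \<in> borel_measurable borel" "g \<in> borel_measurable borel"
    using assms by (auto dest: edecay_measurable)
  show ?thesis
  proof (rule edecayI[where C = "C * D"])
    fix y
    have "norm (f y * g y) \<le> (C * exp (- c * \<bar>y\<bar>)) * (D * exp (- d * \<bar>y\<bar>))"
      unfolding norm_mult by (intro mult_mono C D) (use C(1) in auto)
    also have "\<dots> = C * D * exp (- (c + d) * \<bar>y\<bar>)"
      by (simp add: exp_add[symmetric] algebra_simps)
    finally show "norm (f y * g y) \<le> C * D * exp (- (c + d) * \<bar>y\<bar>)" .
  qed simp
qed

lemma edecay_add:
  assumes "edecay c f" "edecay c g"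
  shows "edecay c (\<lambda>y. f y + g y)"
proof -
  obtain C where C: "C > 0" "\<And>y. norm (f y) \<le> C * exp (- c * \<bar>y\<bar>)" using assms(1) by (rule edecayE) blast
  obtain D where D: "D > 0" "\<And>y. norm (g y) \<le> D * exp (- c * \<bar>y\<bar>)" using assms(2) by (rule edecayE) blast
  have [measurable]: "f \<in> borel_measurable borel" "g \<in> borel_measurable borel"
    using assms by (auto dest: edecay_measurable)
  show ?thesis
  proof (rule edecayI[where C = "C + D"])
    fix y
    show "norm (f y + g y) \<le> (C + D) * exp (- c * \<bar>y\<bar>)"
      using norm_triangle_ineq[of "f y" "g y"] C(2)[of y] D(2)[of y] by (simp add: algebra_simps)
  qed simp
qed

lemma edecay_bounded_mult:
  assumes "edecay c f" "g \<in> borel_measurable borel" "\<And>y. norm (g y) \<le> B"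
  shows "edecay c (\<lambda>y. g y * f y)"
proof -
  have "edecay (0 + c) (\<lambda>y. g y * f y)"
    by (intro edecay_mult assms edecayI[where C = B]) (use assms in auto)
  then show ?thesis by simp
qed

lemma edecay_cmult: "edecay c f \<Longrightarrow> edecay c (\<lambda>y. z * f y)"
  by (rule edecay_bounded_mult[where B = "norm z"]) auto

lemma edecay_zero: "edecay c (\<lambda>_. 0)"
  by (rule edecayI[where C = 0]) auto

lemma edecay_sum: "(\<And>i. i \<in> I \<Longrightarrow> edecay c (f i)) \<Longrightarrow> edecay c (\<lambda>y. \<Sum>i\<in>I. f i y)"
  by (induction I rule: infinite_finite_induct) (auto intro!: edecay_add edecay_zero)

lemma edecay_cnj: "edecay c f \<Longrightarrow> edecay c (\<lambda>y. cnj (f y))"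
  unfolding edecay_def using measurable_compose[of f borel borel cnj borel] borel_measurable_continuous_onI[OF continuous_on_cnj[OF continuous_on_id]]
  by simp

lemma edecay_norm: "edecay c f \<Longrightarrow> edecay c (\<lambda>y. of_real (norm (f y)))"
  unfolding edecay_def by auto

lemma edecay_mono: assumes "edecay c f" "d \<le> c" shows "edecay d f"
proof -
  obtain C where C: "C > 0" "\<And>y. norm (f y) \<le> C * exp (- c * \<bar>y\<bar>)" using assms(1) by (rule edecayE) blast
  show ?thesis
  proof (rule edecayI)
    fix y
    have "d * \<bar>y\<bar> \<le> c * \<bar>y\<bar>" using assms(2) by (intro mult_right_mono) auto
    then show "norm (f y) \<le> C * exp (- d * \<bar>y\<bar>)"
      using C(2)[of y] C(1) by (smt (verit) exp_le_cancel_iff mult_left_mono mult_minus_left)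
  qed (use assms edecay_measurable in blast)
qed

lemma integrable_exp_abs:
  assumes "c > 0"
  shows "integrable lborel (\<lambda>y::real. exp (- c * \<bar>y\<bar>))"
proof -
  have 1: "integrable lborel (\<lambda>y::real. indicator {0<..} y * exp (- (y * c)))"
    using integrable_I0i_exp_mscale[OF assms] by (simp add: set_integrable_def)
  have 2: "integrable lborel (\<lambda>y::real. indicator {0<..} (-y) * exp (y * c))"
    using lborel_integrable_real_affine[OF 1, of "-1" 0] by simp
  have "AE y in lborel. norm (exp (- c * \<bar>y\<bar>)) \<le>
      norm (indicator {0<..} y * exp (- (y * c)) + indicator {0<..} (-y) * exp (y * c) :: real)"
    using AE_lborel_singleton[of 0]
    by eventually_elim (auto simp: indicator_def abs_if mult.commute)
  note ae = this
  show ?thesis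
    by (rule Bochner_Integration.integrable_bound[OF Bochner_Integration.integrable_add[OF 1 2] _ ae]) measurable
qed

lemma edecay_integrable:
  assumes "edecay c f" "c > 0"
  shows "integrable lborel f"
proof -
  obtain C where C: "C > 0" "\<And>y. norm (f y) \<le> C * exp (- c * \<bar>y\<bar>)" using assms(1) by (rule edecayE) blast
  show ?thesis
    by (rule Bochner_Integration.integrable_bound[of _ "\<lambda>y. C * exp (- c * \<bar>y\<bar>)"])
       (use C edecay_measurable[OF assms(1)] integrable_exp_abs[OF assms(2)] in \<open>auto intro!: AE_I2 order_trans[OF C(2)]\<close>)
qed

lemma edecay_mult_integrable:
  "edecay c f \<Longrightarrow> edecay d g \<Longrightarrow> c + d > 0 \<Longrightarrow> integrable lborel (\<lambda>y. f y * g y)"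
  using edecay_mult edecay_integrable by blast

lemma integral_translate_reflect:
  fixes f :: "real \<Rightarrow> 'a :: {banach, second_countable_topology}"
  shows "(LINT y|lborel. f (t - y)) = (LINT y|lborel. f y)"
  using lborel_integral_real_affine[of "-1" f t] by simp

lemma integral_translate:
  fixes f :: "real \<Rightarrow> 'a :: {banach, second_countable_topology}"
  shows "(LINT y|lborel. f (t + y)) = (LINT y|lborel. f y)"
  using lborel_integral_real_affine[of "1" f t] by simp

lemma integrable_translate_reflect:
  fixes f :: "real \<Rightarrow> 'a :: {banach, second_countable_topology}"
  shows "integrable lborel (\<lambda>y. f (t - y)) \<longleftrightarrow> integrable lborel f"
  using lborel_integrable_real_affine_iff[of "-1" f t] by simp

text \<open>
  All applications of Fubini below go through this bound: a kernel K(y - y') is small away from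
  the diagonal, and one decaying factor controls the diagonal.
\<close>

lemma pair_integrable_bound:
  fixes F :: "real \<times> real \<Rightarrow> 'a :: {banach, second_countable_topology}"
  assumes [measurable]: "F \<in> borel_measurable (lborel \<Otimes>\<^sub>M lborel)"
    and "\<delta> > 0" and F: "\<And>x y. norm (F (x, y)) \<le> C * exp (- \<delta> * \<bar>x\<bar>) * exp (- \<delta> * \<bar>x - y\<bar>)"
  shows "integrable (lborel \<Otimes>\<^sub>M lborel) F"
proof -
  define G :: "real \<times> real \<Rightarrow> real" where "G = (\<lambda>(x,y). C * exp (- \<delta> * \<bar>x\<bar>) * exp (- \<delta> * \<bar>x - y\<bar>))"
  have int: "integrable lborel (\<lambda>y. exp (- \<delta> * \<bar>x - y\<bar>))" for x :: real
    using integrable_translate_reflect[of "\<lambda>y. exp (- \<delta> * \<bar>y\<bar>)" x] integrable_exp_abs[OF \<open>\<delta> > 0\<close>] by simp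
  have eq: "(LINT y|lborel. exp (- \<delta> * \<bar>x - y\<bar>)) = (LINT y|lborel. exp (- \<delta> * \<bar>y\<bar>))" for x :: real
    using integral_translate_reflect[of "\<lambda>y. exp (- \<delta> * \<bar>y\<bar>)" x] by simp
  have "integrable (lborel \<Otimes>\<^sub>M lborel) G"
  proof (rule lborel_pair.Fubini_integrable)
    show "G \<in> borel_measurable (lborel \<Otimes>\<^sub>M lborel)" unfolding G_def by measurable
    have "(\<lambda>x. LINT y|lborel. norm (G (x, y))) =
       (\<lambda>x. exp (- \<delta> * \<bar>x\<bar>) * (\<bar>C\<bar> * (LINT y|lborel. exp (- \<delta> * \<bar>y\<bar>))))"
      unfolding G_def by (simp add: abs_mult eq mult_ac eq[unfolded mult_minus_left])
    then show "integrable lborel (\<lambda>x. LINT y|lborel. norm (G (x, y)))"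
      using integrable_exp_abs[OF \<open>\<delta> > 0\<close>] by simp
    show "AE x in lborel. integrable lborel (\<lambda>y. G (x, y))"
      unfolding G_def using int by simp
  qed
  then show ?thesis
    by (rule Bochner_Integration.integrable_bound) (use F in \<open>auto intro!: AE_I2 order_trans[OF F] simp: G_def\<close>)
qed

definition conv :: "(real \<Rightarrow> complex) \<Rightarrow> (real \<Rightarrow> complex) \<Rightarrow> real \<Rightarrow> complex" where
  "conv K f y = (LINT y'|lborel. K (y - y') * f y')"

text \<open>
  Convolution with such a kernel preserves every rate, in particular the negative ones.
\<close>

definition rapid :: "(real \<Rightarrow> complex) \<Rightarrow> bool" where
  "rapid K \<longleftrightarrow> (\<forall>c. edecay c K)"

lemma rapidD: "rapid K \<Longrightarrow> edecay c K"
  unfolding rapid_def by blast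

lemma rapid_measurable [measurable_dest]: "rapid K \<Longrightarrow> K \<in> borel_measurable borel"
  using rapidD edecay_measurable by blast

lemma rapid_bound:
  assumes "rapid K"
  obtains C where "C > 0" "\<And>y. norm (K y) \<le> C * exp (- c * \<bar>y\<bar>)"
  using edecayE[OF rapidD[OF assms, of c]] by blast

lemma exp_shift_bound: "exp (- c * \<bar>y'\<bar>) \<le> exp (- c * \<bar>y\<bar>) * exp (\<bar>c\<bar> * \<bar>y - y'\<bar>)" for c y y' :: real
proof -
  have "c * (\<bar>y\<bar> - \<bar>y'\<bar>) \<le> \<bar>c\<bar> * \<bar>\<bar>y\<bar> - \<bar>y'\<bar>\<bar>" by (metis abs_ge_self abs_mult)
  also have "\<dots> \<le> \<bar>c\<bar> * \<bar>y - y'\<bar>" by (intro mult_left_mono) auto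
  finally show ?thesis by (simp add: exp_add[symmetric] algebra_simps)
qed

lemma conv_pointwise_bound:
  assumes K: "rapid K" and f: "edecay c f"
  obtains C where "C > 0" "\<And>y y'. norm (K (y - y') * f y') \<le> C * exp (- c * \<bar>y\<bar>) * exp (- d * \<bar>y - y'\<bar>)"
proof -
  obtain A where A: "A > 0" "\<And>y. norm (K y) \<le> A * exp (- (d + \<bar>c\<bar>) * \<bar>y\<bar>)" using rapid_bound[OF K] by blast
  obtain B where B: "B > 0" "\<And>y. norm (f y) \<le> B * exp (- c * \<bar>y\<bar>)" using f by (rule edecayE) blast
  show thesis
  proof (rule that[of "A * B"])
    show "A * B > 0" using A B by simp
    fix y y'
    have "norm (K (y - y') * f y') \<le> (A * exp (- (d + \<bar>c\<bar>) * \<bar>y - y'\<bar>)) * (B * exp (- c * \<bar>y'\<bar>))"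
      unfolding norm_mult by (intro mult_mono A B) (use A(1) in auto)
    also have "\<dots> \<le> (A * exp (- (d + \<bar>c\<bar>) * \<bar>y - y'\<bar>)) * (B * (exp (- c * \<bar>y\<bar>) * exp (\<bar>c\<bar> * \<bar>y - y'\<bar>)))"
      by (intro mult_left_mono exp_shift_bound) (use A(1) B(1) in auto)
    also have "\<dots> = A * B * exp (- c * \<bar>y\<bar>) * exp (- d * \<bar>y - y'\<bar>)"
      by (simp add: mult_exp_exp algebra_simps)
    finally show "norm (K (y - y') * f y') \<le> A * B * exp (- c * \<bar>y\<bar>) * exp (- d * \<bar>y - y'\<bar>)" .
  qed
qed

lemma integrable_exp_abs_shift:
  assumes "c > 0"
  shows "integrable lborel (\<lambda>y::real. exp (- c * \<bar>x - y\<bar>))"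
  using integrable_translate_reflect[of "\<lambda>y. exp (- c * \<bar>y\<bar>)" x] integrable_exp_abs[OF assms] by simp

lemma conv_integrable:
  assumes K: "rapid K" and f: "edecay c f"
  shows "integrable lborel (\<lambda>y'. K (y - y') * f y')"
proof -
  obtain C where C: "C > 0" "\<And>y y'. norm (K (y - y') * f y') \<le> C * exp (- c * \<bar>y\<bar>) * exp (- 1 * \<bar>y - y'\<bar>)"
    using conv_pointwise_bound[OF K f] by blast
  have [measurable]: "K \<in> borel_measurable borel" "f \<in> borel_measurable borel"
    using K f by (auto dest: edecay_measurable rapid_measurable)
  show ?thesis
    by (rule Bochner_Integration.integrable_bound[of _ "\<lambda>y'. C * exp (- c * \<bar>y\<bar>) * exp (- 1 * \<bar>y - y'\<bar>)"])
       (use C integrable_exp_abs_shift[of 1 y] in \<open>auto intro!: AE_I2 order_trans[OF C(2)]\<close>)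
qed

lemma edecay_conv:
  assumes K: "rapid K" and f: "edecay c f"
  shows "edecay c (conv K f)"
proof -
  obtain C where C: "C > 0" "\<And>y y'. norm (K (y - y') * f y') \<le> C * exp (- c * \<bar>y\<bar>) * exp (- 1 * \<bar>y - y'\<bar>)"
    using conv_pointwise_bound[OF K f] by blast
  have [measurable]: "K \<in> borel_measurable borel" "f \<in> borel_measurable borel"
    using K f by (auto dest: edecay_measurable rapid_measurable)
  show ?thesis
  proof (rule edecayI[where C = "C * (LINT y|lborel. exp (- 1 * \<bar>y\<bar>))"])
    show "conv K f \<in> borel_measurable borel" unfolding conv_def[abs_def] by measurable
    fix y
    have "norm (conv K f y) \<le> (LINT y'|lborel. C * exp (- c * \<bar>y\<bar>) * exp (- 1 * \<bar>y - y'\<bar>))"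
      unfolding conv_def
      by (rule Bochner_Integration.integral_norm_bound_integral[OF conv_integrable[OF K f]])
         (use C integrable_exp_abs_shift[of 1 y] in auto)
    also have "\<dots> = C * (LINT y|lborel. exp (- 1 * \<bar>y\<bar>)) * exp (- c * \<bar>y\<bar>)"
      using integral_translate_reflect[of "\<lambda>y. exp (- 1 * \<bar>y\<bar>)" y] by simp
    finally show "norm (conv K f y) \<le> C * (LINT y|lborel. exp (- 1 * \<bar>y\<bar>)) * exp (- c * \<bar>y\<bar>)" .
  qed
qed

lemma conv_add: "rapid K \<Longrightarrow> edecay c f \<Longrightarrow> edecay d g \<Longrightarrow> conv K (\<lambda>y. f y + g y) y = conv K f y + conv K g y"
  unfolding conv_def using conv_integrable[of K c f y] conv_integrable[of K d g y]
  by (simp add: distrib_left)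

lemma conv_cmult: "conv K (\<lambda>y. z * f y) y = z * conv K f y"
  unfolding conv_def by (subst integral_mult_right_zero[symmetric]) (simp add: mult_ac)

lemma conv_sum:
  "rapid K \<Longrightarrow> (\<And>i. i \<in> I \<Longrightarrow> edecay c (f i)) \<Longrightarrow> conv K (\<lambda>y. \<Sum>i\<in>I. f i y) y = (\<Sum>i\<in>I. conv K (f i) y)"
  unfolding conv_def using conv_integrable[of K c]
  by (simp add: sum_distrib_left Bochner_Integration.integral_sum)

text \<open>
  An even kernel is its own transpose. This turns propagation to the right of one factor into
  propagation to the left of the other.
\<close>

lemma conv_adjoint:
  assumes K: "rapid K" and f: "edecay c f" and g: "edecay d g" and cd: "c + d > 0"
    and ev: "\<And>y. K (- y) = K y"
  shows "(LINT y|lborel. conv K f y * g y) = (LINT y|lborel. f y * conv K g y)"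
proof -
  have [measurable]: "K \<in> borel_measurable borel" "f \<in> borel_measurable borel" "g \<in> borel_measurable borel"
    using K f g by (auto dest: edecay_measurable rapid_measurable)
  define \<delta> where "\<delta> = c + d"
  have "\<delta> > 0" using cd by (simp add: \<delta>_def)
  obtain C where C: "C > 0" "\<And>y y'. norm (K (y - y') * f y') \<le> C * exp (- c * \<bar>y\<bar>) * exp (- \<delta> * \<bar>y - y'\<bar>)"
    using conv_pointwise_bound[OF K f] by blast
  obtain D where D: "D > 0" "\<And>y. norm (g y) \<le> D * exp (- d * \<bar>y\<bar>)" using g by (rule edecayE) blast
  have int: "integrable (lborel \<Otimes>\<^sub>M lborel) (\<lambda>(y, y'). K (y - y') * f y' * g y)"
  proof (rule pair_integrable_bound[OF _ \<open>\<delta> > 0\<close>, of _ "C * D"])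
    fix y y'
    have "norm (K (y - y') * f y' * g y) \<le> (C * exp (- c * \<bar>y\<bar>) * exp (- \<delta> * \<bar>y - y'\<bar>)) * (D * exp (- d * \<bar>y\<bar>))"
      unfolding norm_mult[of _ "g y"] by (intro mult_mono C D) (use C(1) in auto)
    also have "\<dots> = C * D * exp (- \<delta> * \<bar>y\<bar>) * exp (- \<delta> * \<bar>y - y'\<bar>)"
      by (simp add: mult_exp_exp algebra_simps \<delta>_def)
    finally show "norm (case (y, y') of (y, y') \<Rightarrow> K (y - y') * f y' * g y) \<le> C * D * exp (- \<delta> * \<bar>y\<bar>) * exp (- \<delta> * \<bar>y - y'\<bar>)"
      by simp
  qed measurable
  have "(LINT y|lborel. conv K f y * g y) = (LINT y|lborel. LINT y'|lborel. K (y - y') * f y' * g y)"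
    unfolding conv_def by simp
  also have "\<dots> = (LINT y'|lborel. LINT y|lborel. K (y - y') * f y' * g y)"
    using lborel_pair.Fubini_integral[OF int] by simp
  also have "\<dots> = (LINT y'|lborel. LINT y|lborel. f y' * (K (y' - y) * g y))"
    using ev by (intro Bochner_Integration.integral_cong refl) (metis minus_diff_eq mult.assoc mult.commute)
  also have "\<dots> = (LINT y|lborel. f y * conv K g y)"
    unfolding conv_def by simp
  finally show ?thesis .
qed

section \<open>Differentiation under the integral sign\<close>

lemma norm_difference_quotient:
  fixes a D :: complex and x :: real
  assumes "x \<noteq> 0"
  shows "norm (a / of_real x - D) = norm (a - x *\<^sub>R D) / norm x"
proof -
  have "a / of_real x - D = (a - x *\<^sub>R D) / of_real x"
    using assms by (simp add: scaleR_conv_of_real field_simps)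
  then show ?thesis by (simp add: norm_divide)
qed

lemma has_vector_derivativeI_sequentially:
  fixes F :: "real \<Rightarrow> complex"
  assumes "d > 0" and seq: "\<And>X. (\<And>n. X n \<noteq> 0) \<Longrightarrow> (\<And>n. \<bar>X n\<bar> < d) \<Longrightarrow> X \<longlonglongrightarrow> 0 \<Longrightarrow>
      (\<lambda>n. (F (y + X n) - F y) / of_real (X n)) \<longlonglongrightarrow> D"
  shows "(F has_vector_derivative D) (at y)"
proof -
  have "((\<lambda>x. (F (y + x) - F y) / of_real x) \<longlongrightarrow> D) (at 0 within {-d<..<d})"
    unfolding tendsto_at_iff_sequentially comp_def
  proof (intro allI impI)
    fix X assume X: "\<forall>i. X i \<in> {- d<..<d} - {0}" and lim: "X \<longlonglongrightarrow> 0"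
    have "X n \<noteq> 0" "\<bar>X n\<bar> < d" for n using X[rule_format, of n] by auto
    from seq[OF this lim] show "(\<lambda>n. (F (y + X n) - F y) / of_real (X n)) \<longlonglongrightarrow> D" by blast
  qed
  then have lim: "((\<lambda>x. (F (y + x) - F y) / of_real x) \<longlongrightarrow> D) (at 0)"
    using assms(1) by (subst (asm) at_within_open) auto
  have "((\<lambda>h. norm ((F (y + h) - F y) / of_real h - D)) \<longlongrightarrow> 0) (at 0)"
    using lim by (simp add: LIM_zero tendsto_norm_zero)
  moreover have "\<forall>\<^sub>F h in at 0. norm ((F (y + h) - F y) / of_real h - D) = norm (F (y + h) - F y - h *\<^sub>R D) / norm h"
    unfolding eventually_at_filter
    by (rule always_eventually) (intro allI impI norm_difference_quotient)
  ultimately have "((\<lambda>h. norm (F (y + h) - F y - h *\<^sub>R D) / norm h) \<longlongrightarrow> 0) (at 0)"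
    by (rule Lim_transform_eventually)
  then show ?thesis
    unfolding has_vector_derivative_def has_derivative_at by (auto intro!: bounded_linear_scaleR_left)
qed

lemma norm_diff_le_derivative_bound:
  fixes f :: "real \<Rightarrow> complex"
  assumes "convex S" "\<And>x. x \<in> S \<Longrightarrow> (f has_vector_derivative f' x) (at x)"
    "\<And>x. x \<in> S \<Longrightarrow> norm (f' x) \<le> B" "x \<in> S" "y \<in> S"
  shows "norm (f x - f y) \<le> B * \<bar>x - y\<bar>"
proof -
  have "norm (f x - f y) \<le> B * norm (x - y)"
  proof (rule differentiable_bound[where f' = "\<lambda>x h. h *\<^sub>R f' x", OF \<open>convex S\<close>])
    fix z assume z: "z \<in> S"
    show "(f has_derivative (\<lambda>h. h *\<^sub>R f' z)) (at z within S)"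
      using assms(2)[OF z] by (simp add: has_vector_derivative_def has_derivative_at_withinI)
    show "onorm (\<lambda>h. h *\<^sub>R f' z) \<le> B"
    proof (rule onorm_le)
      fix h :: real
      show "norm (h *\<^sub>R f' z) \<le> B * norm h"
        using mult_right_mono[OF assms(3)[OF z], of "\<bar>h\<bar>"] by (simp add: mult.commute)
    qed
  qed (use assms in auto)
  then show ?thesis by simp
qed

text \<open>
  Difference quotients are dominated by g through the mean value inequality, so dominated
  convergence applies.
\<close>

lemma has_vector_derivative_lebesgue_integral:
  fixes f f' :: "real \<Rightarrow> real \<Rightarrow> complex"
  assumes d: "d > 0"
    and intf: "\<And>y. \<bar>y - y0\<bar> < d \<Longrightarrow> integrable lborel (f y)"
    and meas: "f' y0 \<in> borel_measurable borel"
    and der: "\<And>y z. \<bar>y - y0\<bar> < d \<Longrightarrow> ((\<lambda>y. f y z) has_vector_derivative f' y z) (at y)"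
    and bound: "\<And>y z. \<bar>y - y0\<bar> < d \<Longrightarrow> norm (f' y z) \<le> g z"
    and g: "integrable lborel g"
  shows "((\<lambda>y. LINT z|lborel. f y z) has_vector_derivative (LINT z|lborel. f' y0 z)) (at y0)"
proof (rule has_vector_derivativeI_sequentially[OF d])
  fix X :: "nat \<Rightarrow> real" assume X: "\<And>n. X n \<noteq> 0" "\<And>n. \<bar>X n\<bar> < d" "X \<longlonglongrightarrow> 0"
  have i: "integrable lborel (f (y0 + X n))" for n by (rule intf) (use X in simp)
  have i0: "integrable lborel (f y0)" by (rule intf) (use d in simp)
  have eq: "((LINT z|lborel. f (y0 + X n) z) - (LINT z|lborel. f y0 z)) / of_real (X n) =
     (LINT z|lborel. (f (y0 + X n) z - f y0 z) / of_real (X n))" for n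
    using i[of n] i0 by simp
  note [measurable] = borel_measurable_integrable[OF i] borel_measurable_integrable[OF i0]
  show "(\<lambda>n. ((LINT z|lborel. f (y0 + X n) z) - (LINT z|lborel. f y0 z)) / of_real (X n)) \<longlonglongrightarrow> (LINT z|lborel. f' y0 z)"
    unfolding eq
  proof (rule integral_dominated_convergence[where w = g])
    show "f' y0 \<in> borel_measurable lborel" using meas by simp
    show "(\<lambda>z. (f (y0 + X n) z - f y0 z) / of_real (X n)) \<in> borel_measurable lborel" for n
      by measurable
    show "AE z in lborel. (\<lambda>n. (f (y0 + X n) z - f y0 z) / of_real (X n)) \<longlonglongrightarrow> f' y0 z"
    proof (rule AE_I2)
      fix z
      have "((\<lambda>y. f y z) has_vector_derivative f' y0 z) (at y0)" using der[of y0 z] d by simp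
      then have lim: "((\<lambda>h. norm (f (y0 + h) z - f y0 z - h *\<^sub>R f' y0 z) / norm h) \<longlongrightarrow> 0) (at 0)"
        unfolding has_vector_derivative_def has_derivative_at by simp
      have "(\<lambda>n. norm (f (y0 + X n) z - f y0 z - X n *\<^sub>R f' y0 z) / norm (X n)) \<longlonglongrightarrow> 0"
        by (rule filterlim_compose[OF lim]) (use X in \<open>simp add: filterlim_at\<close>)
      moreover have "norm (f (y0 + X n) z - f y0 z - X n *\<^sub>R f' y0 z) / norm (X n) =
          norm ((f (y0 + X n) z - f y0 z) / of_real (X n) - f' y0 z)" for n
        by (rule norm_difference_quotient[OF X(1), symmetric])
      ultimately have "(\<lambda>n. norm ((f (y0 + X n) z - f y0 z) / of_real (X n) - f' y0 z)) \<longlonglongrightarrow> 0" by simp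
      then show "(\<lambda>n. (f (y0 + X n) z - f y0 z) / of_real (X n)) \<longlonglongrightarrow> f' y0 z"
        by (rule LIM_zero_cancel[OF tendsto_norm_zero_cancel])
    qed
    show "AE z in lborel. norm ((f (y0 + X n) z - f y0 z) / of_real (X n)) \<le> g z" for n
    proof (rule AE_I2)
      fix z
      have "norm (f (y0 + X n) z - f y0 z) \<le> g z * \<bar>y0 + X n - y0\<bar>"
      proof (rule norm_diff_le_derivative_bound[of "{y0 - d<..<y0 + d}" "\<lambda>y. f y z" "\<lambda>y. f' y z"])
        show "y0 + X n \<in> {y0 - d<..<y0 + d}" "y0 \<in> {y0 - d<..<y0 + d}" using X(2)[of n] d by (auto simp: abs_less_iff)
        fix t assume "t \<in> {y0 - d<..<y0 + d}"
        then have t: "\<bar>t - y0\<bar> < d" by (auto simp: abs_less_iff)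
        show "((\<lambda>y. f y z) has_vector_derivative f' t z) (at t)" by (rule der[OF t])
        show "norm (f' t z) \<le> g z" by (rule bound[OF t])
      qed simp
      then show "norm ((f (y0 + X n) z - f y0 z) / of_real (X n)) \<le> g z"
        using X(1)[of n] by (simp add: norm_divide field_simps)
    qed
  qed (use g in simp_all)
qed

section \<open>Complex Gaussian integrals\<close>

lemma gaussian_envelope:
  fixes y :: real
  assumes "p > 0"
  shows "exp (- p * y\<^sup>2) \<le> exp (d\<^sup>2 / (4 * p)) * exp (- d * \<bar>y\<bar>)"
proof -
  have "0 \<le> p * (\<bar>y\<bar> - d / (2 * p))\<^sup>2" using assms by simp
  also have "\<dots> = p * y\<^sup>2 - d * \<bar>y\<bar> + d\<^sup>2 / (4 * p)"
    using assms by (simp add: power2_diff power_divide power2_eq_square field_simps)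
  finally show ?thesis by (simp add: exp_add[symmetric])
qed

lemma power_le_fact_exp: "x ^ n \<le> fact n * exp x" if "x \<ge> 0" for x :: real
proof -
  have "(\<Sum>i\<in>{n}. x ^ i / fact i) \<le> (\<Sum>i. x ^ i / fact i)"
    by (rule sum_le_suminf) (use that summable_exp_generic[of x] in \<open>auto simp: divide_inverse mult.commute\<close>)
  then have "x ^ n / fact n \<le> exp x" by (simp add: exp_def divide_inverse mult.commute)
  then show ?thesis by (simp add: field_simps)
qed

lemma gaussian_poly_bound:
  assumes p: "p > 0" and "Re \<beta> \<ge> p"
  shows "norm (of_real y ^ j * exp (- \<beta> * of_real y ^ 2 + \<gamma> * of_real y)) \<le>
    fact j * exp ((c + 1 + norm \<gamma>)\<^sup>2 / (4 * p)) * exp (- c * \<bar>y\<bar>)"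
proof -
  have "norm (of_real y ^ j * exp (- \<beta> * of_real y ^ 2 + \<gamma> * of_real y)) =
     \<bar>y\<bar> ^ j * exp (- Re \<beta> * y\<^sup>2 + Re \<gamma> * y)"
    by (simp add: norm_mult norm_power power2_eq_square)
  also have "\<dots> \<le> (fact j * exp \<bar>y\<bar>) * exp (- p * y\<^sup>2 + norm \<gamma> * \<bar>y\<bar>)"
  proof (rule mult_mono)
    have "Re \<gamma> * y \<le> \<bar>Re \<gamma>\<bar> * \<bar>y\<bar>" by (metis abs_ge_self abs_mult)
    also have "\<dots> \<le> norm \<gamma> * \<bar>y\<bar>" by (intro mult_right_mono abs_Re_le_cmod) auto
    finally have "Re \<gamma> * y \<le> norm \<gamma> * \<bar>y\<bar>" .
    moreover have "p * y\<^sup>2 \<le> Re \<beta> * y\<^sup>2" using assms(2) by (intro mult_right_mono) auto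
    ultimately show "exp (- Re \<beta> * y\<^sup>2 + Re \<gamma> * y) \<le> exp (- p * y\<^sup>2 + norm \<gamma> * \<bar>y\<bar>)" by simp
  qed (use power_le_fact_exp[of "\<bar>y\<bar>" j] in auto)
  also have "\<dots> = fact j * exp (- p * y\<^sup>2) * exp ((1 + norm \<gamma>) * \<bar>y\<bar>)"
    by (simp add: mult_exp_exp algebra_simps)
  also have "\<dots> \<le> fact j * (exp ((c + 1 + norm \<gamma>)\<^sup>2 / (4 * p)) * exp (- (c + 1 + norm \<gamma>) * \<bar>y\<bar>)) * exp ((1 + norm \<gamma>) * \<bar>y\<bar>)"
    by (intro mult_right_mono mult_left_mono gaussian_envelope p) auto
  also have "\<dots> = fact j * exp ((c + 1 + norm \<gamma>)\<^sup>2 / (4 * p)) * exp (- c * \<bar>y\<bar>)"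
    by (simp add: mult_exp_exp algebra_simps)
  finally show ?thesis .
qed

lemma rapid_gaussian:
  assumes "Re \<beta> > 0"
  shows "rapid (\<lambda>y. of_real y ^ j * exp (- \<beta> * of_real y ^ 2 + \<gamma> * of_real y))"
  unfolding rapid_def
proof
  fix c
  show "edecay c (\<lambda>y. of_real y ^ j * exp (- \<beta> * of_real y ^ 2 + \<gamma> * of_real y))"
    by (rule edecayI[OF _ gaussian_poly_bound[OF assms order_refl]]) measurable
qed

lemma integrable_gaussian:
  assumes "Re \<beta> > 0"
  shows "integrable lborel (\<lambda>y. of_real y ^ j * exp (- \<beta> * of_real y ^ 2 + \<gamma> * of_real y) :: complex)"
  by (rule edecay_integrable[OF rapidD[OF rapid_gaussian[OF assms], of 1]]) simp

text \<open>
  The exponent is quadratic in y with coefficients depending on a real parameter. Varying the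
  quadratic coefficient gives second moments and varying the linear one gives first moments;
  together with the moment identities below this makes Gaussian integrals with complex
  coefficients solutions of ordinary differential equations.
\<close>

lemma gaussian_parameter_derivative:
  fixes A B :: "complex \<Rightarrow> complex"
  assumes d: "d > 0" and p: "p > 0"
    and A: "\<And>t. \<bar>t - s\<bar> < d \<Longrightarrow> (A has_field_derivative A') (at (of_real t))"
    and B: "\<And>t. \<bar>t - s\<bar> < d \<Longrightarrow> (B has_field_derivative B') (at (of_real t))"
    and RA: "\<And>t. \<bar>t - s\<bar> < d \<Longrightarrow> Re (A (of_real t)) \<ge> p"
    and RB: "\<And>t. \<bar>t - s\<bar> < d \<Longrightarrow> norm (B (of_real t)) \<le> q"
  shows "((\<lambda>t. LINT y|lborel. exp (- A (of_real t) * of_real y ^ 2 + B (of_real t) * of_real y)) has_vector_derivative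
     (- A' * (LINT y|lborel. of_real y ^ 2 * exp (- A (of_real s) * of_real y ^ 2 + B (of_real s) * of_real y))
      + B' * (LINT y|lborel. of_real y * exp (- A (of_real s) * of_real y ^ 2 + B (of_real s) * of_real y)))) (at s)"
proof -
  define e where "e t y = exp (- A (of_real t) * of_real y ^ 2 + B (of_real t) * of_real y)" for t y :: real
  define f' where "f' t y = (- A' * of_real y ^ 2 + B' * of_real y) * e t y" for t y :: real
  define M where "M j = fact j * exp ((1 + 1 + q)\<^sup>2 / (4 * p))" for j
  have dom: "norm (of_real y ^ j * e t y) \<le> M j * exp (- 1 * \<bar>y\<bar>)" if t: "\<bar>t - s\<bar> < d" for t y j
  proof -
    have "norm (of_real y ^ j * e t y) \<le> fact j * exp ((1 + 1 + norm (B (of_real t)))\<^sup>2 / (4 * p)) * exp (- 1 * \<bar>y\<bar>)"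
      unfolding e_def by (rule gaussian_poly_bound[OF p RA[OF t]])
    also have "\<dots> \<le> M j * exp (- 1 * \<bar>y\<bar>)"
      unfolding M_def using RB[OF t] p
      by (intro mult_left_mono mult_right_mono) (auto intro!: divide_right_mono power_mono)
    finally show ?thesis .
  qed
  have intj: "integrable lborel (\<lambda>y. of_real y ^ j * e t y)" if t: "\<bar>t - s\<bar> < d" for t j
    unfolding e_def by (rule integrable_gaussian) (use RA[OF t] p in linarith)
  have "((\<lambda>t. LINT y|lborel. e t y) has_vector_derivative (LINT y|lborel. f' s y)) (at s)"
  proof (rule has_vector_derivative_lebesgue_integral[where d = d and
        g = "\<lambda>y. norm A' * (M 2 * exp (- 1 * \<bar>y\<bar>)) + norm B' * (M 1 * exp (- 1 * \<bar>y\<bar>))"])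
    fix t :: real assume t: "\<bar>t - s\<bar> < d"
    show "integrable lborel (e t)" using intj[OF t, of 0] by simp
    fix y
    show "((\<lambda>t. e t y) has_vector_derivative f' t y) (at t)"
    proof -
      have "((\<lambda>w. exp (- A w * of_real y ^ 2 + B w * of_real y)) has_field_derivative f' t y) (at (of_real t))"
        unfolding f'_def e_def
        by (rule derivative_eq_intros A[OF t] B[OF t] refl | simp add: algebra_simps)+
      from has_vector_derivative_real_field[OF this] show ?thesis by (simp add: e_def)
    qed
    have "f' t y = - A' * (of_real y ^ 2 * e t y) + B' * (of_real y ^ 1 * e t y)"
      by (simp add: f'_def algebra_simps)
    then have "norm (f' t y) \<le> norm (- A' * (of_real y ^ 2 * e t y)) + norm (B' * (of_real y ^ 1 * e t y))"
      by (simp only: norm_triangle_ineq)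
    also have "\<dots> \<le> norm A' * (M 2 * exp (- 1 * \<bar>y\<bar>)) + norm B' * (M 1 * exp (- 1 * \<bar>y\<bar>))"
      unfolding norm_mult[of "- A'"] norm_mult[of B'] norm_minus_cancel
      by (intro add_mono mult_left_mono dom[OF t]) auto
    finally show "norm (f' t y) \<le> norm A' * (M 2 * exp (- 1 * \<bar>y\<bar>)) + norm B' * (M 1 * exp (- 1 * \<bar>y\<bar>))" .
  next
    show "f' s \<in> borel_measurable borel" unfolding f'_def e_def by measurable
  next
    have "integrable lborel (\<lambda>y::real. exp (- 1 * \<bar>y\<bar>))" by (rule integrable_exp_abs) simp
    then show "integrable lborel (\<lambda>y. norm A' * (M 2 * exp (- 1 * \<bar>y\<bar>)) + norm B' * (M 1 * exp (- 1 * \<bar>y\<bar>)))"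
      by (intro Bochner_Integration.integrable_add Bochner_Integration.integrable_mult_right)
  qed (rule d)
  moreover have "(LINT y|lborel. f' s y) = - A' * (LINT y|lborel. of_real y ^ 2 * e s y) + B' * (LINT y|lborel. of_real y * e s y)"
  proof -
    have i2: "integrable lborel (\<lambda>y. of_real y ^ 2 * e s y)" by (rule intj) (use d in simp)
    have i1: "integrable lborel (\<lambda>y. of_real y * e s y)" using intj[of s 1] d by simp
    have "(LINT y|lborel. f' s y) = (LINT y|lborel. - A' * (of_real y ^ 2 * e s y) + B' * (of_real y * e s y))"
      unfolding f'_def by (rule Bochner_Integration.integral_cong) (simp_all add: algebra_simps)
    then show ?thesis
      by (simp only: Bochner_Integration.integral_add[OF integrable_mult_right[OF i2] integrable_mult_right[OF i1]]
          integral_mult_right_zero)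
  qed
  ultimately show ?thesis unfolding e_def by simp
qed

text \<open>
  Both sides arise from differentiating the integral of exp (- \<beta> l^2 y^2) with respect to
  l at l = 1: under the integral sign, and after the substitution that shows it to be
  proportional to 1 / l.
\<close>

lemma gaussian_second_moment:
  assumes \<beta>: "Re \<beta> > 0"
  shows "(LINT y|lborel. of_real y ^ 2 * exp (- \<beta> * of_real y ^ 2)) =
     (LINT y|lborel. exp (- \<beta> * of_real y ^ 2)) / (2 * \<beta>)"
proof -
  let ?I = "LINT y|lborel. exp (- \<beta> * of_real y ^ 2)"
  let ?J = "LINT y|lborel. of_real y ^ 2 * exp (- \<beta> * of_real y ^ 2)"
  define A where "A w = \<beta> * w ^ 2" for w
  have d1: "((\<lambda>l. LINT y|lborel. exp (- (\<beta> * (of_real l)\<^sup>2) * of_real y ^ 2)) has_vector_derivative - 2 * \<beta> * ?J) (at 1)"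
  proof -
    have F: "((\<lambda>t. LINT y|lborel. exp (- (\<beta> * (1 + of_real t)) * of_real y ^ 2 + 0 * of_real y)) has_vector_derivative
       (- \<beta> * (LINT y|lborel. of_real y ^ 2 * exp (- (\<beta> * (1 + of_real 0)) * of_real y ^ 2 + 0 * of_real y))
      + 0 * (LINT y|lborel. of_real y * exp (- (\<beta> * (1 + of_real 0)) * of_real y ^ 2 + 0 * of_real y)))) (at 0)"
    proof (rule gaussian_parameter_derivative[where d = "1/2" and p = "Re \<beta> / 2" and q = 0 and
          A = "\<lambda>w. \<beta> * (1 + w)" and B = "\<lambda>_. 0"])
      fix t :: real assume t: "\<bar>t - 0\<bar> < 1 / 2"
      show "((\<lambda>w. \<beta> * (1 + w)) has_field_derivative \<beta>) (at (of_real t))"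
        by (auto intro!: derivative_eq_intros)
      have "Re \<beta> * (1 / 2) \<le> Re \<beta> * (1 + t)" using t \<beta> by (intro mult_left_mono) auto
      then show "Re \<beta> / 2 \<le> Re (\<beta> * (1 + of_real t))" by simp
    qed (use \<beta> in auto)
    have "((\<lambda>l::real. l ^ 2 - 1) has_vector_derivative 2) (at 1)"
      unfolding has_real_derivative_iff_has_vector_derivative[symmetric]
      by (auto intro!: derivative_eq_intros)
    moreover have "((\<lambda>t. LINT y|lborel. exp (- (\<beta> * (1 + of_real t)) * of_real y ^ 2)) has_vector_derivative - \<beta> * ?J) (at (1 ^ 2 - 1))"
      using F by simp
    ultimately have "((\<lambda>t. LINT y|lborel. exp (- (\<beta> * (1 + of_real t)) * of_real y ^ 2)) \<circ> (\<lambda>l. l ^ 2 - 1)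
        has_vector_derivative 2 *\<^sub>R (- \<beta> * ?J)) (at 1)"
      by (rule vector_diff_chain_at)
    then show ?thesis by (simp add: comp_def scaleR_conv_of_real mult.assoc)
  qed
  have d2: "((\<lambda>l. LINT y|lborel. exp (- (\<beta> * (of_real l)\<^sup>2) * of_real y ^ 2)) has_vector_derivative - ?I) (at 1)"
  proof (rule has_vector_derivative_transform_within_open[of "\<lambda>l. of_real (1 / l) * ?I" _ _ "{0<..}"])
    show "((\<lambda>l. of_real (1 / l) * ?I) has_vector_derivative - ?I) (at 1)"
    proof -
      have "((\<lambda>w. 1 / w * ?I) has_field_derivative - ?I) (at (of_real 1))"
        by (auto intro!: derivative_eq_intros)
      from has_vector_derivative_real_field[OF this] show ?thesis by simp
    qed
    fix l :: real assume l: "l \<in> {0<..}"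
    have "?I = \<bar>l\<bar> *\<^sub>R (LINT y|lborel. exp (- \<beta> * of_real (0 + l * y) ^ 2))"
      using l by (intro lborel_integral_real_affine) auto
    also have "\<dots> = of_real l * (LINT y|lborel. exp (- (\<beta> * (of_real l)\<^sup>2) * of_real y ^ 2))"
      using l by (simp add: scaleR_conv_of_real power_mult_distrib mult.assoc)
    finally have "?I = of_real l * (LINT y|lborel. exp (- (\<beta> * (of_real l)\<^sup>2) * of_real y ^ 2))" .
    then show "of_real (1 / l) * ?I = (LINT y|lborel. exp (- (\<beta> * (of_real l)\<^sup>2) * of_real y ^ 2))"
      using l by simp
  qed auto
  have "- 2 * \<beta> * ?J = - ?I" by (rule vector_derivative_unique_at[OF d1 d2])
  moreover have "\<beta> \<noteq> 0" using \<beta> by auto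
  ultimately show ?thesis by (simp add: field_simps)
qed

lemma csqrt_real_mult: "r \<ge> 0 \<Longrightarrow> csqrt (of_real r * z) = of_real (sqrt r) * csqrt z"
proof (cases "r = 0")
  case False
  assume "r \<ge> 0"
  with False have r: "r > 0" by simp
  show ?thesis
    by (rule csqrt_unique) (use r csqrt_principal[of z] in \<open>auto simp: power_mult_distrib simp flip: of_real_power\<close>)
qed simp

lemma gaussian_integral_real: "(LINT y|lborel. exp (- (of_real y ^ 2)) :: complex) = of_real (sqrt pi)"
proof -
  have "(LINT y|lborel. normal_density 0 (1 / sqrt 2) y) = (LINT y|lborel. exp (- y\<^sup>2) / sqrt pi)"
    by (rule Bochner_Integration.integral_cong) (auto simp: normal_density_def power_divide)
  then have "(LINT y|lborel. exp (- y\<^sup>2) :: real) = sqrt pi" by (simp add: field_simps)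
  moreover have "(LINT y|lborel. exp (- (of_real y ^ 2)) :: complex) = (LINT y|lborel. of_real (exp (- y\<^sup>2)))"
    by (rule Bochner_Integration.integral_cong) (auto simp: exp_of_real[symmetric])
  ultimately show ?thesis by simp
qed

text \<open>
  Along the segment from 1 to \<alpha> the left-hand side has derivative 0 by the second moment
  identity, and at 1 it is the real Gaussian integral. The segment stays in the right
  half-plane, where the principal root is holomorphic; this fixes the branch.
\<close>

lemma gaussian_integral:
  assumes \<alpha>: "Re \<alpha> > 0"
  shows "csqrt \<alpha> * (LINT y|lborel. exp (- \<alpha> * of_real y ^ 2)) = of_real (sqrt pi)"
proof -
  define as where "as s = 1 + of_real s * (\<alpha> - 1)" for s :: real
  define p where "p = min 1 (Re \<alpha>)"
  have p: "p > 0" using \<alpha> by (simp add: p_def)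
  have Re_as: "Re (as s) \<ge> p" if "s \<in> {0..1}" for s
  proof -
    have "Re (as s) = (1 - s) * 1 + s * Re \<alpha>" by (simp add: as_def algebra_simps)
    also have "\<dots> \<ge> (1 - s) * p + s * p" using that by (intro add_mono mult_left_mono) (auto simp: p_def)
    finally show ?thesis by (simp add: algebra_simps)
  qed
  define d where "d = p / (2 * (norm (\<alpha> - 1) + 1))"
  have d: "d > 0" using p by (simp add: d_def add_nonneg_pos)
  have near: "Re (as s) \<ge> p / 2" if "s0 \<in> {0..1}" "\<bar>s - s0\<bar> < d" for s s0
  proof -
    have "as s - as s0 = of_real (s - s0) * (\<alpha> - 1)" by (simp add: as_def algebra_simps)
    then have "norm (as s - as s0) = \<bar>s - s0\<bar> * norm (\<alpha> - 1)" by (simp only: norm_mult norm_of_real)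
    also have "\<dots> \<le> d * (norm (\<alpha> - 1) + 1)" using that(2) by (intro mult_mono) auto
    also have "\<dots> = p / 2"
    proof -
      have "norm (\<alpha> - 1) + 1 \<noteq> 0" using norm_ge_zero[of "\<alpha> - 1"] by linarith
      then have "p / (2 * (norm (\<alpha> - 1) + 1)) * (norm (\<alpha> - 1) + 1) = p / 2"
        by (metis nonzero_mult_divide_mult_cancel_right times_divide_eq_left)
      then show ?thesis by (simp only: d_def)
    qed
    finally have "\<bar>Re (as s - as s0)\<bar> \<le> p / 2" using abs_Re_le_cmod order_trans by blast
    with Re_as[OF that(1)] show ?thesis unfolding minus_complex.sel by linarith
  qed
  define K where "K s = (LINT y|lborel. exp (- as s * of_real y ^ 2))" for s
  have K': "(K has_vector_derivative (- (\<alpha> - 1) * K s / (2 * as s))) (at s)" if s: "s \<in> {0..1}" for s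
  proof -
    have pos: "Re (as s) > 0" using Re_as[OF s] p by linarith
    have "((\<lambda>t. LINT y|lborel. exp (- (1 + of_real t * (\<alpha> - 1)) * of_real y ^ 2 + 0 * of_real y)) has_vector_derivative
       (- (\<alpha> - 1) * (LINT y|lborel. of_real y ^ 2 * exp (- (1 + of_real s * (\<alpha> - 1)) * of_real y ^ 2 + 0 * of_real y))
      + 0 * (LINT y|lborel. of_real y * exp (- (1 + of_real s * (\<alpha> - 1)) * of_real y ^ 2 + 0 * of_real y)))) (at s)"
    proof (rule gaussian_parameter_derivative[where d = d and p = "p / 2" and q = 0 and
          A = "\<lambda>w. 1 + w * (\<alpha> - 1)" and B = "\<lambda>_. 0"])
      fix t :: real assume t: "\<bar>t - s\<bar> < d"
      show "((\<lambda>w. 1 + w * (\<alpha> - 1)) has_field_derivative \<alpha> - 1) (at (of_real t))"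
        by (auto intro!: derivative_eq_intros)
      show "p / 2 \<le> Re (1 + of_real t * (\<alpha> - 1))" using near[OF s t] by (simp add: as_def)
    qed (use d p in auto)
    then show ?thesis
      using gaussian_second_moment[OF pos] unfolding K_def[abs_def] as_def by simp
  qed
  have "((\<lambda>s. csqrt (as s) * K s) has_vector_derivative 0) (at s within {0..1})" if s: "s \<in> {0..1}" for s
  proof -
    have pos: "Re (as s) > 0" using Re_as[OF s] p by linarith
    then have nn: "as s \<notin> \<real>\<^sub>\<le>\<^sub>0" "as s \<noteq> 0" by (auto simp: complex_nonpos_Reals_iff)
    have "((\<lambda>w. csqrt (1 + w * (\<alpha> - 1))) has_field_derivative (\<alpha> - 1) / (2 * csqrt (as s))) (at (of_real s))"
      using nn by (auto intro!: derivative_eq_intros simp: as_def)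
    from has_vector_derivative_real_field[OF this]
    have c: "((\<lambda>s. csqrt (as s)) has_vector_derivative (\<alpha> - 1) / (2 * csqrt (as s))) (at s)"
      by (simp add: as_def)
    have "((\<lambda>s. csqrt (as s) * K s) has_vector_derivative
        csqrt (as s) * (- (\<alpha> - 1) * K s / (2 * as s)) + (\<alpha> - 1) / (2 * csqrt (as s)) * K s) (at s)"
      by (rule has_vector_derivative_mult[OF c K'[OF s]])
    moreover have "csqrt (as s) * (- (\<alpha> - 1) * K s / (2 * as s)) + (\<alpha> - 1) / (2 * csqrt (as s)) * K s = 0"
    proof -
      define r where "r = csqrt (as s)"
      have r: "as s = r * r" "r \<noteq> 0" using nn(2) by (simp_all add: r_def power2_eq_square[symmetric])
      have "r * (- (\<alpha> - 1) * K s / (2 * (r * r))) + (\<alpha> - 1) / (2 * r) * K s = 0" using r(2) by (simp add: field_simps)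
      then show ?thesis unfolding r(1)[symmetric] unfolding r_def .
    qed
    ultimately show ?thesis by (simp add: has_vector_derivative_at_within)
  qed
  then have "\<exists>c. \<forall>s\<in>{0..1}. csqrt (as s) * K s = c"
    by (intro has_derivative_zero_constant) (auto simp: has_vector_derivative_def)
  then have "csqrt (as 1) * K 1 = csqrt (as 0) * K 0" by force
  then show ?thesis by (simp add: as_def K_def gaussian_integral_real)
qed

lemma gaussian_first_moment:
  assumes \<beta>: "Re \<beta> > 0"
  shows "(LINT y|lborel. of_real y * exp (- \<beta> * of_real y ^ 2 + \<eta> * of_real y)) =
     \<eta> / (2 * \<beta>) * (LINT y|lborel. exp (- \<beta> * of_real y ^ 2 + \<eta> * of_real y))"
proof -
  have b0: "\<beta> \<noteq> 0" using \<beta> by auto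
  let ?e = "\<lambda>y. exp (- \<beta> * of_real y ^ 2 + \<eta> * of_real y)"
  let ?I = "LINT y|lborel. ?e y" and ?J = "LINT y|lborel. of_real y * ?e y"
  have sq: "?e (l + y) = exp (- \<beta> * of_real l ^ 2 + \<eta> * of_real l) *
      exp (- \<beta> * of_real y ^ 2 + (\<eta> - 2 * \<beta> * of_real l) * of_real y)" for l y :: real
    by (simp add: mult_exp_exp power2_eq_square algebra_simps)
  have F: "((\<lambda>t. LINT y|lborel. exp (- \<beta> * of_real y ^ 2 + (\<eta> - 2 * \<beta> * of_real t) * of_real y)) has_vector_derivative
      (- 0 * (LINT y|lborel. of_real y ^ 2 * exp (- \<beta> * of_real y ^ 2 + (\<eta> - 2 * \<beta> * of_real 0) * of_real y))
      + (- 2 * \<beta>) * (LINT y|lborel. of_real y * exp (- \<beta> * of_real y ^ 2 + (\<eta> - 2 * \<beta> * of_real 0) * of_real y)))) (at 0)"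
  proof (rule gaussian_parameter_derivative[where d = 1 and p = "Re \<beta>" and q = "norm \<eta> + norm (2 * \<beta>)" and
          A = "\<lambda>_. \<beta>" and B = "\<lambda>w. \<eta> - 2 * \<beta> * w"])
    fix t :: real assume t: "\<bar>t - 0\<bar> < 1"
    show "((\<lambda>w. \<eta> - 2 * \<beta> * w) has_field_derivative - 2 * \<beta>) (at (of_real t))"
      by (auto intro!: derivative_eq_intros)
    have "norm (\<eta> - 2 * \<beta> * of_real t) \<le> norm \<eta> + norm (2 * \<beta> * of_real t)" by (rule norm_triangle_ineq4)
    also have "norm (2 * \<beta> * of_real t) \<le> norm (2 * \<beta>) * 1"
      unfolding norm_mult[of "2 * \<beta>"] using t by (intro mult_left_mono) auto
    finally show "norm (\<eta> - 2 * \<beta> * of_real t) \<le> norm \<eta> + norm (2 * \<beta>)" by simp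
  qed (use \<beta> in auto)
  have "((\<lambda>w. exp (- \<beta> * w ^ 2 + \<eta> * w)) has_field_derivative \<eta>) (at (of_real 0))"
    by (auto intro!: derivative_eq_intros)
  from has_vector_derivative_mult[OF has_vector_derivative_real_field[OF this] F]
  have "((\<lambda>l. exp (- \<beta> * of_real l ^ 2 + \<eta> * of_real l) *
      (LINT y|lborel. exp (- \<beta> * of_real y ^ 2 + (\<eta> - 2 * \<beta> * of_real l) * of_real y))) has_vector_derivative
      - 2 * \<beta> * ?J + \<eta> * ?I) (at 0)"
    by simp
  moreover have "exp (- \<beta> * of_real l ^ 2 + \<eta> * of_real l) *
      (LINT y|lborel. exp (- \<beta> * of_real y ^ 2 + (\<eta> - 2 * \<beta> * of_real l) * of_real y)) = ?I" for l :: real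
    using integral_translate[of ?e l] unfolding sq by simp
  ultimately have "((\<lambda>l::real. ?I) has_vector_derivative - 2 * \<beta> * ?J + \<eta> * ?I) (at 0)" by simp
  from vector_derivative_unique_at[OF this has_vector_derivative_const]
  have "\<eta> * ?I = 2 * \<beta> * ?J" by simp
  with b0 show ?thesis by simp
qed

text \<open>
  Replacing \<gamma> by s \<gamma> gives, by the first moment identity, a linear equation in s,
  solved by exp (s^2 \<gamma>^2 / (4 \<beta>)).
\<close>

lemma gaussian_integral_linear:
  assumes \<beta>: "Re \<beta> > 0"
  shows "(LINT y|lborel. exp (- \<beta> * of_real y ^ 2 + \<gamma> * of_real y)) =
     (LINT y|lborel. exp (- \<beta> * of_real y ^ 2)) * exp (\<gamma>\<^sup>2 / (4 * \<beta>))"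
proof -
  define M where "M s = (LINT y|lborel. exp (- \<beta> * of_real y ^ 2 + of_real s * \<gamma> * of_real y))" for s :: real
  have b0: "\<beta> \<noteq> 0" using \<beta> by auto
  have M': "(M has_vector_derivative (\<gamma>\<^sup>2 / (2 * \<beta>) * of_real s * M s)) (at s)" for s
  proof -
    have "((\<lambda>t. LINT y|lborel. exp (- \<beta> * of_real y ^ 2 + (of_real t * \<gamma>) * of_real y)) has_vector_derivative
      (- 0 * (LINT y|lborel. of_real y ^ 2 * exp (- \<beta> * of_real y ^ 2 + (of_real s * \<gamma>) * of_real y))
      + \<gamma> * (LINT y|lborel. of_real y * exp (- \<beta> * of_real y ^ 2 + (of_real s * \<gamma>) * of_real y)))) (at s)"
    proof (rule gaussian_parameter_derivative[where d = 1 and p = "Re \<beta>" and q = "(\<bar>s\<bar> + 1) * norm \<gamma>" and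
          A = "\<lambda>_. \<beta>" and B = "\<lambda>w. w * \<gamma>"])
      fix t :: real assume t: "\<bar>t - s\<bar> < 1"
      show "((\<lambda>w. w * \<gamma>) has_field_derivative \<gamma>) (at (of_real t))"
        by (auto intro!: derivative_eq_intros)
      show "norm (of_real t * \<gamma>) \<le> (\<bar>s\<bar> + 1) * norm \<gamma>"
        unfolding norm_mult using t by (intro mult_right_mono) auto
    qed (use \<beta> in auto)
    then show ?thesis
      using gaussian_first_moment[OF \<beta>, of "of_real s * \<gamma>"]
      by (simp add: M_def[abs_def] power2_eq_square mult_ac)
  qed
  have "((\<lambda>s. exp (- (of_real s ^ 2 * \<gamma>\<^sup>2 / (4 * \<beta>))) * M s) has_vector_derivative 0) (at s within UNIV)" for s
  proof -
    have "((\<lambda>w. exp (- (w ^ 2 * \<gamma>\<^sup>2 / (4 * \<beta>)))) has_field_derivative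
        - (of_real s * \<gamma>\<^sup>2 / (2 * \<beta>)) * exp (- (of_real s ^ 2 * \<gamma>\<^sup>2 / (4 * \<beta>)))) (at (of_real s))"
      using b0 by (auto intro!: derivative_eq_intros simp: field_simps)
    from has_vector_derivative_mult[OF has_vector_derivative_real_field[OF this] M'[of s]]
    show ?thesis by (simp add: algebra_simps)
  qed
  then have "\<exists>c. \<forall>s\<in>UNIV. exp (- (of_real s ^ 2 * \<gamma>\<^sup>2 / (4 * \<beta>))) * M s = c"
    by (intro has_derivative_zero_constant) (auto simp: has_vector_derivative_def)
  then obtain c where c: "\<And>s. exp (- (of_real s ^ 2 * \<gamma>\<^sup>2 / (4 * \<beta>))) * M s = c" by auto
  from c[of 1] c[of 0] have "exp (- (\<gamma>\<^sup>2 / (4 * \<beta>))) * M 1 = M 0" by simp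
  then have "M 1 = M 0 * exp (\<gamma>\<^sup>2 / (4 * \<beta>))" by (simp add: exp_minus field_simps)
  then show ?thesis by (simp add: M_def)
qed

section \<open>Convolution with complex Gaussians\<close>

text \<open>
  The Gaussian of integral 1. The Green's function is of this form at every fixed x > 0.
\<close>

definition gauss :: "complex \<Rightarrow> real \<Rightarrow> complex" where
  "gauss \<alpha> y = csqrt (\<alpha> / of_real pi) * exp (- \<alpha> * of_real y ^ 2)"

definition gauss' :: "complex \<Rightarrow> real \<Rightarrow> complex" where
  "gauss' \<alpha> y = - 2 * \<alpha> * of_real y * gauss \<alpha> y"

lemma gauss_even: "gauss \<alpha> (- y) = gauss \<alpha> y"
  by (simp add: gauss_def)

lemma rapid_cmult: "rapid K \<Longrightarrow> rapid (\<lambda>y. z * K y)"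
  unfolding rapid_def using edecay_cmult by blast

lemma rapid_gauss: "Re \<alpha> > 0 \<Longrightarrow> rapid (gauss \<alpha>)"
  using rapid_cmult[OF rapid_gaussian[of \<alpha> 0 0], of "csqrt (\<alpha> / of_real pi)"]
  by (simp add: gauss_def[abs_def])

lemma rapid_gauss': "Re \<alpha> > 0 \<Longrightarrow> rapid (gauss' \<alpha>)"
  using rapid_cmult[OF rapid_gaussian[of \<alpha> 1 0], of "- 2 * \<alpha> * csqrt (\<alpha> / of_real pi)"]
  by (simp add: gauss_def[abs_def] gauss'_def[abs_def] mult_ac)

lemma csqrt_div_pi: "csqrt (\<alpha> / of_real pi) = csqrt \<alpha> / of_real (sqrt pi)"
  using csqrt_real_mult[of "1 / pi" \<alpha>] by (simp add: real_sqrt_divide)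

lemma integral_gauss: "Re \<alpha> > 0 \<Longrightarrow> (LINT y|lborel. gauss \<alpha> y) = 1"
  using gaussian_integral[of \<alpha>] by (simp add: gauss_def csqrt_div_pi)

lemma gauss_has_vector_derivative: "((\<lambda>y. gauss \<alpha> (y - z)) has_vector_derivative gauss' \<alpha> (y - z)) (at y)"
proof -
  have "((\<lambda>w. csqrt (\<alpha> / of_real pi) * exp (- \<alpha> * (w - of_real z) ^ 2)) has_field_derivative gauss' \<alpha> (y - z)) (at (of_real y))"
    unfolding gauss'_def gauss_def by (auto intro!: derivative_eq_intros simp: algebra_simps)
  from has_vector_derivative_real_field[OF this] show ?thesis by (simp add: gauss_def)
qed

text \<open>
  Convolution with a Gaussian smooths: the traces f_n are differentiable at y = 0 although the
  data that are convolved jump there.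
\<close>

lemma conv_gauss_has_vector_derivative:
  assumes \<alpha>: "Re \<alpha> > 0" and f: "edecay c f"
  shows "(conv (gauss \<alpha>) f has_vector_derivative conv (gauss' \<alpha>) f y) (at y)"
proof -
  have [measurable]: "gauss' \<alpha> \<in> borel_measurable borel" "f \<in> borel_measurable borel"
    using rapid_measurable[OF rapid_gauss'[OF \<alpha>]] edecay_measurable[OF f] by auto
  obtain C where C: "C > 0" "\<And>y y'. norm (gauss' \<alpha> (y - y') * f y') \<le> C * exp (- c * \<bar>y\<bar>) * exp (- 1 * \<bar>y - y'\<bar>)"
    using conv_pointwise_bound[OF rapid_gauss'[OF \<alpha>] f] by blast
  have "((\<lambda>y. LINT z|lborel. gauss \<alpha> (y - z) * f z) has_vector_derivative (LINT z|lborel. gauss' \<alpha> (y - z) * f z)) (at y)"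
  proof (rule has_vector_derivative_lebesgue_integral[where d = 1 and
        g = "\<lambda>z. C * exp (\<bar>c\<bar> * (\<bar>y\<bar> + 1)) * exp 1 * exp (- 1 * \<bar>y - z\<bar>)"])
    fix t :: real assume t: "\<bar>t - y\<bar> < 1"
    show "integrable lborel (\<lambda>z. gauss \<alpha> (t - z) * f z)"
      by (rule conv_integrable[OF rapid_gauss[OF \<alpha>] f])
    fix z
    show "((\<lambda>y. gauss \<alpha> (y - z) * f z) has_vector_derivative gauss' \<alpha> (t - z) * f z) (at t)"
      by (rule has_vector_derivative_mult_left[OF gauss_has_vector_derivative])
    have "norm (gauss' \<alpha> (t - z) * f z) \<le> C * exp (- c * \<bar>t\<bar>) * exp (- 1 * \<bar>t - z\<bar>)" by (rule C)
    also have "\<dots> \<le> C * exp (\<bar>c\<bar> * (\<bar>y\<bar> + 1)) * (exp 1 * exp (- 1 * \<bar>y - z\<bar>))"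
    proof (intro mult_mono)
      have "- c * \<bar>t\<bar> \<le> \<bar>c\<bar> * \<bar>t\<bar>" by (intro mult_right_mono) auto
      also have "\<dots> \<le> \<bar>c\<bar> * (\<bar>y\<bar> + 1)" using t by (intro mult_left_mono) auto
      finally show "exp (- c * \<bar>t\<bar>) \<le> exp (\<bar>c\<bar> * (\<bar>y\<bar> + 1))" by simp
    qed (use C(1) t in \<open>auto simp: mult_exp_exp\<close>)
    finally show "norm (gauss' \<alpha> (t - z) * f z) \<le> C * exp (\<bar>c\<bar> * (\<bar>y\<bar> + 1)) * exp 1 * exp (- 1 * \<bar>y - z\<bar>)"
      by (simp add: mult_ac)
  next
    show "(\<lambda>z. gauss' \<alpha> (y - z) * f z) \<in> borel_measurable borel" by measurable
  next
    show "integrable lborel (\<lambda>z. C * exp (\<bar>c\<bar> * (\<bar>y\<bar> + 1)) * exp 1 * exp (- 1 * \<bar>y - z\<bar>))"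
      using integrable_exp_abs_shift[of 1 y] by (intro Bochner_Integration.integrable_mult_right) auto
  qed simp
  then show ?thesis by (simp add: conv_def[abs_def])
qed

lemma conv_gauss_continuous:
  assumes "Re \<alpha> > 0" "edecay c f"
  shows "continuous_on S (conv (gauss \<alpha>) f)" "isCont (conv (gauss \<alpha>) f) y"
proof -
  show *: "isCont (conv (gauss \<alpha>) f) y" for y
    using conv_gauss_has_vector_derivative[OF assms, of y] has_vector_derivative_continuous by blast
  show "continuous_on S (conv (gauss \<alpha>) f)" using * continuous_at_imp_continuous_on by blast
qed

lemma conv_gauss'_continuous:
  assumes \<alpha>: "Re \<alpha> > 0" and f: "edecay c f"
  shows "isCont (conv (gauss' \<alpha>) f) y"
proof -
  have [measurable]: "gauss' \<alpha> \<in> borel_measurable borel" "f \<in> borel_measurable borel"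
    using rapid_measurable[OF rapid_gauss'[OF \<alpha>]] edecay_measurable[OF f] by auto
  obtain C where C: "C > 0" "\<And>y y'. norm (gauss' \<alpha> (y - y') * f y') \<le> C * exp (- c * \<bar>y\<bar>) * exp (- 1 * \<bar>y - y'\<bar>)"
    using conv_pointwise_bound[OF rapid_gauss'[OF \<alpha>] f] by blast
  have "(\<lambda>n. conv (gauss' \<alpha>) f (X n)) \<longlonglongrightarrow> conv (gauss' \<alpha>) f y" if X: "X \<longlonglongrightarrow> y" "\<And>n. \<bar>X n - y\<bar> < 1" for X
    unfolding conv_def
  proof (rule integral_dominated_convergence[where w = "\<lambda>z. C * exp (\<bar>c\<bar> * (\<bar>y\<bar> + 1)) * exp 1 * exp (- 1 * \<bar>y - z\<bar>)"])
    show "integrable lborel (\<lambda>z. C * exp (\<bar>c\<bar> * (\<bar>y\<bar> + 1)) * exp 1 * exp (- 1 * \<bar>y - z\<bar>))"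
      using integrable_exp_abs_shift[of 1 y] by (intro Bochner_Integration.integrable_mult_right) auto
    show "AE z in lborel. (\<lambda>n. gauss' \<alpha> (X n - z) * f z) \<longlonglongrightarrow> gauss' \<alpha> (y - z) * f z"
      unfolding gauss'_def gauss_def by (intro AE_I2 tendsto_intros X)
    show "AE z in lborel. norm (gauss' \<alpha> (X n - z) * f z) \<le> C * exp (\<bar>c\<bar> * (\<bar>y\<bar> + 1)) * exp 1 * exp (- 1 * \<bar>y - z\<bar>)" for n
    proof (rule AE_I2)
      fix z
      have t: "\<bar>X n - y\<bar> < 1" by (rule X)
      have "norm (gauss' \<alpha> (X n - z) * f z) \<le> C * exp (- c * \<bar>X n\<bar>) * exp (- 1 * \<bar>X n - z\<bar>)" by (rule C)
      also have "\<dots> \<le> C * exp (\<bar>c\<bar> * (\<bar>y\<bar> + 1)) * (exp 1 * exp (- 1 * \<bar>y - z\<bar>))"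
      proof (intro mult_mono)
        have "- c * \<bar>X n\<bar> \<le> \<bar>c\<bar> * \<bar>X n\<bar>" by (intro mult_right_mono) auto
        also have "\<dots> \<le> \<bar>c\<bar> * (\<bar>y\<bar> + 1)" using t by (intro mult_left_mono) auto
        finally show "exp (- c * \<bar>X n\<bar>) \<le> exp (\<bar>c\<bar> * (\<bar>y\<bar> + 1))" by simp
      qed (use C(1) t in \<open>auto simp: mult_exp_exp\<close>)
      finally show "norm (gauss' \<alpha> (X n - z) * f z) \<le> C * exp (\<bar>c\<bar> * (\<bar>y\<bar> + 1)) * exp 1 * exp (- 1 * \<bar>y - z\<bar>)"
        by (simp add: mult_ac)
    qed
  qed measurable
  note lim = this
  have "(conv (gauss' \<alpha>) f \<longlongrightarrow> conv (gauss' \<alpha>) f y) (at y within {y - 1<..<y + 1})"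
    unfolding tendsto_at_iff_sequentially comp_def
  proof (intro allI impI)
    fix X assume X: "\<forall>i. X i \<in> {y - 1<..<y + 1} - {y}" "X \<longlonglongrightarrow> y"
    have "\<bar>X n - y\<bar> < 1" for n using X(1)[rule_format, of n] by (auto simp: abs_less_iff)
    with X(2) show "(\<lambda>n. conv (gauss' \<alpha>) f (X n)) \<longlonglongrightarrow> conv (gauss' \<alpha>) f y" by (rule lim)
  qed
  then show ?thesis unfolding isCont_def by (subst (asm) at_within_open) auto
qed

lemma conv_pair:
  assumes K: "rapid K" and f: "edecay c f" and g: "edecay d g" and cd: "c + d > 0"
  shows "integrable (lborel \<Otimes>\<^sub>M lborel) (\<lambda>(y, y'). K (y - y') * f y' * g y)"
    "(LINT (y, y')|(lborel \<Otimes>\<^sub>M lborel). K (y - y') * f y' * g y) = (LINT y|lborel. conv K f y * g y)"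
proof -
  have [measurable]: "K \<in> borel_measurable borel" "f \<in> borel_measurable borel" "g \<in> borel_measurable borel"
    using K f g by (auto dest: edecay_measurable rapid_measurable)
  define \<delta> where "\<delta> = c + d"
  have "\<delta> > 0" using cd by (simp add: \<delta>_def)
  obtain C where C: "C > 0" "\<And>y y'. norm (K (y - y') * f y') \<le> C * exp (- c * \<bar>y\<bar>) * exp (- \<delta> * \<bar>y - y'\<bar>)"
    using conv_pointwise_bound[OF K f] by blast
  obtain D where D: "D > 0" "\<And>y. norm (g y) \<le> D * exp (- d * \<bar>y\<bar>)" using g by (rule edecayE) blast
  show int: "integrable (lborel \<Otimes>\<^sub>M lborel) (\<lambda>(y, y'). K (y - y') * f y' * g y)"
  proof (rule pair_integrable_bound[OF _ \<open>\<delta> > 0\<close>, of _ "C * D"])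
    fix y y'
    have "norm (K (y - y') * f y' * g y) \<le> (C * exp (- c * \<bar>y\<bar>) * exp (- \<delta> * \<bar>y - y'\<bar>)) * (D * exp (- d * \<bar>y\<bar>))"
      unfolding norm_mult[of _ "g y"] by (intro mult_mono C D) (use C(1) in auto)
    also have "\<dots> = C * D * exp (- \<delta> * \<bar>y\<bar>) * exp (- \<delta> * \<bar>y - y'\<bar>)"
      by (simp add: mult_exp_exp algebra_simps \<delta>_def)
    finally show "norm (case (y, y') of (y, y') \<Rightarrow> K (y - y') * f y' * g y) \<le> C * D * exp (- \<delta> * \<bar>y\<bar>) * exp (- \<delta> * \<bar>y - y'\<bar>)"
      by simp
  qed measurable
  show "(LINT (y, y')|(lborel \<Otimes>\<^sub>M lborel). K (y - y') * f y' * g y) = (LINT y|lborel. conv K f y * g y)"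
    unfolding conv_def using lborel_pair.integral_fst'[OF int] by simp
qed

lemma conv_assoc:
  assumes K: "rapid K" and L: "rapid L" and f: "edecay c f"
  shows "conv K (conv L f) y = conv (conv K L) f y"
proof -
  have [measurable]: "K \<in> borel_measurable borel" "f \<in> borel_measurable borel" "L \<in> borel_measurable borel"
    using K f L by (auto dest: edecay_measurable rapid_measurable)
  obtain C where C: "C > 0" "\<And>y y'. norm (L (y - y') * f y') \<le> C * exp (- c * \<bar>y\<bar>) * exp (- 1 * \<bar>y - y'\<bar>)"
    using conv_pointwise_bound[OF L f] by blast
  define d where "d = 1 + \<bar>c\<bar>"
  obtain A where A: "A > 0" "\<And>y. norm (K y) \<le> A * exp (- d * \<bar>y\<bar>)" using rapid_bound[OF K] by blast
  have int: "integrable (lborel \<Otimes>\<^sub>M lborel) (\<lambda>(z, w). K (y - z) * (L (z - w) * f w))"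
  proof (rule pair_integrable_bound[of _ 1 "A * exp (d * \<bar>y\<bar>) * C"])
    fix z w
    have "norm (K (y - z) * (L (z - w) * f w)) \<le> (A * exp (- d * \<bar>y - z\<bar>)) * (C * exp (- c * \<bar>z\<bar>) * exp (- 1 * \<bar>z - w\<bar>))"
      unfolding norm_mult[of "K (y - z)"] by (intro mult_mono C A) (use A(1) in auto)
    also have "\<dots> = A * C * exp (- d * \<bar>y - z\<bar> - c * \<bar>z\<bar>) * exp (- 1 * \<bar>z - w\<bar>)"
      by (simp add: mult_exp_exp algebra_simps)
    also have "\<dots> \<le> A * C * exp (d * \<bar>y\<bar> - 1 * \<bar>z\<bar>) * exp (- 1 * \<bar>z - w\<bar>)"
    proof (intro mult_right_mono mult_left_mono)
      have "d * \<bar>z\<bar> \<le> d * (\<bar>y - z\<bar> + \<bar>y\<bar>)" by (intro mult_left_mono) (auto simp: d_def)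
      moreover have "- c * \<bar>z\<bar> \<le> \<bar>c\<bar> * \<bar>z\<bar>" by (intro mult_right_mono) auto
      ultimately have "- d * \<bar>y - z\<bar> - c * \<bar>z\<bar> \<le> d * \<bar>y\<bar> - 1 * \<bar>z\<bar>" by (simp add: d_def algebra_simps)
      then show "exp (- d * \<bar>y - z\<bar> - c * \<bar>z\<bar>) \<le> exp (d * \<bar>y\<bar> - 1 * \<bar>z\<bar>)" by simp
    qed (use A(1) C(1) in auto)
    also have "\<dots> = A * exp (d * \<bar>y\<bar>) * C * exp (- 1 * \<bar>z\<bar>) * exp (- 1 * \<bar>z - w\<bar>)"
      by (simp add: mult_exp_exp algebra_simps)
    finally show "norm (case (z, w) of (z, w) \<Rightarrow> K (y - z) * (L (z - w) * f w))
        \<le> A * exp (d * \<bar>y\<bar>) * C * exp (- 1 * \<bar>z\<bar>) * exp (- 1 * \<bar>z - w\<bar>)" by simp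
  qed simp_all
  have "conv K (conv L f) y = (LINT z|lborel. LINT w|lborel. K (y - z) * (L (z - w) * f w))"
    unfolding conv_def by simp
  also have "\<dots> = (LINT w|lborel. LINT z|lborel. K (y - z) * (L (z - w) * f w))"
    using lborel_pair.Fubini_integral[OF int] by simp
  also have "\<dots> = (LINT w|lborel. (LINT z|lborel. K (y - z) * L (z - w)) * f w)"
    by (subst integral_mult_left_zero[symmetric]) (simp add: mult.assoc)
  also have "\<dots> = (LINT w|lborel. conv K L (y - w) * f w)"
  proof (rule Bochner_Integration.integral_cong)
    fix w
    show "(LINT z|lborel. K (y - z) * L (z - w)) * f w = conv K L (y - w) * f w"
      using integral_translate[of "\<lambda>z. K (y - z) * L (z - w)" w] by (simp add: conv_def algebra_simps)
  qed simp
  finally show ?thesis unfolding conv_def[of "conv K L"] .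
qed

section \<open>The energy identity\<close>

text \<open>
  A real, positive heat kernel: the product in the sense of convolution of a complex Gaussian
  and its conjugate. Its parameter is |\<alpha>|^2 / (2 Re \<alpha>) because the reciprocals
  1/\<alpha> and 1/cnj \<alpha> are added under convolution.
\<close>

definition heat :: "complex \<Rightarrow> real \<Rightarrow> real" where
  "heat \<alpha> y = (let g = (norm \<alpha>)\<^sup>2 / (2 * Re \<alpha>) in sqrt (g / pi) * exp (- g * y\<^sup>2))"

lemma heat_pos: "Re \<alpha> > 0 \<Longrightarrow> heat \<alpha> y > 0"
proof -
  assume a: "Re \<alpha> > 0"
  then have "norm \<alpha> > 0" by auto
  with a show ?thesis by (simp add: heat_def Let_def)
qed

lemma div_pi_not_nonpos: "Re \<alpha> > 0 \<Longrightarrow> \<alpha> / of_real pi \<notin> \<real>\<^sub>\<le>\<^sub>0"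
proof -
  assume "Re \<alpha> > 0"
  then have "Re (\<alpha> / of_real pi) > 0" by (simp add: Re_divide_of_real)
  then show ?thesis by (auto simp: complex_nonpos_Reals_iff)
qed

lemma heat_eq_gauss:
  assumes "Re \<alpha> > 0"
  shows "of_real (heat \<alpha> y) = gauss (of_real ((norm \<alpha>)\<^sup>2 / (2 * Re \<alpha>))) y"
proof -
  define g where "g = (norm \<alpha>)\<^sup>2 / (2 * Re \<alpha>)"
  have g: "g \<ge> 0" using assms by (simp add: g_def)
  have "csqrt (of_real g / of_real pi) = of_real (sqrt (g / pi))"
    using csqrt_of_real[of "g / pi"] g by simp
  then show ?thesis
    unfolding heat_def gauss_def g_def[symmetric] Let_def by (simp add: exp_of_real[symmetric])
qed

lemma cnj_gauss:
  assumes "Re \<alpha> > 0"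
  shows "cnj (gauss \<alpha> y) = gauss (cnj \<alpha>) y"
proof -
  have "\<alpha> / of_real pi \<notin> \<real>\<^sub>\<le>\<^sub>0" by (rule div_pi_not_nonpos[OF assms])
  then show ?thesis by (simp add: gauss_def cnj_csqrt exp_cnj)
qed

text \<open>
  Complete the square; the two roots combine to a positive number, hence to the right branch.
\<close>

lemma conv_gauss_cnj:
  assumes \<alpha>: "Re \<alpha> > 0"
  shows "conv (gauss \<alpha>) (gauss (cnj \<alpha>)) y = of_real (heat \<alpha> y)"
proof -
  define p where "p = Re \<alpha>"
  define g where "g = (norm \<alpha>)\<^sup>2 / (2 * p)"
  have p: "p > 0" using \<alpha> by (simp add: p_def)
  have a0: "norm \<alpha> > 0" using \<alpha> by auto
  have sum: "\<alpha> + cnj \<alpha> = of_real (2 * p)" by (simp add: p_def complex_add_cnj)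
  have c1: "csqrt (\<alpha> / of_real pi) * csqrt (cnj \<alpha> / of_real pi) = of_real (norm \<alpha> / pi)"
  proof -
    have "\<alpha> / of_real pi \<notin> \<real>\<^sub>\<le>\<^sub>0" by (rule div_pi_not_nonpos[OF \<alpha>])
    then have "csqrt (cnj \<alpha> / of_real pi) = cnj (csqrt (\<alpha> / of_real pi))" by (simp add: cnj_csqrt)
    then have "csqrt (\<alpha> / of_real pi) * csqrt (cnj \<alpha> / of_real pi) = of_real ((norm (csqrt (\<alpha> / of_real pi)))\<^sup>2)"
      by (simp only: complex_norm_square)
    then show ?thesis by (simp add: norm_divide)
  qed
  have "gauss \<alpha> (y - z) * gauss (cnj \<alpha>) z = of_real (norm \<alpha> / pi) * exp (- \<alpha> * of_real y ^ 2) *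
      exp (- of_real (2 * p) * of_real z ^ 2 + (2 * \<alpha> * of_real y) * of_real z)" for z
  proof -
    have "gauss \<alpha> (y - z) * gauss (cnj \<alpha>) z = (csqrt (\<alpha> / of_real pi) * csqrt (cnj \<alpha> / of_real pi)) *
       exp (- \<alpha> * of_real (y - z) ^ 2 + - cnj \<alpha> * of_real z ^ 2)"
      by (simp only: gauss_def mult_exp_exp[symmetric] mult_ac)
    also have "- \<alpha> * of_real (y - z) ^ 2 + - cnj \<alpha> * of_real z ^ 2 =
        - \<alpha> * of_real y ^ 2 + (- (\<alpha> + cnj \<alpha>) * of_real z ^ 2 + (2 * \<alpha> * of_real y) * of_real z)"
      by (simp add: power2_eq_square algebra_simps)
    finally show ?thesis unfolding c1 sum by (simp only: mult_exp_exp[symmetric] mult.assoc)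
  qed
  then have "conv (gauss \<alpha>) (gauss (cnj \<alpha>)) y = of_real (norm \<alpha> / pi) * exp (- \<alpha> * of_real y ^ 2) *
      (LINT z|lborel. exp (- of_real (2 * p) * of_real z ^ 2 + (2 * \<alpha> * of_real y) * of_real z))"
    by (simp add: conv_def)
  also have "(LINT z|lborel. exp (- of_real (2 * p) * of_real z ^ 2 + (2 * \<alpha> * of_real y) * of_real z)) =
      (LINT z|lborel. exp (- of_real (2 * p) * of_real z ^ 2)) * exp ((2 * \<alpha> * of_real y)\<^sup>2 / (4 * of_real (2 * p)))"
    by (rule gaussian_integral_linear) (use p in simp)
  also have "(LINT z|lborel. exp (- of_real (2 * p) * of_real z ^ 2)) = (of_real (sqrt (pi / (2 * p))) :: complex)"
  proof -
    have "csqrt (of_real (2 * p)) * (LINT z|lborel. exp (- of_real (2 * p) * of_real z ^ 2)) = of_real (sqrt pi)"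
      by (rule gaussian_integral) (use p in simp)
    moreover have "csqrt (of_real (2 * p)) = of_real (sqrt (2 * p))" using p by (intro csqrt_of_real) simp
    moreover have "of_real (sqrt (2 * p)) \<noteq> (0 :: complex)" using p by simp
    ultimately show ?thesis by (simp add: real_sqrt_divide field_simps)
  qed
  also have "of_real (norm \<alpha> / pi) * exp (- \<alpha> * of_real y ^ 2) * (of_real (sqrt (pi / (2 * p))) *
       exp ((2 * \<alpha> * of_real y)\<^sup>2 / (4 * of_real (2 * p)))) =
     of_real (norm \<alpha> / pi * sqrt (pi / (2 * p))) * exp (- \<alpha> * of_real y ^ 2 + (2 * \<alpha> * of_real y)\<^sup>2 / (4 * of_real (2 * p)))"
    by (simp only: mult_exp_exp[symmetric] of_real_mult mult_ac)
  also have "- \<alpha> * of_real y ^ 2 + (2 * \<alpha> * of_real y)\<^sup>2 / (4 * of_real (2 * p)) = of_real (- g * y\<^sup>2)"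
  proof -
    have "of_real (2 * p * g) = \<alpha> * cnj \<alpha>" using p by (simp add: g_def complex_norm_square[symmetric])
    also have "\<dots> = \<alpha> * (of_real (2 * p) - \<alpha>)" using sum by (metis add_diff_cancel_left')
    finally have "of_real (2 * p) * of_real g = \<alpha> * (of_real (2 * p) - \<alpha>)" by simp
    then have g: "of_real g = \<alpha> * (of_real (2 * p) - \<alpha>) / of_real (2 * p)"
      using p by (simp add: field_simps)
    show ?thesis unfolding of_real_mult[of "- g"] of_real_minus g using p
      by (simp add: field_simps power2_eq_square)
  qed
  also have "norm \<alpha> / pi * sqrt (pi / (2 * p)) = sqrt (g / pi)"
  proof -
    have "sqrt (g / pi) = norm \<alpha> / sqrt (2 * p * pi)" using a0 p by (simp add: g_def real_sqrt_divide real_sqrt_mult)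
    moreover have "sqrt (pi / (2 * p)) = pi / sqrt (2 * p * pi)"
    proof -
      have "sqrt pi * sqrt pi = pi" by simp
      then show ?thesis using p by (simp add: real_sqrt_divide real_sqrt_mult field_simps)
    qed
    ultimately show ?thesis by simp
  qed
  finally show ?thesis
    by (simp only: heat_def Let_def g_def[symmetric] p_def[symmetric] exp_of_real of_real_mult[of "sqrt _"])
qed

lemma integral_of_real_eqI:
  fixes f :: "'a \<Rightarrow> real"
  assumes "(LINT x|M. complex_of_real (f x)) = of_real c"
  shows "integral\<^sup>L M f = c"
  using assms by (metis integral_complex_of_real of_real_eq_iff)

lemma conv_one: "rapid K \<Longrightarrow> conv K (\<lambda>_. 1) y = (LINT y|lborel. K y)"
  using integral_translate_reflect[of K y] by (simp add: conv_def)

lemma edecay_one: "edecay 0 (\<lambda>_. 1)"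
  by (rule edecayI[where C = 1]) auto

text \<open>
  With K the Gaussian, the squared norm of K * f is the pairing of f with (K * cnj K) * cnj f,
  and K * cnj K is the heat kernel. As the heat kernel has integral 1 and is even, expanding
  |f(y) - f(y')|^2 gives the squared norm of f twice and minus this pairing twice. The left-hand
  side is the dissipation in one strip.
\<close>

lemma conv_energy:
  assumes \<alpha>: "Re \<alpha> > 0" and f: "edecay c f" and c: "c > 0"
  shows "integrable (lborel \<Otimes>\<^sub>M lborel) (\<lambda>(y, y'). heat \<alpha> (y - y') * (norm (f y - f y'))\<^sup>2)"
    "(LINT (y, y')|(lborel \<Otimes>\<^sub>M lborel). heat \<alpha> (y - y') * (norm (f y - f y'))\<^sup>2) =
       2 * ((LINT y|lborel. (norm (f y))\<^sup>2) - (LINT y|lborel. (norm (conv (gauss \<alpha>) f y))\<^sup>2))"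
proof -
  define H where "H y = complex_of_real (heat \<alpha> y)" for y
  have H_eq: "H = gauss (of_real ((norm \<alpha>)\<^sup>2 / (2 * Re \<alpha>)))"
    unfolding H_def using heat_eq_gauss[OF \<alpha>] by auto
  have g0: "Re (complex_of_real ((norm \<alpha>)\<^sup>2 / (2 * Re \<alpha>))) > 0"
  proof -
    have "norm \<alpha> > 0" using \<alpha> by auto
    with \<alpha> show ?thesis by simp
  qed
  have rH: "rapid H" unfolding H_eq by (rule rapid_gauss[OF g0])
  have iH: "(LINT y|lborel. H y) = 1" unfolding H_eq by (rule integral_gauss[OF g0])
  have evH: "H (- y) = H y" for y unfolding H_eq by (rule gauss_even)
  let ?K = "gauss \<alpha>"
  have rK: "rapid ?K" by (rule rapid_gauss[OF \<alpha>])
  have rK': "rapid (gauss (cnj \<alpha>))" by (rule rapid_gauss) (use \<alpha> in simp)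
  have fc: "edecay c (\<lambda>y. cnj (f y))" by (rule edecay_cnj[OF f])
  have ff: "edecay (c + c) (\<lambda>y. f y * cnj (f y))" by (rule edecay_mult[OF f fc])
  have eng: "(LINT y|lborel. complex_of_real ((norm (conv ?K f y))\<^sup>2)) = (LINT y|lborel. conv H (\<lambda>y. cnj (f y)) y * f y)"
  proof -
    have "cnj (conv ?K f y) = conv (gauss (cnj \<alpha>)) (\<lambda>y. cnj (f y)) y" for y
      unfolding conv_def by (simp add: cnj_gauss[OF \<alpha>] flip: Bochner_Integration.integral_cnj)
    then have "(LINT y|lborel. complex_of_real ((norm (conv ?K f y))\<^sup>2)) =
       (LINT y|lborel. conv ?K f y * conv (gauss (cnj \<alpha>)) (\<lambda>y. cnj (f y)) y)"
      by (simp only: complex_norm_square)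
    also have "\<dots> = (LINT y|lborel. f y * conv ?K (conv (gauss (cnj \<alpha>)) (\<lambda>y. cnj (f y))) y)"
      by (rule conv_adjoint[OF rK f edecay_conv[OF rK' fc]]) (use c gauss_even in auto)
    also have "\<dots> = (LINT y|lborel. f y * conv H (\<lambda>y. cnj (f y)) y)"
      unfolding conv_assoc[OF rK rK' fc] conv_gauss_cnj[OF \<alpha>] H_def by (simp add: conv_gauss_cnj[OF \<alpha>, abs_def] conv_def[of "\<lambda>y. conv _ _ y"])
    finally show ?thesis by (simp add: mult.commute)
  qed
  have eng2: "(LINT y|lborel. conv H f y * cnj (f y)) = (LINT y|lborel. conv H (\<lambda>y. cnj (f y)) y * f y)"
    using conv_adjoint[OF rH f fc _ evH] c by (simp add: mult.commute)
  note P1 = conv_pair[OF rH edecay_one ff]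
  note P2 = conv_pair[OF rH ff edecay_one]
  note P3 = conv_pair[OF rH fc f]
  note P4 = conv_pair[OF rH f fc]
  have v1: "(LINT y|lborel. conv H (\<lambda>_. 1) y * (f y * cnj (f y))) = (LINT y|lborel. f y * cnj (f y))"
    using conv_one[OF rH] iH by simp
  have v2: "(LINT y|lborel. conv H (\<lambda>y. f y * cnj (f y)) y * 1) = (LINT y|lborel. f y * cnj (f y))"
    using conv_adjoint[OF rH ff edecay_one _ evH] c conv_one[OF rH] iH by simp
  \<comment> \<open>|f(y) - f(y')|^2 expanded, each term in the form required by Fubini\<close>
  define D where "D = (\<lambda>(y, y'). H (y - y') * 1 * (f y * cnj (f y)) + H (y - y') * (f y' * cnj (f y')) * 1
       - H (y - y') * cnj (f y') * f y - H (y - y') * f y' * cnj (f y))"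
  have D_eq: "D = (\<lambda>(y, y'). complex_of_real (heat \<alpha> (y - y') * (norm (f y - f y'))\<^sup>2))"
    unfolding D_def H_def by (auto simp: complex_norm_square algebra_simps simp del: of_real_power)
  have c0: "0 + (c + c) > 0" "(c + c) + 0 > 0" "c + c > 0" using c by auto
  note Q1 = P1[OF c0(1)] and Q2 = P2[OF c0(2)] and Q3 = P3[OF c0(3)] and Q4 = P4[OF c0(3)]
  have D_sum: "D = (\<lambda>p. (case p of (y, y') \<Rightarrow> H (y - y') * 1 * (f y * cnj (f y))) + (case p of (y, y') \<Rightarrow> H (y - y') * (f y' * cnj (f y')) * 1)
       - (case p of (y, y') \<Rightarrow> H (y - y') * cnj (f y') * f y) - (case p of (y, y') \<Rightarrow> H (y - y') * f y' * cnj (f y)))"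
    unfolding D_def by auto
  have intD: "integrable (lborel \<Otimes>\<^sub>M lborel) D"
    unfolding D_sum
    by (intro Bochner_Integration.integrable_add Bochner_Integration.integrable_diff Q1 Q2 Q3 Q4)
  have "integral\<^sup>L (lborel \<Otimes>\<^sub>M lborel) D =
     (LINT y|lborel. f y * cnj (f y)) + (LINT y|lborel. f y * cnj (f y))
     - (LINT y|lborel. conv H (\<lambda>y. cnj (f y)) y * f y) - (LINT y|lborel. conv H (\<lambda>y. cnj (f y)) y * f y)"
    unfolding D_sum
    by (subst Bochner_Integration.integral_diff Bochner_Integration.integral_add,
        (intro Bochner_Integration.integrable_add Bochner_Integration.integrable_diff Q1 Q2 Q3 Q4)+)+
       (simp only: Q1(2) Q2(2) Q3(2) Q4(2) v1 v2 eng2)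
  also have "\<dots> = of_real (2 * ((LINT y|lborel. (norm (f y))\<^sup>2) - (LINT y|lborel. (norm (conv ?K f y))\<^sup>2)))"
    unfolding eng[symmetric] complex_norm_square[symmetric] integral_complex_of_real by simp
  finally have I: "integral\<^sup>L (lborel \<Otimes>\<^sub>M lborel) D = of_real (2 * ((LINT y|lborel. (norm (f y))\<^sup>2) - (LINT y|lborel. (norm (conv ?K f y))\<^sup>2)))" .
  have D_real: "D = (\<lambda>p. complex_of_real (case p of (y, y') \<Rightarrow> heat \<alpha> (y - y') * (norm (f y - f y'))\<^sup>2))"
    unfolding D_eq by auto
  show "integrable (lborel \<Otimes>\<^sub>M lborel) (\<lambda>(y, y'). heat \<alpha> (y - y') * (norm (f y - f y'))\<^sup>2)"
    using intD unfolding D_real complex_of_real_integrable_eq .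
  show "(LINT (y, y')|(lborel \<Otimes>\<^sub>M lborel). heat \<alpha> (y - y') * (norm (f y - f y'))\<^sup>2) =
       2 * ((LINT y|lborel. (norm (f y))\<^sup>2) - (LINT y|lborel. (norm (conv ?K f y))\<^sup>2))"
    by (rule integral_of_real_eqI) (use I in \<open>simp only: D_real\<close>)
qed

section \<open>Weak decay of iterated propagation\<close>

lemma conv_pair_real:
  fixes K f g :: "real \<Rightarrow> real"
  assumes K: "rapid (\<lambda>y. of_real (K y))" and f: "edecay c (\<lambda>y. of_real (f y))"
    and g: "edecay d (\<lambda>y. of_real (g y))" and cd: "c + d > 0"
  shows "integrable (lborel \<Otimes>\<^sub>M lborel) (\<lambda>(y, y'). K (y - y') * f y' * g y)"
    "(LINT (y, y')|(lborel \<Otimes>\<^sub>M lborel). K (y - y') * f y' * g y) = (LINT y|lborel. (LINT y'|lborel. K (y - y') * f y') * g y)"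
proof -
  note P = conv_pair[OF K f g cd]
  have eq: "(\<lambda>(y, y'). complex_of_real (K (y - y')) * of_real (f y') * of_real (g y)) =
      (\<lambda>p. of_real (case p of (y, y') \<Rightarrow> K (y - y') * f y' * g y))" by auto
  show "integrable (lborel \<Otimes>\<^sub>M lborel) (\<lambda>(y, y'). K (y - y') * f y' * g y)"
    using P(1) unfolding eq complex_of_real_integrable_eq .
  show "(LINT (y, y')|(lborel \<Otimes>\<^sub>M lborel). K (y - y') * f y' * g y) = (LINT y|lborel. (LINT y'|lborel. K (y - y') * f y') * g y)"
  proof (rule integral_of_real_eqI)
    have "(LINT y|lborel. conv (\<lambda>y. of_real (K y)) (\<lambda>y. of_real (f y)) y * of_real (g y)) =
       (LINT y|lborel. of_real ((LINT y'|lborel. K (y - y') * f y') * g y))"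
      by (simp add: conv_def flip: of_real_mult)
    also have "\<dots> = of_real (LINT y|lborel. (LINT y'|lborel. K (y - y') * f y') * g y)"
      by (rule integral_complex_of_real)
    finally show "(LINT x|(lborel \<Otimes>\<^sub>M lborel). complex_of_real (case x of (y, y') \<Rightarrow> K (y - y') * f y' * g y)) =
      of_real (LINT y|lborel. (LINT y'|lborel. K (y - y') * f y') * g y)"
      using P(2) unfolding eq by simp
  qed
qed

lemma am_gm_weighted: "\<eta> > 0 \<Longrightarrow> a * b \<le> \<eta> / 2 * a\<^sup>2 + b\<^sup>2 / (2 * \<eta>)" for a b \<eta> :: real
proof -
  assume e: "\<eta> > 0"
  have "0 \<le> (\<eta> * a - b)\<^sup>2 / (2 * \<eta>)" using e by simp
  also have "\<dots> = \<eta> / 2 * a\<^sup>2 + b\<^sup>2 / (2 * \<eta>) - a * b"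
    using e by (simp add: power2_eq_square field_simps)
  finally show ?thesis by simp
qed

text \<open>
  F(y) is compared with F(y') for all y' in the window |y - y'| \<le> L. The differences are
  controlled by the dissipation, as the heat kernel is at least \<kappa> in the window, and
  averaging F(y') over the window gains a factor 1 / L against the L2 norm of F. The parameters
  \<eta> and \<zeta> of the weighted arithmetic-geometric mean inequality are left free to be
  chosen after the test function and before L.
\<close>

lemma window_estimate:
  assumes \<alpha>: "Re \<alpha> > 0" and F: "edecay c F" "c > 0" and \<phi>: "edecay c' \<phi>" "c' > 0"
    and L: "L > 0" and \<kappa>: "\<kappa> > 0" "\<And>y. \<bar>y\<bar> \<le> L \<Longrightarrow> \<kappa> \<le> heat \<alpha> y" and \<eta>: "\<eta> > 0" and \<zeta>: "\<zeta> > 0"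
  shows "norm (LINT y|lborel. \<phi> y * F y) \<le> \<eta> / 2 * (LINT y|lborel. (norm (\<phi> y))\<^sup>2)
     + (LINT (y, y')|(lborel \<Otimes>\<^sub>M lborel). heat \<alpha> (y - y') * (norm (F y - F y'))\<^sup>2) / (4 * \<eta> * \<kappa> * L)
     + \<zeta> / 2 * (LINT y|lborel. norm (\<phi> y)) + (LINT y|lborel. norm (\<phi> y)) * (LINT y|lborel. (norm (F y))\<^sup>2) / (4 * \<zeta> * L)"
proof -
  have [measurable]: "F \<in> borel_measurable borel" "\<phi> \<in> borel_measurable borel"
    using F \<phi> by (auto dest: edecay_measurable)
  define K where "K = (indicator {-L..L} :: real \<Rightarrow> real)"
  have K01: "K y \<ge> 0" "K y \<le> 1" for y by (auto simp: K_def)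
  have K: "rapid (\<lambda>y. of_real (K y))"
    unfolding rapid_def
  proof
    fix d
    show "edecay d (\<lambda>y. of_real (K y))"
    proof (rule edecayI[where C = "exp (\<bar>d\<bar> * L)"])
      fix y
      have "d * \<bar>y\<bar> \<le> \<bar>d\<bar> * L" if "\<bar>y\<bar> \<le> L" using that L
        by (intro order_trans[OF mult_right_mono mult_left_mono]) auto
      then show "norm (complex_of_real (K y)) \<le> exp (\<bar>d\<bar> * L) * exp (- d * \<bar>y\<bar>)"
        by (auto simp: K_def indicator_def mult_exp_exp)
    qed (simp add: K_def)
  qed
  have intK: "(LINT y|lborel. K y) = 2 * L" using L by (simp add: K_def)
  have intK': "(LINT y'|lborel. K (y - y')) = 2 * L" for y
    using integral_translate_reflect[of K y] intK by simp
  have one: "edecay 0 (\<lambda>y. of_real 1)" using edecay_one by simp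
  have sq: "edecay (d + d) (\<lambda>y. of_real ((norm (f y))\<^sup>2))" if "edecay d f" for d f
    using edecay_mult[OF edecay_norm[OF that] edecay_norm[OF that]] by (simp add: power2_eq_square)
  note \<phi>n = edecay_norm[OF \<phi>(1)] and \<phi>2 = sq[OF \<phi>(1)] and F2 = sq[OF F(1)]
  have pos: "0 + (c' + c') > 0" "0 + c' > 0" "(c + c) + c' > 0" "0 + (c' + c) > 0" using F(2) \<phi>(2) by auto
  note A1 = conv_pair_real[OF K one \<phi>2 pos(1)] and A2 = conv_pair_real[OF K one \<phi>n pos(2)]
    and A3 = conv_pair_real[OF K F2 \<phi>n pos(3)] and A4 = conv_energy[OF \<alpha> F]
  note A0 = conv_pair[OF K one edecay_mult[OF \<phi>(1) F(1)] pos(4)]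
  define R where "R = (\<lambda>p. \<eta> / 2 * (case p of (y, y') \<Rightarrow> K (y - y') * 1 * (norm (\<phi> y))\<^sup>2)
     + (case p of (y, y') \<Rightarrow> heat \<alpha> (y - y') * (norm (F y - F y'))\<^sup>2) / (2 * \<eta> * \<kappa>)
     + \<zeta> / 2 * (case p of (y, y') \<Rightarrow> K (y - y') * 1 * norm (\<phi> y))
     + (case p of (y, y') \<Rightarrow> K (y - y') * (norm (F y'))\<^sup>2 * norm (\<phi> y)) / (2 * \<zeta>))"
  have intR: "integrable (lborel \<Otimes>\<^sub>M lborel) R"
    unfolding R_def by (intro Bochner_Integration.integrable_add integrable_mult_right integrable_divide A1 A2 A3 A4)
  have ptw: "norm (case p of (y, y') \<Rightarrow> complex_of_real (K (y - y')) * of_real 1 * (\<phi> y * F y)) \<le> R p" for p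
  proof (cases p)
    case (Pair y y')
    have h: "heat \<alpha> (y - y') \<ge> 0" using heat_pos[OF \<alpha>] less_imp_le by blast
    show ?thesis
    proof (cases "\<bar>y - y'\<bar> \<le> L")
      case True
      then have k1: "K (y - y') = 1" by (auto simp: K_def abs_le_iff)
      have "norm (\<phi> y * F y) \<le> norm (\<phi> y) * (norm (F y - F y') + norm (F y'))"
        unfolding norm_mult using norm_triangle_sub[of "F y" "F y'"] by (intro mult_left_mono) auto
      also have "\<dots> = norm (\<phi> y) * norm (F y - F y') + norm (\<phi> y) * (1 * norm (F y'))"
        by (simp add: algebra_simps)
      also have "\<dots> \<le> (\<eta> / 2 * (norm (\<phi> y))\<^sup>2 + (norm (F y - F y'))\<^sup>2 / (2 * \<eta>))
          + norm (\<phi> y) * (\<zeta> / 2 * 1\<^sup>2 + (norm (F y'))\<^sup>2 / (2 * \<zeta>))"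
        by (intro add_mono mult_left_mono am_gm_weighted \<eta> \<zeta>) auto
      also have "(norm (F y - F y'))\<^sup>2 / (2 * \<eta>) \<le> heat \<alpha> (y - y') * (norm (F y - F y'))\<^sup>2 / (2 * \<eta> * \<kappa>)"
      proof -
        have "\<kappa> * (norm (F y - F y'))\<^sup>2 \<le> heat \<alpha> (y - y') * (norm (F y - F y'))\<^sup>2"
          using \<kappa>(2)[OF True] by (intro mult_right_mono) auto
        then show ?thesis using \<kappa>(1) \<eta> by (simp add: field_simps)
      qed
      finally show ?thesis by (simp add: Pair R_def k1 algebra_simps)
    next
      case False
      then have k0: "K (y - y') = 0" by (auto simp: K_def indicator_def)
      show ?thesis using h \<eta> \<kappa>(1) by (simp add: Pair R_def k0)
    qed
  qed
  have "2 * L * norm (LINT y|lborel. \<phi> y * F y) =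
      norm (LINT p|(lborel \<Otimes>\<^sub>M lborel). (case p of (y, y') \<Rightarrow> complex_of_real (K (y - y')) * of_real 1 * (\<phi> y * F y)))"
  proof -
    have "conv (\<lambda>y. of_real (K y)) (\<lambda>y. of_real 1) y = of_real (2 * L)" for y
      using conv_one[OF K, of y] intK by simp
    then have "(LINT p|(lborel \<Otimes>\<^sub>M lborel). (case p of (y, y') \<Rightarrow> complex_of_real (K (y - y')) * of_real 1 * (\<phi> y * F y))) =
        of_real (2 * L) * (LINT y|lborel. \<phi> y * F y)"
      unfolding A0(2) by simp
    then show ?thesis using L by (simp add: norm_mult)
  qed
  also have "\<dots> \<le> integral\<^sup>L (lborel \<Otimes>\<^sub>M lborel) R"
    by (rule Bochner_Integration.integral_norm_bound_integral[OF A0(1) intR ptw])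
  also have "\<dots> = \<eta> / 2 * (2 * L * (LINT y|lborel. (norm (\<phi> y))\<^sup>2))
     + (LINT (y, y')|(lborel \<Otimes>\<^sub>M lborel). heat \<alpha> (y - y') * (norm (F y - F y'))\<^sup>2) / (2 * \<eta> * \<kappa>)
     + \<zeta> / 2 * (2 * L * (LINT y|lborel. norm (\<phi> y)))
     + (LINT y|lborel. (LINT y'|lborel. K (y - y') * (norm (F y'))\<^sup>2) * norm (\<phi> y)) / (2 * \<zeta>)"
  proof -
    have e1: "(LINT (y, y')|(lborel \<Otimes>\<^sub>M lborel). K (y - y') * 1 * (norm (\<phi> y))\<^sup>2) = 2 * L * (LINT y|lborel. (norm (\<phi> y))\<^sup>2)"
      unfolding A1(2) using intK' by simp
    have e2: "(LINT (y, y')|(lborel \<Otimes>\<^sub>M lborel). K (y - y') * 1 * norm (\<phi> y)) = 2 * L * (LINT y|lborel. norm (\<phi> y))"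
      unfolding A2(2) using intK' by simp
    show ?thesis
      unfolding R_def
      by (subst Bochner_Integration.integral_add,
        (intro Bochner_Integration.integrable_add integrable_mult_right integrable_divide A1 A2 A3 A4)+)+
       (simp only: integral_mult_right_zero integral_divide_zero e1 e2 A3(2))
  qed
  also have "(LINT y|lborel. (LINT y'|lborel. K (y - y') * (norm (F y'))\<^sup>2) * norm (\<phi> y)) \<le>
      (LINT y|lborel. (LINT y|lborel. (norm (F y))\<^sup>2) * norm (\<phi> y))"
  proof (rule integral_mono)
    have "integrable (lborel \<Otimes>\<^sub>M lborel) (\<lambda>(y, y'). K (y - y') * (norm (F y'))\<^sup>2 * norm (\<phi> y))" by (rule A3)
    from lborel_pair.integrable_fst'[OF this]
    show "integrable lborel (\<lambda>y. (LINT y'|lborel. K (y - y') * (norm (F y'))\<^sup>2) * norm (\<phi> y))" by simp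
    show "integrable lborel (\<lambda>y. (LINT y|lborel. (norm (F y))\<^sup>2) * norm (\<phi> y))"
      using edecay_integrable[OF \<phi>] by simp
    fix y
    have "edecay (c + c) (\<lambda>y. of_real ((norm (F y))\<^sup>2))" by (rule F2)
    from edecay_integrable[OF this] F(2) have iF: "integrable lborel (\<lambda>y. (norm (F y))\<^sup>2)"
      unfolding complex_of_real_integrable_eq by simp
    have "(LINT y'|lborel. K (y - y') * (norm (F y'))\<^sup>2) \<le> (LINT y'|lborel. (norm (F y'))\<^sup>2)"
    proof (rule integral_mono[OF _ iF])
      show "integrable lborel (\<lambda>y'. K (y - y') * (norm (F y'))\<^sup>2)"
        by (rule Bochner_Integration.integrable_bound[OF iF])
           (use K01 in \<open>auto simp: K_def abs_mult intro!: AE_I2 mult_left_le_one_le\<close>)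
    qed (use K01 in \<open>auto intro!: mult_left_le_one_le\<close>)
    then show "(LINT y'|lborel. K (y - y') * (norm (F y'))\<^sup>2) * norm (\<phi> y) \<le> (LINT y|lborel. (norm (F y))\<^sup>2) * norm (\<phi> y)"
      by (intro mult_right_mono) auto
  qed
  finally have "2 * L * norm (LINT y|lborel. \<phi> y * F y) \<le> \<eta> / 2 * (2 * L * (LINT y|lborel. (norm (\<phi> y))\<^sup>2))
     + (LINT (y, y')|(lborel \<Otimes>\<^sub>M lborel). heat \<alpha> (y - y') * (norm (F y - F y'))\<^sup>2) / (2 * \<eta> * \<kappa>)
     + \<zeta> / 2 * (2 * L * (LINT y|lborel. norm (\<phi> y)))
     + (LINT y|lborel. norm (\<phi> y)) * (LINT y|lborel. (norm (F y))\<^sup>2) / (2 * \<zeta>)"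
    using \<zeta> by (simp add: divide_right_mono mult.commute)
  from divide_right_mono[OF this, of "2 * L"] show ?thesis
    using L by (simp add: add_divide_distrib algebra_simps)
qed

lemma heat_antimono:
  assumes "Re \<alpha> > 0" "\<bar>y\<bar> \<le> L"
  shows "heat \<alpha> L \<le> heat \<alpha> y"
proof -
  have "y\<^sup>2 \<le> L\<^sup>2" using assms(2) by (metis abs_ge_zero power2_abs power_mono)
  then have "(norm \<alpha>)\<^sup>2 / (2 * Re \<alpha>) * y\<^sup>2 \<le> (norm \<alpha>)\<^sup>2 / (2 * Re \<alpha>) * L\<^sup>2"
    using assms(1) by (intro mult_left_mono) auto
  then show ?thesis unfolding heat_def Let_def using assms(1) by (intro mult_left_mono) auto
qed

text \<open>
  The energy decreases, hence converges, so the dissipation tends to 0. In the window estimate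
  \<eta> and \<zeta> are made small first, then L large, and then the dissipation small.
  Finitely many parameters keep the lower bound \<kappa> for the heat kernels positive; the
  unimodular factor s does not change the energy.
\<close>

lemma propagation_tendsto_weakly_0:
  fixes f :: "nat \<Rightarrow> real \<Rightarrow> complex"
  assumes A: "finite A" "\<And>z. z \<in> A \<Longrightarrow> Re z > 0" "\<And>j. \<alpha> j \<in> A"
    and s: "s \<in> borel_measurable borel" "\<And>y. norm (s y) \<le> 1" "\<And>y. y \<noteq> 0 \<Longrightarrow> norm (s y) = 1"
    and f0: "edecay c (f 0)" "c > 0"
    and fS: "\<And>j. f (Suc j) = conv (gauss (\<alpha> j)) (\<lambda>y. s y * f j y)"
    and \<phi>: "edecay c' \<phi>" "c' > 0"
  shows "(\<lambda>j. LINT y|lborel. \<phi> y * f j y) \<longlonglongrightarrow> 0"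
proof -
  have ra: "Re (\<alpha> j) > 0" for j using A by blast
  define F where "F j y = s y * f j y" for j y
  have f: "edecay c (f j)" for j
  proof (induction j)
    case (Suc j) then show ?case
      unfolding fS by (intro edecay_conv rapid_gauss ra edecay_bounded_mult[OF _ s(1,2)])
  qed (rule f0)
  have F: "edecay c (F j)" for j
    unfolding F_def by (intro edecay_bounded_mult[OF _ s(1,2)] f)
  note [measurable] = edecay_measurable[OF f] edecay_measurable[OF \<phi>(1)] s(1)
  define E where "E j = (LINT y|lborel. (norm (f j y))\<^sup>2)" for j
  \<comment> \<open>the factor s has modulus 1 except possibly at 0\<close>
  have E_F: "(LINT y|lborel. (norm (F j y))\<^sup>2) = E j" for j
    unfolding E_def F_def
  proof (rule integral_cong_AE)
    show "AE y in lborel. (norm (s y * f j y))\<^sup>2 = (norm (f j y))\<^sup>2"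
      using AE_lborel_singleton[of 0] by eventually_elim (simp add: norm_mult s(3))
  qed measurable
  define D where "D j = (LINT (y, y')|(lborel \<Otimes>\<^sub>M lborel). heat (\<alpha> j) (y - y') * (norm (F j y - F j y'))\<^sup>2)" for j
  have D: "D j = 2 * (E j - E (Suc j))" for j
    using conv_energy(2)[OF ra F f0(2), of j j] unfolding D_def E_F unfolding E_def fS F_def .
  have D0: "D j \<ge> 0" for j
  proof -
    have "(case p of (y, y') \<Rightarrow> heat (\<alpha> j) (y - y') * (norm (F j y - F j y'))\<^sup>2) \<ge> 0" for p
      using heat_pos[OF ra[of j], of "fst p - snd p"] by (simp add: case_prod_beta)
    then show ?thesis unfolding D_def by (rule Bochner_Integration.integral_nonneg)
  qed
  have "E (Suc j) \<le> E j" for j using D[of j] D0[of j] by simp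
  then have dec: "decseq E" by (rule decseq_SucI)
  have E0: "E j \<ge> 0" for j unfolding E_def by simp
  obtain e where e: "E \<longlonglongrightarrow> e" using decseq_convergent[OF dec, of 0] E0 by blast
  have "D \<longlonglongrightarrow> 2 * (e - e)" unfolding D[abs_def] by (intro tendsto_intros e LIMSEQ_Suc)
  then have Dlim: "D \<longlonglongrightarrow> 0" by simp
  have EE: "E j \<le> E 0" for j using dec by (simp add: decseq_def)
  have main: "(\<lambda>j. LINT y|lborel. \<psi> y * F j y) \<longlonglongrightarrow> 0" if \<psi>: "edecay c' \<psi>" for \<psi>
  proof (rule LIMSEQ_I)
    fix \<epsilon> :: real assume \<epsilon>: "\<epsilon> > 0"
    define p1 where "p1 = (LINT y|lborel. norm (\<psi> y))"
    define p2 where "p2 = (LINT y|lborel. (norm (\<psi> y))\<^sup>2)"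
    have p: "p1 \<ge> 0" "p2 \<ge> 0" by (auto simp: p1_def p2_def)
    \<comment> \<open>each of the four terms of the window estimate becomes at most \<epsilon> / 4\<close>
    define \<eta> where "\<eta> = \<epsilon> / (2 * (p2 + 1))"
    define \<zeta> where "\<zeta> = \<epsilon> / (2 * (p1 + 1))"
    have \<eta>: "\<eta> > 0" and \<zeta>: "\<zeta> > 0" using \<epsilon> p by (auto simp: \<eta>_def \<zeta>_def)
    define L where "L = p1 * E 0 / (\<zeta> * \<epsilon>) + 1"
    have L: "L > 0" using p E0[of 0] \<zeta> \<epsilon> by (auto simp: L_def intro!: add_nonneg_pos)
    define \<kappa> where "\<kappa> = Min ((\<lambda>z. heat z L) ` A)"
    have Ane: "A \<noteq> {}" using A(3) by auto
    have \<kappa>: "\<kappa> > 0" unfolding \<kappa>_def using A Ane by (subst Min_gr_iff) (auto intro: heat_pos)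
    have \<kappa>le: "\<kappa> \<le> heat (\<alpha> j) y" if "\<bar>y\<bar> \<le> L" for j y
    proof -
      have "\<kappa> \<le> heat (\<alpha> j) L" unfolding \<kappa>_def using A by (intro Min_le) auto
      also have "\<dots> \<le> heat (\<alpha> j) y" by (rule heat_antimono[OF ra that])
      finally show ?thesis .
    qed
    have "\<epsilon> * \<eta> * \<kappa> * L > 0" using \<epsilon> \<eta> \<kappa> L by simp
    from LIMSEQ_D[OF Dlim this] obtain N where N: "\<And>j. j \<ge> N \<Longrightarrow> norm (D j - 0) < \<epsilon> * \<eta> * \<kappa> * L" by blast
    show "\<exists>N. \<forall>j\<ge>N. norm ((LINT y|lborel. \<psi> y * F j y) - 0) < \<epsilon>"
    proof (intro exI allI impI)
      fix j assume j: "j \<ge> N"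
      have "norm (LINT y|lborel. \<psi> y * F j y) \<le> \<eta> / 2 * p2 + D j / (4 * \<eta> * \<kappa> * L) + \<zeta> / 2 * p1 + p1 * E j / (4 * \<zeta> * L)"
        using window_estimate[OF ra F f0(2) \<psi> \<phi>(2) L \<kappa> \<kappa>le \<eta> \<zeta>, of j]
        unfolding E_F D_def p1_def p2_def .
      also have "\<eta> / 2 * p2 < \<epsilon> / 4"
      proof -
        have "\<eta> / 2 * p2 = \<epsilon> / 4 * (p2 / (p2 + 1))" using p by (simp add: \<eta>_def)
        also have "\<dots> < \<epsilon> / 4 * 1" using \<epsilon> p by (intro mult_strict_left_mono) auto
        finally show ?thesis by simp
      qed
      also have "\<zeta> / 2 * p1 \<le> \<epsilon> / 4"
      proof -
        have "\<zeta> / 2 * p1 = \<epsilon> / 4 * (p1 / (p1 + 1))" using p by (simp add: \<zeta>_def)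
        also have "\<dots> \<le> \<epsilon> / 4 * 1" using \<epsilon> p by (intro mult_left_mono) auto
        finally show ?thesis by simp
      qed
      also have "D j / (4 * \<eta> * \<kappa> * L) \<le> \<epsilon> / 4"
        using N[OF j] \<eta> \<kappa> L by (simp add: field_simps)
      also have "p1 * E j / (4 * \<zeta> * L) \<le> \<epsilon> / 4"
      proof -
        have "p1 * E j \<le> p1 * E 0" using EE p by (intro mult_left_mono) auto
        also have "\<dots> \<le> \<zeta> * \<epsilon> * L" using \<zeta> \<epsilon> by (simp add: L_def field_simps)
        finally show ?thesis using \<zeta> L by (simp add: field_simps)
      qed
      finally show "norm ((LINT y|lborel. \<psi> y * F j y) - 0) < \<epsilon>" by simp
    qed
  qed
  have [measurable]: "(\<lambda>y. cnj (s y)) \<in> borel_measurable borel"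
    by (rule measurable_compose[OF s(1) borel_measurable_continuous_onI[OF continuous_on_cnj[OF continuous_on_id]]])
  \<comment> \<open>testing f against \<phi> is testing s f against cnj s \<phi>\<close>
  have "edecay c' (\<lambda>y. cnj (s y) * \<phi> y)"
    by (rule edecay_bounded_mult[OF \<phi>(1), of _ 1]) (use s(2) in simp_all)
  from main[OF this] have lim: "(\<lambda>j. LINT y|lborel. cnj (s y) * \<phi> y * F j y) \<longlonglongrightarrow> 0" .
  have "(LINT y|lborel. cnj (s y) * \<phi> y * F j y) = (LINT y|lborel. \<phi> y * f j y)" for j
  proof (rule integral_cong_AE)
    show "AE y in lborel. cnj (s y) * \<phi> y * F j y = \<phi> y * f j y"
      using AE_lborel_singleton[of 0]
    proof eventually_elim
      case (elim y)
      have sc: "s y * cnj (s y) = 1" using s(3)[OF elim] complex_norm_square[of "s y"] by simp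
      have "cnj (s y) * \<phi> y * F j y = (s y * cnj (s y)) * (\<phi> y * f j y)" by (simp only: F_def mult_ac)
      with sc show ?case by simp
    qed
  qed (simp_all add: F_def)
  with lim show ?thesis by simp
qed

section \<open>The Green's function as a family of Gaussians\<close>

text \<open>
  exp (i k y^2 / (2 t)) is exp (- \<alpha> y^2) for this \<alpha>, whose real part is positive
  because Im k > 0.
\<close>

definition gauss_rate :: "complex \<Rightarrow> real \<Rightarrow> complex" where
  "gauss_rate k t = k / (2 * \<i> * of_real t)"

lemma gauss_rate_eq: "gauss_rate k t = (- \<i> * k / 2) / of_real t"
proof -
  have "2 * \<i> * of_real t = \<i> * (2 * complex_of_real t)" by simp
  then have "gauss_rate k t = (k / \<i>) / (2 * of_real t)"
    unfolding gauss_rate_def by (simp only: divide_divide_eq_left)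
  then show ?thesis by simp
qed

lemma Re_gauss_rate: "Re (gauss_rate k t) = Im k / (2 * t)"
  by (simp add: gauss_rate_eq Re_divide_of_real)

lemma Re_gauss_rate_pos: "Im k > 0 \<Longrightarrow> t > 0 \<Longrightarrow> Re (gauss_rate k t) > 0"
  by (simp add: Re_gauss_rate)

lemma norm_gauss_rate: "t > 0 \<Longrightarrow> norm (gauss_rate k t) = norm k / (2 * t)"
  by (simp add: gauss_rate_def norm_divide norm_mult)

lemma green_eq_gauss: "green k x y = (if x > 0 then gauss (gauss_rate k x) y else 0)"
proof (cases "x > 0")
  case True
  have e1: "k / (2 * of_real pi * \<i> * of_real x) = gauss_rate k x / of_real pi" by (simp add: gauss_rate_def field_simps)
  have e2: "\<i> * k * (of_real y)\<^sup>2 / (2 * of_real x) = - gauss_rate k x * of_real y ^ 2"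
    by (simp add: gauss_rate_eq)
  show ?thesis using True unfolding green_def gauss_def e1 e2 by simp
qed (simp add: green_def)

text \<open>
  Parabolic scaling. It makes the convergence of the Green's function to a point source an
  instance of dominated convergence with one fixed Gaussian.
\<close>

lemma green_scale:
  assumes "t > 0"
  shows "of_real (sqrt t) * gauss (gauss_rate k t) (sqrt t * z) = gauss (gauss_rate k 1) z"
proof -
  have "gauss_rate k t / of_real pi = of_real (1 / t) * (gauss_rate k 1 / of_real pi)" by (simp add: gauss_rate_eq)
  then have "csqrt (gauss_rate k t / of_real pi) = of_real (sqrt (1 / t)) * csqrt (gauss_rate k 1 / of_real pi)"
    by (simp only:) (rule csqrt_real_mult, use assms in simp)
  moreover have "gauss_rate k t * of_real (sqrt t * z) ^ 2 = gauss_rate k 1 * of_real z ^ 2"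
    using assms by (simp add: gauss_rate_eq power_mult_distrib flip: of_real_power)
  ultimately show ?thesis
    using assms by (simp add: gauss_def real_sqrt_divide)
qed

definition gauss'' :: "complex \<Rightarrow> real \<Rightarrow> complex" where
  "gauss'' \<alpha> y = (4 * \<alpha>\<^sup>2 * of_real y ^ 2 - 2 * \<alpha>) * gauss \<alpha> y"

lemma gauss'_has_vector_derivative: "((\<lambda>y. gauss' \<alpha> (y - z)) has_vector_derivative gauss'' \<alpha> (y - z)) (at y)"
proof -
  have "((\<lambda>w. - 2 * \<alpha> * (w - of_real z) * (csqrt (\<alpha> / of_real pi) * exp (- \<alpha> * (w - of_real z) ^ 2))) has_field_derivative gauss'' \<alpha> (y - z)) (at (of_real y))"
    unfolding gauss''_def gauss_def by (auto intro!: derivative_eq_intros simp: algebra_simps power2_eq_square)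
  from has_vector_derivative_real_field[OF this] show ?thesis by (simp add: gauss_def gauss'_def)
qed

text \<open>
  As a function of its starting point x the Green's function solves the adjoint equation.
\<close>

lemma green_time_derivative:
  assumes x: "x < X" and k: "k \<noteq> 0"
  shows "((\<lambda>x. gauss (gauss_rate k (X - x)) z) has_vector_derivative - (\<i> / (2 * k) * gauss'' (gauss_rate k (X - x)) z)) (at x)"
proof -
  define A where "A = - \<i> * k / 2"
  have A0: "A \<noteq> 0" using k by (simp add: A_def)
  define c where "c = csqrt (A / of_real pi)"
  have g: "gauss (gauss_rate k t) z = c * (of_real (1 / sqrt t) * exp (- (A * of_real z ^ 2) * of_real (1 / t)))" if "t > 0" for t
  proof -
    have "gauss_rate k t / of_real pi = of_real (1 / t) * (A / of_real pi)" by (simp add: gauss_rate_eq A_def)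
    then have "csqrt (gauss_rate k t / of_real pi) = of_real (sqrt (1 / t)) * c"
      unfolding c_def by (simp only:) (rule csqrt_real_mult, use that in simp)
    moreover have "- gauss_rate k t * of_real z ^ 2 = - (A * of_real z ^ 2) * of_real (1 / t)" by (simp add: gauss_rate_eq A_def)
    ultimately show ?thesis unfolding gauss_def by (simp add: real_sqrt_divide)
  qed
  define t where "t = X - x"
  have t: "t > 0" using x by (simp add: t_def)
  have d1: "((\<lambda>x. 1 / sqrt (X - x)) has_vector_derivative (1 / sqrt t / (2 * t))) (at x)"
    unfolding has_real_derivative_iff_has_vector_derivative[symmetric]
    using t by (auto intro!: derivative_eq_intros simp: t_def[symmetric] field_simps)
  have d2: "((\<lambda>x. 1 / (X - x)) has_vector_derivative 1 / t\<^sup>2) (at x)"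
    unfolding has_real_derivative_iff_has_vector_derivative[symmetric]
    using t by (auto intro!: derivative_eq_intros simp: t_def[symmetric] power2_eq_square field_simps)
  define E where "E = - (A * of_real z ^ 2)"
  have d3: "((\<lambda>w. exp (E * w)) has_field_derivative E * exp (E * of_real (1 / t))) (at (of_real (1 / t)))"
    by (auto intro!: derivative_eq_intros)
  have d4: "((\<lambda>x. exp (E * of_real (1 / (X - x)))) has_vector_derivative (1 / t\<^sup>2) *\<^sub>R (E * exp (E * of_real (1 / t)))) (at x)"
    using vector_diff_chain_at[OF d2, of "\<lambda>u. exp (E * of_real u)"] has_vector_derivative_real_field[OF d3] 
    by (simp add: comp_def t_def)
  have d5: "((\<lambda>x. complex_of_real (1 / sqrt (X - x))) has_vector_derivative of_real (1 / sqrt t / (2 * t))) (at x)"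
    by (rule has_vector_derivative_of_real) (use d1 in \<open>simp add: has_real_derivative_iff_has_vector_derivative\<close>)
  have "((\<lambda>x. c * (of_real (1 / sqrt (X - x)) * exp (E * of_real (1 / (X - x))))) has_vector_derivative
      c * (of_real (1 / sqrt (X - x)) * ((1 / t\<^sup>2) *\<^sub>R (E * exp (E * of_real (1 / t)))) +
        of_real (1 / sqrt t / (2 * t)) * exp (E * of_real (1 / (X - x))))) (at x)"
    by (intro has_vector_derivative_mult_right has_vector_derivative_mult d4 d5)
  moreover have "c * (of_real (1 / sqrt (X - x)) * ((1 / t\<^sup>2) *\<^sub>R (E * exp (E * of_real (1 / t)))) +
        of_real (1 / sqrt t / (2 * t)) * exp (E * of_real (1 / (X - x)))) = - (\<i> / (2 * k) * gauss'' (gauss_rate k (X - x)) z)"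
  proof -
    have ct: "complex_of_real t \<noteq> 0" using t by simp
    have k2: "\<i> / (2 * k) = 1 / (4 * A)" using k by (simp add: A_def field_simps)
    have gauss_rate: "gauss_rate k t = A / of_real t" by (simp add: gauss_rate_eq A_def)
    have "- (\<i> / (2 * k) * gauss'' (gauss_rate k t) z) =
        - (1 / (4 * A) * (4 * (A / of_real t)\<^sup>2 * of_real z ^ 2 - 2 * (A / of_real t))) * gauss (gauss_rate k t) z"
      unfolding gauss''_def k2 gauss_rate by simp
    also have "- (1 / (4 * A) * (4 * (A / of_real t)\<^sup>2 * of_real z ^ 2 - 2 * (A / of_real t))) = E / of_real t ^ 2 + 1 / (2 * of_real t)"
      using A0 ct by (simp add: E_def field_simps power2_eq_square)
    also have "(E / of_real t ^ 2 + 1 / (2 * of_real t)) * gauss (gauss_rate k t) z =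
      c * (of_real (1 / sqrt t) * ((1 / t\<^sup>2) *\<^sub>R (E * exp (E * of_real (1 / t)))) + of_real (1 / sqrt t / (2 * t)) * exp (E * of_real (1 / t)))"
      unfolding g[OF t] E_def[symmetric] by (simp add: scaleR_conv_of_real algebra_simps)
    finally show ?thesis unfolding t_def[symmetric] by simp
  qed
  ultimately have "((\<lambda>x. c * (of_real (1 / sqrt (X - x)) * exp (E * of_real (1 / (X - x))))) has_vector_derivative
     - (\<i> / (2 * k) * gauss'' (gauss_rate k (X - x)) z)) (at x)" by simp
  then show ?thesis
    by (rule has_vector_derivative_transform_within_open[of _ _ _ "{..<X}"])
       (use x in \<open>auto simp: g E_def\<close>)
qed

lemma green_uniform_bound:
  assumes k: "Im k > 0" and t: "0 < t1"
  obtains M where "M > 0" "\<And>t z. t1 \<le> t \<Longrightarrow> t \<le> t2 \<Longrightarrow> norm (gauss (gauss_rate k t) z) \<le> M * exp (- d * \<bar>z\<bar>)"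
    "\<And>t z. t1 \<le> t \<Longrightarrow> t \<le> t2 \<Longrightarrow> norm (gauss' (gauss_rate k t) z) \<le> M * exp (- d * \<bar>z\<bar>)"
proof (cases "t1 \<le> t2")
  case True
  define p where "p = Im k / (2 * t2)"
  have p: "p > 0" using k t True by (simp add: p_def)
  define Q where "Q = sqrt (norm k / (2 * t1) / pi)"
  define B where "B = exp ((d + 1 + norm (0::complex))\<^sup>2 / (4 * p))"
  define M where "M = Q * B + (norm k / t1) * (Q * B) + 1"
  have Q: "Q \<ge> 0" using t by (simp add: Q_def)
  have B: "B > 0" by (simp add: B_def)
  have R: "Re (gauss_rate k s) \<ge> p" if "t1 \<le> s" "s \<le> t2" for s
    unfolding Re_gauss_rate p_def using that t k by (intro divide_left_mono) auto
  have na: "norm (gauss_rate k s) \<le> norm k / (2 * t1)" if "t1 \<le> s" for s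
    using that t by (simp add: norm_gauss_rate frac_le)
  have q: "norm (csqrt (gauss_rate k s / of_real pi)) \<le> Q" if "t1 \<le> s" for s
  proof -
    have "norm (gauss_rate k s) / pi \<le> norm k / (2 * t1) / pi" using na[OF that] by (intro divide_right_mono) auto
    then show ?thesis unfolding Q_def by (simp only: norm_csqrt norm_divide norm_of_real abs_of_pos[OF pi_gt_zero] real_sqrt_le_iff)
  qed
  show thesis
  proof (rule that[of M])
    show "M > 0" unfolding M_def using Q B t by (intro add_nonneg_pos add_nonneg_nonneg) auto
    fix s z assume s: "t1 \<le> s" "s \<le> t2"
    have b: "norm (of_real z ^ j * exp (- gauss_rate k s * of_real z ^ 2)) \<le> fact j * B * exp (- d * \<bar>z\<bar>)" for j
      using gaussian_poly_bound[OF p R[OF s], of z j 0 d] by (simp add: B_def)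
    have "norm (gauss (gauss_rate k s) z) \<le> Q * (fact 0 * B * exp (- d * \<bar>z\<bar>))"
      unfolding gauss_def norm_mult using b[of 0] by (intro mult_mono q s Q) auto
    also have "\<dots> \<le> M * exp (- d * \<bar>z\<bar>)"
      using Q B t by (simp add: M_def algebra_simps)
    finally show "norm (gauss (gauss_rate k s) z) \<le> M * exp (- d * \<bar>z\<bar>)" .
    have "norm (gauss' (gauss_rate k s) z) = 2 * norm (gauss_rate k s) * (norm (csqrt (gauss_rate k s / of_real pi)) * norm (of_real z ^ 1 * exp (- gauss_rate k s * of_real z ^ 2)))"
      by (simp add: gauss'_def gauss_def norm_mult)
    also have "\<dots> \<le> 2 * (norm k / (2 * t1)) * (Q * (fact 1 * B * exp (- d * \<bar>z\<bar>)))"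
      by (intro mult_mono q s Q b na) (use t Q in auto)
    also have "\<dots> \<le> M * exp (- d * \<bar>z\<bar>)"
      using Q B t by (simp add: M_def algebra_simps)
    finally show "norm (gauss' (gauss_rate k s) z) \<le> M * exp (- d * \<bar>z\<bar>)" .
  qed
next
  case False
  show thesis by (rule that[of 1]) (use False in auto)
qed

section \<open>Uniqueness in a strip\<close>

text \<open>
  The derivatives are carried as arguments, so that solutions can be added, reflected and glued
  by acting on them. The relation between Fx and Fyy is L F = 0 solved for Fx, where -1/(2ik) =
  i/(2k).
\<close>

definition parabolic_on :: "complex \<Rightarrow> (real \<times> real) set \<Rightarrow> (real \<Rightarrow> real \<Rightarrow> complex) \<Rightarrow>
    (real \<Rightarrow> real \<Rightarrow> complex) \<Rightarrow> (real \<Rightarrow> real \<Rightarrow> complex) \<Rightarrow> (real \<Rightarrow> real \<Rightarrow> complex) \<Rightarrow> bool" where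
  "parabolic_on k S F Fx Fy Fyy \<longleftrightarrow>
     (\<forall>(x, y)\<in>S. ((\<lambda>s. F s y) has_vector_derivative Fx x y) (at x) \<and>
        (F x has_vector_derivative Fy x y) (at y) \<and> (Fy x has_vector_derivative Fyy x y) (at y) \<and>
        Fx x y = \<i> / (2 * k) * Fyy x y) \<and>
     continuous_on S (\<lambda>(x, y). F x y) \<and> continuous_on S (\<lambda>(x, y). Fx x y) \<and>
     continuous_on S (\<lambda>(x, y). Fy x y) \<and> continuous_on S (\<lambda>(x, y). Fyy x y)"

lemma parabolic_onD:
  assumes "parabolic_on k S F Fx Fy Fyy" "(x, y) \<in> S"
  shows "((\<lambda>s. F s y) has_vector_derivative Fx x y) (at x)" "(F x has_vector_derivative Fy x y) (at y)"
    "(Fy x has_vector_derivative Fyy x y) (at y)" "Fx x y = \<i> / (2 * k) * Fyy x y"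
  using assms unfolding parabolic_on_def by auto

lemma parabolic_on_cont:
  assumes "parabolic_on k S F Fx Fy Fyy"
  shows "continuous_on S (\<lambda>(x, y). F x y)" "continuous_on S (\<lambda>(x, y). Fx x y)"
    "continuous_on S (\<lambda>(x, y). Fyy x y)" "continuous_on S (\<lambda>(x, y). Fy x y)"
  using assms unfolding parabolic_on_def by auto

lemma has_vector_derivative_continuous_on:
  assumes "\<And>y. (f has_vector_derivative f' y) (at y)"
  shows "continuous_on S f"
  using has_vector_derivative_continuous[OF assms] continuous_at_imp_continuous_on by blast

text \<open>
  The cutoff (1 - ((y - Y)/R)^2)^2 on [Y - R, Y + R] vanishes to second order at both ends, so
  that two integrations by parts leave no boundary terms.
\<close>

definition cutoff :: "real \<Rightarrow> real \<Rightarrow> real \<Rightarrow> real" where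
  "cutoff Y R y = (1 - ((y - Y) / R)\<^sup>2)\<^sup>2"
definition cutoff' :: "real \<Rightarrow> real \<Rightarrow> real \<Rightarrow> real" where
  "cutoff' Y R y = - 4 * ((y - Y) / R) * (1 - ((y - Y) / R)\<^sup>2) / R"
definition cutoff'' :: "real \<Rightarrow> real \<Rightarrow> real \<Rightarrow> real" where
  "cutoff'' Y R y = (12 * ((y - Y) / R)\<^sup>2 - 4) / R\<^sup>2"

lemma cutoff_derivs:
  assumes "R > 0"
  shows "((\<lambda>y. complex_of_real (cutoff Y R y)) has_vector_derivative of_real (cutoff' Y R y)) (at y)"
    "((\<lambda>y. complex_of_real (cutoff' Y R y)) has_vector_derivative of_real (cutoff'' Y R y)) (at y)"
proof -
  have "(cutoff Y R has_field_derivative cutoff' Y R y) (at y)"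
    unfolding cutoff_def[abs_def] cutoff'_def using assms
    by (auto intro!: derivative_eq_intros simp: field_simps power2_eq_square)
  then show "((\<lambda>y. complex_of_real (cutoff Y R y)) has_vector_derivative of_real (cutoff' Y R y)) (at y)"
    by (rule has_vector_derivative_of_real)
  have "(cutoff' Y R has_field_derivative cutoff'' Y R y) (at y)"
    unfolding cutoff'_def[abs_def] cutoff''_def using assms
    by (auto intro!: derivative_eq_intros simp: field_simps power2_eq_square)
  then show "((\<lambda>y. complex_of_real (cutoff' Y R y)) has_vector_derivative of_real (cutoff'' Y R y)) (at y)"
    by (rule has_vector_derivative_of_real)
qed

lemma cutoff_bounds:
  assumes "R \<ge> 1" "y \<in> {Y - R..Y + R}"
  shows "0 \<le> cutoff Y R y" "cutoff Y R y \<le> 1" "\<bar>cutoff' Y R y\<bar> \<le> 4 / R" "\<bar>cutoff'' Y R y\<bar> \<le> 8 / R"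
proof -
  define w where "w = (y - Y) / R"
  have w: "\<bar>w\<bar> \<le> 1" using assms by (auto simp: w_def abs_le_iff field_simps)
  have w2: "0 \<le> w\<^sup>2" "w\<^sup>2 \<le> 1" using w by (auto simp: abs_square_le_1)
  show "0 \<le> cutoff Y R y" by (simp add: cutoff_def)
  show "cutoff Y R y \<le> 1" unfolding cutoff_def w_def[symmetric] using w2 by (intro power_le_one) auto
  have "\<bar>w\<bar> * \<bar>1 - w\<^sup>2\<bar> \<le> 1 * 1" using w w2 by (intro mult_mono) auto
  then show "\<bar>cutoff' Y R y\<bar> \<le> 4 / R"
    unfolding cutoff'_def w_def[symmetric] using assms(1) by (simp add: abs_mult divide_right_mono)
  have "\<bar>12 * w\<^sup>2 - 4\<bar> \<le> 8" using w2 by linarith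
  then have "\<bar>12 * w\<^sup>2 - 4\<bar> / R\<^sup>2 \<le> 8 / R\<^sup>2" by (intro divide_right_mono) auto
  also have "\<dots> \<le> 8 / R" using assms(1) by (intro divide_left_mono) (auto simp: power2_eq_square)
  finally show "\<bar>cutoff'' Y R y\<bar> \<le> 8 / R" unfolding cutoff''_def w_def[symmetric] by simp
qed

lemma cutoff_ends: "R > 0 \<Longrightarrow> cutoff Y R (Y + R) = 0" "R > 0 \<Longrightarrow> cutoff Y R (Y - R) = 0"
    "R > 0 \<Longrightarrow> cutoff' Y R (Y + R) = 0" "R > 0 \<Longrightarrow> cutoff' Y R (Y - R) = 0"
  by (auto simp: cutoff_def cutoff'_def)

text \<open>
  F solves the equation and G the adjoint one. After two integrations by parts only terms in
  which the cutoff is differentiated remain.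
\<close>

lemma cutoff_pairing_derivative:
  fixes Y x :: real
  assumes k: "Im k > 0" and sol: "parabolic_on k ({x0<..<X} \<times> UNIV) F Fx Fy Fyy"
    and R: "R > 0" and x: "x \<in> {x0<..<X}"
  defines "G \<equiv> \<lambda>x (y::real). gauss (gauss_rate k (X - x)) (y - Y)" and "G' \<equiv> \<lambda>x (y::real). gauss' (gauss_rate k (X - x)) (y - Y)"
  shows "((\<lambda>x. integral {Y - R..Y + R} (\<lambda>y. of_real (cutoff Y R y) * F x y * G x y)) has_vector_derivative
     \<i> / (2 * k) * integral {Y - R..Y + R} (\<lambda>y. F x y * (of_real (cutoff'' Y R y) * G x y + 2 * of_real (cutoff' Y R y) * G' x y))) (at x)"
proof -
  let ?I = "{Y - R..Y + R}" and ?U = "{x0<..<X}"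
  let ?c = "\<lambda>y. complex_of_real (cutoff Y R y)" and ?c' = "\<lambda>y. complex_of_real (cutoff' Y R y)"
    and ?c'' = "\<lambda>y. complex_of_real (cutoff'' Y R y)"
  define G'' where "G'' x y = gauss'' (gauss_rate k (X - x)) (y - Y)" for x y
  have k0: "k \<noteq> 0" using k by auto
  define D where "D = \<i> / (2 * k)"
  have Gt: "((\<lambda>x. G x y) has_vector_derivative - (D * G'' x y)) (at x)" if "x \<in> ?U" for x y
    unfolding G_def G''_def D_def using green_time_derivative[OF _ k0] that by auto
  have Gy: "(G x has_vector_derivative G' x y) (at y)" "(G' x has_vector_derivative G'' x y) (at y)" for x y
    unfolding G_def G'_def G''_def by (rule gauss_has_vector_derivative gauss'_has_vector_derivative)+
  note sl = parabolic_onD[OF sol] and sc = parabolic_on_cont[OF sol]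
  define fx where "fx x y = ?c y * (Fx x y * G x y - F x y * (D * G'' x y))" for x y
  have contal: "continuous_on (?U \<times> T) (\<lambda>p. gauss_rate k (X - fst p))" for T :: "real set"
    unfolding gauss_rate_def by (intro continuous_intros) auto
  have contG: "continuous_on (?U \<times> T) (\<lambda>p. G (fst p) (snd p))" "continuous_on (?U \<times> T) (\<lambda>p. G'' (fst p) (snd p))" for T
  proof -
    have "gauss_rate k (X - fst p) / of_real pi \<notin> \<real>\<^sub>\<le>\<^sub>0" if "p \<in> ?U \<times> T" for p
      by (rule div_pi_not_nonpos[OF Re_gauss_rate_pos[OF k]]) (use that in auto)
    then have "(\<lambda>p. gauss_rate k (X - fst p) / of_real pi) ` (?U \<times> T) \<subseteq> - \<real>\<^sub>\<le>\<^sub>0" by auto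
    moreover have "continuous_on (?U \<times> T) (\<lambda>p. gauss_rate k (X - fst p) / of_real pi)"
      by (intro continuous_intros contal) auto
    ultimately have "continuous_on (?U \<times> T) (\<lambda>p. csqrt (gauss_rate k (X - fst p) / of_real pi))"
      by (intro continuous_on_compose2[OF continuous_on_csqrt]) auto
    then show 1: "continuous_on (?U \<times> T) (\<lambda>p. G (fst p) (snd p))" unfolding G_def gauss_def
      by (intro continuous_intros contal)
    show "continuous_on (?U \<times> T) (\<lambda>p. G'' (fst p) (snd p))" unfolding G''_def gauss''_def
      using 1 unfolding G_def by (intro continuous_intros contal)
  qed
  have cF: "continuous_on (?U \<times> T) (\<lambda>p. F (fst p) (snd p))" "continuous_on (?U \<times> T) (\<lambda>p. Fx (fst p) (snd p))"
     "continuous_on (?U \<times> T) (\<lambda>p. Fyy (fst p) (snd p))" for T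
  proof -
    have sub: "?U \<times> T \<subseteq> ?U \<times> UNIV" by auto
    show "continuous_on (?U \<times> T) (\<lambda>p. F (fst p) (snd p))" "continuous_on (?U \<times> T) (\<lambda>p. Fx (fst p) (snd p))"
     "continuous_on (?U \<times> T) (\<lambda>p. Fyy (fst p) (snd p))"
      using continuous_on_subset[OF sc(1) sub] continuous_on_subset[OF sc(2) sub] continuous_on_subset[OF sc(3) sub]
      by (simp_all add: case_prod_beta)
  qed
  have cc: "continuous_on T ?c" "continuous_on T ?c'" "continuous_on T ?c''" for T
    unfolding cutoff_def cutoff'_def cutoff''_def using R by (auto intro!: continuous_intros)
  have contG': "continuous_on S (G x)" "continuous_on S (G' x)" "continuous_on S (F x)" if x: "x \<in> ?U" for x S
  proof -
    have xS: "(x, y) \<in> {x0<..<X} \<times> UNIV" for y using x by simp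
    show "continuous_on S (G x)" by (rule has_vector_derivative_continuous_on[OF Gy(1)])
    show "continuous_on S (G' x)" by (rule has_vector_derivative_continuous_on[OF Gy(2)])
    show "continuous_on S (F x)" by (rule has_vector_derivative_continuous_on[OF sl(2)[OF xS]])
  qed
  have "((\<lambda>x. integral (cbox (Y - R) (Y + R)) (\<lambda>y. ?c y * F x y * G x y)) has_vector_derivative
      integral (cbox (Y - R) (Y + R)) (fx x)) (at x within ?U)"
  proof (rule leibniz_rule_vector_derivative[OF _ _ _ x])
    fix x y assume x: "x \<in> ?U"
    have "((\<lambda>x. ?c y * (F x y * G x y)) has_vector_derivative ?c y * (F x y * - (D * G'' x y) + Fx x y * G x y)) (at x)"
      by (intro has_vector_derivative_mult_right has_vector_derivative_mult sl Gt x) (use x in auto)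
    then show "((\<lambda>x. ?c y * F x y * G x y) has_vector_derivative fx x y) (at x within ?U)"
      unfolding fx_def by (simp add: mult.assoc has_vector_derivative_at_within)
  next
    fix x assume x: "x \<in> ?U"
    have "continuous_on (cbox (Y - R) (Y + R)) (\<lambda>y. ?c y * F x y * G x y)"
      by (intro continuous_on_mult cc contG'[OF x])
    then show "(\<lambda>y. ?c y * F x y * G x y) integrable_on cbox (Y - R) (Y + R)" by (rule integrable_continuous)
  next
    show "continuous_on (?U \<times> cbox (Y - R) (Y + R)) (\<lambda>(x, t). fx x t)"
      unfolding fx_def case_prod_beta
      by (intro continuous_on_mult continuous_on_diff continuous_on_const cF contG
          continuous_on_compose2[OF cc(1)[of UNIV] continuous_on_snd[OF continuous_on_id]] subset_UNIV)
  qed simp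
  then have der: "((\<lambda>x. integral ?I (\<lambda>y. ?c y * F x y * G x y)) has_vector_derivative integral ?I (fx x)) (at x)"
    using x by (simp add: at_within_open[of x ?U])
  define r where "r y = F x y * (?c'' y * G x y + 2 * ?c' y * G' x y)" for y
  define b where "b y = Fy x y * (?c y * G x y) - F x y * (?c y * G' x y + ?c' y * G x y)" for y
  have bder: "(b has_vector_derivative (Fyy x y * (?c y * G x y) - F x y * (?c y * G'' x y + 2 * ?c' y * G' x y + ?c'' y * G x y))) (at y)" for y
  proof -
    have p1: "((\<lambda>y. ?c y * G x y) has_vector_derivative (?c y * G' x y + ?c' y * G x y)) (at y)"
      by (intro has_vector_derivative_mult cutoff_derivs R Gy)
    have p2: "((\<lambda>y. ?c y * G' x y + ?c' y * G x y) has_vector_derivative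
        ((?c y * G'' x y + ?c' y * G' x y) + (?c' y * G' x y + ?c'' y * G x y))) (at y)"
      by (intro has_vector_derivative_mult has_vector_derivative_add cutoff_derivs R Gy)
    have "(b has_vector_derivative (Fy x y * (?c y * G' x y + ?c' y * G x y) + Fyy x y * (?c y * G x y)) -
       (F x y * ((?c y * G'' x y + ?c' y * G' x y) + (?c' y * G' x y + ?c'' y * G x y)) + Fy x y * (?c y * G' x y + ?c' y * G x y))) (at y)"
      unfolding b_def by (intro has_vector_derivative_diff has_vector_derivative_mult[OF sl(3) p1] has_vector_derivative_mult[OF sl(2) p2]) (use x in auto)
    then show ?thesis by (simp add: algebra_simps)
  qed
  have "((\<lambda>y. Fyy x y * (?c y * G x y) - F x y * (?c y * G'' x y + 2 * ?c' y * G' x y + ?c'' y * G x y)) has_integral b (Y + R) - b (Y - R)) ?I"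
    by (rule fundamental_theorem_of_calculus) (use R has_vector_derivative_at_within[OF bder] in auto)
  moreover have "b (Y + R) = 0" "b (Y - R) = 0" using R by (simp_all add: b_def cutoff_ends)
  ultimately have hi: "((\<lambda>y. Fyy x y * (?c y * G x y) - F x y * (?c y * G'' x y + 2 * ?c' y * G' x y + ?c'' y * G x y)) has_integral 0) ?I" by simp
  have rint: "r integrable_on ?I" unfolding r_def
    by (intro integrable_continuous_interval continuous_intros cc contG'[OF x])
  have "fx x = (\<lambda>y. D * (Fyy x y * (?c y * G x y) - F x y * (?c y * G'' x y + 2 * ?c' y * G' x y + ?c'' y * G x y)) + D * r y)"
    using sl(4)[of x] x unfolding fx_def r_def D_def[symmetric] by (auto simp: algebra_simps)
  then have "(fx x has_integral D * 0 + D * integral ?I r) ?I"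
    using has_integral_add[OF has_integral_mult_right[OF hi, of D] has_integral_mult_right[OF integrable_integral[OF rint], of D]]
    by (simp only:)
  then have "integral ?I (fx x) = D * integral ?I r" by (simp add: integral_unique)
  with der show ?thesis unfolding r_def D_def by simp
qed

lemma exp_abs_growth: "c \<ge> 0 \<Longrightarrow> exp (c * \<bar>y\<bar>) \<le> exp (c * \<bar>Y\<bar>) * exp (c * \<bar>y - Y\<bar>)" for c y Y :: real
proof -
  assume "c \<ge> 0"
  then have "c * \<bar>y\<bar> \<le> c * (\<bar>Y\<bar> + \<bar>y - Y\<bar>)" by (intro mult_left_mono) auto
  then show ?thesis by (simp add: exp_add[symmetric] algebra_simps)
qed

text \<open>
  The derivatives of the cutoff are O(1/R), so the pairing with cutoff is constant up to O(1/R).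
  The Gaussian decay of the kernel beats the exponential growth of F.
\<close>

lemma pairing_constant:
  fixes Y :: real
  assumes k: "Im k > 0" and sol: "parabolic_on k ({x0<..<X} \<times> UNIV) F Fx Fy Fyy"
    and c: "c \<ge> 0" and F: "\<And>x y. x \<in> {x0<..<X} \<Longrightarrow> norm (F x y) \<le> C * exp (c * \<bar>y\<bar>)"
    and x1: "x0 < x1" "x1 \<le> x2" "x2 < X"
  shows "(LINT y|lborel. F x1 y * gauss (gauss_rate k (X - x1)) (y - Y)) = (LINT y|lborel. F x2 y * gauss (gauss_rate k (X - x2)) (y - Y))"
proof -
  let ?S = "{x1..x2}"
  have SU: "?S \<subseteq> {x0<..<X}" using x1 by auto
  have C0: "C \<ge> 0"
  proof -
    have "0 \<le> C * exp (c * \<bar>0\<bar>)" by (rule order_trans[OF norm_ge_zero F[of x1]]) (use x1 in auto)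
    then show ?thesis by simp
  qed
  define G where "G x y = gauss (gauss_rate k (X - x)) (y - Y)" for x y
  define G' where "G' x y = gauss' (gauss_rate k (X - x)) (y - Y)" for x y
  obtain M where M: "M > 0" "\<And>t z. X - x2 \<le> t \<Longrightarrow> t \<le> X - x1 \<Longrightarrow> norm (gauss (gauss_rate k t) z) \<le> M * exp (- (c + 1) * \<bar>z\<bar>)"
    "\<And>t z. X - x2 \<le> t \<Longrightarrow> t \<le> X - x1 \<Longrightarrow> norm (gauss' (gauss_rate k t) z) \<le> M * exp (- (c + 1) * \<bar>z\<bar>)"
    using green_uniform_bound[OF k, of "X - x2" "X - x1" "c + 1"] x1 by auto
  have FG: "norm (F x y * g) \<le> C * exp (c * \<bar>Y\<bar>) * M * exp (- 1 * \<bar>Y - y\<bar>)"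
    if "x \<in> ?S" "norm g \<le> M * exp (- (c + 1) * \<bar>y - Y\<bar>)" for x y g
  proof -
    have "norm (F x y * g) \<le> (C * exp (c * \<bar>y\<bar>)) * (M * exp (- (c + 1) * \<bar>y - Y\<bar>))"
      unfolding norm_mult using F[of x y] that SU C0 by (intro mult_mono) auto
    also have "\<dots> \<le> (C * (exp (c * \<bar>Y\<bar>) * exp (c * \<bar>y - Y\<bar>))) * (M * exp (- (c + 1) * \<bar>y - Y\<bar>))"
      using C0 M(1) by (intro mult_right_mono mult_left_mono exp_abs_growth c) auto
    also have "\<dots> = C * exp (c * \<bar>Y\<bar>) * M * exp (- 1 * \<bar>Y - y\<bar>)"
      by (simp add: mult_exp_exp abs_minus_commute algebra_simps)
    finally show ?thesis .
  qed
  have G_le: "norm (G x y) \<le> M * exp (- (c + 1) * \<bar>y - Y\<bar>)" "norm (G' x y) \<le> M * exp (- (c + 1) * \<bar>y - Y\<bar>)" if "x \<in> ?S" for x y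
  proof -
    have t: "X - x2 \<le> X - x" "X - x \<le> X - x1" using that by auto
    show "norm (G x y) \<le> M * exp (- (c + 1) * \<bar>y - Y\<bar>)" unfolding G_def by (rule M(2)[OF t])
    show "norm (G' x y) \<le> M * exp (- (c + 1) * \<bar>y - Y\<bar>)" unfolding G'_def by (rule M(3)[OF t])
  qed
  define B where "B = C * exp (c * \<bar>Y\<bar>) * M"
  have B0: "B \<ge> 0" using C0 M(1) by (simp add: B_def)
  have iexp: "integrable lborel (\<lambda>y. exp (- 1 * \<bar>Y - y\<bar>))" by (rule integrable_exp_abs_shift) simp
  define J where "J = (LINT y|lborel. exp (- 1 * \<bar>Y - y\<bar>))"
  have J: "integral UNIV (\<lambda>y. exp (- 1 * \<bar>Y - y\<bar>)) = J" unfolding J_def by (rule integral_lborel[OF iexp])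
  define \<Phi> where "\<Phi> R x = integral {Y - R..Y + R} (\<lambda>y. of_real (cutoff Y R y) * F x y * G x y)" for R x
  have contF: "continuous_on S (F x)" "continuous_on S (G x)" "continuous_on S (G' x)" if "x \<in> ?S" for x S
  proof -
    have xS: "(x, y) \<in> {x0<..<X} \<times> UNIV" for y using that SU by auto
    show "continuous_on S (F x)" by (rule has_vector_derivative_continuous_on[OF parabolic_onD(2)[OF sol xS]])
    show "continuous_on S (G x)" "continuous_on S (G' x)"
      unfolding G_def G'_def
      by (rule has_vector_derivative_continuous_on[OF gauss_has_vector_derivative]
          has_vector_derivative_continuous_on[OF gauss'_has_vector_derivative])+
  qed
  have contc: "continuous_on S (\<lambda>y. complex_of_real (cutoff Y R y))" "continuous_on S (\<lambda>y. complex_of_real (cutoff' Y R y))"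
     "continuous_on S (\<lambda>y. complex_of_real (cutoff'' Y R y))" if "R > 0" for R S
    unfolding cutoff_def cutoff'_def cutoff''_def using that by (auto intro!: continuous_intros)
  have small: "norm (\<Phi> R x2 - \<Phi> R x1) \<le> norm (\<i> / (2 * k)) * (16 / R * B * J) * \<bar>x2 - x1\<bar>" if R: "R \<ge> 1" for R
  proof (rule norm_diff_le_derivative_bound[of ?S])
    fix x assume x: "x \<in> ?S"
    have R0: "R > 0" using R by simp
    define r where "r y = F x y * (of_real (cutoff'' Y R y) * G x y + 2 * of_real (cutoff' Y R y) * G' x y)" for y
    show "(\<Phi> R has_vector_derivative \<i> / (2 * k) * integral {Y - R..Y + R} r) (at x)"
      unfolding \<Phi>_def[abs_def] G_def r_def G'_def
      by (rule cutoff_pairing_derivative[OF k sol R0]) (use x SU in auto)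
    have "norm (integral {Y - R..Y + R} r) \<le> integral {Y - R..Y + R} (\<lambda>y. 16 / R * B * exp (- 1 * \<bar>Y - y\<bar>))"
    proof (rule integral_norm_bound_integral)
      show "r integrable_on {Y - R..Y + R}" unfolding r_def
        by (intro integrable_continuous_interval continuous_intros contF x contc R0)
      show "(\<lambda>y. 16 / R * B * exp (- 1 * \<bar>Y - y\<bar>)) integrable_on {Y - R..Y + R}"
        by (intro integrable_continuous_interval continuous_intros)
      fix y assume y: "y \<in> {Y - R..Y + R}"
      note cb = cutoff_bounds[OF R y]
      have "norm (r y) \<le> norm (of_real (cutoff'' Y R y) * (F x y * G x y)) + norm (2 * of_real (cutoff' Y R y) * (F x y * G' x y))"
        unfolding r_def using norm_triangle_ineq[of "of_real (cutoff'' Y R y) * (F x y * G x y)" "2 * of_real (cutoff' Y R y) * (F x y * G' x y)"]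
        by (simp add: algebra_simps)
      also have "norm (of_real (cutoff'' Y R y) * (F x y * G x y)) \<le> 8 / R * (B * exp (- 1 * \<bar>Y - y\<bar>))"
        unfolding norm_mult[of "of_real _"] norm_of_real B_def by (intro mult_mono cb FG x G_le) (use R in auto)
      also have "norm (2 * of_real (cutoff' Y R y) * (F x y * G' x y)) \<le> (2 * (4 / R)) * (B * exp (- 1 * \<bar>Y - y\<bar>))"
        unfolding norm_mult[of "2 * of_real _"] norm_mult[of 2] norm_of_real B_def norm_numeral
        by (intro mult_mono cb FG x G_le) (use R in auto)
      finally show "norm (r y) \<le> 16 / R * B * exp (- 1 * \<bar>Y - y\<bar>)" by (simp add: algebra_simps)
    qed
    also have "\<dots> = 16 / R * B * integral {Y - R..Y + R} (\<lambda>y. exp (- 1 * \<bar>Y - y\<bar>))" by simp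
    also have "\<dots> \<le> 16 / R * B * J"
    proof (intro mult_left_mono)
      show "integral {Y - R..Y + R} (\<lambda>y. exp (- 1 * \<bar>Y - y\<bar>)) \<le> J"
        unfolding J[symmetric]
        by (rule integral_subset_le) (use integrable_on_lborel[OF iexp] in \<open>auto intro!: integrable_continuous_interval continuous_intros\<close>)
    qed (use R B0 in auto)
    finally show "norm (\<i> / (2 * k) * integral {Y - R..Y + R} r) \<le> norm (\<i> / (2 * k)) * (16 / R * B * J)"
      unfolding norm_mult[of "\<i> / (2 * k)"] by (intro mult_left_mono) auto
  qed (use x1 in auto)
  have lim: "(\<lambda>n. \<Phi> (real (Suc n)) x) \<longlonglongrightarrow> (LINT y|lborel. F x y * G x y)" if x: "x \<in> ?S" for x
  proof -
    define f where "f n y = indicator {Y - real (Suc n)..Y + real (Suc n)} y *\<^sub>R (of_real (cutoff Y (real (Suc n)) y) * F x y * G x y)" for n y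
    have "(\<lambda>n. LINT y|lborel. f n y) \<longlonglongrightarrow> (LINT y|lborel. F x y * G x y)"
    proof (rule integral_dominated_convergence[where w = "\<lambda>y. B * exp (- 1 * \<bar>Y - y\<bar>)"])
      have [measurable]: "F x \<in> borel_measurable borel" "G x \<in> borel_measurable borel"
        using contF[OF x, of UNIV] by (auto intro: borel_measurable_continuous_onI)
      have [measurable]: "(\<lambda>y. complex_of_real (cutoff Y R y)) \<in> borel_measurable borel" for R
        unfolding cutoff_def by measurable
      show "(\<lambda>y. F x y * G x y) \<in> borel_measurable lborel" by measurable
      show "f n \<in> borel_measurable lborel" for n unfolding f_def by measurable
      show "integrable lborel (\<lambda>y. B * exp (- 1 * \<bar>Y - y\<bar>))" using iexp by simp
      show "AE y in lborel. (\<lambda>n. f n y) \<longlonglongrightarrow> F x y * G x y"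
      proof (rule AE_I2)
        fix y
        have "(\<lambda>n. (y - Y) / real (Suc n)) \<longlonglongrightarrow> 0" by real_asymp
        then have "(\<lambda>n. (1 - ((y - Y) / real (Suc n))\<^sup>2)\<^sup>2) \<longlonglongrightarrow> (1 - 0\<^sup>2)\<^sup>2" by (intro tendsto_intros)
        then have "(\<lambda>n. cutoff Y (real (Suc n)) y) \<longlonglongrightarrow> 1" by (simp add: cutoff_def)
        then have "(\<lambda>n. of_real (cutoff Y (real (Suc n)) y) * F x y * G x y) \<longlonglongrightarrow> of_real 1 * F x y * G x y"
          by (intro tendsto_intros)
        moreover have "\<forall>\<^sub>F n in sequentially. of_real (cutoff Y (real (Suc n)) y) * F x y * G x y = f n y"
        proof -
          obtain N :: nat where N: "\<bar>y - Y\<bar> \<le> real N" using real_arch_simple by blast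
          show ?thesis
          proof (rule eventually_sequentiallyI[of N])
            fix n assume "n \<ge> N"
            then have "real n \<ge> real N" by simp
            with N have "y \<in> {Y - real (Suc n)..Y + real (Suc n)}" by (auto simp: abs_le_iff)
            then show "of_real (cutoff Y (real (Suc n)) y) * F x y * G x y = f n y" by (simp add: f_def)
          qed
        qed
        ultimately have "(\<lambda>n. f n y) \<longlonglongrightarrow> of_real 1 * F x y * G x y" by (rule Lim_transform_eventually)
        then show "(\<lambda>n. f n y) \<longlonglongrightarrow> F x y * G x y" by simp
      qed
      show "AE y in lborel. norm (f n y) \<le> B * exp (- 1 * \<bar>Y - y\<bar>)" for n
      proof (rule AE_I2)
        fix y
        show "norm (f n y) \<le> B * exp (- 1 * \<bar>Y - y\<bar>)"
        proof (cases "y \<in> {Y - real (Suc n)..Y + real (Suc n)}")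
          case True
          have cb: "0 \<le> cutoff Y (real (Suc n)) y" "cutoff Y (real (Suc n)) y \<le> 1"
            by (rule cutoff_bounds[OF _ True], simp)+
          have "norm (f n y) = cutoff Y (real (Suc n)) y * norm (F x y * G x y)"
            using True cb by (simp add: f_def norm_mult)
          also have "\<dots> \<le> 1 * (B * exp (- 1 * \<bar>Y - y\<bar>))"
            unfolding B_def by (intro mult_mono cb FG x G_le) auto
          finally show ?thesis by simp
        qed (use B0 in \<open>simp add: f_def\<close>)
      qed
    qed
    moreover have "(LINT y|lborel. f n y) = \<Phi> (real (Suc n)) x" for n
    proof -
      have "set_integrable lborel {Y - real (Suc n)..Y + real (Suc n)} (\<lambda>y. of_real (cutoff Y (real (Suc n)) y) * F x y * G x y)"
        by (intro borel_integrable_atLeastAtMost' continuous_intros contF x contc) simp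
      from set_borel_integral_eq_integral(2)[OF this] show ?thesis
        by (simp add: \<Phi>_def f_def set_lebesgue_integral_def)
    qed
    ultimately show ?thesis by simp
  qed
  have "(\<lambda>n. \<Phi> (real (Suc n)) x2 - \<Phi> (real (Suc n)) x1) \<longlonglongrightarrow> 0"
  proof (rule Lim_null_comparison)
    show "\<forall>\<^sub>F n in sequentially. norm (\<Phi> (real (Suc n)) x2 - \<Phi> (real (Suc n)) x1) \<le>
        (norm (\<i> / (2 * k)) * 16 * B * J * \<bar>x2 - x1\<bar>) * (1 / real (Suc n))"
      using small[of "real (Suc _)"] by (intro always_eventually allI) (simp add: mult_ac)
    show "(\<lambda>n. (norm (\<i> / (2 * k)) * 16 * B * J * \<bar>x2 - x1\<bar>) * (1 / real (Suc n))) \<longlonglongrightarrow> 0"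
      by (rule tendsto_mult_right_zero[OF LIMSEQ_Suc[OF lim_const_over_n]])
  qed
  moreover have "(\<lambda>n. \<Phi> (real (Suc n)) x2 - \<Phi> (real (Suc n)) x1) \<longlonglongrightarrow> (LINT y|lborel. F x2 y * G x2 y) - (LINT y|lborel. F x1 y * G x1 y)"
    by (intro tendsto_diff lim) (use x1 in auto)
  ultimately have "(LINT y|lborel. F x2 y * G x2 y) - (LINT y|lborel. F x1 y * G x1 y) = 0"
    using LIMSEQ_unique by blast
  then show ?thesis by (simp add: G_def)
qed

text \<open>
  Uniqueness and representation in one: the pairing of F with the kernel ending at (X, Y) is
  constant in x. At the left end it tends to the convolution of the trace with the Green's
  function, at the right end to the value of F at (X, Y).
\<close>

lemma parabolic_representation:
  fixes Y :: real
  assumes k: "Im k > 0" and sol: "parabolic_on k ({x0<..<X} \<times> UNIV) F Fx Fy Fyy" and X: "x0 < X"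
    and c: "c \<ge> 0" and F: "\<And>x y. x \<in> {x0<..<X} \<Longrightarrow> norm (F x y) \<le> C * exp (c * \<bar>y\<bar>)"
    and left: "\<And>y. y \<noteq> 0 \<Longrightarrow> ((\<lambda>x. F x y) \<longlongrightarrow> \<beta> y) (at_right x0)" and \<beta>: "\<beta> \<in> borel_measurable borel"
    and right: "((\<lambda>(x, y). F x y) \<longlongrightarrow> L) (at (X, Y) within {x0<..<X} \<times> UNIV)"
  shows "conv (gauss (gauss_rate k (X - x0))) \<beta> Y = L"
proof -
  define T where "T = X - x0"
  have T: "T > 0" using X by (simp add: T_def)
  have C0: "C \<ge> 0"
  proof -
    have "0 \<le> C * exp (c * \<bar>0\<bar>)" by (rule order_trans[OF norm_ge_zero F[of "x0 + T / 2"]]) (use T in \<open>auto simp: T_def field_simps\<close>)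
    then show ?thesis by simp
  qed
  have contF: "continuous_on S (F x)" if "x \<in> {x0<..<X}" for x S
  proof -
    have xS: "(x, y) \<in> {x0<..<X} \<times> UNIV" for y using that by auto
    show ?thesis by (rule has_vector_derivative_continuous_on[OF parabolic_onD(2)[OF sol xS]])
  qed
  have Fm: "F x \<in> borel_measurable borel" if "x \<in> {x0<..<X}" for x
    using contF[OF that, of UNIV] by (rule borel_measurable_continuous_onI)
  define a where "a n = T / real (n + 2)" for n :: nat
  have a: "a n > 0" "a n \<le> T / 2" for n using T by (auto simp: a_def field_simps)
  have ane: "a n \<noteq> 0" for n using a(1)[of n] by simp
  have aT: "a n < T" for n using a(2)[of n] T by simp
  have alim: "a \<longlonglongrightarrow> 0" unfolding a_def by (rule LIMSEQ_ignore_initial_segment[OF lim_const_over_n])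
  define \<Phi> where "\<Phi> x = (LINT y|lborel. F x y * gauss (gauss_rate k (X - x)) (y - Y))" for x
  have const: "\<Phi> (x0 + a n) = \<Phi> (X - a n)" for n
    unfolding \<Phi>_def by (rule pairing_constant[OF k sol c F]) (use a[of n] aT[of n] T in \<open>auto simp: T_def\<close>)
  have lim1: "(\<lambda>n. \<Phi> (x0 + a n)) \<longlonglongrightarrow> (LINT y|lborel. \<beta> y * gauss (gauss_rate k T) (y - Y))"
    unfolding \<Phi>_def
  proof -
    obtain M where M: "M > 0" "\<And>t z. T / 2 \<le> t \<Longrightarrow> t \<le> T \<Longrightarrow> norm (gauss (gauss_rate k t) z) \<le> M * exp (- (c + 1) * \<bar>z\<bar>)"
      using green_uniform_bound[OF k half_gt_zero[OF T], of T "c + 1"] by metis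
    show "(\<lambda>n. LINT y|lborel. F (x0 + a n) y * gauss (gauss_rate k (X - (x0 + a n))) (y - Y)) \<longlonglongrightarrow> (LINT y|lborel. \<beta> y * gauss (gauss_rate k T) (y - Y))"
    proof (rule integral_dominated_convergence[where w = "\<lambda>y. C * exp (c * \<bar>Y\<bar>) * M * exp (- 1 * \<bar>Y - y\<bar>)"])
      have [measurable]: "gauss z \<in> borel_measurable borel" for z unfolding gauss_def by measurable
      have [measurable]: "F (x0 + a n) \<in> borel_measurable borel" for n
        using Fm[of "x0 + a n"] a(1)[of n] aT[of n] by (auto simp: T_def)
      show "(\<lambda>y. \<beta> y * gauss (gauss_rate k T) (y - Y)) \<in> borel_measurable lborel" using \<beta> by measurable
      show "(\<lambda>y. F (x0 + a n) y * gauss (gauss_rate k (X - (x0 + a n))) (y - Y)) \<in> borel_measurable lborel" for n by measurable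
      show "integrable lborel (\<lambda>y. C * exp (c * \<bar>Y\<bar>) * M * exp (- 1 * \<bar>Y - y\<bar>))"
        using integrable_exp_abs_shift[of 1 Y] by simp
      show "AE y in lborel. (\<lambda>n. F (x0 + a n) y * gauss (gauss_rate k (X - (x0 + a n))) (y - Y)) \<longlonglongrightarrow> \<beta> y * gauss (gauss_rate k T) (y - Y)"
        using AE_lborel_singleton[of 0]
      proof eventually_elim
        case (elim y)
        have "filterlim (\<lambda>n. x0 + a n) (at_right x0) sequentially"
          unfolding filterlim_at
        proof
          show "\<forall>\<^sub>F n in sequentially. x0 + a n \<in> {x0<..} \<and> x0 + a n \<noteq> x0"
            by (rule always_eventually) (use a(1) in \<open>simp add: less_imp_neq[symmetric]\<close>)
          show "(\<lambda>n. x0 + a n) \<longlonglongrightarrow> x0" using tendsto_add[OF tendsto_const alim, of x0] by simp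
        qed
        from filterlim_compose[OF left[OF elim] this]
        have 1: "(\<lambda>n. F (x0 + a n) y) \<longlonglongrightarrow> \<beta> y" .
        have "(\<lambda>n. gauss_rate k (X - (x0 + a n))) \<longlonglongrightarrow> gauss_rate k (X - (x0 + 0))"
          unfolding gauss_rate_def by (intro tendsto_intros alim) (use X in auto)
        then have lal: "(\<lambda>n. gauss_rate k (X - (x0 + a n))) \<longlonglongrightarrow> gauss_rate k T" by (simp add: T_def)
        have "isCont (\<lambda>w. csqrt (w / of_real pi) * exp (- w * of_real (y - Y) ^ 2)) (gauss_rate k T)"
          by (intro continuous_intros isCont_csqrt' div_pi_not_nonpos[OF Re_gauss_rate_pos[OF k T]]) auto
        from isCont_tendsto_compose[OF this lal]
        have "(\<lambda>n. gauss (gauss_rate k (X - (x0 + a n))) (y - Y)) \<longlonglongrightarrow> gauss (gauss_rate k T) (y - Y)"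
          unfolding gauss_def .
        with 1 show ?case by (intro tendsto_intros)
      qed
      show "AE y in lborel. norm (F (x0 + a n) y * gauss (gauss_rate k (X - (x0 + a n))) (y - Y)) \<le> C * exp (c * \<bar>Y\<bar>) * M * exp (- 1 * \<bar>Y - y\<bar>)" for n
      proof (rule AE_I2)
        fix y
        have "norm (F (x0 + a n) y * gauss (gauss_rate k (X - (x0 + a n))) (y - Y)) \<le> (C * exp (c * \<bar>y\<bar>)) * (M * exp (- (c + 1) * \<bar>y - Y\<bar>))"
          unfolding norm_mult using a[of n] aT[of n] C0 T by (intro mult_mono F M(2)) (auto simp: T_def)
        also have "\<dots> \<le> (C * (exp (c * \<bar>Y\<bar>) * exp (c * \<bar>y - Y\<bar>))) * (M * exp (- (c + 1) * \<bar>y - Y\<bar>))"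
          using C0 M(1) by (intro mult_right_mono mult_left_mono exp_abs_growth c) auto
        also have "\<dots> = C * exp (c * \<bar>Y\<bar>) * M * exp (- 1 * \<bar>Y - y\<bar>)"
          by (simp add: mult_exp_exp abs_minus_commute algebra_simps)
        finally show "norm (F (x0 + a n) y * gauss (gauss_rate k (X - (x0 + a n))) (y - Y)) \<le> C * exp (c * \<bar>Y\<bar>) * M * exp (- 1 * \<bar>Y - y\<bar>)" .
      qed
    qed
  qed
  \<comment> \<open>y = Y + sqrt t z, the variable in which the kernel does not depend on t\<close>
  have \<Phi>_scaled: "\<Phi> (X - t) = (LINT z|lborel. F (X - t) (Y + sqrt t * z) * gauss (gauss_rate k 1) z)" if t: "t > 0" for t
  proof -
    have "\<Phi> (X - t) = \<bar>sqrt t\<bar> *\<^sub>R (LINT z|lborel. F (X - t) (Y + sqrt t * z) * gauss (gauss_rate k t) (sqrt t * z))"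
      unfolding \<Phi>_def using lborel_integral_real_affine[of "sqrt t" "\<lambda>y. F (X - t) y * gauss (gauss_rate k t) (y - Y)" Y] t by simp
    also have "\<dots> = (LINT z|lborel. of_real (sqrt t) * (F (X - t) (Y + sqrt t * z) * gauss (gauss_rate k t) (sqrt t * z)))"
      using t by (simp add: scaleR_conv_of_real)
    also have "\<dots> = (LINT z|lborel. F (X - t) (Y + sqrt t * z) * gauss (gauss_rate k 1) z)"
      using green_scale[OF t, of k] by (intro Bochner_Integration.integral_cong) (simp_all add: mult.left_commute)
    finally show ?thesis .
  qed
  have r1: "rapid (gauss (gauss_rate k 1))" by (rule rapid_gauss[OF Re_gauss_rate_pos[OF k]]) simp
  obtain M where M: "M > 0" "\<And>z. norm (gauss (gauss_rate k 1) z) \<le> M * exp (- (c * sqrt T + 1) * \<bar>z\<bar>)"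
    using rapid_bound[OF r1, of "c * sqrt T + 1"] by blast
  have "(\<lambda>n. LINT z|lborel. F (X - a n) (Y + sqrt (a n) * z) * gauss (gauss_rate k 1) z) \<longlonglongrightarrow> (LINT z|lborel. L * gauss (gauss_rate k 1) z)"
  proof (rule integral_dominated_convergence[where w = "\<lambda>z. C * exp (c * \<bar>Y\<bar>) * M * exp (- 1 * \<bar>z\<bar>)"])
    have [measurable]: "gauss z \<in> borel_measurable borel" for z unfolding gauss_def by measurable
    have [measurable]: "F (X - a n) \<in> borel_measurable borel" for n
      using Fm[of "X - a n"] a(1)[of n] aT[of n] by (auto simp: T_def)
    show "(\<lambda>z. L * gauss (gauss_rate k 1) z) \<in> borel_measurable lborel" by measurable
    show "(\<lambda>z. F (X - a n) (Y + sqrt (a n) * z) * gauss (gauss_rate k 1) z) \<in> borel_measurable lborel" for n by measurable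
    show "integrable lborel (\<lambda>z. C * exp (c * \<bar>Y\<bar>) * M * exp (- 1 * \<bar>z\<bar>))"
      by (intro Bochner_Integration.integrable_mult_right integrable_exp_abs) simp
    show "AE z in lborel. (\<lambda>n. F (X - a n) (Y + sqrt (a n) * z) * gauss (gauss_rate k 1) z) \<longlonglongrightarrow> L * gauss (gauss_rate k 1) z"
    proof (intro AE_I2 tendsto_intros)
      fix z
      have "(\<lambda>n. (X - a n, Y + sqrt (a n) * z)) \<longlonglongrightarrow> (X - 0, Y + sqrt 0 * z)"
        by (intro tendsto_intros alim)
      then have "filterlim (\<lambda>n. (X - a n, Y + sqrt (a n) * z)) (at (X, Y) within {x0<..<X} \<times> UNIV) sequentially"
        unfolding filterlim_at using a(1) aT ane by (auto simp: T_def algebra_simps)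
      from filterlim_compose[OF right this] show "(\<lambda>n. F (X - a n) (Y + sqrt (a n) * z)) \<longlonglongrightarrow> L" by simp
    qed
    show "AE z in lborel. norm (F (X - a n) (Y + sqrt (a n) * z) * gauss (gauss_rate k 1) z) \<le> C * exp (c * \<bar>Y\<bar>) * M * exp (- 1 * \<bar>z\<bar>)" for n
    proof (rule AE_I2)
      fix z
      have sq: "sqrt (a n) \<le> sqrt T" using aT[of n] by (simp add: less_imp_le)
      have "norm (F (X - a n) (Y + sqrt (a n) * z)) \<le> C * exp (c * \<bar>Y + sqrt (a n) * z\<bar>)"
        by (rule F) (use a(1)[of n] aT[of n] in \<open>auto simp: T_def\<close>)
      also have "\<dots> \<le> C * exp (c * (\<bar>Y\<bar> + sqrt T * \<bar>z\<bar>))"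
      proof -
        have "\<bar>Y + sqrt (a n) * z\<bar> \<le> \<bar>Y\<bar> + sqrt (a n) * \<bar>z\<bar>"
          using abs_triangle_ineq[of Y "sqrt (a n) * z"] a(1)[of n] by (simp add: abs_mult)
        also have "\<dots> \<le> \<bar>Y\<bar> + sqrt T * \<bar>z\<bar>" using sq by (intro add_left_mono mult_right_mono) auto
        finally have "c * \<bar>Y + sqrt (a n) * z\<bar> \<le> c * (\<bar>Y\<bar> + sqrt T * \<bar>z\<bar>)" using c by (rule mult_left_mono)
        then show ?thesis using C0 by (intro mult_left_mono) auto
      qed
      finally have "norm (F (X - a n) (Y + sqrt (a n) * z) * gauss (gauss_rate k 1) z) \<le>
        (C * exp (c * (\<bar>Y\<bar> + sqrt T * \<bar>z\<bar>))) * (M * exp (- (c * sqrt T + 1) * \<bar>z\<bar>))"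
        unfolding norm_mult using C0 by (intro mult_mono M(2)) auto
      also have "\<dots> = C * exp (c * \<bar>Y\<bar>) * M * exp (- 1 * \<bar>z\<bar>)" by (simp add: mult_exp_exp algebra_simps)
      finally show "norm (F (X - a n) (Y + sqrt (a n) * z) * gauss (gauss_rate k 1) z) \<le> C * exp (c * \<bar>Y\<bar>) * M * exp (- 1 * \<bar>z\<bar>)" .
    qed
  qed
  moreover have "(LINT z|lborel. L * gauss (gauss_rate k 1) z) = L"
    using integral_gauss[of "gauss_rate k 1"] Re_gauss_rate_pos[OF k, of 1] by simp
  ultimately have lim2: "(\<lambda>n. \<Phi> (X - a n)) \<longlonglongrightarrow> L" by (simp only: \<Phi>_scaled[OF a(1)])
  have "(LINT y|lborel. \<beta> y * gauss (gauss_rate k T) (y - Y)) = L"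
    using LIMSEQ_unique[OF lim1[unfolded const] lim2] .
  moreover have "gauss (gauss_rate k T) (Y - y) * \<beta> y = \<beta> y * gauss (gauss_rate k T) (y - Y)" for y
    using gauss_even[of "gauss_rate k T" "y - Y"] by simp
  ultimately show ?thesis unfolding conv_def T_def by (simp only:)
qed

section \<open>Exponential decay in a half-plane\<close>

text \<open>
  The powers of the cosine form a positive approximate identity made of finitely many harmonics,
  whose coefficients are largest in the middle.
\<close>

lemma cos_power_expansion:
  "complex_of_real (cos \<phi> ^ (2 * N)) = (\<Sum>l\<le>2 * N. of_nat (2 * N choose l) / 4 ^ N * exp (\<i> * of_real (2 * \<phi>) * of_int (int N - int l)))"
proof -
  have c: "complex_of_real (cos \<phi>) = (exp (\<i> * of_real \<phi>) + exp (- (\<i> * of_real \<phi>))) / 2"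
    by (simp add: cos_of_real[symmetric] cos_exp_eq)
  have "complex_of_real (cos \<phi> ^ (2 * N)) = (exp (- (\<i> * of_real \<phi>)) + exp (\<i> * of_real \<phi>)) ^ (2 * N) / 2 ^ (2 * N)"
    by (simp add: c power_divide add.commute)
  also have "\<dots> = (\<Sum>l\<le>2 * N. of_nat (2 * N choose l) * exp (- (\<i> * of_real \<phi>)) ^ l * exp (\<i> * of_real \<phi>) ^ (2 * N - l)) / 2 ^ (2 * N)"
    by (subst binomial_ring) simp
  also have "\<dots> = (\<Sum>l\<le>2 * N. of_nat (2 * N choose l) / 4 ^ N * exp (\<i> * of_real (2 * \<phi>) * of_int (int N - int l)))"
    unfolding sum_divide_distrib
  proof (rule sum.cong)
    fix l assume "l \<in> {..2 * N}"
    then have l: "of_nat (2 * N - l) = (2 * of_nat N - of_nat l :: complex)" by (simp add: of_nat_diff)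
    have "exp (- (\<i> * of_real \<phi>)) ^ l * exp (\<i> * of_real \<phi>) ^ (2 * N - l) = exp (\<i> * of_real (2 * \<phi>) * of_int (int N - int l))"
      unfolding exp_of_nat_mult[symmetric] l exp_add[symmetric] by (simp add: algebra_simps)
    moreover have "(2::complex) ^ (2 * N) = 4 ^ N" by (simp add: power_mult)
    ultimately show "of_nat (2 * N choose l) * exp (- (\<i> * of_real \<phi>)) ^ l * exp (\<i> * of_real \<phi>) ^ (2 * N - l) / 2 ^ (2 * N) =
       of_nat (2 * N choose l) / 4 ^ N * exp (\<i> * of_real (2 * \<phi>) * of_int (int N - int l))"
      by (simp add: mult.assoc)
  qed simp
  finally show ?thesis .
qed

lemma integral_fourier_mode:
  assumes "h > 0"
  shows "integral {-h..h} (\<lambda>t. exp (\<i> * of_real (pi * t / h) * of_int n)) = (if n = 0 then of_real (2 * h) else 0)"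
proof (cases "n = 0")
  case False
  define w where "w = \<i> * of_real (pi / h) * of_int n"
  have w0: "w \<noteq> 0" using False assms by (simp add: w_def)
  have "((\<lambda>t. exp (of_real t * w)) has_integral exp (of_real h * w) / w - exp (of_real (-h) * w) / w) {-h..h}"
  proof (rule fundamental_theorem_of_calculus)
    fix t assume "t \<in> {-h..h}"
    have "((\<lambda>z. exp (z * w) / w) has_field_derivative exp (of_real t * w)) (at (of_real t))"
      using w0 by (auto intro!: derivative_eq_intros)
    from has_vector_derivative_real_field[OF this]
    show "((\<lambda>t. exp (of_real t * w) / w) has_vector_derivative exp (of_real t * w)) (at t within {-h..h})" .
  qed (use assms in auto)
  moreover have "exp (of_real h * w) = exp (of_real (-h) * w)"
  proof -
    have "of_real h * w = of_real (-h) * w + \<i> * (of_int n * (of_real pi * 2))" using assms by (simp add: w_def field_simps)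
    then show ?thesis by (simp only: exp_plus_2pin)
  qed
  moreover have "(\<lambda>t. exp (of_real t * w)) = (\<lambda>t. exp (\<i> * of_real (pi * t / h) * of_int n))"
    by (simp add: w_def field_simps)
  ultimately show ?thesis using False by (simp add: integral_unique)
qed (use assms in \<open>simp add: scaleR_conv_of_real\<close>)

text \<open>
  Average Q against cos^(2N)(\<pi> t / (2 h)). Each harmonic enters with a coefficient at most
  the central one, which is also the total mass of the kernel up to the factor 2 h. The average
  is therefore bounded by the sum of the Fourier coefficients, and it tends to Q 0 by
  continuity. The factor 2 accounts for n and -n.
\<close>

lemma norm_le_sum_fourier_coeffs:
  fixes Q :: "real \<Rightarrow> complex"
  assumes h: "h > 0" and Q: "continuous_on {-h..h} Q"
    and c: "\<And>n::int. norm (integral {-h..h} (\<lambda>t. Q t * exp (\<i> * of_real (pi * t / h) * of_int n))) \<le> 2 * h * g (nat \<bar>n\<bar>)"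
    and g: "summable g" "\<And>m. g m \<ge> 0"
  shows "norm (Q 0) \<le> 2 * suminf g"
proof (rule field_le_epsilon)
  fix \<epsilon> :: real assume \<epsilon>: "\<epsilon> > 0"
  let ?I = "{-h..h}"
  obtain \<delta> where \<delta>: "\<delta> > 0" "\<And>t. t \<in> ?I \<Longrightarrow> \<bar>t\<bar> < \<delta> \<Longrightarrow> norm (Q t - Q 0) < \<epsilon> / 2"
  proof -
    have "(0::real) \<in> ?I" using h by auto
    with Q obtain \<delta> where "\<delta> > 0" "\<forall>t\<in>?I. dist t 0 < \<delta> \<longrightarrow> dist (Q t) (Q 0) < \<epsilon> / 2"
      using \<epsilon> unfolding continuous_on_iff by (metis half_gt_zero)
    then show thesis using that by (auto simp: dist_norm)
  qed
  obtain B where B: "\<And>t. t \<in> ?I \<Longrightarrow> norm (Q t) \<le> B"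
  proof -
    obtain B where "\<forall>x\<in>Q ` ?I. norm x \<le> B"
      using compact_imp_bounded[OF compact_continuous_image[OF Q compact_Icc]] unfolding bounded_iff by blast
    then show thesis by (intro that) auto
  qed
  have B0: "B \<ge> 0" by (rule order_trans[OF norm_ge_zero B[of 0]]) (use h in auto)
  define d where "d = min \<delta> h"
  have d: "0 < d" "d \<le> \<delta>" "d \<le> h" using \<delta> h by (auto simp: d_def)
  \<comment> \<open>bound for the kernel outside |t| < d; its mass is at least of order 1/N, so the geometric
      decay of the powers wins\<close>
  define \<rho> where "\<rho> = (cos (pi * d / (2 * h)))\<^sup>2"
  have dh: "0 < pi * d / (2 * h)" "pi * d / (2 * h) \<le> pi / 2" using d h by (auto simp: field_simps)
  have cosd: "0 \<le> cos (pi * d / (2 * h))" "cos (pi * d / (2 * h)) < 1"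
  proof -
    show "0 \<le> cos (pi * d / (2 * h))" by (rule cos_ge_zero) (use dh in auto)
    have "cos (pi * d / (2 * h)) < cos 0" by (rule cos_monotone_0_pi) (use dh in auto)
    then show "cos (pi * d / (2 * h)) < 1" by simp
  qed
  have \<rho>: "0 \<le> \<rho>" "\<rho> < 1" using cosd by (auto simp: \<rho>_def power_less_one_iff abs_square_less_1)
  define W where "W N t = cos (pi * t / (2 * h)) ^ (2 * N)" for N t
  have W0: "W N t \<ge> 0" for N t by (simp add: W_def power_mult)
  have W_small: "W N t \<le> \<rho> ^ N" if "t \<in> ?I" "\<bar>t\<bar> \<ge> d" for N t
  proof -
    have "cos (pi * \<bar>t\<bar> / (2 * h)) \<le> cos (pi * d / (2 * h))"
    proof (rule cos_monotone_0_pi_le)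
      show "pi * d / (2 * h) \<le> pi * \<bar>t\<bar> / (2 * h)" using that h by (intro divide_right_mono mult_left_mono) auto
      have "pi * \<bar>t\<bar> / (2 * h) \<le> pi * h / (2 * h)" using that h by (intro divide_right_mono mult_left_mono) auto
      also have "\<dots> \<le> pi" using h by simp
      finally show "pi * \<bar>t\<bar> / (2 * h) \<le> pi" .
    qed (use dh in simp)
    moreover have "0 \<le> cos (pi * \<bar>t\<bar> / (2 * h))"
    proof (rule cos_ge_zero)
      have "pi * \<bar>t\<bar> / (2 * h) \<le> pi * h / (2 * h)" using that h by (intro divide_right_mono mult_left_mono) auto
      then show "pi * \<bar>t\<bar> / (2 * h) \<le> pi / 2" using h by simp
      have "0 \<le> pi * \<bar>t\<bar> / (2 * h)" using h by simp
      then show "- (pi / 2) \<le> pi * \<bar>t\<bar> / (2 * h)" using pi_gt_zero by linarith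
    qed
    moreover have "cos (pi * t / (2 * h)) = cos (pi * \<bar>t\<bar> / (2 * h))" by (auto simp: abs_if)
    ultimately show ?thesis unfolding W_def \<rho>_def power_mult by (simp add: power_mono)
  qed
  have contW: "continuous_on ?I (\<lambda>t. complex_of_real (W N t))" for N
    unfolding W_def using h by (intro continuous_intros) auto
  define b where "b N l = complex_of_real (real (2 * N choose l) / 4 ^ N)" for N l
  define E where "E n t = exp (\<i> * of_real (pi * t / h) * of_int n)" for n :: int and t :: real
  have W_eq: "complex_of_real (W N t) = (\<Sum>l\<le>2 * N. b N l * E (int N - int l) t)" for N t
    unfolding W_def cos_power_expansion b_def E_def by (intro sum.cong) (simp_all add: mult.commute)
  have contE: "continuous_on ?I (E n)" for n unfolding E_def using h by (intro continuous_intros) auto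
  define I where "I N = 2 * h * (real (2 * N choose N) / 4 ^ N)" for N
  have I_nonneg: "I N \<ge> 0" for N using h by (simp add: I_def)
  have intW: "integral ?I (\<lambda>t. complex_of_real (W N t)) = of_real (I N)" for N
  proof -
    have "integral ?I (\<lambda>t. complex_of_real (W N t)) = (\<Sum>l\<le>2 * N. b N l * integral ?I (E (int N - int l)))"
      unfolding W_eq by (subst integral_sum) (auto intro!: integrable_continuous_interval continuous_intros contE)
    also have "\<dots> = (\<Sum>l\<le>2 * N. if l = N then b N l * of_real (2 * h) else 0)"
      unfolding E_def integral_fourier_mode[OF h] by (intro sum.cong) auto
    also have "\<dots> = b N N * of_real (2 * h)" by (subst sum.delta) auto
    finally show ?thesis by (simp add: b_def I_def)
  qed
  have WQ: "norm (integral ?I (\<lambda>t. of_real (W N t) * Q t)) \<le> I N * (2 * suminf g)" for N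
  proof -
    have "integral ?I (\<lambda>t. of_real (W N t) * Q t) = (\<Sum>l\<le>2 * N. b N l * integral ?I (\<lambda>t. Q t * E (int N - int l) t))"
    proof -
      have "(\<lambda>t. of_real (W N t) * Q t) = (\<lambda>t. \<Sum>l\<le>2 * N. b N l * (Q t * E (int N - int l) t))"
        unfolding W_eq sum_distrib_right by (simp add: mult_ac)
      then show ?thesis
        by (simp only:, subst integral_sum) (auto intro!: integrable_continuous_interval continuous_intros contE Q)
    qed
    also have "norm \<dots> \<le> (\<Sum>l\<le>2 * N. norm (b N l) * norm (integral ?I (\<lambda>t. Q t * E (int N - int l) t)))"
      by (rule order_trans[OF norm_sum]) (simp add: norm_mult)
    also have "\<dots> \<le> (\<Sum>l\<le>2 * N. (real (2 * N choose N) / 4 ^ N) * (2 * h * g (nat \<bar>int N - int l\<bar>)))"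
    proof (intro sum_mono mult_mono)
      fix l
      have "real (2 * N choose l) \<le> real (2 * N choose N)" using binomial_maximum'[of N l] by simp
      then show "norm (b N l) \<le> real (2 * N choose N) / 4 ^ N"
        unfolding b_def norm_of_real by (simp add: divide_right_mono)
      show "norm (integral ?I (\<lambda>t. Q t * E (int N - int l) t)) \<le> 2 * h * g (nat \<bar>int N - int l\<bar>)"
        unfolding E_def by (rule c)
    qed auto
    also have "\<dots> = I N * (\<Sum>l\<le>2 * N. g (nat \<bar>int N - int l\<bar>))"
      unfolding sum_distrib_left by (intro sum.cong) (simp_all add: I_def)
    also have "(\<Sum>l\<le>2 * N. g (nat \<bar>int N - int l\<bar>)) \<le> 2 * suminf g"
    proof -
      have part: "sum g {..N} \<le> suminf g" by (rule sum_le_suminf[OF g(1)]) (use g(2) in auto)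
      have "{..2 * N} = {..N} \<union> {N<..2 * N}" by auto
      then have "(\<Sum>l\<le>2 * N. g (nat \<bar>int N - int l\<bar>)) = (\<Sum>l\<le>N. g (nat \<bar>int N - int l\<bar>)) + (\<Sum>l\<in>{N<..2 * N}. g (nat \<bar>int N - int l\<bar>))"
        by (simp only:, subst sum.union_disjoint) auto
      also have "(\<Sum>l\<le>N. g (nat \<bar>int N - int l\<bar>)) = sum g {..N}"
        by (rule sum.reindex_bij_witness[of _ "\<lambda>m. N - m" "\<lambda>l. N - l"]) (auto simp: nat_diff_distrib' of_nat_diff[symmetric] simp del: of_nat_diff)
      also have "(\<Sum>l\<in>{N<..2 * N}. g (nat \<bar>int N - int l\<bar>)) = sum g {0<..N}"
        by (rule sum.reindex_bij_witness[of _ "\<lambda>m. N + m" "\<lambda>l. l - N"]) (auto simp: abs_if nat_diff_distrib)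
      also have "sum g {0<..N} \<le> sum g {..N}" by (rule sum_mono2) (use g(2) in auto)
      finally show ?thesis using part by simp
    qed
    finally show ?thesis using I_nonneg[of N] by (auto intro: mult_left_mono)
  qed
  have I_lower: "I N \<ge> h / real N" if "N > 0" for N
  proof -
    have "4 ^ N / (2 * real N) \<le> real (2 * N choose N)" using central_binomial_lower_bound[OF that] .
    then have "1 / (2 * real N) \<le> real (2 * N choose N) / 4 ^ N" using that by (simp add: field_simps)
    then have "2 * h * (1 / (2 * real N)) \<le> I N" unfolding I_def using h by (intro mult_left_mono) auto
    then show ?thesis by simp
  qed
  have diff: "norm (integral ?I (\<lambda>t. of_real (W N t) * (Q t - Q 0))) \<le> \<epsilon> / 2 * I N + 2 * B * \<rho> ^ N * (2 * h)" for N
  proof -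
    have "norm (integral ?I (\<lambda>t. of_real (W N t) * (Q t - Q 0))) \<le> integral ?I (\<lambda>t. \<epsilon> / 2 * W N t + 2 * B * \<rho> ^ N)"
    proof (rule integral_norm_bound_integral)
      show "(\<lambda>t. of_real (W N t) * (Q t - Q 0)) integrable_on ?I"
        by (intro integrable_continuous_interval continuous_intros contW Q)
      show "(\<lambda>t. \<epsilon> / 2 * W N t + 2 * B * \<rho> ^ N) integrable_on ?I"
        unfolding W_def by (intro integrable_continuous_interval continuous_intros) (use h in auto)
      fix t assume t: "t \<in> ?I"
      have nW: "norm (of_real (W N t) * (Q t - Q 0)) = W N t * norm (Q t - Q 0)"
        using W0[of N t] by (simp add: norm_mult)
      show "norm (of_real (W N t) * (Q t - Q 0)) \<le> \<epsilon> / 2 * W N t + 2 * B * \<rho> ^ N"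
        unfolding nW
      proof (cases "\<bar>t\<bar> < d")
        case True
        have "W N t * norm (Q t - Q 0) \<le> W N t * (\<epsilon> / 2)"
          using \<delta>(2)[OF t] True d W0 by (intro mult_left_mono) auto
        then have "W N t * norm (Q t - Q 0) \<le> \<epsilon> / 2 * W N t" by (simp only: mult.commute[of "\<epsilon> / 2"])
        moreover have "0 \<le> 2 * B * \<rho> ^ N" using B0 \<rho> by simp
        ultimately show "W N t * norm (Q t - Q 0) \<le> \<epsilon> / 2 * W N t + 2 * B * \<rho> ^ N" by linarith
      next
        case False
        have "norm (Q t - Q 0) \<le> B + B" using norm_triangle_ineq4[of "Q t" "Q 0"] B[OF t] B[of 0] h by force
        then have "W N t * norm (Q t - Q 0) \<le> \<rho> ^ N * (2 * B)"
          using W_small[OF t, of N] False W0 \<rho> by (intro mult_mono) auto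
        then have "W N t * norm (Q t - Q 0) \<le> 2 * B * \<rho> ^ N" by (simp only: mult.commute[of "2 * B"])
        moreover have "0 \<le> \<epsilon> / 2 * W N t" using \<epsilon> W0 by simp
        ultimately show "W N t * norm (Q t - Q 0) \<le> \<epsilon> / 2 * W N t + 2 * B * \<rho> ^ N" by linarith
      qed
    qed
    also have "\<dots> = \<epsilon> / 2 * I N + 2 * B * \<rho> ^ N * (2 * h)"
    proof -
      have cW: "continuous_on ?I (W N)" unfolding W_def using h by (intro continuous_intros) auto
      have "integral ?I (W N) = I N"
      proof -
        have "((complex_of_real \<circ> W N) has_integral of_real (integral ?I (W N))) ?I"
          by (rule has_integral_linear[OF integrable_integral[OF integrable_continuous_interval[OF cW]] bounded_linear_of_real])
        then have "integral ?I (\<lambda>t. complex_of_real (W N t)) = of_real (integral ?I (W N))"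
          by (simp add: comp_def integral_unique)
        with intW[of N] show ?thesis by (metis of_real_eq_iff)
      qed
      moreover have "integral ?I (\<lambda>t. \<epsilon> / 2 * W N t + 2 * B * \<rho> ^ N) = integral ?I (\<lambda>t. \<epsilon> / 2 * W N t) + integral ?I (\<lambda>t. 2 * B * \<rho> ^ N)"
        by (rule integral_add) (auto intro!: integrable_continuous_interval continuous_intros cW)
      ultimately show ?thesis using h by simp
    qed
    finally show ?thesis .
  qed
  have main: "norm (Q 0) \<le> 2 * suminf g + \<epsilon> / 2 + 4 * B * (real N * \<rho> ^ N)" if N: "N > 0" for N
  proof -
    have IN: "I N > 0" using I_lower[OF N] h N by (smt (verit) divide_pos_pos of_nat_0_less_iff)
    have "of_real (I N) * Q 0 = integral ?I (\<lambda>t. of_real (W N t) * Q 0)"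
      using intW[of N] by simp
    also have "\<dots> = integral ?I (\<lambda>t. of_real (W N t) * Q t - of_real (W N t) * (Q t - Q 0))"
      by (simp add: algebra_simps)
    also have "\<dots> = integral ?I (\<lambda>t. of_real (W N t) * Q t) - integral ?I (\<lambda>t. of_real (W N t) * (Q t - Q 0))"
      by (rule integral_diff) (auto intro!: integrable_continuous_interval continuous_intros contW Q)
    finally have "norm (of_real (I N) * Q 0) \<le> I N * (2 * suminf g) + (\<epsilon> / 2 * I N + 2 * B * \<rho> ^ N * (2 * h))"
      using norm_triangle_le_diff[OF add_mono[OF WQ[of N] diff[of N]]] by simp
    then have "I N * norm (Q 0) \<le> I N * (2 * suminf g + \<epsilon> / 2) + 4 * B * \<rho> ^ N * h"
      using IN by (simp add: norm_mult algebra_simps)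
    also have "h \<le> I N * real N" using I_lower[OF N] N by (simp add: field_simps)
    finally have "I N * norm (Q 0) \<le> I N * (2 * suminf g + \<epsilon> / 2) + 4 * B * \<rho> ^ N * (I N * real N)"
      using B0 \<rho> by (simp add: mult_left_mono)
    also have "\<dots> = I N * (2 * suminf g + \<epsilon> / 2 + 4 * B * (real N * \<rho> ^ N))" by (simp add: algebra_simps)
    finally show ?thesis using IN by simp
  qed
  have "(\<lambda>N. real N * \<rho> ^ N) \<longlonglongrightarrow> 0" using powser_times_n_limit_0[of \<rho>] \<rho> by (simp add: mult.commute)
  then have "(\<lambda>N. 4 * B * (real N * \<rho> ^ N)) \<longlonglongrightarrow> 0" by (rule tendsto_mult_right_zero)
  then have lim: "(\<lambda>N. 2 * suminf g + \<epsilon> / 2 + 4 * B * (real N * \<rho> ^ N)) \<longlonglongrightarrow> 2 * suminf g + \<epsilon> / 2 + 0"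
    by (intro tendsto_intros)
  have "norm (Q 0) \<le> 2 * suminf g + \<epsilon> / 2 + 0"
    by (rule tendsto_lowerbound[OF lim]) (use main in \<open>auto intro!: eventually_sequentiallyI[of 1]\<close>)
  then show "norm (Q 0) \<le> 2 * suminf g + \<epsilon>" using \<epsilon> by simp
qed

text \<open>
  A' - i \<omega> A is a multiple of exp (- i \<omega> y), which grows, and the multiple
  vanishes because A tends to 0; what remains is exp (i \<omega> y).
\<close>

lemma decaying_mode:
  fixes A A' :: "real \<Rightarrow> complex"
  assumes \<omega>: "Im \<omega> > 0"
    and A: "\<And>y. y > 0 \<Longrightarrow> (A has_vector_derivative A' y) (at y)"
    and A': "\<And>y. y > 0 \<Longrightarrow> (A' has_vector_derivative - (\<omega>\<^sup>2 * A y)) (at y)"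
    and lim: "(A \<longlongrightarrow> 0) at_top" and y: "y \<ge> 1"
  shows "norm (A y) = norm (A 1) * exp (- Im \<omega> * (y - 1))"
proof -
  have w0: "\<omega> \<noteq> 0" using \<omega> by auto
  have expd: "((\<lambda>y. exp (z * of_real y)) has_vector_derivative z * exp (z * of_real y)) (at y)" for z :: complex and y
  proof -
    have "((\<lambda>w. exp (z * w)) has_field_derivative z * exp (z * of_real y)) (at (of_real y))"
      by (auto intro!: derivative_eq_intros)
    from has_vector_derivative_real_field[OF this] show ?thesis .
  qed
  have const: "\<exists>c. \<forall>y\<in>{0<..}. (A' y - z * A y) * exp (z * of_real y) = c" if z: "z\<^sup>2 = - \<omega>\<^sup>2" for z
  proof (rule has_derivative_zero_constant)
    fix y :: real assume "y \<in> {0<..}"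
    then have y: "y > 0" by simp
    have "((\<lambda>y. (A' y - z * A y) * exp (z * of_real y)) has_vector_derivative
      (A' y - z * A y) * (z * exp (z * of_real y)) + (- (\<omega>\<^sup>2 * A y) - z * A' y) * exp (z * of_real y)) (at y)"
      by (rule has_vector_derivative_mult[OF has_vector_derivative_diff[OF A'[OF y] has_vector_derivative_mult_right[OF A[OF y], of z]] expd[of z y]])
    moreover have "(A' y - z * A y) * (z * exp (z * of_real y)) + (- (\<omega>\<^sup>2 * A y) - z * A' y) * exp (z * of_real y) =
       (- (z\<^sup>2) - \<omega>\<^sup>2) * A y * exp (z * of_real y)"
      by (simp add: algebra_simps power2_eq_square)
    ultimately show "((\<lambda>y. (A' y - z * A y) * exp (z * of_real y)) has_derivative (\<lambda>h. 0)) (at y within {0<..})"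
      using z by (simp add: has_vector_derivative_def has_derivative_at_withinI)
  qed simp
  obtain P where P: "\<And>y. y > 0 \<Longrightarrow> (A' y - \<i> * \<omega> * A y) * exp (\<i> * \<omega> * of_real y) = P"
    using const[of "\<i> * \<omega>"] by (auto simp: power_mult_distrib)
  obtain S where S: "\<And>y. y > 0 \<Longrightarrow> (A' y - - (\<i> * \<omega>) * A y) * exp (- (\<i> * \<omega>) * of_real y) = S"
    using const[of "- (\<i> * \<omega>)"] by (auto simp: power_mult_distrib)
  have sol: "2 * \<i> * \<omega> * A y = S * exp (\<i> * \<omega> * of_real y) - P * exp (- (\<i> * \<omega>) * of_real y)" if "y > 0" for y
  proof -
    have e: "exp (\<i> * \<omega> * of_real y) * exp (- (\<i> * \<omega>) * of_real y) = 1" by (simp add: exp_add[symmetric])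
    have "S * exp (\<i> * \<omega> * of_real y) - P * exp (- (\<i> * \<omega>) * of_real y) =
      ((A' y - - (\<i> * \<omega>) * A y) - (A' y - \<i> * \<omega> * A y)) * (exp (\<i> * \<omega> * of_real y) * exp (- (\<i> * \<omega>) * of_real y))"
      unfolding P[OF that, symmetric] S[OF that, symmetric] by (simp add: algebra_simps)
    then show ?thesis unfolding e by simp
  qed
  have tail: "((\<lambda>y. exp (\<i> * \<omega> * of_real y)) \<longlongrightarrow> 0) at_top"
  proof (rule tendsto_norm_zero_cancel)
    have "((\<lambda>y. exp (- (Im \<omega> * y))) \<longlongrightarrow> 0) at_top"
      by (rule filterlim_compose[OF exp_at_bot])
         (use \<omega> in \<open>auto simp: filterlim_uminus_at_bot intro!: filterlim_tendsto_pos_mult_at_top[OF tendsto_const _ filterlim_ident]\<close>)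
    then show "((\<lambda>y. norm (exp (\<i> * \<omega> * of_real y))) \<longlongrightarrow> 0) at_top" by simp
  qed
  have "((\<lambda>y. S * exp (\<i> * \<omega> * of_real y) - 2 * \<i> * \<omega> * A y) \<longlongrightarrow> S * 0 - 2 * \<i> * \<omega> * 0) at_top"
    by (intro tendsto_intros tail lim)
  then have "((\<lambda>y. norm (S * exp (\<i> * \<omega> * of_real y) - 2 * \<i> * \<omega> * A y)) \<longlongrightarrow> 0) at_top"
    by (simp add: tendsto_norm_zero)
  then have "norm P \<le> 0"
  proof (rule tendsto_lowerbound)
    show "\<forall>\<^sub>F y in at_top. norm P \<le> norm (S * exp (\<i> * \<omega> * of_real y) - 2 * \<i> * \<omega> * A y)"
      using eventually_gt_at_top[of 0]
    proof eventually_elim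
      case (elim y)
      have "S * exp (\<i> * \<omega> * of_real y) - 2 * \<i> * \<omega> * A y = P * exp (- (\<i> * \<omega>) * of_real y)"
        using sol[OF elim] by simp
      then have "norm (S * exp (\<i> * \<omega> * of_real y) - 2 * \<i> * \<omega> * A y) = norm P * exp (Im \<omega> * y)"
        by (simp add: norm_mult)
      moreover have "norm P * 1 \<le> norm P * exp (Im \<omega> * y)" using \<omega> elim by (intro mult_left_mono) auto
      ultimately show ?case by simp
    qed
  qed simp
  then have P0: "P = 0" by simp
  have "norm (2 * \<i> * \<omega> * A y) = norm (2 * \<i> * \<omega> * A 1) * exp (- Im \<omega> * (y - 1))"
    using sol[of y] sol[of 1] y by (simp add: P0 norm_mult mult_exp_exp algebra_simps)
  then show ?thesis using w0 by (simp add: norm_mult)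
qed

text \<open>
  A multiple of csqrt k serves for l > 0 and i times it for l < 0. Since k lies in the open
  upper half-plane, both parts of csqrt k are positive, so either root has imaginary part of
  order sqrt |l|.
\<close>

lemma root_of_real_multiple:
  fixes k :: complex and l :: real
  assumes "Im k > 0"
  defines "c \<equiv> sqrt 2 * min (Re (csqrt k)) (Im (csqrt k))"
  shows "c > 0" "\<exists>\<omega>. \<omega>\<^sup>2 = 2 * k * of_real l \<and> Im \<omega> \<ge> c * sqrt \<bar>l\<bar>"
proof -
  define r where "r = csqrt k"
  have "Im (r\<^sup>2) > 0" using assms(1) by (simp add: r_def)
  then have "Re r * Im r > 0" by (simp add: power2_eq_square mult.commute)
  moreover have "Re r \<ge> 0" unfolding r_def by (rule Re_csqrt)
  ultimately have r: "Re r > 0" "Im r > 0" by (auto simp: zero_less_mult_iff)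
  then show "c > 0" by (simp add: c_def r_def)
  have r2: "r\<^sup>2 = k" by (simp add: r_def)
  have s2: "complex_of_real (sqrt (2 * \<bar>l\<bar>)) ^ 2 = of_real (2 * \<bar>l\<bar>)"
    by (simp flip: of_real_power)
  have sq: "sqrt (2 * \<bar>l\<bar>) = sqrt 2 * sqrt \<bar>l\<bar>" by (rule real_sqrt_mult)
  show "\<exists>\<omega>. \<omega>\<^sup>2 = 2 * k * of_real l \<and> Im \<omega> \<ge> c * sqrt \<bar>l\<bar>"
  proof (cases "l \<ge> 0")
    case True
    have "(of_real (sqrt (2 * \<bar>l\<bar>)) * r)\<^sup>2 = 2 * k * of_real l"
      unfolding power_mult_distrib s2 r2 using True by simp
    moreover have "c * sqrt \<bar>l\<bar> \<le> Im (of_real (sqrt (2 * \<bar>l\<bar>)) * r)"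
      unfolding sq c_def r_def[symmetric] by (simp add: mult.commute[of "sqrt \<bar>l\<bar>"] mult_right_mono)
    ultimately show ?thesis by blast
  next
    case False
    have "(\<i> * of_real (sqrt (2 * \<bar>l\<bar>)) * r)\<^sup>2 = 2 * k * of_real l"
      unfolding power_mult_distrib s2 r2 using False by simp
    moreover have "c * sqrt \<bar>l\<bar> \<le> Im (\<i> * of_real (sqrt (2 * \<bar>l\<bar>)) * r)"
      unfolding sq c_def r_def[symmetric] by (simp add: mult.commute[of "sqrt \<bar>l\<bar>"] mult_right_mono)
    ultimately show ?thesis by blast
  qed
qed

lemma arithmetic_progression_lower_bound:
  fixes \<Lambda> p :: real
  assumes p: "p > 0" and nz: "\<And>n::int. \<Lambda> + p * of_int n \<noteq> 0"
  obtains \<kappa> where "\<kappa> > 0" "\<And>n::int. \<kappa> * (\<bar>of_int n\<bar> + 1) \<le> \<bar>\<Lambda> + p * of_int n\<bar>"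
proof -
  define n0 where "n0 = \<lceil>(2 * \<bar>\<Lambda>\<bar> + p) / p\<rceil>"
  define S where "S = {- n0..n0}"
  define m where "m = Min ((\<lambda>n. \<bar>\<Lambda> + p * of_int n\<bar> / (\<bar>of_int n\<bar> + 1)) ` S)"
  have n0: "n0 \<ge> 0" using p by (simp add: n0_def) (smt (verit) divide_nonneg_pos ceiling_less_zero)
  have fin: "finite S" "S \<noteq> {}" using n0 by (auto simp: S_def)
  have m: "m > 0" unfolding m_def using fin nz by (subst Min_gr_iff) (auto intro!: divide_pos_pos add_nonneg_pos)
  show thesis
  proof (rule that[of "min m (p / 2)"])
    show "min m (p / 2) > 0" using m p by simp
    fix n :: int
    show "min m (p / 2) * (\<bar>of_int n\<bar> + 1) \<le> \<bar>\<Lambda> + p * of_int n\<bar>"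
    proof (cases "n \<in> S")
      case True
      have "m \<le> \<bar>\<Lambda> + p * of_int n\<bar> / (\<bar>of_int n\<bar> + 1)" unfolding m_def using fin True by (intro Min_le) auto
      then have "m * (\<bar>of_int n\<bar> + 1) \<le> \<bar>\<Lambda> + p * of_int n\<bar>" by (simp add: pos_le_divide_eq add_nonneg_pos)
      moreover have "min m (p / 2) * (\<bar>of_int n\<bar> + 1) \<le> m * (\<bar>of_int n\<bar> + 1)" by (intro mult_right_mono) auto
      ultimately show ?thesis by linarith
    next
      case False
      then have "\<bar>n\<bar> \<ge> n0" by (auto simp: S_def)
      then have "real_of_int \<bar>n\<bar> \<ge> (2 * \<bar>\<Lambda>\<bar> + p) / p" unfolding n0_def by (simp add: ceiling_le_iff)
      then have "p * \<bar>of_int n\<bar> \<ge> 2 * \<bar>\<Lambda>\<bar> + p" using p by (simp add: field_simps)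
      moreover have "\<bar>p * of_int n\<bar> = p * \<bar>of_int n\<bar>" using p by (simp add: abs_mult)
      moreover have "p / 2 * (\<bar>of_int n\<bar> + 1) = p * \<bar>of_int n\<bar> / 2 + p / 2" by (simp add: algebra_simps)
      moreover have "min m (p / 2) * (\<bar>of_int n\<bar> + 1) \<le> p / 2 * (\<bar>of_int n\<bar> + 1)" by (intro mult_right_mono) auto
      ultimately show ?thesis by linarith
    qed
  qed
qed

lemma exp_neg_sqrt_bound:
  assumes "x > 0" "m > 0"
  shows "exp (- (x * sqrt m)) \<le> 24 / x ^ 4 * (1 / m\<^sup>2)"
proof -
  have "(x * sqrt m) ^ 4 \<le> fact 4 * exp (x * sqrt m)" using power_le_fact_exp[of "x * sqrt m" 4] assms by simp
  moreover have "(x * sqrt m) ^ 4 = x ^ 4 * m\<^sup>2"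
  proof -
    have "sqrt m ^ 4 = (sqrt m ^ 2) ^ 2" by (simp flip: power_mult)
    then show ?thesis using assms by (simp add: power_mult_distrib)
  qed
  moreover have "fact 4 = (24::real)" by (simp add: fact_numeral)
  ultimately have "x ^ 4 * m\<^sup>2 \<le> 24 * exp (x * sqrt m)" by simp
  then show ?thesis using assms by (simp add: exp_minus field_simps)
qed

text \<open>
  Separation of variables. The n-th Fourier coefficient over one quasi-period satisfies A'' = -
  2 k (\<Lambda> + 2 \<pi> n / a) A with a nonzero factor; as it tends to 0, it is a decaying
  exponential. The rates are bounded below by a multiple of sqrt (|n| + 1), which makes the sum
  of the coefficients converge and decay exponentially in y.
\<close>

lemma half_plane_decay:
  fixes q qx qy qyy :: "real \<Rightarrow> real \<Rightarrow> complex" and k :: complex and a \<Lambda> :: real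
  assumes k: "Im k > 0" and a: "a > 0" and nz: "\<And>n::int. \<Lambda> + 2 * pi / a * of_int n \<noteq> 0"
    and sol: "parabolic_on k (UNIV \<times> {0<..}) q qx qy qyy"
    and per: "\<And>x y. y > 0 \<Longrightarrow> q (x + a) y = exp (- (\<i> * of_real (\<Lambda> * a))) * q x y"
    and dec: "\<And>\<epsilon>. \<epsilon> > 0 \<Longrightarrow> \<exists>Y. \<forall>x y. y > Y \<and> y > 0 \<longrightarrow> norm (q x y) < \<epsilon>"
  shows "\<exists>\<mu>>0. \<forall>x0. \<exists>C. \<forall>y\<ge>2. norm (q x0 y) \<le> C * exp (- \<mu> * y)"
proof -
  define l where "l n = \<Lambda> + 2 * pi / a * of_int n" for n :: int
  define c0 where "c0 = sqrt 2 * min (Re (csqrt k)) (Im (csqrt k))"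
  have c0: "c0 > 0" unfolding c0_def by (rule root_of_real_multiple(1)[OF k])
  have "2 * pi / a > 0" using a by simp
  from arithmetic_progression_lower_bound[OF this nz]
  obtain \<kappa> where \<kappa>: "\<kappa> > 0" "\<And>n::int. \<kappa> * (\<bar>of_int n\<bar> + 1) \<le> \<bar>l n\<bar>" unfolding l_def by blast
  define \<mu> where "\<mu> = c0 * sqrt \<kappa>"
  have \<mu>: "\<mu> > 0" using c0 \<kappa> by (simp add: \<mu>_def)
  define h where "h = a / 2"
  have h: "h > 0" using a by (simp add: h_def)
  let ?I = "{-h..h}"
  note sl = parabolic_onD[OF sol] and sc = parabolic_on_cont[OF sol]
  show ?thesis
  proof (rule exI[of _ \<mu>], intro conjI \<mu> allI)
    fix x0 :: real
    \<comment> \<open>the phases \<Lambda> t make the integrands periodic in spite of the Floquet multiplier\<close>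
    define e where "e n t = exp (\<i> * of_real (l n * t))" for n :: int and t :: real
    have conte: "continuous_on S (e n)" for S n unfolding e_def by (intro continuous_intros)
    have norme: "norm (e n t) = 1" for n t by (simp add: e_def)
    define A where "A n y = integral ?I (\<lambda>t. q (x0 + t) y * e n t)" for n y
    define A1 where "A1 n y = integral ?I (\<lambda>t. qy (x0 + t) y * e n t)" for n y
    define A2 where "A2 n y = integral ?I (\<lambda>t. qyy (x0 + t) y * e n t)" for n y
    have shiftcont: "continuous_on (U \<times> T) (\<lambda>p. f (x0 + snd p) (fst p))"
      if f: "continuous_on (UNIV \<times> {0<..}) (\<lambda>(x, y). f x y)" and U: "U \<subseteq> {0<..}" for f :: "real \<Rightarrow> real \<Rightarrow> complex" and U T :: "real set"
    proof -
      have ct: "continuous_on (U \<times> T) (\<lambda>p. (x0 + snd p, fst p))" by (intro continuous_intros)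
      have sub: "(\<lambda>p. (x0 + snd p, fst p)) ` (U \<times> T) \<subseteq> UNIV \<times> {0<..}" using U by (auto simp: subset_iff)
      show ?thesis using continuous_on_compose2[OF f ct sub] by simp
    qed
    have slice: "continuous_on T (\<lambda>t. f (x0 + t) y)"
      if f: "continuous_on (UNIV \<times> {0<..}) (\<lambda>(x, y). f x y)" and y: "y > 0" for f :: "real \<Rightarrow> real \<Rightarrow> complex" and T y
    proof -
      have "continuous_on T (\<lambda>t. (x0 + t, y))" by (intro continuous_intros)
      from continuous_on_compose2[OF f this] y show ?thesis by auto
    qed
    have leib: "((\<lambda>y. integral ?I (\<lambda>t. f (x0 + t) y * e n t)) has_vector_derivative integral ?I (\<lambda>t. f' (x0 + t) y * e n t)) (at y)"
      if f: "continuous_on (UNIV \<times> {0<..}) (\<lambda>(x, y). f x y)" and f': "continuous_on (UNIV \<times> {0<..}) (\<lambda>(x, y). f' x y)"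
        and d: "\<And>x y. y > 0 \<Longrightarrow> (f x has_vector_derivative f' x y) (at y)" and y: "y > 0"
      for f f' :: "real \<Rightarrow> real \<Rightarrow> complex" and n y
    proof -
      have "((\<lambda>y. integral (cbox (-h) h) (\<lambda>t. f (x0 + t) y * e n t)) has_vector_derivative integral (cbox (-h) h) (\<lambda>t. f' (x0 + t) y * e n t)) (at y within {0<..})"
      proof (rule leibniz_rule_vector_derivative)
        fix y t :: real assume "y \<in> {0<..}"
        then have y: "y > 0" by simp
        show "((\<lambda>y. f (x0 + t) y * e n t) has_vector_derivative f' (x0 + t) y * e n t) (at y within {0<..})"
          by (rule has_vector_derivative_at_within[OF has_vector_derivative_mult_left[OF d[OF y]]])
      next
        fix y :: real assume "y \<in> {0<..}"
        then have y: "y > 0" by simp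
        show "(\<lambda>t. f (x0 + t) y * e n t) integrable_on cbox (-h) h"
          by (rule integrable_continuous[OF continuous_on_mult[OF slice[OF f y] conte]])
      next
        have "continuous_on ({0<..} \<times> cbox (-h) h) (\<lambda>p. e n (snd p))"
          by (rule continuous_on_compose2[OF conte[of UNIV] continuous_on_snd[OF continuous_on_id]]) auto
        then have "continuous_on ({0<..} \<times> cbox (-h) h) (\<lambda>p. f' (x0 + snd p) (fst p) * e n (snd p))"
          by (rule continuous_on_mult[OF shiftcont[OF f' order_refl]])
        then show "continuous_on ({0<..} \<times> cbox (-h) h) (\<lambda>(y, t). f' (x0 + t) y * e n t)"
          by (simp add: case_prod_beta)
      qed (use y in auto)
      then show ?thesis using y by (simp add: at_within_open[of y "{0<..}"])
    qed
    have dA: "(A n has_vector_derivative A1 n y) (at y)" if "y > 0" for n y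
      unfolding A_def[abs_def] A1_def by (rule leib[OF sc(1) sc(4) _ that]) (use sl(2) in auto)
    have dA1: "(A1 n has_vector_derivative A2 n y) (at y)" if "y > 0" for n y
      unfolding A1_def[abs_def] A2_def by (rule leib[OF sc(4) sc(3) _ that]) (use sl(3) in auto)
    have A2: "A2 n y = - (2 * k * of_real (l n) * A n y)" if y: "y > 0" for n y
    proof -
      have k0: "k \<noteq> 0" using k by auto
      define B where "B t = q (x0 + t) y * e n t" for t
      have de: "(e n has_vector_derivative \<i> * of_real (l n) * e n t) (at t)" for t
      proof -
        have "((\<lambda>w. exp (\<i> * (of_real (l n) * w))) has_field_derivative \<i> * of_real (l n) * e n t) (at (of_real t))"
          unfolding e_def by (auto intro!: derivative_eq_intros)
        from has_vector_derivative_real_field[OF this] show ?thesis by (simp add: e_def[abs_def])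
      qed
      have dq: "((\<lambda>t. q (x0 + t) y) has_vector_derivative qx (x0 + t) y) (at t)" for t
      proof -
        have "((\<lambda>s. q s y) has_vector_derivative qx (x0 + t) y) (at (x0 + t))" using sl(1)[of "x0 + t" y] y by simp
        moreover have "((\<lambda>t. x0 + t) has_vector_derivative 1) (at t)" by (auto intro!: derivative_eq_intros)
        ultimately show ?thesis using vector_diff_chain_at[of "\<lambda>t. x0 + t" 1 t "\<lambda>s. q s y"] by (simp add: comp_def)
      qed
      have "((\<lambda>t. q (x0 + t) y * (\<i> * of_real (l n) * e n t) + qx (x0 + t) y * e n t) has_integral B h - B (-h)) ?I"
      proof (rule fundamental_theorem_of_calculus)
        fix t assume "t \<in> ?I"
        show "(B has_vector_derivative q (x0 + t) y * (\<i> * of_real (l n) * e n t) + qx (x0 + t) y * e n t) (at t within ?I)"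
          unfolding B_def by (rule has_vector_derivative_at_within[OF has_vector_derivative_mult[OF dq de]])
      qed (use h in auto)
      moreover have "B h = B (-h)"
      proof -
        have "q (x0 + h) y = exp (- (\<i> * of_real (\<Lambda> * a))) * q (x0 - h) y"
        proof -
          have "x0 - h + a = x0 + h" by (simp add: h_def)
          with per[OF y, of "x0 - h"] show ?thesis by (simp only:)
        qed
        moreover have "exp (- (\<i> * of_real (\<Lambda> * a))) * e n h = e n (-h)"
        proof -
          have "l n * h = \<Lambda> * a + l n * (- h) + of_int n * (pi * 2)" using a by (simp add: l_def h_def field_simps)
          from arg_cong[OF this, of "\<lambda>x. \<i> * complex_of_real x"]
          have "\<i> * of_real (l n * h) = \<i> * of_real (\<Lambda> * a) + \<i> * of_real (l n * (-h)) + \<i> * (of_int n * (of_real pi * 2))"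
            by (simp only: of_real_add of_real_mult of_real_of_int_eq of_real_numeral distrib_left)
          then have "e n h = exp (\<i> * of_real (\<Lambda> * a) + \<i> * of_real (l n * (-h)))"
            unfolding e_def by (simp only: exp_plus_2pin)
          then show ?thesis by (simp add: e_def exp_add[symmetric])
        qed
        ultimately show ?thesis unfolding B_def by (simp add: mult_ac)
      qed
      ultimately have 1: "((\<lambda>t. q (x0 + t) y * (\<i> * of_real (l n) * e n t) + qx (x0 + t) y * e n t) has_integral 0) ?I" by simp
      have 2: "((\<lambda>t. q (x0 + t) y * e n t) has_integral A n y) ?I"
        unfolding A_def by (rule integrable_integral[OF integrable_continuous_interval[OF continuous_on_mult[OF slice[OF sc(1) y] conte]]])
      have qyyx: "qyy x y = - (2 * \<i> * k) * qx x y" for x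
        using sl(4)[of x y] y k0 by (simp add: field_simps)
      have "(\<lambda>t. qyy (x0 + t) y * e n t) = (\<lambda>t. - (2 * \<i> * k) * (q (x0 + t) y * (\<i> * of_real (l n) * e n t) + qx (x0 + t) y * e n t)
          + (2 * \<i> * k) * (\<i> * of_real (l n)) * (q (x0 + t) y * e n t))"
        unfolding qyyx by (simp add: algebra_simps)
      then have "((\<lambda>t. qyy (x0 + t) y * e n t) has_integral - (2 * \<i> * k) * 0 + (2 * \<i> * k) * (\<i> * of_real (l n)) * A n y) ?I"
        using has_integral_add[OF has_integral_mult_right[OF 1, of "- (2 * \<i> * k)"] has_integral_mult_right[OF 2, of "(2 * \<i> * k) * (\<i> * of_real (l n))"]]
        by (simp only:)
      then have "A2 n y = (2 * \<i> * k) * (\<i> * of_real (l n)) * A n y"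
        unfolding A2_def by (simp only: integral_unique mult_zero_right add_0)
      also have "\<dots> = (\<i> * \<i>) * (2 * k * of_real (l n) * A n y)" by (simp only: mult_ac)
      finally show ?thesis by simp
    qed
    have A_bound: "norm (A n y) \<le> 2 * h * B" if B: "\<And>t. t \<in> ?I \<Longrightarrow> norm (q (x0 + t) y) \<le> B" and y: "y > 0" for n y B
    proof -
      have B0: "B \<ge> 0" by (rule order_trans[OF norm_ge_zero B[of 0]]) (use h in auto)
      have "norm (integral (cbox (-h) h) (\<lambda>t. q (x0 + t) y * e n t)) \<le> B * measure lborel (cbox (-h) h)"
      proof (rule Henstock_Kurzweil_Integration.integrable_bound[OF B0])
        show "(\<lambda>t. q (x0 + t) y * e n t) integrable_on cbox (-h) h"
          by (rule integrable_continuous[OF continuous_on_mult[OF slice[OF sc(1) y] conte]])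
      qed (use B in \<open>auto simp: norm_mult norme\<close>)
      then show ?thesis using h by (simp add: A_def mult.commute)
    qed
    have Alim: "(A n \<longlongrightarrow> 0) at_top" for n
    proof (rule tendstoI)
      fix \<epsilon> :: real assume \<epsilon>: "\<epsilon> > 0"
      obtain Y where Y: "\<And>x y. y > Y \<Longrightarrow> y > 0 \<Longrightarrow> norm (q x y) < \<epsilon> / (4 * h)"
        using dec[of "\<epsilon> / (4 * h)"] \<epsilon> h by auto
      show "\<forall>\<^sub>F y in at_top. dist (A n y) 0 < \<epsilon>"
        using eventually_gt_at_top[of "max Y 0"]
      proof eventually_elim
        case (elim y)
        then have y: "y > Y" "y > 0" by auto
        have "norm (A n y) \<le> 2 * h * (\<epsilon> / (4 * h))" by (rule A_bound) (use Y[OF y] y in \<open>auto intro: less_imp_le\<close>)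
        also have "\<dots> < \<epsilon>" using h \<epsilon> by simp
        finally show ?case by simp
      qed
    qed
    obtain M where M: "\<And>t. t \<in> ?I \<Longrightarrow> norm (q (x0 + t) 1) \<le> M"
    proof -
      have c1: "continuous_on ?I (\<lambda>t. q (x0 + t) 1)" by (rule slice[OF sc(1)]) simp
      then obtain M where "\<forall>z\<in>(\<lambda>t. q (x0 + t) 1) ` ?I. norm z \<le> M"
        using compact_imp_bounded[OF compact_continuous_image[OF c1 compact_Icc]] unfolding bounded_iff by blast
      then show thesis by (intro that) auto
    qed
    have M0: "M \<ge> 0" by (rule order_trans[OF norm_ge_zero M[of 0]]) (use h in auto)
    have Adec: "norm (A n y) \<le> 2 * h * M * exp (- (c0 * sqrt \<bar>l n\<bar>) * (y - 1))" if y: "y \<ge> 1" for n y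
    proof -
      obtain \<omega> where \<omega>: "\<omega>\<^sup>2 = 2 * k * of_real (l n)" "Im \<omega> \<ge> c0 * sqrt \<bar>l n\<bar>"
        using root_of_real_multiple(2)[OF k, of "l n"] unfolding c0_def by blast
      have "l n \<noteq> 0" using nz[of n] by (simp add: l_def)
      then have "c0 * sqrt \<bar>l n\<bar> > 0" using c0 by simp
      with \<omega> have Im: "Im \<omega> > 0" by linarith
      have "norm (A n y) = norm (A n 1) * exp (- Im \<omega> * (y - 1))"
      proof (rule decaying_mode[OF Im, of "A n" "A1 n"])
        show "(A1 n has_vector_derivative - (\<omega>\<^sup>2 * A n y)) (at y)" if "y > 0" for y
          using dA1[OF that, of n] A2[OF that, of n] \<omega>(1) by simp
      qed (use dA Alim y in auto)
      also have "\<dots> \<le> 2 * h * M * exp (- (c0 * sqrt \<bar>l n\<bar>) * (y - 1))"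
      proof (rule mult_mono)
        show "norm (A n 1) \<le> 2 * h * M" by (rule A_bound[OF M]) auto
        have "c0 * sqrt \<bar>l n\<bar> * (y - 1) \<le> Im \<omega> * (y - 1)" using \<omega>(2) y by (intro mult_right_mono) auto
        then show "exp (- Im \<omega> * (y - 1)) \<le> exp (- (c0 * sqrt \<bar>l n\<bar>) * (y - 1))" by simp
      qed (use h M0 in auto)
      finally show ?thesis .
    qed
    define g where "g m = exp (- (\<mu> * sqrt (real m + 1)))" for m :: nat
    have g_sum: "summable g"
    proof (rule summable_comparison_test')
      show "summable (\<lambda>m. 24 / \<mu> ^ 4 * (1 / (real m + 1)\<^sup>2))"
      proof (rule summable_mult)
        have "summable (\<lambda>m. inverse (real (Suc m) ^ 2))"
          using inverse_power_summable[of 2, where 'a = real] by (subst summable_Suc_iff) simp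
        then show "summable (\<lambda>m. 1 / (real m + 1)\<^sup>2)" by (simp add: inverse_eq_divide add.commute)
      qed
      fix m :: nat
      show "norm (g m) \<le> 24 / \<mu> ^ 4 * (1 / (real m + 1)\<^sup>2)"
        unfolding g_def using exp_neg_sqrt_bound[OF \<mu>, of "real m + 1"] by simp
    qed
    have final: "norm (q x0 y) \<le> 2 * (M * exp (- \<mu> * (y - 2)) * suminf g)" if y: "y \<ge> 2" for y
    proof -
      define Q where "Q t = q (x0 + t) y * exp (\<i> * of_real (\<Lambda> * t))" for t
      have y0: "y > 0" using y by simp
      have "norm (Q 0) \<le> 2 * suminf (\<lambda>m. M * exp (- \<mu> * (y - 2)) * g m)"
      proof (rule norm_le_sum_fourier_coeffs[OF h])
        show "continuous_on ?I Q" unfolding Q_def by (rule continuous_on_mult[OF slice[OF sc(1) y0]]) (intro continuous_intros)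
        fix n :: int
        have "Q t * exp (\<i> * of_real (pi * t / h) * of_int n) = q (x0 + t) y * e n t" for t
        proof -
          have "\<i> * of_real (\<Lambda> * t) + \<i> * of_real (pi * t / h) * of_int n = \<i> * of_real (l n * t)"
            using a by (simp add: l_def h_def field_simps)
          then show ?thesis unfolding Q_def e_def by (metis exp_add mult.assoc)
        qed
        then have "norm (integral ?I (\<lambda>t. Q t * exp (\<i> * of_real (pi * t / h) * of_int n))) = norm (A n y)"
          by (simp add: A_def)
        also have "\<dots> \<le> 2 * h * M * exp (- (c0 * sqrt \<bar>l n\<bar>) * (y - 1))" by (rule Adec) (use y in simp)
        also have "\<dots> \<le> 2 * h * M * exp (- \<mu> * (y - 2) - \<mu> * sqrt (real (nat \<bar>n\<bar>) + 1))"
        proof -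
          define r where "r = sqrt (\<bar>of_int n\<bar> + 1)"
          have r1: "r \<ge> 1" by (simp add: r_def)
          have "sqrt (\<kappa> * (\<bar>of_int n\<bar> + 1)) \<le> sqrt \<bar>l n\<bar>" using \<kappa>(2)[of n] by (rule real_sqrt_le_mono)
          then have "\<mu> * r \<le> c0 * sqrt \<bar>l n\<bar>" using c0 by (simp add: \<mu>_def r_def real_sqrt_mult mult.assoc)
          then have "\<mu> * r * (y - 1) \<le> c0 * sqrt \<bar>l n\<bar> * (y - 1)" using y by (intro mult_right_mono) auto
          moreover have "\<mu> * r * (y - 1) = \<mu> * r * (y - 2) + \<mu> * r" by (simp add: algebra_simps)
          moreover have "\<mu> * 1 * (y - 2) \<le> \<mu> * r * (y - 2)" using r1 \<mu> y by (intro mult_right_mono mult_left_mono) auto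
          ultimately have "- (c0 * sqrt \<bar>l n\<bar>) * (y - 1) \<le> - \<mu> * (y - 2) - \<mu> * r" by simp
          then show ?thesis using h M0 by (intro mult_left_mono) (auto simp: r_def)
        qed
        also have "\<dots> = 2 * h * (M * exp (- \<mu> * (y - 2)) * g (nat \<bar>n\<bar>))"
          unfolding g_def by (simp only: diff_conv_add_uminus exp_add mult_ac)
        finally show "norm (integral ?I (\<lambda>t. Q t * exp (\<i> * of_real (pi * t / h) * of_int n))) \<le> 2 * h * (M * exp (- \<mu> * (y - 2)) * g (nat \<bar>n\<bar>))" .
      next
        show "summable (\<lambda>m. M * exp (- \<mu> * (y - 2)) * g m)" by (rule summable_mult[OF g_sum])
      qed (use M0 in \<open>simp add: g_def\<close>)
      also have "suminf (\<lambda>m. M * exp (- \<mu> * (y - 2)) * g m) = M * exp (- \<mu> * (y - 2)) * suminf g"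
        by (rule suminf_mult[OF g_sum])
      finally show ?thesis by (simp add: Q_def)
    qed
    show "\<exists>C. \<forall>y\<ge>2. norm (q x0 y) \<le> C * exp (- \<mu> * y)"
    proof (intro exI allI impI)
      fix y :: real assume "y \<ge> 2"
      from final[OF this] show "norm (q x0 y) \<le> (2 * M * suminf g * exp (2 * \<mu>)) * exp (- \<mu> * y)"
        by (simp add: algebra_simps exp_diff exp_minus exp_add field_simps)
    qed
  qed
qed

section \<open>Edges and the incident wave\<close>

lemma edge_plus_2: "edge a b (n + 2) = edge a b n + a"
  by (auto simp: edge_def algebra_simps)

text \<open>
  The reflection x \<rightarrow> b - x permutes the edges. This symmetry is the origin of the
  index 1 - n in the embedding formula.
\<close>

lemma edge_reflect: "edge a b (1 - n) = b - edge a b n"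
proof (cases "even n")
  case True
  then obtain m where "n = 2 * m" by (elim evenE)
  moreover have "(1 - 2 * m) div 2 = - m" by simp
  ultimately show ?thesis by (simp add: edge_def)
next
  case False
  then obtain m where n: "n = 2 * m + 1" by (elim oddE)
  have "(- (2 * m)) div 2 = - m" by presburger
  with n show ?thesis by (simp add: edge_def)
qed

definition gap :: "real \<Rightarrow> real \<Rightarrow> int \<Rightarrow> real" where
  "gap a b n = edge a b (n + 1) - edge a b n"

lemma gap_eq: "gap a b n = (if even n then b else a - b)"
proof (cases "even n")
  case True
  then obtain m where "n = 2 * m" by (elim evenE)
  then show ?thesis by (simp add: gap_def edge_def)
next
  case False
  then obtain m where n: "n = 2 * m + 1" by (elim oddE)
  have "(2 * m + 2) div 2 = m + 1" by simp
  then show ?thesis by (simp add: n gap_def edge_def algebra_simps)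
qed

lemma edge_strict_mono:
  assumes "0 < b" "b < a" "m < n"
  shows "edge a b m < edge a b n"
  using assms(3)
proof (induction n rule: int_gr_induct)
  case base then show ?case using gap_eq[of a b m] assms(1,2) by (simp add: gap_def split: if_splits)
next
  case (step n) then show ?case using gap_eq[of a b n] assms(1,2) by (simp add: gap_def split: if_splits)
qed

lemma edge_mono: "0 < b \<Longrightarrow> b < a \<Longrightarrow> m \<le> n \<Longrightarrow> edge a b m \<le> edge a b n"
  using edge_strict_mono[of b a m n] by (cases "m = n") auto

lemma edge_less_iff: "0 < b \<Longrightarrow> b < a \<Longrightarrow> edge a b m < edge a b n \<longleftrightarrow> m < n"
  using edge_strict_mono[of b a m n] edge_mono[of b a n m] by (cases "m < n") auto

lemma ex_strip:
  assumes "0 < b" "b < a"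
  shows "\<exists>m. edge a b m \<le> x \<and> x < edge a b (m + 1)"
proof -
  define q where "q = \<lfloor>x / a\<rfloor>"
  have a: "a > 0" using assms by simp
  have "of_int q \<le> x / a" "x / a < of_int q + 1" unfolding q_def by linarith+
  then have q: "a * of_int q \<le> x" "x < a * of_int q + a" using a by (simp_all add: field_simps)
  have "(2 * q + 2) div 2 = q + 1" by simp
  then have e: "edge a b (2 * q) = a * of_int q" "edge a b (2 * q + 1) = a * of_int q + b" "edge a b (2 * q + 1 + 1) = a * of_int q + a"
    by (simp_all add: edge_def algebra_simps)
  show ?thesis
  proof (cases "x < a * of_int q + b")
    case True then show ?thesis using q e by (intro exI[of _ "2 * q"]) simp
  next
    case False then show ?thesis using q e by (intro exI[of _ "2 * q + 1"]) simp
  qed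
qed

lemma strip_unique:
  assumes "0 < b" "b < a" "edge a b m \<le> x" "x < edge a b (m + 1)" "edge a b n \<le> x" "x < edge a b (n + 1)"
  shows "m = n"
proof -
  have "edge a b m < edge a b (n + 1)" "edge a b n < edge a b (m + 1)" using assms by linarith+
  then show ?thesis using edge_less_iff[OF assms(1,2)] by simp
qed

lemma strip_of_eq:
  assumes "0 < b" "b < a" "edge a b m \<le> x" "x < edge a b (m + 1)"
  shows "strip_of a b x = m"
  unfolding strip_of_def by (rule the_equality) (use assms strip_unique[OF assms(1,2)] in blast)+

text \<open>
  The incident wave continued to the whole plane.
\<close>

definition plane_wave :: "complex \<Rightarrow> complex \<Rightarrow> real \<Rightarrow> real \<Rightarrow> complex" where
  "plane_wave k \<theta> x y = exp (- \<i> * k * of_real x * \<theta>\<^sup>2 / 2 - \<i> * k * \<theta> * of_real y)"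

lemma norm_plane_wave: "k * \<theta>\<^sup>2 \<in> \<real> \<Longrightarrow> norm (plane_wave k \<theta> x y) = exp (Im (k * \<theta>) * y)"
proof -
  assume "k * \<theta>\<^sup>2 \<in> \<real>"
  then obtain l where l: "k * \<theta>\<^sup>2 = of_real l" by (elim Reals_cases)
  have "- \<i> * k * of_real x * \<theta>\<^sup>2 / 2 - \<i> * k * \<theta> * of_real y = - \<i> * (k * \<theta>\<^sup>2) * of_real x / 2 - \<i> * (k * \<theta>) * of_real y"
    by (simp add: mult_ac)
  moreover have "Re (- \<i> * (k * \<theta>\<^sup>2) * of_real x / 2 - \<i> * (k * \<theta>) * of_real y) = Im (k * \<theta>) * y"
    unfolding l by (simp add: algebra_simps)
  ultimately show ?thesis unfolding plane_wave_def norm_exp_eq_Re by (simp only:)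
qed

lemma plane_wave_parabolic:
  assumes "k \<noteq> 0"
  shows "parabolic_on k S (plane_wave k \<theta>) (\<lambda>x y. (- \<i> * k * \<theta>\<^sup>2 / 2) * plane_wave k \<theta> x y)
    (\<lambda>x y. (- \<i> * k * \<theta>) * plane_wave k \<theta> x y) (\<lambda>x y. (- \<i> * k * \<theta>)\<^sup>2 * plane_wave k \<theta> x y)"
proof -
  have dx: "((\<lambda>s. plane_wave k \<theta> s y) has_vector_derivative (- \<i> * k * \<theta>\<^sup>2 / 2) * plane_wave k \<theta> x y) (at x)" for x y
  proof -
    have "((\<lambda>w. exp (- \<i> * k * w * \<theta>\<^sup>2 / 2 - \<i> * k * \<theta> * of_real y)) has_field_derivative (- \<i> * k * \<theta>\<^sup>2 / 2) * plane_wave k \<theta> x y) (at (of_real x))"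
      unfolding plane_wave_def by (auto intro!: derivative_eq_intros)
    from has_vector_derivative_real_field[OF this] show ?thesis by (simp add: plane_wave_def)
  qed
  have dy: "(plane_wave k \<theta> x has_vector_derivative (- \<i> * k * \<theta>) * plane_wave k \<theta> x y) (at y)" for x y
  proof -
    have "((\<lambda>w. exp (- \<i> * k * of_real x * \<theta>\<^sup>2 / 2 - \<i> * k * \<theta> * w)) has_field_derivative (- \<i> * k * \<theta>) * plane_wave k \<theta> x y) (at (of_real y))"
      unfolding plane_wave_def by (auto intro!: derivative_eq_intros)
    from has_vector_derivative_real_field[OF this] show ?thesis by (simp add: plane_wave_def[abs_def])
  qed
  have dyy: "((\<lambda>y. (- \<i> * k * \<theta>) * plane_wave k \<theta> x y) has_vector_derivative (- \<i> * k * \<theta>)\<^sup>2 * plane_wave k \<theta> x y) (at y)" for x y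
    using has_vector_derivative_mult_right[OF dy[of x y], of "- \<i> * k * \<theta>"] by (simp only: power2_eq_square mult.assoc)
  have eqn: "(- \<i> * k * \<theta>\<^sup>2 / 2) * plane_wave k \<theta> x y = \<i> / (2 * k) * ((- \<i> * k * \<theta>)\<^sup>2 * plane_wave k \<theta> x y)" for x y
  proof -
    have "(- \<i> * k * \<theta>)\<^sup>2 = - (k\<^sup>2 * \<theta>\<^sup>2)" by (simp add: power_mult_distrib)
    then show ?thesis using assms by (simp add: power2_eq_square)
  qed
  have cont: "continuous_on S (\<lambda>(x, y). c * plane_wave k \<theta> x y)" for c
    unfolding plane_wave_def case_prod_beta by (intro continuous_intros) auto
  show ?thesis unfolding parabolic_on_def
    using dx dy dyy eqn cont[of 1] cont[of "- \<i> * k * \<theta>\<^sup>2 / 2"] cont[of "- \<i> * k * \<theta>"] cont[of "(- \<i> * k * \<theta>)\<^sup>2"] by auto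
qed

lemma plane_wave_edecay:
  assumes "k * \<theta>\<^sup>2 \<in> \<real>" "Im (k * \<theta>) \<ge> 0"
  shows "edecay (- Im (k * \<theta>)) (plane_wave k \<theta> x)"
proof (rule edecayI[where C = 1])
  show "plane_wave k \<theta> x \<in> borel_measurable borel" unfolding plane_wave_def by measurable
  fix y
  have "Im (k * \<theta>) * y \<le> Im (k * \<theta>) * \<bar>y\<bar>" using assms(2) by (intro mult_left_mono) auto
  then show "norm (plane_wave k \<theta> x y) \<le> 1 * exp (- (- Im (k * \<theta>)) * \<bar>y\<bar>)" unfolding norm_plane_wave[OF assms(1)] by (simp only: minus_minus mult_1 exp_le_cancel_iff)
qed

text \<open>
  The continued incident wave solves the equation in the whole plane, so it is propagated into
  itself; at an edge only the sign on y < 0 disturbs it.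
\<close>

lemma conv_plane_wave:
  assumes k: "Im k > 0" and r: "k * \<theta>\<^sup>2 \<in> \<real>" and i: "Im (k * \<theta>) \<ge> 0" and t: "t > 0"
  shows "conv (gauss (gauss_rate k t)) (plane_wave k \<theta> x) y = plane_wave k \<theta> (x + t) y"
proof -
  have k0: "k \<noteq> 0" using k by auto
  have "conv (gauss (gauss_rate k (x + t - x))) (plane_wave k \<theta> x) y = plane_wave k \<theta> (x + t) y"
  proof (rule parabolic_representation[OF k plane_wave_parabolic[OF k0] _ i])
    show "norm (plane_wave k \<theta> x' y) \<le> 1 * exp (Im (k * \<theta>) * \<bar>y\<bar>)" for x' y
    proof -
      have "Im (k * \<theta>) * y \<le> Im (k * \<theta>) * \<bar>y\<bar>" using i by (intro mult_left_mono) auto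
      then show ?thesis unfolding norm_plane_wave[OF r] by (simp only: mult_1 exp_le_cancel_iff)
    qed
    show "((\<lambda>x. plane_wave k \<theta> x y) \<longlongrightarrow> plane_wave k \<theta> x y) (at_right x)" for y
      unfolding plane_wave_def by (intro tendsto_intros) auto
    show "plane_wave k \<theta> x \<in> borel_measurable borel" unfolding plane_wave_def by measurable
    show "((\<lambda>(x, y). plane_wave k \<theta> x y) \<longlongrightarrow> plane_wave k \<theta> (x + t) y) (at (x + t, y) within {x<..<x + t} \<times> UNIV)"
    proof -
      have "continuous_on UNIV (\<lambda>p. plane_wave k \<theta> (fst p) (snd p))" unfolding plane_wave_def by (intro continuous_intros) auto
      then have "isCont (\<lambda>p. plane_wave k \<theta> (fst p) (snd p)) (x + t, y)" by (simp add: continuous_on_eq_continuous_at)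
      then have "((\<lambda>p. plane_wave k \<theta> (fst p) (snd p)) \<longlongrightarrow> plane_wave k \<theta> (x + t) y) (at (x + t, y))" by (simp add: isCont_def)
      then show ?thesis unfolding case_prod_beta by (rule tendsto_within_subset) simp
    qed
  qed (use t in simp)
  then show ?thesis by simp
qed

section \<open>Edge sources\<close>

lemma half_line_parts:
  fixes F F' :: "real \<Rightarrow> complex"
  assumes F: "\<And>y. (F has_vector_derivative F' y) (at y)" and F': "\<And>y. isCont F' y"
  shows "(F \<longlongrightarrow> 0) at_top \<Longrightarrow> set_integrable lborel {0<..} F' \<Longrightarrow> (LINT y:{0<..}|lborel. F' y) = - F 0"
    "(F \<longlongrightarrow> 0) at_bot \<Longrightarrow> set_integrable lborel {..<0} F' \<Longrightarrow> (LINT y:{..<0}|lborel. F' y) = F 0"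
proof -
  have c: "isCont F 0" using has_vector_derivative_continuous[OF F] by blast
  have cr: "(F \<longlongrightarrow> F 0) (at_right 0)" "(F \<longlongrightarrow> F 0) (at_left 0)"
    using c unfolding isCont_def by (auto intro: tendsto_within_subset[of _ _ _ UNIV])
  {
    assume lim: "(F \<longlongrightarrow> 0) at_top" and i: "set_integrable lborel {0<..} F'"
    have e: "einterval 0 \<infinity> = {0<..}" by (auto simp: einterval_def)
    have "(LBINT y=0..\<infinity>. F' y) = 0 - F 0"
      by (rule interval_integral_FTC_integrable)
         (use F F' i e lim cr in \<open>auto simp: zero_ereal_def ereal_tendsto_simps\<close>)
    then show "(LINT y:{0<..}|lborel. F' y) = - F 0" by (simp add: interval_lebesgue_integral_def e)
  }
  {
    assume lim: "(F \<longlongrightarrow> 0) at_bot" and i: "set_integrable lborel {..<0} F'"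
    have e: "einterval (-\<infinity>) 0 = {..<0}" by (auto simp: einterval_def)
    have "(LBINT y=-\<infinity>..0. F' y) = F 0 - 0"
      by (rule interval_integral_FTC_integrable)
         (use F F' i e lim cr in \<open>auto simp: zero_ereal_def ereal_tendsto_simps\<close>)
    then show "(LINT y:{..<0}|lborel. F' y) = F 0" by (simp add: interval_lebesgue_integral_def e)
  }
qed

lemma integral_split_at_0:
  fixes f :: "real \<Rightarrow> complex"
  assumes f: "integrable lborel f"
  shows "(LINT y|lborel. f y) = (LINT y:{0<..}|lborel. f y) + (LINT y:{..<0}|lborel. f y)"
proof -
  have i: "integrable lborel (\<lambda>y. indicator {0<..} y *\<^sub>R f y)" "integrable lborel (\<lambda>y. indicator {..<0} y *\<^sub>R f y)"
    using f by (auto intro: integrable_mult_indicator)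
  have "(LINT y|lborel. f y) = (LINT y|lborel. indicator {0<..} y *\<^sub>R f y + indicator {..<0} y *\<^sub>R f y)"
  proof (rule integral_cong_AE)
    show "AE y in lborel. f y = indicator {0<..} y *\<^sub>R f y + indicator {..<0} y *\<^sub>R f y"
      using AE_lborel_singleton[of 0] by eventually_elim (auto simp: indicator_def)
  qed (use f i in \<open>auto dest: borel_measurable_integrable\<close>)
  then show ?thesis using i by (simp add: set_lebesgue_integral_def)
qed

text \<open>
  The factor acquired when an edge is passed. The value 0 at y = 0 agrees with sgn for \<sigma>
  = -1.
\<close>

definition edge_sign :: "complex \<Rightarrow> real \<Rightarrow> complex" where
  "edge_sign \<sigma> y = (if y > 0 then 1 else if y < 0 then \<sigma> else 0)"

lemma edge_sign_measurable [measurable]: "edge_sign \<sigma> \<in> borel_measurable borel"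
  unfolding edge_sign_def by measurable

text \<open>
  The diffraction problem reduced to the line: f n is the trace of a sheet combination at x_n -
  0, and r n is the trace at x_n + 0 minus the incident wave.
\<close>

locale edge_traces =
  fixes a b :: real and k \<theta> \<sigma> :: complex and f :: "int \<Rightarrow> real \<Rightarrow> complex" and r :: "int \<Rightarrow> real \<Rightarrow> complex" and c :: real
  assumes ab: "0 < b" "b < a" and k: "Im k > 0" and real: "k * \<theta>\<^sup>2 \<in> \<real>" and inc: "Im (k * \<theta>) > 0"
    and \<sigma>: "\<sigma> = 1 \<or> \<sigma> = -1" and c: "c > 0"
    and r_eq: "\<And>n y. r n y = edge_sign \<sigma> y * f n y - plane_wave k \<theta> (edge a b n) y"
    and r_decay: "\<And>n. edecay c (r n)"
    and f_step: "\<And>n. f (n + 1) = conv (gauss (gauss_rate k (gap a b n))) (\<lambda>y. edge_sign \<sigma> y * f n y)"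
    and r_per: "\<And>n y. r (n + 2) y = exp (- \<i> * k * of_real a * \<theta>\<^sup>2 / 2) * r n y"
begin

abbreviation s where "s \<equiv> edge_sign \<sigma>"
abbreviation E where "E \<equiv> exp (- \<i> * k * of_real a * \<theta>\<^sup>2 / 2)"
definition \<alpha> where "\<alpha> n = gauss_rate k (gap a b n)"
definition e where "e n = plane_wave k \<theta> (edge a b n)"
abbreviation P where "P n \<equiv> conv (gauss (\<alpha> n))"

lemma gap_pos: "gap a b n > 0" using gap_eq[of a b n] ab by simp

lemma \<alpha>_pos: "Re (\<alpha> n) > 0" unfolding \<alpha>_def by (rule Re_gauss_rate_pos[OF k gap_pos])

lemma \<alpha>_even: "even (n - m) \<Longrightarrow> \<alpha> n = \<alpha> m"
  unfolding \<alpha>_def gap_eq by auto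

lemma norm_E: "norm E = 1"
proof -
  obtain l where l: "k * \<theta>\<^sup>2 = of_real l" using real by (elim Reals_cases)
  have "- \<i> * k * of_real a * \<theta>\<^sup>2 / 2 = - \<i> * (k * \<theta>\<^sup>2) * of_real a / 2" by (simp add: mult_ac)
  moreover have "Re (- \<i> * (k * \<theta>\<^sup>2) * of_real a / 2) = 0" unfolding l by simp
  ultimately show ?thesis by (simp only: norm_exp_eq_Re exp_zero)
qed

lemma s_bound: "norm (s y) \<le> 1" "y \<noteq> 0 \<Longrightarrow> norm (s y) = 1"
  using \<sigma> by (auto simp: edge_sign_def)

lemma s_edecay: "edecay d F \<Longrightarrow> edecay d (\<lambda>y. s y * F y)"
  by (rule edecay_bounded_mult[OF _ edge_sign_measurable s_bound(1)])

lemma rapid_\<alpha>: "rapid (gauss (\<alpha> n))" by (rule rapid_gauss[OF \<alpha>_pos])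

lemma P_edecay: "edecay d F \<Longrightarrow> edecay d (P n F)" by (rule edecay_conv[OF rapid_\<alpha>])

lemma e_edecay: "edecay (- Im (k * \<theta>)) (e n)"
  unfolding e_def by (rule plane_wave_edecay[OF real]) (use inc in linarith)

lemma e_step: "e (n + 1) = P n (e n)"
proof
  fix y
  have "P n (e n) y = plane_wave k \<theta> (edge a b n + gap a b n) y"
    unfolding \<alpha>_def e_def by (rule conv_plane_wave[OF k real _ gap_pos]) (use inc in linarith)
  then show "e (n + 1) y = P n (e n) y" by (simp add: e_def gap_def)
qed

lemma sf_eq: "s y * f n y = r n y + e n y" by (simp add: r_eq e_def)

lemma f_eq: "f (n + 1) y = P n (r n) y + e (n + 1) y"
proof -
  have "f (n + 1) y = P n (\<lambda>y. r n y + e n y) y" unfolding f_step \<alpha>_def sf_eq ..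
  also have "\<dots> = P n (r n) y + P n (e n) y" by (rule conv_add[OF rapid_\<alpha> r_decay e_edecay])
  finally show ?thesis by (simp add: e_step)
qed

lemma f_eq': "f n y = P (n - 1) (r (n - 1)) y + e n y"
  using f_eq[of "n - 1" y] by simp

text \<open>
  H applied to f n. Written by means of r n, because H annihilates the incident wave and the
  derivative may be put on the Gaussian.
\<close>

definition h where "h n y = conv (gauss' (\<alpha> (n - 1))) (r (n - 1)) y + \<i> * k * \<theta> * P (n - 1) (r (n - 1)) y"

lemma h_edecay: "edecay c (h n)"
  unfolding h_def[abs_def]
  by (intro edecay_add edecay_cmult edecay_conv rapid_gauss rapid_gauss' \<alpha>_pos r_decay)

lemma f_deriv: "(f n has_vector_derivative h n y - \<i> * k * \<theta> * f n y) (at y)"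
proof -
  have e': "(e n has_vector_derivative (- \<i> * k * \<theta>) * e n y) (at y)"
    unfolding e_def by (rule parabolic_onD(2)[OF plane_wave_parabolic[of k UNIV]]) (use k in auto)
  have "((\<lambda>y. P (n - 1) (r (n - 1)) y + e n y) has_vector_derivative conv (gauss' (\<alpha> (n - 1))) (r (n - 1)) y + (- \<i> * k * \<theta>) * e n y) (at y)"
    by (rule has_vector_derivative_add[OF conv_gauss_has_vector_derivative[OF \<alpha>_pos r_decay] e'])
  moreover have "conv (gauss' (\<alpha> (n - 1))) (r (n - 1)) y + (- \<i> * k * \<theta>) * e n y = h n y - \<i> * k * \<theta> * f n y"
    unfolding h_def f_eq' by (simp add: algebra_simps)
  ultimately show ?thesis unfolding f_eq'[abs_def] by simp
qed

lemma h_cont: "isCont (h n) y"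
  unfolding h_def[abs_def]
  by (intro continuous_intros conv_gauss'_continuous[OF \<alpha>_pos r_decay] conv_gauss_continuous[OF \<alpha>_pos r_decay])

text \<open>
  On each half-line z > 0 and z < 0 the derivative is moved from the kernel to the data. The two
  boundary terms at z = 0 add up to the jump (1 - \<sigma>) f_n(0) of the data times the kernel:
  this is the field of a point source at the edge.
\<close>

lemma H_conv:
  assumes t: "t > 0"
  shows "conv (gauss' (gauss_rate k t)) (r n) y + \<i> * k * \<theta> * conv (gauss (gauss_rate k t)) (r n) y =
    (1 - \<sigma>) * f n 0 * gauss (gauss_rate k t) y + conv (gauss (gauss_rate k t)) (\<lambda>y. s y * h n y) y"
proof -
  define \<beta> where "\<beta> = gauss_rate k t"
  have \<beta>: "Re \<beta> > 0" unfolding \<beta>_def by (rule Re_gauss_rate_pos[OF k t])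
  let ?K = "gauss \<beta>" and ?K' = "gauss' \<beta>"
  have rK: "rapid ?K" "rapid ?K'" by (rule rapid_gauss[OF \<beta>] rapid_gauss'[OF \<beta>])+
  define A where "A z = ?K (y - z) * (s z * h n z - \<i> * k * \<theta> * r n z) - ?K' (y - z) * r n z" for z
  have sh: "edecay c (\<lambda>z. s z * h n z)" by (rule s_edecay[OF h_edecay])
  have i1: "integrable lborel (\<lambda>z. ?K (y - z) * (s z * h n z))" by (rule conv_integrable[OF rK(1) sh])
  have i2: "integrable lborel (\<lambda>z. ?K (y - z) * r n z)" by (rule conv_integrable[OF rK(1) r_decay])
  have i3: "integrable lborel (\<lambda>z. ?K' (y - z) * r n z)" by (rule conv_integrable[OF rK(2) r_decay])
  have A_eq: "A = (\<lambda>z. ?K (y - z) * (s z * h n z) - \<i> * k * \<theta> * (?K (y - z) * r n z) - ?K' (y - z) * r n z)"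
    unfolding A_def by (auto simp: algebra_simps)
  have iA: "integrable lborel A"
    unfolding A_eq by (intro Bochner_Integration.integrable_diff integrable_mult_right i1 i2 i3)
  have A_int: "(LINT z|lborel. A z) = conv ?K (\<lambda>y. s y * h n y) y - \<i> * k * \<theta> * conv ?K (r n) y - conv ?K' (r n) y"
    unfolding A_eq conv_def using i1 i2 i3 by simp
  have ed: "(e n has_vector_derivative (- \<i> * k * \<theta>) * e n z) (at z)" for z
    unfolding e_def by (rule parabolic_onD(2)[OF plane_wave_parabolic[of k UNIV]]) (use k in auto)
  \<comment> \<open>the product of kernel and data, extended smoothly across z = 0 from z > 0 for \<tau> = 1 and
      from z < 0 for \<tau> = \<sigma>\<close>
  define B where "B \<tau> z = ?K (y - z) * (\<tau> * f n z - e n z)" for \<tau> z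
  define B' where "B' \<tau> z = ?K (y - z) * (\<tau> * h n z - \<i> * k * \<theta> * (\<tau> * f n z - e n z)) - ?K' (y - z) * (\<tau> * f n z - e n z)" for \<tau> z
  have Kd: "((\<lambda>z. ?K (y - z)) has_vector_derivative - ?K' (y - z)) (at z)" for z
  proof -
    have "((\<lambda>z. ?K (z - y)) has_vector_derivative ?K' (z - y)) (at z)" by (rule gauss_has_vector_derivative)
    moreover have "?K (y - z) = ?K (z - y)" for z using gauss_even[of \<beta> "z - y"] by simp
    moreover have "- ?K' (y - z) = ?K' (z - y)" using gauss_even[of \<beta> "z - y"] by (simp add: gauss'_def algebra_simps)
    ultimately show ?thesis by simp
  qed
  have Bd: "(B \<tau> has_vector_derivative B' \<tau> z) (at z)" for \<tau> z
  proof -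
    have "((\<lambda>z. \<tau> * f n z - e n z) has_vector_derivative \<tau> * (h n z - \<i> * k * \<theta> * f n z) - (- \<i> * k * \<theta>) * e n z) (at z)"
      by (rule has_vector_derivative_diff[OF has_vector_derivative_mult_right[OF f_deriv] ed])
    from has_vector_derivative_mult[OF Kd this]
    have "(B \<tau> has_vector_derivative ?K (y - z) * (\<tau> * (h n z - \<i> * k * \<theta> * f n z) - (- \<i> * k * \<theta>) * e n z)
       + - ?K' (y - z) * (\<tau> * f n z - e n z)) (at z)" unfolding B_def[abs_def] .
    then show ?thesis unfolding B'_def by (simp add: algebra_simps)
  qed
  have fc: "isCont (f n) z" for z using has_vector_derivative_continuous[OF f_deriv] .
  have ec: "isCont (e n) z" for z using has_vector_derivative_continuous[OF ed] .
  have Kc: "isCont (\<lambda>z. ?K (y - z)) z" "isCont (\<lambda>z. ?K' (y - z)) z" for z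
    unfolding gauss'_def gauss_def by (intro continuous_intros)+
  have B'c: "isCont (B' \<tau>) z" for \<tau> z
    unfolding B'_def by (intro continuous_intros Kc h_cont fc ec)
  have rp: "r n z = 1 * f n z - e n z" if "z > 0" for z using that by (simp add: r_eq e_def edge_sign_def)
  have rm: "r n z = \<sigma> * f n z - e n z" if "z < 0" for z using that by (simp add: r_eq e_def edge_sign_def)
  have pos: "A z = B' 1 z" if "z > 0" for z unfolding A_def B'_def rp[OF that] using that by (simp add: edge_sign_def)
  have neg: "A z = B' \<sigma> z" if "z < 0" for z unfolding A_def B'_def rm[OF that] using that by (simp add: edge_sign_def)
  obtain M where M: "M > 0" "\<And>y z. norm (?K (y - z) * r n z) \<le> M * exp (- c * \<bar>y\<bar>) * exp (- 1 * \<bar>y - z\<bar>)"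
    using conv_pointwise_bound[OF rK(1) r_decay] by blast
  have ex: "((\<lambda>z. M * exp (- c * \<bar>y\<bar>) * exp (- 1 * \<bar>y - z\<bar>)) \<longlongrightarrow> 0) at_top" "((\<lambda>z. M * exp (- c * \<bar>y\<bar>) * exp (- 1 * \<bar>y - z\<bar>)) \<longlongrightarrow> 0) at_bot"
  proof -
    have "filterlim (\<lambda>z::real. - y + z) at_top at_top"
      by (rule filterlim_tendsto_add_at_top[OF tendsto_const filterlim_ident])
    then have "filterlim (\<lambda>z::real. \<bar>- y + z\<bar>) at_top at_top" by (rule filterlim_at_top_mono) (auto intro!: always_eventually)
    then have "filterlim (\<lambda>z. - \<bar>- y + z\<bar>) at_bot at_top" by (simp add: filterlim_uminus_at_bot)
    from filterlim_compose[OF exp_at_bot this] have 1: "((\<lambda>z. exp (- 1 * \<bar>y - z\<bar>)) \<longlongrightarrow> 0) at_top"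
      by (simp add: abs_minus_commute)
    have "filterlim (\<lambda>z::real. y + z) at_top at_top"
      by (rule filterlim_tendsto_add_at_top[OF tendsto_const filterlim_ident])
    then have "filterlim (\<lambda>z::real. \<bar>y + z\<bar>) at_top at_top" by (rule filterlim_at_top_mono) (auto intro!: always_eventually)
    then have "filterlim (\<lambda>z. - \<bar>y + z\<bar>) at_bot at_top" by (simp add: filterlim_uminus_at_bot)
    from filterlim_compose[OF exp_at_bot this] have "((\<lambda>z. exp (- 1 * \<bar>y - (- z)\<bar>)) \<longlongrightarrow> 0) at_top" by simp
    then have 2: "((\<lambda>z. exp (- 1 * \<bar>y - z\<bar>)) \<longlongrightarrow> 0) at_bot"
      by (subst at_bot_mirror, subst filterlim_filtermap) simp
    show "((\<lambda>z. M * exp (- c * \<bar>y\<bar>) * exp (- 1 * \<bar>y - z\<bar>)) \<longlongrightarrow> 0) at_top" by (rule tendsto_mult_right_zero[OF 1])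
    show "((\<lambda>z. M * exp (- c * \<bar>y\<bar>) * exp (- 1 * \<bar>y - z\<bar>)) \<longlongrightarrow> 0) at_bot" by (rule tendsto_mult_right_zero[OF 2])
  qed
  have limp: "(B 1 \<longlongrightarrow> 0) at_top"
  proof (rule Lim_null_comparison[OF _ ex(1)])
    show "\<forall>\<^sub>F z in at_top. norm (B 1 z) \<le> M * exp (- c * \<bar>y\<bar>) * exp (- 1 * \<bar>y - z\<bar>)"
      using eventually_gt_at_top[of 0] by eventually_elim (use M(2) in \<open>simp only: B_def rp[symmetric]\<close>)
  qed
  have limm: "(B \<sigma> \<longlongrightarrow> 0) at_bot"
  proof (rule Lim_null_comparison[OF _ ex(2)])
    show "\<forall>\<^sub>F z in at_bot. norm (B \<sigma> z) \<le> M * exp (- c * \<bar>y\<bar>) * exp (- 1 * \<bar>y - z\<bar>)"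
      using eventually_gt_at_bot[of 0] by eventually_elim (use M(2) in \<open>simp only: B_def rm[symmetric]\<close>)
  qed
  have sp: "(\<lambda>z. indicator {0<..} z *\<^sub>R B' 1 z) = (\<lambda>z. indicator {0<..} z *\<^sub>R A z)"
    by (rule ext) (simp add: pos split: split_indicator)
  have sm: "(\<lambda>z. indicator {..<0} z *\<^sub>R B' \<sigma> z) = (\<lambda>z. indicator {..<0} z *\<^sub>R A z)"
    by (rule ext) (simp add: neg split: split_indicator)
  have I: "set_integrable lborel {0<..} (B' 1)" "set_integrable lborel {..<0} (B' \<sigma>)"
    unfolding set_integrable_def sp sm by (auto intro: integrable_mult_indicator iA)
  have "(LINT z|lborel. A z) = (LINT z:{0<..}|lborel. B' 1 z) + (LINT z:{..<0}|lborel. B' \<sigma> z)"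
    unfolding integral_split_at_0[OF iA] set_lebesgue_integral_def sp sm ..
  also have "\<dots> = - B 1 0 + B \<sigma> 0"
    using half_line_parts(1)[OF Bd B'c limp I(1)] half_line_parts(2)[OF Bd B'c limm I(2)] by simp
  also have "\<dots> = - ((1 - \<sigma>) * f n 0 * ?K y)" by (simp add: B_def algebra_simps)
  finally have "conv ?K (\<lambda>y. s y * h n y) y - \<i> * k * \<theta> * conv ?K (r n) y - conv ?K' (r n) y = - ((1 - \<sigma>) * f n 0 * ?K y)"
    unfolding A_int .
  then have "conv ?K' (r n) y + \<i> * k * \<theta> * conv ?K (r n) y = (1 - \<sigma>) * f n 0 * ?K y + conv ?K (\<lambda>y. s y * h n y) y"
    by (simp add: algebra_simps)
  then show ?thesis unfolding \<beta>_def .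
qed

lemma h_step: "h (n + 1) y = (1 - \<sigma>) * f n 0 * gauss (\<alpha> n) y + P n (\<lambda>y. s y * h n y) y"
  using H_conv[OF gap_pos[of n], of n y] unfolding h_def[of "n + 1"] \<alpha>_def by simp

primrec propagate :: "int \<Rightarrow> nat \<Rightarrow> (real \<Rightarrow> complex) \<Rightarrow> real \<Rightarrow> complex" where
  "propagate n 0 F = F"
| "propagate n (Suc j) F = P (n + int j) (\<lambda>y. s y * propagate n j F y)"

lemma propagate_edecay: "edecay d F \<Longrightarrow> edecay d (propagate n j F)"
  by (induction j) (auto intro!: P_edecay s_edecay)

lemma propagate_cmult: "propagate n j (\<lambda>y. z * F y) y = z * propagate n j F y"
proof (induction j arbitrary: y)
  case (Suc j)
  have "propagate n (Suc j) (\<lambda>y. z * F y) y = P (n + int j) (\<lambda>y. z * (s y * propagate n j F y)) y"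
    by (simp add: Suc mult.left_commute)
  then show ?case by (simp add: conv_cmult)
qed simp

lemma propagate_even_shift: "even (n - m) \<Longrightarrow> propagate n j F = propagate m j F"
proof (induction j)
  case (Suc j)
  have "\<alpha> (n + int j) = \<alpha> (m + int j)" by (rule \<alpha>_even) (use Suc.prems in simp)
  with Suc show ?case by simp
qed simp

lemma propagate_weak_limit:
  assumes F: "edecay d F" "d > 0" and \<phi>: "edecay d' \<phi>" "d' > 0"
  shows "(\<lambda>j. LINT y|lborel. \<phi> y * propagate n j F y) \<longlonglongrightarrow> 0"
proof (rule propagation_tendsto_weakly_0[where A = "\<alpha> ` {0, 1}" and \<alpha> = "\<lambda>j. \<alpha> (n + int j)" and s = s and c = d and c' = d'])
  show "\<alpha> (n + int j) \<in> \<alpha> ` {0, 1}" for j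
  proof (cases "even (n + int j)")
    case True then have "\<alpha> (n + int j) = \<alpha> 0" by (intro \<alpha>_even) simp
    then show ?thesis by simp
  next
    case False then have "\<alpha> (n + int j) = \<alpha> 1" by (intro \<alpha>_even) simp
    then show ?thesis by simp
  qed
qed (use \<alpha>_pos s_bound F \<phi> in \<open>auto\<close>)

lemma r_shift: "r n y = E ^ M * r (n - 2 * int M) y"
proof (induction M)
  case (Suc M)
  have "r (n - 2 * int M) y = E * r (n - 2 * int (Suc M)) y"
    using r_per[of "n - 2 * int (Suc M)" y] by (simp add: algebra_simps)
  with Suc show ?case by (simp add: mult_ac)
qed simp

lemma h_shift: "h n y = E ^ M * h (n - 2 * int M) y"
proof -
  have "\<alpha> (n - 1) = \<alpha> (n - 2 * int M - 1)" by (rule \<alpha>_even) simp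
  moreover have "r (n - 1) = (\<lambda>y. E ^ M * r (n - 2 * int M - 1) y)"
    using r_shift[of "n - 1" _ M] by (auto simp: algebra_simps)
  ultimately show ?thesis unfolding h_def by (simp only: conv_cmult) (simp add: algebra_simps)
qed

lemma norm_pairing_shift:
  assumes G: "\<And>n y. G n y = E ^ M * G (n - 2 * int M) y"
  shows "norm (LINT y|lborel. \<phi> y * G (n - 2 * int M) y) = norm (LINT y|lborel. \<phi> y * G n y)"
proof -
  have "(LINT y|lborel. \<phi> y * G n y) = (LINT y|lborel. E ^ M * (\<phi> y * G (n - 2 * int M) y))"
    using G[of n] by (simp add: mult_ac)
  then show ?thesis by (simp only: integral_mult_right_zero norm_mult norm_power norm_E power_one mult_1)
qed

text \<open>
  The starting edge moves to the left with the number of steps. By Floquet the data are those at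
  one of the two edges m and m - 1 up to a unimodular factor, so the limit reduces to two limits
  with fixed data.
\<close>

lemma remainder_weak_limit:
  assumes \<phi>: "edecay d' \<phi>" "d' > 0"
  shows "(\<lambda>N. LINT y|lborel. \<phi> y * propagate (m - int N) N (h (m - int N)) y) \<longlonglongrightarrow> 0"
proof (rule Lim_null_comparison)
  define u where "u n N = norm (LINT y|lborel. \<phi> y * propagate n N (h n) y)" for n N
  have "u n \<longlonglongrightarrow> 0" for n
    unfolding u_def by (rule tendsto_norm_zero[OF propagate_weak_limit[OF h_edecay c \<phi>]])
  from tendsto_add[OF this[of m] this[of "m - 1"]]
  show "(\<lambda>N. u m N + u (m - 1) N) \<longlonglongrightarrow> 0" by simp
  have key: "norm (LINT y|lborel. \<phi> y * propagate (n - 2 * int M) N (h (n - 2 * int M)) y) = u n N" for n M N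
  proof -
    have "propagate n N (h n) y = E ^ M * propagate (n - 2 * int M) N (h (n - 2 * int M)) y" for n y
    proof -
      have "h n = (\<lambda>y. E ^ M * h (n - 2 * int M) y)" using h_shift[of n _ M] by auto
      moreover have "propagate n N = propagate (n - 2 * int M) N" by (rule ext, rule propagate_even_shift) simp
      ultimately show ?thesis by (simp only: propagate_cmult)
    qed
    from norm_pairing_shift[of "\<lambda>n. propagate n N (h n)", OF this] show ?thesis unfolding u_def .
  qed
  have u0: "u n N \<ge> 0" for n N by (simp add: u_def)
  show "\<forall>\<^sub>F N in sequentially. norm (LINT y|lborel. \<phi> y * propagate (m - int N) N (h (m - int N)) y) \<le> u m N + u (m - 1) N"
  proof (intro always_eventually allI)
    fix N
    show "norm (LINT y|lborel. \<phi> y * propagate (m - int N) N (h (m - int N)) y) \<le> u m N + u (m - 1) N"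
    proof (cases "even N")
      case True
      then obtain M where N: "int N = 2 * int M" by (auto elim!: evenE)
      show ?thesis unfolding N using key[of m M N] u0[of "m - 1" N] by simp
    next
      case False
      then obtain M where "N = 2 * M + 1" by (auto elim!: oddE)
      then have N: "m - int N = m - 1 - 2 * int M" by simp
      show ?thesis unfolding N using key[of "m - 1" M N] u0[of m N] by simp
    qed
  qed
qed

lemma conv_remainder_limit:
  assumes K: "rapid K"
  shows "(\<lambda>N. conv K (\<lambda>y. s y * propagate (m - int N) N (h (m - int N)) y) y) \<longlonglongrightarrow> 0"
proof -
  have "edecay 1 (\<lambda>z. s z * K (y - z))"
  proof (rule s_edecay)
    obtain C where C: "C > 0" "\<And>z. norm (K z) \<le> C * exp (- 1 * \<bar>z\<bar>)" using rapid_bound[OF K] by blast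
    have [measurable]: "K \<in> borel_measurable borel" by (rule rapid_measurable[OF K])
    show "edecay 1 (\<lambda>z. K (y - z))"
    proof (rule edecayI[where C = "C * exp \<bar>y\<bar>"])
      fix z
      have "norm (K (y - z)) \<le> C * exp (- 1 * \<bar>y - z\<bar>)" by (rule C)
      also have "\<dots> \<le> C * (exp \<bar>y\<bar> * exp (- 1 * \<bar>z\<bar>))"
        using C(1) by (intro mult_left_mono) (auto simp: mult_exp_exp)
      finally show "norm (K (y - z)) \<le> C * exp \<bar>y\<bar> * exp (- 1 * \<bar>z\<bar>)" by (simp add: mult.assoc)
    qed measurable
  qed
  from remainder_weak_limit[OF this, of m]
  show ?thesis by (simp add: conv_def mult_ac)
qed

text \<open>
  The trace at x_(n+j+1) - 0 of the field radiated by a unit point source at the edge n; for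
  \<sigma> = -1 this is w_n on sheet 1.
\<close>

definition g where "g n j = propagate (n + 1) j (gauss (\<alpha> n))"

lemma g_edecay: "edecay d (g n j)"
  unfolding g_def by (rule propagate_edecay[OF rapidD[OF rapid_\<alpha>]])

lemma g_0: "g n 0 = gauss (\<alpha> n)"
  by (simp add: g_def)

lemma g_Suc: "g n (Suc j) = P (n + int j + 1) (\<lambda>y. s y * g n j y)"
  by (simp add: g_def algebra_simps)

lemma h_expansion:
  "h m y = (\<Sum>i<N. (1 - \<sigma>) * f (m - 1 - int i) 0 * g (m - 1 - int i) i y) + propagate (m - int N) N (h (m - int N)) y"
proof (induction N arbitrary: m y)
  case (Suc N)
  define S where "S y = (\<Sum>i<N. (1 - \<sigma>) * f (m - 2 - int i) 0 * g (m - 2 - int i) i y)" for y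
  define R where "R = propagate (m - 1 - int N) N (h (m - 1 - int N))"
  have IH: "h (m - 1) y = S y + R y" for y
    using Suc.IH[of "m - 1" y] unfolding S_def R_def by simp
  have Sd: "edecay c (\<lambda>y. s y * S y)" unfolding S_def
    by (intro s_edecay edecay_sum edecay_cmult g_edecay)
  have Rd: "edecay c (\<lambda>y. s y * R y)" unfolding R_def by (intro s_edecay propagate_edecay h_edecay)
  have "h m y = (1 - \<sigma>) * f (m - 1) 0 * gauss (\<alpha> (m - 1)) y + P (m - 1) (\<lambda>y. s y * S y + s y * R y) y"
    using h_step[of "m - 1" y] unfolding IH by (simp add: distrib_left)
  also have "P (m - 1) (\<lambda>y. s y * S y + s y * R y) y = P (m - 1) (\<lambda>y. s y * S y) y + P (m - 1) (\<lambda>y. s y * R y) y"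
    by (rule conv_add[OF rapid_\<alpha> Sd Rd])
  also have "P (m - 1) (\<lambda>y. s y * R y) y = propagate (m - int (Suc N)) (Suc N) (h (m - int (Suc N))) y"
    unfolding R_def by (simp add: algebra_simps)
  also have "P (m - 1) (\<lambda>y. s y * S y) y = (\<Sum>i<N. (1 - \<sigma>) * f (m - 1 - int (Suc i)) 0 * g (m - 1 - int (Suc i)) (Suc i) y)"
  proof -
    have "(\<lambda>y. s y * S y) = (\<lambda>y. \<Sum>i<N. ((1 - \<sigma>) * f (m - 2 - int i) 0) * (s y * g (m - 2 - int i) i y))"
      unfolding S_def sum_distrib_left by (simp add: mult_ac)
    then have "P (m - 1) (\<lambda>y. s y * S y) y = (\<Sum>i<N. P (m - 1) (\<lambda>y. ((1 - \<sigma>) * f (m - 2 - int i) 0) * (s y * g (m - 2 - int i) i y)) y)"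
      by (simp only:) (rule conv_sum[OF rapid_\<alpha>, of _ c], intro edecay_cmult s_edecay g_edecay)
    also have "\<dots> = (\<Sum>i<N. (1 - \<sigma>) * f (m - 1 - int (Suc i)) 0 * g (m - 1 - int (Suc i)) (Suc i) y)"
    proof (rule sum.cong)
      fix i
      have "m - 1 - int (Suc i) = m - 2 - int i" "m - 2 - int i + int i + 1 = m - 1" by simp_all
      then show "P (m - 1) (\<lambda>y. ((1 - \<sigma>) * f (m - 2 - int i) 0) * (s y * g (m - 2 - int i) i y)) y =
          (1 - \<sigma>) * f (m - 1 - int (Suc i)) 0 * g (m - 1 - int (Suc i)) (Suc i) y"
        by (simp only: conv_cmult g_Suc)
    qed simp
    finally show ?thesis .
  qed
  finally show ?case by (simp add: sum.lessThan_Suc_shift g_0 del: sum.lessThan_Suc)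
qed simp

text \<open>
  The expansion of H V at distance t behind the edge m. The remainder of the expansion of h m is
  paired with a Gaussian, which is a test function for the weak limit.
\<close>

lemma field_sums:
  assumes t: "t > 0"
  shows "(\<lambda>N. (1 - \<sigma>) * f m 0 * gauss (gauss_rate k t) y +
      (\<Sum>i<N. (1 - \<sigma>) * f (m - 1 - int i) 0 * conv (gauss (gauss_rate k t)) (\<lambda>y. s y * g (m - 1 - int i) i y) y))
    \<longlonglongrightarrow> conv (gauss' (gauss_rate k t)) (r m) y + \<i> * k * \<theta> * conv (gauss (gauss_rate k t)) (r m) y"
proof -
  let ?K = "gauss (gauss_rate k t)"
  have rK: "rapid ?K" by (rule rapid_gauss[OF Re_gauss_rate_pos[OF k t]])
  let ?R = "\<lambda>N. propagate (m - int N) N (h (m - int N))"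
  have eq: "conv (gauss' (gauss_rate k t)) (r m) y + \<i> * k * \<theta> * conv ?K (r m) y - conv ?K (\<lambda>y. s y * ?R N y) y =
     (1 - \<sigma>) * f m 0 * ?K y + (\<Sum>i<N. (1 - \<sigma>) * f (m - 1 - int i) 0 * conv ?K (\<lambda>y. s y * g (m - 1 - int i) i y) y)" for N
  proof -
    define S where "S y = (\<Sum>i<N. (1 - \<sigma>) * f (m - 1 - int i) 0 * g (m - 1 - int i) i y)" for y
    have Sd: "edecay c (\<lambda>y. s y * S y)" unfolding S_def
      by (intro s_edecay edecay_sum edecay_cmult g_edecay)
    have Rd: "edecay c (\<lambda>y. s y * ?R N y)" by (intro s_edecay propagate_edecay h_edecay)
    have "conv ?K (\<lambda>y. s y * h m y) y = conv ?K (\<lambda>y. s y * S y + s y * ?R N y) y"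
      using h_expansion[of m _ N] unfolding S_def by (simp add: distrib_left)
    also have "\<dots> = conv ?K (\<lambda>y. s y * S y) y + conv ?K (\<lambda>y. s y * ?R N y) y"
      by (rule conv_add[OF rK Sd Rd])
    also have "conv ?K (\<lambda>y. s y * S y) y = (\<Sum>i<N. (1 - \<sigma>) * f (m - 1 - int i) 0 * conv ?K (\<lambda>y. s y * g (m - 1 - int i) i y) y)"
    proof -
      have "(\<lambda>y. s y * S y) = (\<lambda>y. \<Sum>i<N. ((1 - \<sigma>) * f (m - 1 - int i) 0) * (s y * g (m - 1 - int i) i y))"
        unfolding S_def sum_distrib_left by (simp add: mult_ac)
      then have "conv ?K (\<lambda>y. s y * S y) y = (\<Sum>i<N. conv ?K (\<lambda>y. ((1 - \<sigma>) * f (m - 1 - int i) 0) * (s y * g (m - 1 - int i) i y)) y)"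
        by (simp only:) (rule conv_sum[OF rK, of _ c], intro edecay_cmult s_edecay g_edecay)
      then show ?thesis by (simp add: conv_cmult)
    qed
    finally show ?thesis unfolding H_conv[OF t] by simp
  qed
  have "(\<lambda>N. conv (gauss' (gauss_rate k t)) (r m) y + \<i> * k * \<theta> * conv ?K (r m) y - conv ?K (\<lambda>y. s y * ?R N y) y)
    \<longlonglongrightarrow> conv (gauss' (gauss_rate k t)) (r m) y + \<i> * k * \<theta> * conv ?K (r m) y - 0"
    by (intro tendsto_intros conv_remainder_limit rK)
  then show ?thesis unfolding eq by simp
qed

lemma h_sums: "(\<lambda>N. \<Sum>i<N. (1 - \<sigma>) * f (m - 1 - int i) 0 * g (m - 1 - int i) i y) \<longlonglongrightarrow> h m y"
proof -
  have "(\<lambda>N. propagate (m - int (Suc N)) (Suc N) (h (m - int (Suc N))) y) \<longlonglongrightarrow> 0"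
    using conv_remainder_limit[OF rapid_\<alpha>[of "m - 1"], of "m - 1" y] by (simp add: algebra_simps)
  then have "(\<lambda>N. propagate (m - int N) N (h (m - int N)) y) \<longlonglongrightarrow> 0" by (rule LIMSEQ_imp_Suc)
  then have "(\<lambda>N. h m y - propagate (m - int N) N (h (m - int N)) y) \<longlonglongrightarrow> h m y - 0" by (intro tendsto_intros)
  moreover have "h m y - propagate (m - int N) N (h (m - int N)) y = (\<Sum>i<N. (1 - \<sigma>) * f (m - 1 - int i) 0 * g (m - 1 - int i) i y)" for N
    using h_expansion[of m y N] by simp
  ultimately show ?thesis by simp
qed

lemma sf_edecay: "edecay (- Im (k * \<theta>)) (\<lambda>y. s y * f n y)"
proof -
  have "- Im (k * \<theta>) \<le> c" using inc c by linarith
  from edecay_add[OF edecay_mono[OF r_decay this] e_edecay] show ?thesis by (simp add: sf_eq)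
qed

lemma adjoint_step:
  assumes B: "edecay (- Im (k * \<theta>)) B"
  shows "(LINT y|lborel. g n (Suc j) y * B y) = (LINT y|lborel. s y * g n j y * P (n + int j + 1) B y)"
  unfolding g_Suc
  by (rule conv_adjoint[OF rapid_\<alpha> s_edecay[OF g_edecay[of "Im (k * \<theta>) + 1"]] B])
     (use gauss_even in auto)

text \<open>
  Each step moves the Gaussian of one strip from the Green's function to the trace. The gaps met
  by the source at 1 - n on its way to the right are those met on the way from n to the left,
  since gaps depend on the parity of the index only.
\<close>

lemma pairing_f: "(LINT y|lborel. g (1 - n) j y * (s y * f (n - 1 - int j) y)) = f n 0"
proof (induction j)
  case 0
  have "\<alpha> (1 - n) = \<alpha> (n - 1)" by (rule \<alpha>_even) simp
  then have "(LINT y|lborel. g (1 - n) 0 y * (s y * f (n - 1 - int 0) y)) = P (n - 1) (\<lambda>y. s y * f (n - 1) y) 0"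
    unfolding g_0 conv_def using gauss_even by simp
  also have "\<dots> = f n 0" using f_step[of "n - 1"] by (simp add: \<alpha>_def)
  finally show ?case .
next
  case (Suc j)
  have same_gap: "\<alpha> (1 - n + int j + 1) = \<alpha> (n - 1 - int (Suc j))" by (rule \<alpha>_even) simp
  have idx: "n - 1 - int (Suc j) + 1 = n - 1 - int j" by simp
  have "(LINT y|lborel. g (1 - n) (Suc j) y * (s y * f (n - 1 - int (Suc j)) y)) =
     (LINT y|lborel. s y * g (1 - n) j y * P (n - 1 - int (Suc j)) (\<lambda>y. s y * f (n - 1 - int (Suc j)) y) y)"
    unfolding adjoint_step[OF sf_edecay] same_gap ..
  also have "P (n - 1 - int (Suc j)) (\<lambda>y. s y * f (n - 1 - int (Suc j)) y) = f (n - 1 - int j)"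
    unfolding \<alpha>_def using f_step[of "n - 1 - int (Suc j)"] unfolding idx by (rule sym)
  also have "(LINT y|lborel. s y * g (1 - n) j y * f (n - 1 - int j) y) = (LINT y|lborel. g (1 - n) j y * (s y * f (n - 1 - int j) y))"
    by (simp add: mult_ac)
  finally show ?case using Suc by simp
qed

text \<open>
  The integrals in the series of the directivity V_(1-n), up to a phase and a sign.
\<close>

definition J where "J n j = (LINT y:{..<0}|lborel. g (1 - n) j y * e (n - 1 - int j) y)"

text \<open>
  As for the traces, but e_(n+1) is the propagation of e_n and not of s e_n. The difference e -
  s e = (1 - \<sigma>) e on y < 0 is lost at every step.
\<close>

lemma pairing_e: "(LINT y|lborel. g (1 - n) N y * e (n - 1 - int N) y) = e n 0 - (1 - \<sigma>) * (\<Sum>j<N. J n j)"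
proof (induction N)
  case 0
  have "\<alpha> (1 - n) = \<alpha> (n - 1)" by (rule \<alpha>_even) simp
  then have "(LINT y|lborel. g (1 - n) 0 y * e (n - 1 - int 0) y) = P (n - 1) (e (n - 1)) 0"
    unfolding g_0 conv_def using gauss_even by simp
  also have "\<dots> = e n 0" using e_step[of "n - 1"] by simp
  finally show ?case by simp
next
  case (Suc j)
  have same_gap: "\<alpha> (1 - n + int j + 1) = \<alpha> (n - 1 - int (Suc j))" by (rule \<alpha>_even) simp
  have idx: "n - 1 - int (Suc j) + 1 = n - 1 - int j" by simp
  have ig: "integrable lborel (\<lambda>y. g (1 - n) j y * e (n - 1 - int j) y)"
    by (rule edecay_mult_integrable[OF g_edecay[of "Im (k * \<theta>) + 1"] e_edecay]) simp
  then have i: "integrable lborel (\<lambda>y. indicator {..<0} y *\<^sub>R (g (1 - n) j y * e (n - 1 - int j) y))"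
    by (auto intro: integrable_mult_indicator)
  have [measurable]: "g (1 - n) j \<in> borel_measurable borel" "e m \<in> borel_measurable borel" for m
    using edecay_measurable[OF g_edecay] edecay_measurable[OF e_edecay] by auto
  have "(LINT y|lborel. g (1 - n) (Suc j) y * e (n - 1 - int (Suc j)) y) =
     (LINT y|lborel. s y * g (1 - n) j y * P (n - 1 - int (Suc j)) (e (n - 1 - int (Suc j))) y)"
    unfolding adjoint_step[OF e_edecay] same_gap ..
  also have "P (n - 1 - int (Suc j)) (e (n - 1 - int (Suc j))) = e (n - 1 - int j)"
    using e_step[of "n - 1 - int (Suc j)"] unfolding idx by (rule sym)
  also have "(LINT y|lborel. s y * g (1 - n) j y * e (n - 1 - int j) y) =
     (LINT y|lborel. g (1 - n) j y * e (n - 1 - int j) y - (1 - \<sigma>) * (indicator {..<0} y *\<^sub>R (g (1 - n) j y * e (n - 1 - int j) y)))"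
  proof (rule integral_cong_AE)
    show "AE y in lborel. s y * g (1 - n) j y * e (n - 1 - int j) y =
      g (1 - n) j y * e (n - 1 - int j) y - (1 - \<sigma>) * (indicator {..<0} y *\<^sub>R (g (1 - n) j y * e (n - 1 - int j) y))"
      using AE_lborel_singleton[of 0] by eventually_elim (auto simp: edge_sign_def indicator_def algebra_simps)
  qed measurable
  also have "\<dots> = (LINT y|lborel. g (1 - n) j y * e (n - 1 - int j) y) - (1 - \<sigma>) * J n j"
    by (simp only: J_def set_lebesgue_integral_def Bochner_Integration.integral_diff[OF ig integrable_mult_right[OF i]] integral_mult_right_zero)
  finally show ?case unfolding Suc by (simp add: distrib_left diff_diff_eq)
qed

text \<open>
  The traces minus the incident waves are, up to unimodular factors, two fixed functions, and
  the source fields tend weakly to 0 against both. So the pairing with the traces, which is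
  f_n(0), has the same limit as the pairing with the incident waves.
\<close>

lemma amplitude_sums: "(\<lambda>N. e n 0 - (1 - \<sigma>) * (\<Sum>j<N. J n j)) \<longlonglongrightarrow> f n 0"
proof -
  define u where "u m N = norm (LINT y|lborel. g (1 - n) N y * r m y)" for m N
  have "u m \<longlonglongrightarrow> 0" for m
    unfolding u_def g_def
    using tendsto_norm_zero[OF propagate_weak_limit[OF rapidD[OF rapid_\<alpha>, of 1 "1 - n"] _ r_decay c, of m "1 - n + 1"]]
    by (simp add: mult.commute)
  from tendsto_add[OF this[of "n - 1"] this[of "n - 2"]]
  have ulim: "(\<lambda>N. u (n - 1) N + u (n - 2) N) \<longlonglongrightarrow> 0" by simp
  have key: "norm (LINT y|lborel. g (1 - n) N y * r (m - 2 * int M) y) = u m N" for m M N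
    unfolding u_def by (rule norm_pairing_shift[of r, OF r_shift])
  have u0: "u m N \<ge> 0" for m N by (simp add: u_def)
  have "(\<lambda>N. LINT y|lborel. g (1 - n) N y * r (n - 1 - int N) y) \<longlonglongrightarrow> 0"
  proof (rule Lim_null_comparison[OF always_eventually ulim], rule allI)
    fix N
    show "norm (LINT y|lborel. g (1 - n) N y * r (n - 1 - int N) y) \<le> u (n - 1) N + u (n - 2) N"
    proof (cases "even N")
      case True
      then obtain M where N: "int N = 2 * int M" by (auto elim!: evenE)
      show ?thesis unfolding N using key[of N "n - 1" M] u0[of "n - 2" N] by simp
    next
      case False
      then obtain M where "N = 2 * M + 1" by (auto elim!: oddE)
      then have N: "n - 1 - int N = n - 2 - 2 * int M" by simp
      show ?thesis unfolding N using key[of N "n - 2" M] u0[of "n - 1" N] by simp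
    qed
  qed
  then have "(\<lambda>N. f n 0 - (LINT y|lborel. g (1 - n) N y * r (n - 1 - int N) y)) \<longlonglongrightarrow> f n 0 - 0"
    by (intro tendsto_intros)
  moreover have "f n 0 - (LINT y|lborel. g (1 - n) N y * r (n - 1 - int N) y) = e n 0 - (1 - \<sigma>) * (\<Sum>j<N. J n j)" for N
  proof -
    have i1: "integrable lborel (\<lambda>y. g (1 - n) N y * r (n - 1 - int N) y)"
      by (rule edecay_mult_integrable[OF g_edecay[of 1] r_decay]) (use c in simp)
    have i2: "integrable lborel (\<lambda>y. g (1 - n) N y * e (n - 1 - int N) y)"
      by (rule edecay_mult_integrable[OF g_edecay[of "Im (k * \<theta>) + 1"] e_edecay]) simp
    have "f n 0 = (LINT y|lborel. g (1 - n) N y * r (n - 1 - int N) y + g (1 - n) N y * e (n - 1 - int N) y)"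
      using pairing_f[of n N] by (simp add: sf_eq distrib_left)
    also have "\<dots> = (LINT y|lborel. g (1 - n) N y * r (n - 1 - int N) y) + (e n 0 - (1 - \<sigma>) * (\<Sum>j<N. J n j))"
      using i1 i2 by (simp add: pairing_e)
    finally show ?thesis by simp
  qed
  ultimately show ?thesis by simp
qed

end

section \<open>Solutions on charts\<close>

lemma classical_imp_parabolic_on:
  assumes k: "k \<noteq> 0" and F: "classical_solution_on k D F" and c: "continuous_on D (\<lambda>(x, y). F x y)"
  shows "parabolic_on k D F (dx F) (dy F) (dy (dy F))"
proof -
  have "((\<lambda>s. F s y) has_vector_derivative dx F x y) (at x) \<and> (F x has_vector_derivative dy F x y) (at y) \<and>
     (dy F x has_vector_derivative dy (dy F) x y) (at y) \<and> dx F x y = \<i> / (2 * k) * dy (dy F) x y" if "(x, y) \<in> D" for x y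
  proof -
    have d: "(\<lambda>s. F s y) differentiable (at x)" "(\<lambda>t. F x t) differentiable (at y)" "(\<lambda>t. dy F x t) differentiable (at y)"
      and p: "parabolic k F x y = 0"
      using F that unfolding classical_solution_on_def by auto
    have "dx F x y = - (dy (dy F) x y / (2 * \<i> * k))" using p by (simp add: parabolic_def eq_neg_iff_add_eq_0)
    also have "\<dots> = \<i> / (2 * k) * dy (dy F) x y"
    proof -
      have "2 * \<i> * k = \<i> * (2 * k)" by simp
      then have "dy (dy F) x y / (2 * \<i> * k) = (dy (dy F) x y / \<i>) / (2 * k)" by (simp only: divide_divide_eq_left)
      then show ?thesis by simp
    qed
    finally show ?thesis
      using d[unfolded vector_derivative_works] unfolding dx_def dy_def by simp
  qed
  then show ?thesis using F c unfolding parabolic_on_def classical_solution_on_def by auto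
qed

lemma parabolic_on_subset:
  "parabolic_on k S F Fx Fy Fyy \<Longrightarrow> T \<subseteq> S \<Longrightarrow> parabolic_on k T F Fx Fy Fyy"
  unfolding parabolic_on_def by (auto elim!: continuous_on_subset)

lemma open_slices:
  fixes S :: "(real \<times> real) set"
  assumes "open S"
  shows "open {s. (s, y) \<in> S}" "open {t. (x, t) \<in> S}"
proof -
  have "open ((\<lambda>s. (s, y)) -` S)" "open ((\<lambda>t. (x, t)) -` S)"
    by (intro open_vimage assms continuous_intros)+
  then show "open {s. (s, y) \<in> S}" "open {t. (x, t) \<in> S}" by (simp_all add: vimage_def)
qed

lemma continuous_on_case_prod_cong:
  assumes "continuous_on S (\<lambda>(x, y). F x y)" "\<And>x y. (x, y) \<in> S \<Longrightarrow> G x y = F x y"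
  shows "continuous_on S (\<lambda>(x, y). G x y)"
  using assms(1) by (rule continuous_on_eq) (use assms(2) in auto)

lemma parabolic_on_cong:
  assumes S: "open S" and F: "parabolic_on k S F Fx Fy Fyy" and eq: "\<And>x y. (x, y) \<in> S \<Longrightarrow> G x y = F x y"
  shows "parabolic_on k S G Fx Fy Fyy"
proof -
  have "((\<lambda>s. G s y) has_vector_derivative Fx x y) (at x)" "(G x has_vector_derivative Fy x y) (at y)" if "(x, y) \<in> S" for x y
  proof -
    show "((\<lambda>s. G s y) has_vector_derivative Fx x y) (at x)"
      by (rule has_vector_derivative_transform_within_open[OF parabolic_onD(1)[OF F that] open_slices(1)[OF S]])
         (use that eq in auto)
    show "(G x has_vector_derivative Fy x y) (at y)"
      by (rule has_vector_derivative_transform_within_open[OF parabolic_onD(2)[OF F that] open_slices(2)[OF S]])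
         (use that eq in auto)
  qed
  moreover have "continuous_on S (\<lambda>(x, y). G x y)"
    by (rule continuous_on_case_prod_cong[OF parabolic_on_cont(1)[OF F] eq])
  ultimately show ?thesis using F unfolding parabolic_on_def by auto
qed

lemma parabolic_on_add_mult:
  assumes F: "parabolic_on k S F Fx Fy Fyy" and G: "parabolic_on k S G Gx Gy Gyy"
  shows "parabolic_on k S (\<lambda>x y. F x y + z * G x y) (\<lambda>x y. Fx x y + z * Gx x y) (\<lambda>x y. Fy x y + z * Gy x y) (\<lambda>x y. Fyy x y + z * Gyy x y)"
proof -
  have "continuous_on S (\<lambda>(x, y). A x y + z * B x y)"
    if "continuous_on S (\<lambda>(x, y). A x y)" "continuous_on S (\<lambda>(x, y). B x y)" for A B :: "real \<Rightarrow> real \<Rightarrow> complex"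
    using continuous_on_add[OF that(1) continuous_on_mult_left[OF that(2), of z]] by (simp add: case_prod_beta)
  note cont = this
  have "Fx x y + z * Gx x y = \<i> / (2 * k) * (Fyy x y + z * Gyy x y)" if "(x, y) \<in> S" for x y
    unfolding parabolic_onD(4)[OF F that] parabolic_onD(4)[OF G that] by (simp add: algebra_simps)
  then show ?thesis
    unfolding parabolic_on_def
    using cont[OF parabolic_on_cont(1)[OF F] parabolic_on_cont(1)[OF G]] cont[OF parabolic_on_cont(2)[OF F] parabolic_on_cont(2)[OF G]]
      cont[OF parabolic_on_cont(3)[OF F] parabolic_on_cont(3)[OF G]] cont[OF parabolic_on_cont(4)[OF F] parabolic_on_cont(4)[OF G]]
    by (auto intro!: has_vector_derivative_add has_vector_derivative_mult_right parabolic_onD(1-3)[OF F] parabolic_onD(1-3)[OF G])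
qed

lemma parabolic_on_mult:
  assumes F: "parabolic_on k S F Fx Fy Fyy"
  shows "parabolic_on k S (\<lambda>x y. z * F x y) (\<lambda>x y. z * Fx x y) (\<lambda>x y. z * Fy x y) (\<lambda>x y. z * Fyy x y)"
  using parabolic_on_add_mult[OF F F, of "z - 1"] by (simp add: algebra_simps)

lemma parabolic_on_reflect:
  assumes F: "parabolic_on k S F Fx Fy Fyy"
  shows "parabolic_on k {(x, y). (x, - y) \<in> S} (\<lambda>x y. F x (- y)) (\<lambda>x y. Fx x (- y)) (\<lambda>x y. - Fy x (- y)) (\<lambda>x y. Fyy x (- y))"
proof -
  have n: "(uminus has_vector_derivative (- 1)) (at (y::real))" for y by (auto intro!: derivative_eq_intros)
  have c: "continuous_on {(x, y). (x, - y) \<in> S} (\<lambda>(x, y). A x (- y))"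
    if "continuous_on S (\<lambda>(x, y). A x y)" for A :: "real \<Rightarrow> real \<Rightarrow> complex"
  proof -
    have ct: "continuous_on {(x, y). (x, - y) \<in> S} (\<lambda>p. (fst p, - snd p))" by (intro continuous_intros)
    have sub: "(\<lambda>p. (fst p, - snd p)) ` {(x, y). (x, - y) \<in> S} \<subseteq> S" by auto
    show ?thesis using continuous_on_compose2[OF that ct sub] by (simp add: case_prod_beta)
  qed
  have "((\<lambda>y. F x (- y)) has_vector_derivative - Fy x (- y)) (at y)" "((\<lambda>y. - Fy x (- y)) has_vector_derivative Fyy x (- y)) (at y)"
    if "(x, - y) \<in> S" for x y
    using vector_diff_chain_at[OF n[of y] parabolic_onD(2)[OF F that]]
      has_vector_derivative_minus[OF vector_diff_chain_at[OF n[of y] parabolic_onD(3)[OF F that]]]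
    by (simp_all add: comp_def)
  moreover have "continuous_on {(x, y). (x, - y) \<in> S} (\<lambda>(x, y). - Fy x (- y))"
    using continuous_on_minus[OF c[OF parabolic_on_cont(4)[OF F]]] by (simp add: case_prod_beta)
  ultimately show ?thesis
    using parabolic_onD(1,4)[OF F] c[OF parabolic_on_cont(1)[OF F]] c[OF parabolic_on_cont(2)[OF F]] c[OF parabolic_on_cont(3)[OF F]]
    unfolding parabolic_on_def by auto
qed

text \<open>
  Being a solution is local. The derivatives are recovered from the function, so that the local
  ones fit together.
\<close>

lemma parabolic_on_local:
  assumes loc: "\<And>p. p \<in> D \<Longrightarrow> \<exists>S Fx Fy Fyy. open S \<and> p \<in> S \<and> parabolic_on k S q Fx Fy Fyy"
  shows "parabolic_on k D q (dx q) (dy q) (dy (dy q))"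
proof -
  have key: "((\<lambda>s. q s y) has_vector_derivative dx q x y) (at x) \<and> (q x has_vector_derivative dy q x y) (at y) \<and>
     (dy q x has_vector_derivative dy (dy q) x y) (at y) \<and> dx q x y = \<i> / (2 * k) * dy (dy q) x y \<and>
     isCont (\<lambda>(x, y). q x y) (x, y) \<and> isCont (\<lambda>(x, y). dx q x y) (x, y) \<and> isCont (\<lambda>(x, y). dy q x y) (x, y) \<and>
     isCont (\<lambda>(x, y). dy (dy q) x y) (x, y)" if xy: "(x, y) \<in> D" for x y
  proof -
    obtain S Fx Fy Fyy where S: "open S" "(x, y) \<in> S" and F: "parabolic_on k S q Fx Fy Fyy" using loc[OF xy] by blast
    have ex: "dx q x y = Fx x y" if "(x, y) \<in> S" for x y
      unfolding dx_def by (rule vector_derivative_at[OF parabolic_onD(1)[OF F that]])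
    have ey: "dy q x y = Fy x y" if "(x, y) \<in> S" for x y
      unfolding dy_def by (rule vector_derivative_at) (use parabolic_onD(2)[OF F that] in simp)
    have dyy: "(dy q x has_vector_derivative Fyy x y) (at y)" if "(x, y) \<in> S" for x y
      by (rule has_vector_derivative_transform_within_open[OF parabolic_onD(3)[OF F that] open_slices(2)[OF S(1)]])
         (use that ey in auto)
    have eyy: "dy (dy q) x y = Fyy x y" if "(x, y) \<in> S" for x y
      unfolding dy_def[of "dy q"] by (rule vector_derivative_at) (use dyy[OF that] in simp)
    have ic: "isCont (\<lambda>(x, y). A x y) (x, y)"
      if c: "continuous_on S (\<lambda>(x, y). B x y)" and e: "\<And>x y. (x, y) \<in> S \<Longrightarrow> A x y = B x y" for A B :: "real \<Rightarrow> real \<Rightarrow> complex"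
    proof -
      have "continuous_on S (\<lambda>(x, y). A x y)"
        by (rule continuous_on_case_prod_cong[OF c e])
      then show ?thesis using S by (simp add: continuous_on_eq_continuous_at)
    qed
    show ?thesis
      using parabolic_onD[OF F S(2)] dyy[OF S(2)] ex[OF S(2)] ey[OF S(2)] eyy[OF S(2)]
        ic[OF parabolic_on_cont(1)[OF F] refl] ic[OF parabolic_on_cont(2)[OF F] ex]
        ic[OF parabolic_on_cont(4)[OF F] ey] ic[OF parabolic_on_cont(3)[OF F] eyy] by simp
  qed
  have "continuous_on D f" if "\<And>x y. (x, y) \<in> D \<Longrightarrow> isCont f (x, y)" for f :: "real \<times> real \<Rightarrow> complex"
    by (rule continuous_at_imp_continuous_on) (use that in auto)
  then show ?thesis using key unfolding parabolic_on_def by auto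
qed

lemma open_chart_domain: "open (chart_domain a b n)"
proof -
  have "chart_domain a b n = {p. edge a b (n - 1) < fst p} \<inter> {p. fst p < edge a b (n + 1)} \<inter> - ({p. snd p = 0} \<inter> {p. fst p \<le> edge a b n})"
    by (auto simp: chart_domain_def)
  moreover have "open {p::real \<times> real. edge a b (n - 1) < fst p}" "open {p::real \<times> real. fst p < edge a b (n + 1)}"
    "closed {p::real \<times> real. snd p = 0}" "closed {p::real \<times> real. fst p \<le> edge a b n}"
    by (intro open_Collect_less closed_Collect_eq closed_Collect_le continuous_intros)+
  ultimately show ?thesis by (auto intro!: open_Int closed_Int simp: open_Compl)
qed

lemma compact_locally_bounded:
  fixes K :: "'a::metric_space set"
  assumes K: "compact K" and loc: "\<And>p. p \<in> K \<Longrightarrow> \<exists>r>0. \<exists>B. \<forall>z. dist z p < r \<longrightarrow> Q B z"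
    and mono: "\<And>B B' z. B \<le> B' \<Longrightarrow> Q B z \<Longrightarrow> Q (B'::real) z"
  shows "\<exists>B. \<forall>z\<in>K. Q B z"
proof -
  obtain r B where rB: "\<And>p. p \<in> K \<Longrightarrow> r p > 0" "\<And>p z. p \<in> K \<Longrightarrow> dist z p < r p \<Longrightarrow> Q (B p) z"
    using loc by metis
  have cover: "K \<subseteq> (\<Union>p\<in>K. ball p (r p))" using rB(1) by force
  obtain T where T: "T \<subseteq> K" "finite T" "K \<subseteq> (\<Union>p\<in>T. ball p (r p))"
    by (rule compactE_image[OF K _ cover]) auto
  define M where "M = (\<Sum>p\<in>T. \<bar>B p\<bar>)"
  have "Q M z" if zK: "z \<in> K" for z
  proof -
    obtain p where p: "p \<in> T" "z \<in> ball p (r p)" using T(3) zK by blast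
    have "Q (B p) z" using rB(2)[of p z] T(1) p by (auto simp: dist_commute)
    moreover have "B p \<le> M"
      unfolding M_def using member_le_sum[of p T "\<lambda>p. \<bar>B p\<bar>"] p T(2) abs_ge_self[of "B p"] by force
    ultimately show ?thesis by (rule mono[rotated])
  qed
  then show ?thesis by blast
qed

section \<open>Growth of the total field\<close>

locale diffraction =
  fixes a b :: real and k \<theta> :: complex and u :: field
  assumes ab: "0 < b" "b < a" and Rek: "Re k > 0" and k: "Im k > 0" and Re\<theta>: "Re \<theta> > 0"
    and real: "k * \<theta>\<^sup>2 \<in> \<real>" and pos: "Re (k * \<theta>\<^sup>2) > 0" and psi: "\<forall>n. psi a k \<theta> n \<noteq> 0"
    and tf: "total_field a b k \<theta> u"
begin

abbreviation x where "x \<equiv> edge a b"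

lemma a0: "a > 0" using ab by simp

lemma k0: "k \<noteq> 0" using k by auto

lemma inc: "Im (k * \<theta>) > 0"
proof -
  define l where "l = Re (k * \<theta>\<^sup>2)"
  have l: "k * \<theta>\<^sup>2 = of_real l" "l > 0" using of_real_Re[OF real] pos unfolding l_def by (simp_all only:)
  have t0: "\<theta> \<noteq> 0" using Re\<theta> by auto
  have "\<theta>\<^sup>2 = of_real l / k" using l(1) k0 by (simp add: field_simps)
  then have "Im (\<theta>\<^sup>2) = - (l * Im k / (norm k)\<^sup>2)" by (simp add: Im_divide cmod_power2)
  moreover have "l * Im k / (norm k)\<^sup>2 > 0" using l(2) k k0 by simp
  moreover have "Im (\<theta>\<^sup>2) = 2 * Re \<theta> * Im \<theta>" by (simp add: power2_eq_square)
  ultimately have "2 * Re \<theta> * Im \<theta> < 0" by linarith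
  then have "Im \<theta> < 0" using Re\<theta> by (simp add: mult_less_0_iff)
  have "k * \<theta> = of_real l / \<theta>" using l(1) t0 by (simp add: field_simps power2_eq_square)
  then have "Im (k * \<theta>) = - (l * Im \<theta>) / (norm \<theta>)\<^sup>2" by (simp only: Im_divide cmod_power2) simp
  moreover have "- (l * Im \<theta>) > 0" using l(2) \<open>Im \<theta> < 0\<close> by (simp add: mult_pos_neg)
  moreover have "(norm \<theta>)\<^sup>2 > 0" using t0 by simp
  ultimately show ?thesis by (simp only: divide_pos_pos)
qed

definition c1 where "c1 = Im (k * \<theta>)"

lemma c1: "c1 > 0" unfolding c1_def by (rule inc)

lemma edge_step: "x (n - 1) < x n" "x n < x (n + 1)"
  using edge_strict_mono[OF ab, of "n - 1" n] edge_strict_mono[OF ab, of n "n + 1"] by auto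

lemma not_branch: "(X, y) \<notin> branch_points a b \<longleftrightarrow> \<not> (y = 0 \<and> (\<exists>n. X = x n))"
  by (auto simp: branch_points_def)

lemma strip_chart: "x n < X \<Longrightarrow> X < x (n + 1) \<Longrightarrow> (X, y) \<in> chart_domain a b n"
  using edge_step[of n] by (auto simp: chart_domain_def)

lemma edge_chart: "y \<noteq> 0 \<Longrightarrow> (x n, y) \<in> chart_domain a b n"
  using edge_step[of n] by (auto simp: chart_domain_def)

lemma in_chart_cont: "\<nu> \<in> {1, 2} \<Longrightarrow> continuous_on (chart_domain a b n) (\<lambda>(X, y). in_chart a b u n \<nu> X y)"
  using tf unfolding total_field_def continuous_on_surface_def by auto

lemma in_chart_parabolic: "\<nu> \<in> {1, 2} \<Longrightarrow> \<exists>Fx Fy Fyy. parabolic_on k (chart_domain a b n) (in_chart a b u n \<nu>) Fx Fy Fyy"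
  using tf classical_imp_parabolic_on[OF k0 _ in_chart_cont] unfolding total_field_def solves_on_surface_def by blast

lemma plane_wave_bound: "norm (plane_wave k \<theta> X y) = exp (c1 * y)"
  unfolding c1_def by (rule norm_plane_wave[OF real])

lemma u_inc_eq: "u_inc k \<theta> X y \<nu> = (if \<nu> = 1 \<and> y > 0 then plane_wave k \<theta> X y else 0)"
  by (simp add: u_inc_def plane_wave_def)

lemma floq: "\<nu> \<in> {1, 2} \<Longrightarrow> y \<noteq> 0 \<Longrightarrow> u (X + a) y \<nu> = exp (- \<i> * k * of_real a * \<theta>\<^sup>2 / 2) * u X y \<nu>"
  using tf unfolding total_field_def floquet_def by (auto simp: not_branch)

lemma decay:
  assumes "\<epsilon> > 0"
  shows "\<exists>Y. \<forall>X y. \<forall>\<nu>\<in>{1, 2}. \<bar>y\<bar> > Y \<and> y \<noteq> 0 \<longrightarrow> norm (u X y \<nu> - u_inc k \<theta> X y \<nu>) < \<epsilon>"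
proof -
  have "decays a b (scattered k \<theta> u)" using tf unfolding total_field_def by blast
  then obtain Y where "\<forall>X y. \<forall>\<nu>\<in>{1, 2}. \<bar>y\<bar> > Y \<and> (X, y) \<notin> branch_points a b \<longrightarrow> norm (scattered k \<theta> u X y \<nu>) < \<epsilon>"
    using assms unfolding decays_def by blast
  then show ?thesis unfolding scattered_def not_branch by blast
qed

text \<open>
  Near a branch point this is a hypothesis on the field, elsewhere it is continuity in a chart.
\<close>

lemma locally_bounded:
  "\<exists>r>0. \<exists>B. \<forall>z. dist z p < r \<longrightarrow> (z \<notin> branch_points a b \<longrightarrow> norm (u (fst z) (snd z) 1) \<le> B \<and> norm (u (fst z) (snd z) 2) \<le> B)"
proof (cases "p \<in> branch_points a b")
  case True
  have "bounded_near_branch_points a b u" using tf unfolding total_field_def by blast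
  then obtain r B where r: "r > 0" and B: "\<And>X y \<nu>. \<nu> \<in> {1, 2} \<Longrightarrow> dist (X, y) p < r \<Longrightarrow> (X, y) \<noteq> p \<Longrightarrow> norm (u X y \<nu>) \<le> B"
    using True unfolding bounded_near_branch_points_def by meson
  show ?thesis
  proof (rule exI[of _ r], rule conjI[OF r], rule exI[of _ B], intro allI impI)
    fix z assume z: "dist z p < r" "z \<notin> branch_points a b"
    then have "z \<noteq> p" using True by auto
    with z(1) show "norm (u (fst z) (snd z) 1) \<le> B \<and> norm (u (fst z) (snd z) 2) \<le> B"
      using B[of 1 "fst z" "snd z"] B[of 2 "fst z" "snd z"] by auto
  qed
next
  case False
  obtain X y where p: "p = (X, y)" by (cases p)
  obtain m where m: "x m \<le> X" "X < x (m + 1)" using ex_strip[OF ab] by blast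
  have pc: "p \<in> chart_domain a b m"
  proof (cases "X = x m")
    case True
    then have "y \<noteq> 0" using False p by (auto simp: not_branch)
    then show ?thesis using edge_chart[of y m] True p by simp
  next
    case False then show ?thesis using strip_chart[of m X y] m p by simp
  qed
  have "\<exists>r>0. \<forall>z. dist z p < r \<longrightarrow> norm (case z of (X, y) \<Rightarrow> in_chart a b u m \<nu> X y) \<le> norm (case p of (X, y) \<Rightarrow> in_chart a b u m \<nu> X y) + 1"
    if \<nu>: "\<nu> \<in> {1, 2}" for \<nu>
  proof -
    have "isCont (\<lambda>(X, y). in_chart a b u m \<nu> X y) p"
      using in_chart_cont[OF \<nu>] open_chart_domain pc by (simp add: continuous_on_eq_continuous_at)
    then obtain r where r: "r > 0" "\<And>z. dist z p < r \<Longrightarrow> dist (case z of (X, y) \<Rightarrow> in_chart a b u m \<nu> X y) (case p of (X, y) \<Rightarrow> in_chart a b u m \<nu> X y) < 1"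
      unfolding continuous_at_eps_delta by (metis zero_less_one dist_norm)
    show ?thesis
    proof (intro exI[of _ r] conjI r(1) allI impI)
      fix z assume "dist z p < r"
      from r(2)[OF this] show "norm (case z of (X, y) \<Rightarrow> in_chart a b u m \<nu> X y) \<le> norm (case p of (X, y) \<Rightarrow> in_chart a b u m \<nu> X y) + 1"
        unfolding dist_norm using norm_triangle_sub[of "case z of (X, y) \<Rightarrow> in_chart a b u m \<nu> X y" "case p of (X, y) \<Rightarrow> in_chart a b u m \<nu> X y"] by linarith
    qed
  qed
  note loc = this
  define N where "N \<nu> = norm (case p of (X, y) \<Rightarrow> in_chart a b u m \<nu> X y) + 1" for \<nu>
  obtain r1 where r1: "r1 > 0" "\<And>z. dist z p < r1 \<Longrightarrow> norm (in_chart a b u m 1 (fst z) (snd z)) \<le> N 1"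
    using loc[of 1] unfolding N_def by (auto simp: case_prod_beta)
  obtain r2 where r2: "r2 > 0" "\<And>z. dist z p < r2 \<Longrightarrow> norm (in_chart a b u m 2 (fst z) (snd z)) \<le> N 2"
    using loc[of 2] unfolding N_def by (auto simp: case_prod_beta)
  show ?thesis
  proof (rule exI[of _ "min r1 r2"], intro conjI)
    show "min r1 r2 > 0" using r1 r2 by simp
    show "\<exists>B. \<forall>z. dist z p < min r1 r2 \<longrightarrow> (z \<notin> branch_points a b \<longrightarrow> norm (u (fst z) (snd z) 1) \<le> B \<and> norm (u (fst z) (snd z) 2) \<le> B)"
    proof (rule exI[of _ "max (N 1) (N 2)"], intro allI impI)
      fix z assume "dist z p < min r1 r2"
      with r1(2)[of z] r2(2)[of z] show "norm (u (fst z) (snd z) 1) \<le> max (N 1) (N 2) \<and> norm (u (fst z) (snd z) 2) \<le> max (N 1) (N 2)"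
        by (auto simp: in_chart_def split: if_splits)
    qed
  qed
qed

lemma bounded_on_box:
  "\<exists>B. \<forall>X\<in>{A..A'}. \<forall>y\<in>{-Y..Y}. (X, y) \<notin> branch_points a b \<longrightarrow> norm (u X y 1) \<le> B \<and> norm (u X y 2) \<le> B"
proof -
  have "\<exists>B. \<forall>z\<in>{A..A'} \<times> {-Y..Y}. (z \<notin> branch_points a b \<longrightarrow> norm (u (fst z) (snd z) 1) \<le> B \<and> norm (u (fst z) (snd z) 2) \<le> B)"
  proof (rule compact_locally_bounded[OF compact_Times[OF compact_Icc compact_Icc]])
    fix p show "\<exists>r>0. \<exists>B. \<forall>z. dist z p < r \<longrightarrow> (z \<notin> branch_points a b \<longrightarrow> norm (u (fst z) (snd z) 1) \<le> B \<and> norm (u (fst z) (snd z) 2) \<le> B)"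
      by (rule locally_bounded)
  qed (auto intro: order_trans)
  then obtain B where B: "\<And>z. z \<in> {A..A'} \<times> {-Y..Y} \<Longrightarrow> z \<notin> branch_points a b \<Longrightarrow> norm (u (fst z) (snd z) 1) \<le> B \<and> norm (u (fst z) (snd z) 2) \<le> B"
    by blast
  show ?thesis
  proof (intro exI[of _ B] ballI impI)
    fix X y assume "X \<in> {A..A'}" "y \<in> {-Y..Y}" "(X, y) \<notin> branch_points a b"
    with B[of "(X, y)"] show "norm (u X y 1) \<le> B \<and> norm (u X y 2) \<le> B" by simp
  qed
qed

text \<open>
  Uniqueness in a strip needs a bound up to the edges. For bounded y it follows by compactness,
  for large |y| from the decay of the scattered field; the incident wave gives the rate.
\<close>

lemma growth_bound:
  "\<exists>C. \<forall>X\<in>{A..A'}. \<forall>y. (X, y) \<notin> branch_points a b \<longrightarrow> norm (u X y 1) \<le> C * exp (c1 * \<bar>y\<bar>) \<and> norm (u X y 2) \<le> C * exp (c1 * \<bar>y\<bar>)"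
proof -
  obtain Y where Y: "\<And>X y \<nu>. \<nu> \<in> {1, 2} \<Longrightarrow> \<bar>y\<bar> > Y \<Longrightarrow> y \<noteq> 0 \<Longrightarrow> norm (u X y \<nu> - u_inc k \<theta> X y \<nu>) < 1"
    using decay[of 1] by auto
  define Z where "Z = \<bar>Y\<bar> + 1"
  obtain B where B: "\<And>X y. X \<in> {A..A'} \<Longrightarrow> y \<in> {-Z..Z} \<Longrightarrow> (X, y) \<notin> branch_points a b \<Longrightarrow> norm (u X y 1) \<le> B \<and> norm (u X y 2) \<le> B"
    using bounded_on_box[of A A' Z] by blast
  have e1: "1 \<le> exp (c1 * \<bar>y\<bar>)" for y using c1 by simp
  have big: "norm (u X y \<nu>) \<le> (\<bar>B\<bar> + 2) * exp (c1 * \<bar>y\<bar>)" if "\<nu> \<in> {1, 2}" "y \<notin> {-Z..Z}" for X y \<nu>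
  proof -
    have y: "\<bar>y\<bar> > Y" "y \<noteq> 0" using that(2) by (auto simp: Z_def)
    have ui: "norm (u_inc k \<theta> X y \<nu>) \<le> exp (c1 * \<bar>y\<bar>)" unfolding u_inc_eq using c1 by (auto simp: plane_wave_bound)
    have "norm (u X y \<nu>) \<le> norm (u X y \<nu> - u_inc k \<theta> X y \<nu>) + norm (u_inc k \<theta> X y \<nu>)"
      using norm_triangle_ineq[of "u X y \<nu> - u_inc k \<theta> X y \<nu>" "u_inc k \<theta> X y \<nu>"] by simp
    also have "\<dots> \<le> exp (c1 * \<bar>y\<bar>) + exp (c1 * \<bar>y\<bar>)" using Y[OF that(1) y, of X] e1[of y] ui by linarith
    also have "\<dots> = 2 * exp (c1 * \<bar>y\<bar>)" by simp
    also have "\<dots> \<le> (\<bar>B\<bar> + 2) * exp (c1 * \<bar>y\<bar>)" by (intro mult_right_mono) auto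
    finally show ?thesis .
  qed
  have small: "B \<le> (\<bar>B\<bar> + 2) * exp (c1 * \<bar>y\<bar>)" for y
  proof -
    have "B \<le> (\<bar>B\<bar> + 2) * 1" by simp
    also have "\<dots> \<le> (\<bar>B\<bar> + 2) * exp (c1 * \<bar>y\<bar>)" by (intro mult_left_mono e1) simp
    finally show ?thesis .
  qed
  show ?thesis
  proof (rule exI[of _ "\<bar>B\<bar> + 2"], intro ballI allI impI)
    fix X y assume X: "X \<in> {A..A'}" "(X, y) \<notin> branch_points a b"
    show "norm (u X y 1) \<le> (\<bar>B\<bar> + 2) * exp (c1 * \<bar>y\<bar>) \<and> norm (u X y 2) \<le> (\<bar>B\<bar> + 2) * exp (c1 * \<bar>y\<bar>)"
    proof (cases "y \<in> {-Z..Z}")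
      case True
      from B[OF X(1) this X(2)] small[of y] show ?thesis by (auto intro: order_trans)
    next
      case False
      from big[of 1, OF _ this] big[of 2, OF _ this] show ?thesis by simp
    qed
  qed
qed

end

section \<open>Even and odd combinations of the sheets\<close>

text \<open>
  Exchanging the sheets acts on the combination by the scalar \<sigma>, so it becomes a function
  on the cut plane with multiplicative jumps.
\<close>

locale sheet_combination = diffraction +
  fixes \<sigma> :: complex
  assumes \<sigma>: "\<sigma> = 1 \<or> \<sigma> = -1"
begin

lemma \<sigma>2: "\<sigma> * \<sigma> = 1" "\<sigma> * (\<sigma> * z) = z" using \<sigma> by auto

definition V where "V X y = u X y 1 + \<sigma> * u X y 2"
text \<open>
  V continued from the right of the edge n to its left, across the cut.
\<close>

definition W where "W n X y = in_chart a b u n 1 X y + \<sigma> * in_chart a b u n 2 X y"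

lemma W_eq: "W n X y = (if X < x n \<and> y < 0 then \<sigma> * V X y else V X y)"
  unfolding W_def V_def in_chart_def using \<sigma> by (auto simp: algebra_simps)

lemma W_parabolic: "\<exists>Fx Fy Fyy. parabolic_on k (chart_domain a b n) (W n) Fx Fy Fyy"
proof -
  obtain Fx Fy Fyy where 1: "parabolic_on k (chart_domain a b n) (in_chart a b u n 1) Fx Fy Fyy"
    using in_chart_parabolic[of 1] by blast
  obtain Gx Gy Gyy where 2: "parabolic_on k (chart_domain a b n) (in_chart a b u n 2) Gx Gy Gyy"
    using in_chart_parabolic[of 2] by blast
  from parabolic_on_add_mult[OF 1 2, of \<sigma>] show ?thesis unfolding W_def by blast
qed

lemma W_cont: "p \<in> chart_domain a b n \<Longrightarrow> isCont (\<lambda>(X, y). W n X y) p"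
proof -
  assume p: "p \<in> chart_domain a b n"
  obtain Fx Fy Fyy where "parabolic_on k (chart_domain a b n) (W n) Fx Fy Fyy" using W_parabolic by blast
  from parabolic_on_cont(1)[OF this] show ?thesis using open_chart_domain p by (simp add: continuous_on_eq_continuous_at)
qed

lemma strip_parabolic: "\<exists>Fx Fy Fyy. parabolic_on k ({x n<..<x (n + 1)} \<times> UNIV) V Fx Fy Fyy"
proof -
  obtain Fx Fy Fyy where 1: "parabolic_on k (chart_domain a b n) (W n) Fx Fy Fyy" using W_parabolic by blast
  have "{x n<..<x (n + 1)} \<times> UNIV \<subseteq> chart_domain a b n" using strip_chart by auto
  from parabolic_on_subset[OF 1 this]
  have "parabolic_on k ({x n<..<x (n + 1)} \<times> UNIV) V Fx Fy Fyy"
    by (rule parabolic_on_cong[rotated]) (auto simp: W_eq open_Times)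
  then show ?thesis by blast
qed

lemma norm_V_le: "norm (V X y) \<le> norm (u X y 1) + norm (u X y 2)"
proof -
  have "norm \<sigma> = 1" using \<sigma> by auto
  then show ?thesis unfolding V_def using norm_triangle_ineq[of "u X y 1" "\<sigma> * u X y 2"] by (simp add: norm_mult)
qed

lemma V_growth: "\<exists>C. \<forall>X\<in>{A..A'}. \<forall>y. (X, y) \<notin> branch_points a b \<longrightarrow> norm (V X y) \<le> C * exp (c1 * \<bar>y\<bar>)"
proof -
  obtain C where C: "\<And>X y. X \<in> {A..A'} \<Longrightarrow> (X, y) \<notin> branch_points a b \<Longrightarrow> norm (u X y 1) \<le> C * exp (c1 * \<bar>y\<bar>) \<and> norm (u X y 2) \<le> C * exp (c1 * \<bar>y\<bar>)"
    using growth_bound[of A A'] by blast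
  show ?thesis
  proof (rule exI[of _ "2 * C"], intro ballI allI impI)
    fix X y assume "X \<in> {A..A'}" "(X, y) \<notin> branch_points a b"
    from C[OF this] norm_V_le[of X y] show "norm (V X y) \<le> 2 * C * exp (c1 * \<bar>y\<bar>)" by (simp add: mult.assoc) 
  qed
qed

lemma strip_not_branch: "x n < X \<Longrightarrow> X < x (n + 1) \<Longrightarrow> (X, y) \<notin> branch_points a b"
  using edge_less_iff[OF ab] by (auto simp: not_branch)

definition \<beta> where "\<beta> n y = (if y = 0 then 0 else V (x n) y)"

lemma V_left_limit: "y \<noteq> 0 \<Longrightarrow> ((\<lambda>X. V X y) \<longlongrightarrow> \<beta> n y) (at_right (x n))"
proof -
  assume y: "y \<noteq> 0"
  have "isCont (\<lambda>(X, y). W n X y) (x n, y)" by (rule W_cont[OF edge_chart[OF y]])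
  moreover have "filterlim (\<lambda>X. (X, y)) (nhds (x n, y)) (at_right (x n))"
    by (intro tendsto_intros)
  ultimately have "((\<lambda>X. W n X y) \<longlongrightarrow> W n (x n) y) (at_right (x n))"
    using isCont_tendsto_compose[of "(x n, y)" "\<lambda>(X, y). W n X y" "\<lambda>X. (X, y)"] by simp
  moreover have "\<forall>\<^sub>F X in at_right (x n). W n X y = V X y"
    by (rule eventually_mono[OF eventually_at_right_less]) (simp add: W_eq)
  ultimately have "((\<lambda>X. V X y) \<longlongrightarrow> W n (x n) y) (at_right (x n))" by (rule Lim_transform_eventually)
  then show ?thesis using y by (simp add: W_eq \<beta>_def)
qed

lemma \<beta>_measurable [measurable]: "\<beta> n \<in> borel_measurable borel"
proof -
  obtain Fx Fy Fyy where F: "parabolic_on k ({x n<..<x (n + 1)} \<times> UNIV) V Fx Fy Fyy" using strip_parabolic by blast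
  define X where "X j = x n + (x (n + 1) - x n) / real (j + 2)" for j
  have g: "x (n + 1) - x n > 0" using edge_step[of n] by simp
  have X: "x n < X j" "X j < x (n + 1)" for j
  proof -
    show "x n < X j" using g by (simp add: X_def)
    have "(x (n + 1) - x n) / real (j + 2) < (x (n + 1) - x n) / 1" using g by (intro divide_strict_left_mono) auto
    then show "X j < x (n + 1)" by (simp add: X_def)
  qed
  have "(\<lambda>j. (x (n + 1) - x n) / real (j + 2)) \<longlonglongrightarrow> 0" by (rule LIMSEQ_ignore_initial_segment[OF lim_const_over_n])
  from tendsto_add[OF tendsto_const this, of "x n"] have Xl: "X \<longlonglongrightarrow> x n" by (simp add: X_def[abs_def])
  have fl: "filterlim X (at_right (x n)) sequentially"
    unfolding filterlim_at using Xl X(1) by (auto intro!: always_eventually less_imp_neq[symmetric])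
  have m [measurable]: "V (X j) \<in> borel_measurable borel" for j
  proof (rule borel_measurable_continuous_onI, rule has_vector_derivative_continuous_on)
    fix y show "(V (X j) has_vector_derivative Fy (X j) y) (at y)" using parabolic_onD(2)[OF F, of "X j" y] X[of j] by simp
  qed
  show ?thesis
  proof (rule borel_measurable_LIMSEQ_metric)
    show "(\<lambda>y. indicator (- {0}) y *\<^sub>R V (X j) y) \<in> borel_measurable borel" for j by measurable
    fix y :: real
    show "(\<lambda>j. indicator (- {0}) y *\<^sub>R V (X j) y) \<longlonglongrightarrow> \<beta> n y"
    proof (cases "y = 0")
      case False
      then show ?thesis using filterlim_compose[OF V_left_limit[OF False, of n] fl] by simp
    qed (simp add: \<beta>_def)
  qed
qed

lemma V_representation_limit:
  assumes X: "x n < X" "X \<le> x (n + 1)"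
    and right: "((\<lambda>(X, y). V X y) \<longlongrightarrow> L) (at (X, Y) within {x n<..<X} \<times> UNIV)"
  shows "conv (gauss (gauss_rate k (X - x n))) (\<beta> n) Y = L"
proof -
  obtain Fx Fy Fyy where F: "parabolic_on k ({x n<..<x (n + 1)} \<times> UNIV) V Fx Fy Fyy" using strip_parabolic by blast
  have sub: "{x n<..<X} \<times> UNIV \<subseteq> {x n<..<x (n + 1)} \<times> UNIV" using X by auto
  obtain C where C: "\<And>X' y. X' \<in> {x n..x (n + 1)} \<Longrightarrow> (X', y) \<notin> branch_points a b \<Longrightarrow> norm (V X' y) \<le> C * exp (c1 * \<bar>y\<bar>)"
    using V_growth[of "x n" "x (n + 1)"] by blast
  show ?thesis
  proof (rule parabolic_representation[OF k parabolic_on_subset[OF F sub] X(1) less_imp_le[OF c1] _ V_left_limit \<beta>_measurable right])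
    show "norm (V X' y) \<le> C * exp (c1 * \<bar>y\<bar>)" if "X' \<in> {x n<..<X}" for X' y
      by (rule C) (use that X strip_not_branch[of n X' y] in auto)
  qed
qed

lemma V_representation:
  assumes X: "x n < X" "X < x (n + 1)"
  shows "V X Y = conv (gauss (gauss_rate k (X - x n))) (\<beta> n) Y"
proof (rule V_representation_limit[symmetric, OF X(1) less_imp_le[OF X(2)]])
  have "isCont (\<lambda>(X, y). W n X y) (X, Y)" by (rule W_cont[OF strip_chart[OF X]])
  then have "((\<lambda>(X, y). W n X y) \<longlongrightarrow> W n X Y) (at (X, Y) within {x n<..<X} \<times> UNIV)"
    unfolding isCont_def by (auto intro: tendsto_within_subset)
  moreover have "W n X Y = V X Y" using X by (simp add: W_eq)
  moreover have "\<forall>\<^sub>F p in at (X, Y) within {x n<..<X} \<times> UNIV. (case p of (X, y) \<Rightarrow> W n X y) = (case p of (X, y) \<Rightarrow> V X y)"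
    unfolding eventually_at_filter by (rule always_eventually) (auto simp: W_eq)
  ultimately show "((\<lambda>(X, y). V X y) \<longlongrightarrow> V X Y) (at (X, Y) within {x n<..<X} \<times> UNIV)"
    using Lim_transform_eventually by fastforce
qed

lemma edge_representation:
  assumes Y: "Y \<noteq> 0"
  shows "edge_sign \<sigma> Y * V (x (n + 1)) Y = conv (gauss (gauss_rate k (gap a b n))) (\<beta> n) Y"
proof -
  let ?p = "(x (n + 1), Y)" and ?S = "{x n<..<x (n + 1)} \<times> (UNIV :: real set)"
  have "isCont (\<lambda>(X, y). W (n + 1) X y) ?p" by (rule W_cont[OF edge_chart[OF Y]])
  then have "((\<lambda>(X, y). W (n + 1) X y) \<longlongrightarrow> W (n + 1) (x (n + 1)) Y) (at ?p)" by (simp add: isCont_def)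
  moreover have "W (n + 1) (x (n + 1)) Y = V (x (n + 1)) Y" by (simp add: W_eq)
  ultimately have 1: "((\<lambda>(X, y). W (n + 1) X y) \<longlongrightarrow> V (x (n + 1)) Y) (at ?p within ?S)"
    using tendsto_within_subset[of "\<lambda>(X, y). W (n + 1) X y" _ ?p UNIV ?S] by simp
  then have "((\<lambda>p. edge_sign \<sigma> Y * (case p of (X, y) \<Rightarrow> W (n + 1) X y)) \<longlongrightarrow> edge_sign \<sigma> Y * V (x (n + 1)) Y) (at ?p within ?S)"
    by (intro tendsto_intros)
  moreover have "\<forall>\<^sub>F p in at ?p within ?S. edge_sign \<sigma> Y * (case p of (X, y) \<Rightarrow> W (n + 1) X y) = (case p of (X, y) \<Rightarrow> V X y)"
  proof -
    have "open {p :: real \<times> real. snd p * Y > 0}" by (intro open_Collect_less continuous_intros)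
    moreover have "?p \<in> {p. snd p * Y > 0}" using Y by (cases "Y > 0") (auto simp: zero_less_mult_iff)
    ultimately have "\<forall>\<^sub>F p in nhds ?p. snd p * Y > 0" using eventually_nhds_in_open by fastforce
    then show ?thesis
      unfolding eventually_at_filter
    proof eventually_elim
      case (elim p)
      show ?case
      proof (intro impI)
        assume "p \<in> ?S"
        obtain X y where p: "p = (X, y)" by (cases p)
        have X: "X < x (n + 1)" using \<open>p \<in> ?S\<close> p by auto
        have "y > 0 \<and> Y > 0 \<or> y < 0 \<and> Y < 0" using elim p by (auto simp: zero_less_mult_iff)
        then show "edge_sign \<sigma> Y * (case p of (X, y) \<Rightarrow> W (n + 1) X y) = (case p of (X, y) \<Rightarrow> V X y)"
          using X \<sigma>2 by (auto simp: p W_eq edge_sign_def)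
      qed
    qed
  qed
  ultimately have "((\<lambda>(X, y). V X y) \<longlongrightarrow> edge_sign \<sigma> Y * V (x (n + 1)) Y) (at ?p within ?S)"
    by (rule Lim_transform_eventually)
  from V_representation_limit[OF _ order_refl this] edge_step[of n] show ?thesis by (simp add: gap_def)
qed

text \<open>
  The convolution extends the left-hand trace V(x_n - 0, .) to y = 0, where V itself has an
  arbitrary value at the branch point.
\<close>

definition f where "f n y = conv (gauss (gauss_rate k (gap a b (n - 1)))) (\<beta> (n - 1)) y"

lemma \<beta>_eq: "\<beta> n = (\<lambda>y. edge_sign \<sigma> y * f n y)"
proof
  fix y
  show "\<beta> n y = edge_sign \<sigma> y * f n y"
  proof (cases "y = 0")
    case False
    have "f n y = edge_sign \<sigma> y * V (x n) y" using edge_representation[OF False, of "n - 1"] by (simp add: f_def)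
    then show ?thesis using False \<sigma>2 by (auto simp: \<beta>_def edge_sign_def)
  qed (simp add: \<beta>_def edge_sign_def)
qed

lemma f_step: "f (n + 1) = conv (gauss (gauss_rate k (gap a b n))) (\<lambda>y. edge_sign \<sigma> y * f n y)"
  using \<beta>_eq[of n] by (auto simp: f_def)

definition \<Lambda> where "\<Lambda> = Re (k * \<theta>\<^sup>2) / 2"

lemma \<Lambda>_eq: "k * \<theta>\<^sup>2 = of_real (2 * \<Lambda>)"
proof -
  have e: "2 * \<Lambda> = Re (k * \<theta>\<^sup>2)" unfolding \<Lambda>_def by simp
  show ?thesis unfolding e of_real_Re[OF real] ..
qed

lemma E_eq: "exp (- \<i> * k * of_real a * \<theta>\<^sup>2 / 2) = exp (- (\<i> * of_real (\<Lambda> * a)))"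
proof -
  have "- \<i> * k * of_real a * \<theta>\<^sup>2 / 2 = - (\<i> * (k * \<theta>\<^sup>2) * of_real a / 2)" by (simp add: mult_ac)
  also have "\<dots> = - (\<i> * of_real (\<Lambda> * a))" unfolding \<Lambda>_eq by simp
  finally show ?thesis by (simp only:)
qed

text \<open>
  The number is k psi_n^2 / 2, so this is where psi_n \<noteq> 0 is used.
\<close>

lemma \<Lambda>_nz: "\<Lambda> + 2 * pi / a * of_int n \<noteq> 0"
proof
  assume "\<Lambda> + 2 * pi / a * of_int n = 0"
  then have "complex_of_real (2 * (\<Lambda> + 2 * pi / a * of_int n)) = 0" by simp
  then have "k * \<theta>\<^sup>2 + 4 * of_real pi * of_int n / of_real a = 0" unfolding \<Lambda>_eq by (simp add: algebra_simps)
  moreover have "k * (\<theta>\<^sup>2 + 4 * of_real pi * of_int n / (k * of_real a)) = k * \<theta>\<^sup>2 + 4 * of_real pi * of_int n / of_real a"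
    using k0 by (simp add: distrib_left)
  ultimately have "\<theta>\<^sup>2 + 4 * of_real pi * of_int n / (k * of_real a) = 0" using k0 by (metis mult_eq_0_iff)
  then have "psi a k \<theta> n = 0" by (simp add: psi_def)
  with psi show False by blast
qed

lemma V_floquet: "y \<noteq> 0 \<Longrightarrow> V (X + a) y = exp (- \<i> * k * of_real a * \<theta>\<^sup>2 / 2) * V X y"
  unfolding V_def using floq[of 1 y X] floq[of 2 y X] by (simp add: algebra_simps)

lemma plane_wave_floquet: "plane_wave k \<theta> (X + a) y = exp (- \<i> * k * of_real a * \<theta>\<^sup>2 / 2) * plane_wave k \<theta> X y"
  unfolding plane_wave_def exp_add[symmetric] by (rule arg_cong[where f = exp]) (simp add: field_simps)

lemma V_decay:
  assumes "\<epsilon> > 0"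
  shows "\<exists>Y. \<forall>X y. \<bar>y\<bar> > Y \<and> y \<noteq> 0 \<longrightarrow> norm (V X y - (if y > 0 then plane_wave k \<theta> X y else 0)) < \<epsilon>"
proof -
  obtain Y where Y: "\<And>X y \<nu>. \<nu> \<in> {1, 2} \<Longrightarrow> \<bar>y\<bar> > Y \<Longrightarrow> y \<noteq> 0 \<Longrightarrow> norm (u X y \<nu> - u_inc k \<theta> X y \<nu>) < \<epsilon> / 2"
    using decay[of "\<epsilon> / 2"] assms by auto
  show ?thesis
  proof (rule exI[of _ Y], intro allI impI)
    fix X y assume y: "\<bar>y\<bar> > Y \<and> y \<noteq> 0"
    have "V X y - (if y > 0 then plane_wave k \<theta> X y else 0) = (u X y 1 - u_inc k \<theta> X y 1) + \<sigma> * (u X y 2 - u_inc k \<theta> X y 2)"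
      by (auto simp: V_def u_inc_eq)
    also have "norm \<dots> \<le> norm (u X y 1 - u_inc k \<theta> X y 1) + norm (u X y 2 - u_inc k \<theta> X y 2)"
      using norm_triangle_ineq[of "u X y 1 - u_inc k \<theta> X y 1" "\<sigma> * (u X y 2 - u_inc k \<theta> X y 2)"] \<sigma> by (auto simp: norm_mult)
    also have "\<dots> < \<epsilon>" using Y[of 1 y X] Y[of 2 y X] y by auto
    finally show "norm (V X y - (if y > 0 then plane_wave k \<theta> X y else 0)) < \<epsilon>" .
  qed
qed

lemma upper_decay: "\<exists>\<mu>>0. \<forall>X. \<exists>C. \<forall>y\<ge>2. norm (V X y - plane_wave k \<theta> X y) \<le> C * exp (- \<mu> * y)"
proof (rule half_plane_decay[OF k a0 \<Lambda>_nz])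
  show "parabolic_on k (UNIV \<times> {0<..}) (\<lambda>X y. V X y - plane_wave k \<theta> X y) (dx (\<lambda>X y. V X y - plane_wave k \<theta> X y))
     (dy (\<lambda>X y. V X y - plane_wave k \<theta> X y)) (dy (dy (\<lambda>X y. V X y - plane_wave k \<theta> X y)))"
  proof (rule parabolic_on_local)
    fix p :: "real \<times> real" assume "p \<in> UNIV \<times> {0::real<..}"
    then obtain X y where p: "p = (X, y)" "y > 0" by auto
    obtain m where m: "x m \<le> X" "X < x (m + 1)" using ex_strip[OF ab] by blast
    define S where "S = chart_domain a b m \<inter> (UNIV \<times> {0<..})"
    have S: "open S" unfolding S_def by (intro open_Int open_chart_domain open_Times) auto
    have pS: "p \<in> S" using m p edge_step(1)[of m] by (auto simp: S_def chart_domain_def)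
    obtain Fx Fy Fyy where F: "parabolic_on k (chart_domain a b m) (W m) Fx Fy Fyy" using W_parabolic by blast
    have sub: "S \<subseteq> chart_domain a b m" by (auto simp: S_def)
    have G: "parabolic_on k S (\<lambda>X y. V X y - plane_wave k \<theta> X y)
       (\<lambda>X y. Fx X y + (-1) * ((- \<i> * k * \<theta>\<^sup>2 / 2) * plane_wave k \<theta> X y)) (\<lambda>X y. Fy X y + (-1) * ((- \<i> * k * \<theta>) * plane_wave k \<theta> X y))
       (\<lambda>X y. Fyy X y + (-1) * ((- \<i> * k * \<theta>)\<^sup>2 * plane_wave k \<theta> X y))"
      by (rule parabolic_on_cong[OF S parabolic_on_add_mult[OF parabolic_on_subset[OF F sub] plane_wave_parabolic[OF k0], of "-1"]])
         (auto simp: S_def W_eq)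
    show "\<exists>S Fx Fy Fyy. open S \<and> p \<in> S \<and> parabolic_on k S (\<lambda>X y. V X y - plane_wave k \<theta> X y) Fx Fy Fyy"
      using S pS G by blast
  qed
  show "V (X + a) y - plane_wave k \<theta> (X + a) y = exp (- (\<i> * of_real (\<Lambda> * a))) * (V X y - plane_wave k \<theta> X y)" if "y > 0" for X y
    using V_floquet[of y X] plane_wave_floquet[of X y] that unfolding E_eq by (simp add: right_diff_distrib)
  show "\<exists>Y. \<forall>X y. y > Y \<and> y > 0 \<longrightarrow> norm (V X y - plane_wave k \<theta> X y) < \<epsilon>" if eps: "\<epsilon> > 0" for \<epsilon>
  proof -
    obtain Y where Y: "\<And>X y. \<bar>y\<bar> > Y \<Longrightarrow> y \<noteq> 0 \<Longrightarrow> norm (V X y - (if y > 0 then plane_wave k \<theta> X y else 0)) < \<epsilon>"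
      using V_decay[OF eps] by blast
    show ?thesis
    proof (rule exI[of _ Y], intro allI impI)
      fix X y assume "y > Y \<and> y > 0"
      with Y[of y X] show "norm (V X y - plane_wave k \<theta> X y) < \<epsilon>" by auto
    qed
  qed
qed

text \<open>
  Along y < 0 the combination V picks up a factor \<sigma> at every edge. The factor parity
  undoes this, and it is a-periodic since there are two edges per period.
\<close>

definition parity where "parity X = (if even (strip_of a b X) then 1 else \<sigma>)"

lemma norm_parity: "norm (parity X) = 1" using \<sigma> by (auto simp: parity_def)

lemma strip_of_shift: "strip_of a b (X + a) = strip_of a b X + 2"
proof -
  obtain m where m: "x m \<le> X" "X < x (m + 1)" using ex_strip[OF ab] by blast
  have "x (m + 2) \<le> X + a" "X + a < x (m + 2 + 1)"
    using m edge_plus_2[of a b m] edge_plus_2[of a b "m + 1"] by (simp_all add: algebra_simps)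
  then show ?thesis using strip_of_eq[OF ab m] strip_of_eq[OF ab] by simp
qed

text \<open>
  The product of parity and V extends over the cuts to a solution in the whole lower half-plane
  with the same Floquet multiplier, so the reflected function satisfies the hypotheses of the
  decay lemma.
\<close>

lemma lower_decay: "\<exists>\<mu>>0. \<forall>X. \<exists>C. \<forall>y\<ge>2. norm (V X (- y)) \<le> C * exp (- \<mu> * y)"
proof -
  define q where "q X y = parity X * V X y" for X y
  have sol: "parabolic_on k (UNIV \<times> {..<0}) q (dx q) (dy q) (dy (dy q))"
  proof (rule parabolic_on_local)
    fix p :: "real \<times> real" assume "p \<in> UNIV \<times> {..<0::real}"
    then obtain X y where p: "p = (X, y)" "y < 0" by auto
    obtain m where m: "x m \<le> X" "X < x (m + 1)" using ex_strip[OF ab] by blast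
    define S where "S = chart_domain a b m \<inter> (UNIV \<times> {..<0})"
    define z where "z = (if even m then 1 else \<sigma>)"
    have S: "open S" unfolding S_def by (intro open_Int open_chart_domain open_Times) auto
    have pS: "p \<in> S" using m p edge_step(1)[of m] by (auto simp: S_def chart_domain_def)
    obtain Fx Fy Fyy where F: "parabolic_on k (chart_domain a b m) (W m) Fx Fy Fyy" using W_parabolic by blast
    have sub: "S \<subseteq> chart_domain a b m" by (auto simp: S_def)
    have G: "parabolic_on k S q (\<lambda>X y. z * Fx X y) (\<lambda>X y. z * Fy X y) (\<lambda>X y. z * Fyy X y)"
    proof (rule parabolic_on_cong[OF S parabolic_on_mult[OF parabolic_on_subset[OF F sub]]])
      fix X y assume "(X, y) \<in> S"
      then have X: "x (m - 1) < X" "X < x (m + 1)" "y < 0" by (auto simp: S_def chart_domain_def)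
      show "q X y = z * W m X y"
      proof (cases "X < x m")
        case True
        have "strip_of a b X = m - 1" by (rule strip_of_eq[OF ab]) (use X True in auto)
        then show ?thesis using True X(3) \<sigma>2 by (auto simp: q_def parity_def z_def W_eq)
      next
        case False
        have "strip_of a b X = m" by (rule strip_of_eq[OF ab]) (use X False in auto)
        then show ?thesis using False by (auto simp: q_def parity_def z_def W_eq)
      qed
    qed
    show "\<exists>S Fx Fy Fyy. open S \<and> p \<in> S \<and> parabolic_on k S q Fx Fy Fyy" using S pS G by blast
  qed
  have set_eq: "{(X, y). (X, - y) \<in> UNIV \<times> {..<0::real}} = UNIV \<times> {0<..}" by auto
  have "\<exists>\<mu>>0. \<forall>X. \<exists>C. \<forall>y\<ge>2. norm (q X (- y)) \<le> C * exp (- \<mu> * y)"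
  proof (rule half_plane_decay[OF k a0 \<Lambda>_nz])
    show "parabolic_on k (UNIV \<times> {0<..}) (\<lambda>X y. q X (- y)) (\<lambda>X y. dx q X (- y)) (\<lambda>X y. - dy q X (- y)) (\<lambda>X y. dy (dy q) X (- y))"
      using parabolic_on_reflect[OF sol] unfolding set_eq .
    show "q (X + a) (- y) = exp (- (\<i> * of_real (\<Lambda> * a))) * q X (- y)" if "y > 0" for X y
      using V_floquet[of "- y" X] that unfolding E_eq by (simp add: q_def parity_def strip_of_shift)
    show "\<exists>Y. \<forall>X y. y > Y \<and> y > 0 \<longrightarrow> norm (q X (- y)) < \<epsilon>" if eps: "\<epsilon> > 0" for \<epsilon>
    proof -
      obtain Y where Y: "\<And>X y. \<bar>y\<bar> > Y \<Longrightarrow> y \<noteq> 0 \<Longrightarrow> norm (V X y - (if y > 0 then plane_wave k \<theta> X y else 0)) < \<epsilon>"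
        using V_decay[OF eps] by blast
      show ?thesis
      proof (rule exI[of _ Y], intro allI impI)
        fix X y assume "y > Y \<and> y > 0"
        with Y[of "- y" X] show "norm (q X (- y)) < \<epsilon>" by (auto simp: q_def norm_mult norm_parity)
      qed
    qed
  qed
  then show ?thesis by (simp add: q_def norm_mult norm_parity)
qed

text \<open>
  Large |y| is covered by the two half-plane lemmas, bounded y by the growth bound. The rate
  does not depend on the edge.
\<close>

lemma trace_decay: "\<exists>c>0. \<forall>n. edecay c (\<lambda>y. \<beta> n y - plane_wave k \<theta> (x n) y)"
proof -
  obtain \<mu>1 where \<mu>1: "\<mu>1 > 0" "\<And>X. \<exists>C. \<forall>y\<ge>2. norm (V X y - plane_wave k \<theta> X y) \<le> C * exp (- \<mu>1 * y)"
    using upper_decay by blast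
  obtain \<mu>2 where \<mu>2: "\<mu>2 > 0" "\<And>X. \<exists>C. \<forall>y\<ge>2. norm (V X (- y)) \<le> C * exp (- \<mu>2 * y)"
    using lower_decay by blast
  define c where "c = min (min \<mu>1 \<mu>2) c1"
  have c: "c > 0" "c \<le> \<mu>1" "c \<le> \<mu>2" "c \<le> c1" using \<mu>1 \<mu>2 c1 by (auto simp: c_def)
  show ?thesis
  proof (intro exI[of _ c] conjI c(1) allI)
    fix n
    obtain C1 where C1: "\<And>y. y \<ge> 2 \<Longrightarrow> norm (V (x n) y - plane_wave k \<theta> (x n) y) \<le> C1 * exp (- \<mu>1 * y)" using \<mu>1(2)[of "x n"] by blast
    obtain C2 where C2: "\<And>y. y \<ge> 2 \<Longrightarrow> norm (V (x n) (- y)) \<le> C2 * exp (- \<mu>2 * y)" using \<mu>2(2)[of "x n"] by blast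
    obtain C3 where C3: "\<And>y. (x n, y) \<notin> branch_points a b \<Longrightarrow> norm (V (x n) y) \<le> C3 * exp (c1 * \<bar>y\<bar>)"
      using V_growth[of "x n" "x n"] by auto
    define D where "D = (\<bar>C3\<bar> + 1) * exp (c1 * 2) * exp (c * 2)"
    define C where "C = \<bar>C1\<bar> + \<bar>C2\<bar> + 1 + D"
    have D0: "D \<ge> 0" by (simp add: D_def)
    have em: "exp (- \<mu> * \<bar>y\<bar>) \<le> exp (- c * \<bar>y\<bar>)" if "c \<le> \<mu>" for \<mu> y using that by (simp add: mult_right_mono)
    show "edecay c (\<lambda>y. \<beta> n y - plane_wave k \<theta> (x n) y)"
    proof (rule edecayI[where C = C])
      show "(\<lambda>y. \<beta> n y - plane_wave k \<theta> (x n) y) \<in> borel_measurable borel"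
        by (intro borel_measurable_diff \<beta>_measurable) (simp add: plane_wave_def)
      fix y :: real
      consider "y \<ge> 2" | "y \<le> -2" | "\<bar>y\<bar> < 2" by linarith
      then show "norm (\<beta> n y - plane_wave k \<theta> (x n) y) \<le> C * exp (- c * \<bar>y\<bar>)"
      proof cases
        case 1
        have "norm (\<beta> n y - plane_wave k \<theta> (x n) y) \<le> C1 * exp (- \<mu>1 * \<bar>y\<bar>)" using C1[OF 1] 1 by (simp add: \<beta>_def)
        also have "\<dots> \<le> C * exp (- c * \<bar>y\<bar>)"
          by (intro mult_mono em c) (use D0 in \<open>auto simp: C_def\<close>)
        finally show ?thesis .
      next
        case 2
        have "norm (\<beta> n y - plane_wave k \<theta> (x n) y) \<le> norm (V (x n) y) + norm (plane_wave k \<theta> (x n) y)"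
          using 2 norm_triangle_ineq4 by (simp add: \<beta>_def)
        also have "norm (V (x n) y) \<le> \<bar>C2\<bar> * exp (- \<mu>2 * \<bar>y\<bar>)"
        proof -
          have "norm (V (x n) y) \<le> C2 * exp (- \<mu>2 * \<bar>y\<bar>)" using C2[of "- y"] 2 by simp
          also have "\<dots> \<le> \<bar>C2\<bar> * exp (- \<mu>2 * \<bar>y\<bar>)" by (intro mult_right_mono) auto
          finally show ?thesis .
        qed
        also have "\<bar>C2\<bar> * exp (- \<mu>2 * \<bar>y\<bar>) \<le> \<bar>C2\<bar> * exp (- c * \<bar>y\<bar>)" by (intro mult_left_mono em c) auto
        also have "norm (plane_wave k \<theta> (x n) y) = exp (- c1 * \<bar>y\<bar>)" unfolding plane_wave_bound using 2 by simp
        also have "exp (- c1 * \<bar>y\<bar>) \<le> 1 * exp (- c * \<bar>y\<bar>)" using em[OF c(4)] by simp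
        finally have "norm (\<beta> n y - plane_wave k \<theta> (x n) y) \<le> (\<bar>C2\<bar> + 1) * exp (- c * \<bar>y\<bar>)" by (simp add: distrib_right)
        also have "\<dots> \<le> C * exp (- c * \<bar>y\<bar>)" by (intro mult_right_mono) (use D0 in \<open>auto simp: C_def\<close>)
        finally show ?thesis .
      next
        case 3
        have e2: "exp (c1 * \<bar>y\<bar>) \<le> exp (c1 * 2)" using 3 c1 by simp
        have "norm (\<beta> n y) \<le> \<bar>C3\<bar> * exp (c1 * 2)"
        proof (cases "y = 0")
          case False
          have "norm (\<beta> n y) \<le> C3 * exp (c1 * \<bar>y\<bar>)" using C3[of y] False by (simp add: \<beta>_def not_branch)
          also have "\<dots> \<le> \<bar>C3\<bar> * exp (c1 * 2)" by (intro mult_mono e2) auto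
          finally show ?thesis .
        qed (simp add: \<beta>_def)
        moreover have "norm (plane_wave k \<theta> (x n) y) \<le> exp (c1 * 2)"
        proof -
          have "c1 * y \<le> c1 * 2" using 3 c1 by (intro mult_left_mono) auto
          then show ?thesis unfolding plane_wave_bound by simp
        qed
        ultimately have "norm (\<beta> n y - plane_wave k \<theta> (x n) y) \<le> (\<bar>C3\<bar> + 1) * exp (c1 * 2)"
          using norm_triangle_ineq4[of "\<beta> n y" "plane_wave k \<theta> (x n) y"] by (simp add: distrib_right)
        also have "\<dots> \<le> (\<bar>C3\<bar> + 1) * exp (c1 * 2) * (exp (c * 2) * exp (- c * \<bar>y\<bar>))"
        proof -
          have "1 \<le> exp (c * 2) * exp (- c * \<bar>y\<bar>)" using 3 c(1) by (simp add: mult_exp_exp)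
          then show ?thesis by (metis abs_ge_zero add_nonneg_nonneg exp_ge_zero mult_left_mono mult.right_neutral mult_nonneg_nonneg zero_le_one)
        qed
        also have "\<dots> = D * exp (- c * \<bar>y\<bar>)" by (simp add: D_def)
        also have "\<dots> \<le> C * exp (- c * \<bar>y\<bar>)" by (intro mult_right_mono) (auto simp: C_def)
        finally show ?thesis .
      qed
    qed
  qed
qed

lemma traces: "\<exists>c. edge_traces a b k \<theta> \<sigma> f (\<lambda>n y. \<beta> n y - plane_wave k \<theta> (x n) y) c"
proof -
  obtain c where c: "c > 0" "\<And>n. edecay c (\<lambda>y. \<beta> n y - plane_wave k \<theta> (x n) y)" using trace_decay by blast
  have "edge_traces a b k \<theta> \<sigma> f (\<lambda>n y. \<beta> n y - plane_wave k \<theta> (x n) y) c"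
  proof (unfold_locales)
    show "\<beta> n y - plane_wave k \<theta> (x n) y = edge_sign \<sigma> y * f n y - plane_wave k \<theta> (x n) y" for n y by (simp add: \<beta>_eq)
    show "f (n + 1) = conv (gauss (gauss_rate k (gap a b n))) (\<lambda>y. edge_sign \<sigma> y * f n y)" for n by (rule f_step)
    show "\<beta> (n + 2) y - plane_wave k \<theta> (x (n + 2)) y = exp (- \<i> * k * of_real a * \<theta>\<^sup>2 / 2) * (\<beta> n y - plane_wave k \<theta> (x n) y)" for n y
      unfolding edge_plus_2 plane_wave_floquet \<beta>_def using V_floquet[of y "x n"] by (simp add: right_diff_distrib edge_plus_2)
  qed (use ab k real inc \<sigma> c in auto)
  then show ?thesis by blast
qed

end

section \<open>The embedding formula\<close>

text \<open>
  Edges to the right of the observation point do not contribute, so the bilateral sum is a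
  one-sided one.
\<close>

lemma sums_bilateralI:
  assumes zero: "\<And>n. n > m \<Longrightarrow> t n = 0"
    and lim: "(\<lambda>N. t m + (\<Sum>i<N. t (m - 1 - int i))) \<longlonglongrightarrow> S"
  shows "sums_bilateral t S"
proof -
  define \<phi> where "\<phi> N = t m + (\<Sum>i<N. t (m - 1 - int i))" for N
  have sum_eq: "(\<Sum>n\<in>{- int M..int N}. t n) = \<phi> (nat (int M + m))" if M: "int M + m \<ge> 0" and N: "int N \<ge> m" for M N
  proof -
    have "(\<Sum>n\<in>{- int M..int N}. t n) = (\<Sum>n\<in>{- int M..m}. t n)"
      by (rule sum.mono_neutral_right) (use zero N in auto)
    also have "{- int M..m} = insert m {- int M..<m}" using M by auto
    also have "(\<Sum>n\<in>insert m {- int M..<m}. t n) = t m + (\<Sum>n\<in>{- int M..<m}. t n)" by simp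
    also have "(\<Sum>n\<in>{- int M..<m}. t n) = (\<Sum>i<nat (int M + m). t (m - 1 - int i))"
      by (rule sum.reindex_bij_witness[of _ "\<lambda>i. m - 1 - int i" "\<lambda>n. nat (m - 1 - n)"]) (use M in auto)
    finally show ?thesis by (simp add: \<phi>_def)
  qed
  have "filterlim (\<lambda>M. nat (int M + m)) sequentially sequentially"
    unfolding filterlim_at_top
  proof
    fix Z :: nat
    show "\<forall>\<^sub>F M in sequentially. Z \<le> nat (int M + m)"
      by (rule eventually_sequentiallyI[of "nat (int Z - m)"]) auto
  qed
  from filterlim_compose[OF this filterlim_fst]
  have "filterlim (\<lambda>p. nat (int (fst p) + m)) sequentially (sequentially \<times>\<^sub>F (sequentially :: nat filter))" .
  from filterlim_compose[OF lim this]
  have "((\<lambda>p. \<phi> (nat (int (fst p) + m))) \<longlongrightarrow> S) (sequentially \<times>\<^sub>F (sequentially :: nat filter))"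
    unfolding \<phi>_def .
  moreover have "\<forall>\<^sub>F p in sequentially \<times>\<^sub>F sequentially. \<phi> (nat (int (fst p) + m)) = (case p of (M, N) \<Rightarrow> \<Sum>n\<in>{- int M..int N}. t n)"
  proof -
    have "\<forall>\<^sub>F M in sequentially. int M + m \<ge> 0" by (rule eventually_sequentiallyI[of "nat (- m)"]) auto
    moreover have "\<forall>\<^sub>F N in sequentially. int N \<ge> m" by (rule eventually_sequentiallyI[of "nat m"]) auto
    ultimately have "\<forall>\<^sub>F p in sequentially \<times>\<^sub>F sequentially. int (fst p) + m \<ge> 0 \<and> int (snd p) \<ge> m"
      by (rule eventually_prodI[THEN eventually_mono]) (auto)
    then show ?thesis by eventually_elim (auto simp: sum_eq split: prod.split)
  qed
  ultimately show ?thesis unfolding sums_bilateral_def by (rule Lim_transform_eventually)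
qed

lemma of_real_sgn: "complex_of_real (sgn y) = edge_sign (-1) y"
  by (simp add: edge_sign_def sgn_if)

locale odd_traces = edge_traces a b k \<theta> "-1" f r c for a b k \<theta> f r c
begin

lemma strip_field_Suc:
  assumes "X > edge a b (n + int j + 1)" and g: "\<And>y. strip_field a b k n j (edge a b (n + int j + 1)) y = g n j y"
  shows "strip_field a b k n (Suc j) X y = conv (gauss (gauss_rate k (X - edge a b (n + int j + 1)))) (\<lambda>y. s y * g n j y) y"
  using assms by (simp add: conv_def green_eq_gauss of_real_sgn mult_ac)

lemma strip_field_edge: "strip_field a b k n j (edge a b (n + int j + 1)) y = g n j y"
proof (induction j arbitrary: y)
  case 0
  show ?case using gap_pos[of n] by (simp add: green_eq_gauss g_0 \<alpha>_def gap_def)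
next
  case (Suc j)
  have i: "n + int (Suc j) + 1 = (n + int j + 1) + 1" by simp
  have gp: "edge a b (n + int (Suc j) + 1) - edge a b (n + int j + 1) = gap a b (n + int j + 1)"
    unfolding i gap_def ..
  have "edge a b (n + int (Suc j) + 1) > edge a b (n + int j + 1)"
    using gap_pos[of "n + int j + 1"] gp by simp
  from strip_field_Suc[OF this Suc.IH] show ?case unfolding gp g_Suc \<alpha>_def .
qed

lemma edge_green_strip:
  assumes X: "edge a b m < X" "X < edge a b (m + 1)"
  shows "n > m \<Longrightarrow> edge_green a b k n X y 1 = 0"
    "edge_green a b k m X y 1 = gauss (gauss_rate k (X - edge a b m)) y"
    "edge_green a b k (m - 1 - int i) X y 1 = conv (gauss (gauss_rate k (X - edge a b m))) (\<lambda>y. s y * g (m - 1 - int i) i y) y"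
proof -
  have st: "strip_of a b X = m" by (rule strip_of_eq[OF ab]) (use X in auto)
  have lt: "\<not> X < edge a b n" if "n \<le> m" for n using edge_mono[OF ab that] X by linarith
  show "edge_green a b k n X y 1 = 0" if "n > m"
    using edge_mono[OF ab, of "m + 1" n] that X by (simp add: edge_green_def)
  show "edge_green a b k m X y 1 = gauss (gauss_rate k (X - edge a b m)) y"
    using lt[of m] X by (simp add: edge_green_def st Let_def green_eq_gauss)
  let ?n = "m - 1 - int i"
  have e: "?n + int i + 1 = m" by simp
  have j: "nat (m - ?n) = Suc i" by simp
  have "edge_green a b k ?n X y 1 = strip_field a b k ?n (Suc i) X y"
    using lt[of ?n] X unfolding edge_green_def Let_def st j by simp
  also have "\<dots> = conv (gauss (gauss_rate k (X - edge a b m))) (\<lambda>y. s y * g ?n i y) y"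
    using strip_field_Suc[of ?n i X, unfolded e, OF X(1)] strip_field_edge[of ?n i, unfolded e] by blast
  finally show "edge_green a b k ?n X y 1 = conv (gauss (gauss_rate k (X - edge a b m))) (\<lambda>y. s y * g ?n i y) y" .
qed

text \<open>
  At x = x_m the value stands for the limit from the right, which carries the sign s; the source
  at x_m itself has not yet radiated.
\<close>

lemma edge_green_edge:
  shows "n > m \<Longrightarrow> edge_green a b k n (edge a b m) y 1 = 0"
    "edge_green a b k m (edge a b m) y 1 = 0"
    "edge_green a b k (m - 1 - int i) (edge a b m) y 1 = s y * g (m - 1 - int i) i y"
proof -
  have st: "strip_of a b (edge a b m) = m"
    by (rule strip_of_eq[OF ab order_refl]) (use edge_strict_mono[OF ab, of m "m + 1"] in simp)
  have lt: "\<not> edge a b m < edge a b n" if "n \<le> m" for n using edge_mono[OF ab that] by linarith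
  show "edge_green a b k n (edge a b m) y 1 = 0" if "n > m"
    using edge_strict_mono[OF ab that] by (simp add: edge_green_def)
  show "edge_green a b k m (edge a b m) y 1 = 0" by (simp add: edge_green_def st Let_def edge_trace_def)
  let ?n = "m - 1 - int i"
  have e: "?n + int i + 1 = m" "?n + int (Suc i) = m" by simp_all
  have j: "nat (m - ?n) = Suc i" by simp
  have "edge_green a b k ?n (edge a b m) y 1 = edge_trace a b k ?n (Suc i) y"
    using lt[of ?n] unfolding edge_green_def Let_def st j by simp
  also have "\<dots> = s y * strip_field a b k ?n i (edge a b m) y"
    unfolding edge_trace_def e(2) by (simp add: of_real_sgn)
  also have "\<dots> = s y * g ?n i y" using strip_field_edge[of ?n i y] unfolding e(1) by simp
  finally show "edge_green a b k ?n (edge a b m) y 1 = s y * g ?n i y" .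
qed

lemma e_0: "e n 0 = exp (- \<i> * k * of_real (edge a b n) * \<theta>\<^sup>2 / 2)"
  by (simp add: e_def plane_wave_def)

text \<open>
  Both sides are limits of the same partial sums: the phase times the m-th summand of V_(1-n) is
  - 2 J n m, because x_(1-n) = b - x_n turns distances from the edge 1 - n to the right into
  distances from the edge n to the left.
\<close>

lemma directivity_eq: "exp (- \<i> * k * of_real (edge a b n) * \<theta>\<^sup>2 / 2) * directivity a b k (1 - n) \<theta> = f n 0"
proof -
  define T where "T j = (let m = (1 - n) + 1 + int j
     in exp (\<i> * k * of_real (edge a b m - edge a b (1 - n)) * \<theta>\<^sup>2 / 2)
        * (LINT y:{..0}|lborel. edge_green a b k (1 - n) (edge a b m) y 1 * exp (- \<i> * k * \<theta> * of_real y)))" for j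
  have dir: "directivity a b k (1 - n) \<theta> = 1 + 2 * suminf T"
    unfolding directivity_def T_def ..
  have e0: "e n 0 \<noteq> 0" unfolding e_0 by simp
  have T: "e n 0 * T j = - J n j" for j
  proof -
    define m where "m = (1 - n) + 1 + int j"
    have m1: "m - 1 - int j = 1 - n" by (simp add: m_def)
    have m2: "m = 1 - (n - 1 - int j)" by (simp add: m_def)
    have diff: "edge a b m - edge a b (1 - n) = edge a b n - edge a b (n - 1 - int j)"
      unfolding m2 edge_reflect by simp
    have "T j = exp (\<i> * k * of_real (edge a b n - edge a b (n - 1 - int j)) * \<theta>\<^sup>2 / 2)
        * (LINT y:{..0}|lborel. edge_green a b k (1 - n) (edge a b m) y 1 * exp (- \<i> * k * \<theta> * of_real y))"
      unfolding T_def Let_def m_def[symmetric] diff ..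
    also have "(LINT y:{..0}|lborel. edge_green a b k (1 - n) (edge a b m) y 1 * exp (- \<i> * k * \<theta> * of_real y)) =
       (LINT y:{..<0}|lborel. - (g (1 - n) j y * exp (- \<i> * k * \<theta> * of_real y)))"
      unfolding set_lebesgue_integral_def
    proof (rule integral_cong_AE)
      have eg: "edge_green a b k (1 - n) (edge a b m) y 1 = s y * g (1 - n) j y" for y
        using edge_green_edge(3)[of m j y] unfolding m1 .
      have [measurable]: "g (1 - n) j \<in> borel_measurable borel" using edecay_measurable[OF g_edecay] .
      show "(\<lambda>y. indicator {..0} y *\<^sub>R (edge_green a b k (1 - n) (edge a b m) y 1 * exp (- \<i> * k * \<theta> * of_real y))) \<in> borel_measurable lborel"
        unfolding eg by measurable
      show "(\<lambda>y. indicator {..<0} y *\<^sub>R (- (g (1 - n) j y * exp (- \<i> * k * \<theta> * of_real y)))) \<in> borel_measurable lborel"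
        by measurable
      show "AE y in lborel. indicator {..0} y *\<^sub>R (edge_green a b k (1 - n) (edge a b m) y 1 * exp (- \<i> * k * \<theta> * of_real y)) =
         indicator {..<0} y *\<^sub>R (- (g (1 - n) j y * exp (- \<i> * k * \<theta> * of_real y)))"
        unfolding eg using AE_lborel_singleton[of 0] by eventually_elim (auto simp: edge_sign_def split: split_indicator)
    qed
    finally have TT: "T j = exp (\<i> * k * of_real (edge a b n - edge a b (n - 1 - int j)) * \<theta>\<^sup>2 / 2)
        * (LINT y:{..<0}|lborel. - (g (1 - n) j y * exp (- \<i> * k * \<theta> * of_real y)))" .
    have "e n 0 * T j = (LINT y:{..<0}|lborel. e n 0 * (exp (\<i> * k * of_real (edge a b n - edge a b (n - 1 - int j)) * \<theta>\<^sup>2 / 2)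
        * - (g (1 - n) j y * exp (- \<i> * k * \<theta> * of_real y))))"
      unfolding TT set_lebesgue_integral_def mult_scaleR_right[symmetric] integral_mult_right_zero ..
    also have "\<dots> = (LINT y:{..<0}|lborel. - (g (1 - n) j y * e (n - 1 - int j) y))"
    proof -
      have rearrange: "p * (q * - (r * t)) = - (r * (p * q * t))" for p q r t :: complex by (simp add: mult_ac)
      have "e n 0 * exp (\<i> * k * of_real (edge a b n - edge a b (n - 1 - int j)) * \<theta>\<^sup>2 / 2) * exp (- \<i> * k * \<theta> * of_real y) = e (n - 1 - int j) y" for y
        unfolding e_def plane_wave_def exp_add[symmetric] by (rule arg_cong[where f = exp]) (simp add: field_simps)
      then have "e n 0 * (exp (\<i> * k * of_real (edge a b n - edge a b (n - 1 - int j)) * \<theta>\<^sup>2 / 2)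
        * - (g (1 - n) j y * exp (- \<i> * k * \<theta> * of_real y))) = - (g (1 - n) j y * e (n - 1 - int j) y)" for y
        unfolding rearrange by (simp only:)
      then show ?thesis by (simp only:)
    qed
    also have "\<dots> = - J n j" unfolding J_def set_lebesgue_integral_def by simp
    finally show ?thesis .
  qed
  have "(\<lambda>N. e n 0 - (1 - (-1)) * (\<Sum>j<N. J n j)) \<longlonglongrightarrow> f n 0" by (rule amplitude_sums)
  moreover have "e n 0 - (1 - (-1)) * (\<Sum>j<N. J n j) = e n 0 + 2 * (e n 0 * (\<Sum>j<N. T j))" for N
    unfolding sum_distrib_left[of "e n 0"] T by (simp add: sum_negf)
  ultimately have lim: "(\<lambda>N. e n 0 + 2 * (e n 0 * (\<Sum>j<N. T j))) \<longlonglongrightarrow> f n 0" by (simp only:)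
  have "(\<lambda>N. (e n 0 + 2 * (e n 0 * (\<Sum>j<N. T j)) - e n 0) / (2 * e n 0)) \<longlonglongrightarrow> (f n 0 - e n 0) / (2 * e n 0)"
    by (intro tendsto_divide tendsto_diff lim tendsto_const) (use e0 in simp)
  then have "T sums ((f n 0 - e n 0) / (2 * e n 0))" unfolding sums_def using e0 by simp
  then have "suminf T = (f n 0 - e n 0) / (2 * e n 0)" by (rule sums_unique[symmetric])
  then show ?thesis unfolding dir e_0[symmetric] using e0 by (simp add: field_simps)
qed

end

context diffraction begin

sublocale even: sheet_combination a b k \<theta> u 1 by unfold_locales simp
sublocale odd: sheet_combination a b k \<theta> u "-1" by unfold_locales simp

end

context sheet_combination begin

lemma V_deriv_strip:
  assumes c: "edge_traces a b k \<theta> \<sigma> f (\<lambda>n y. \<beta> n y - plane_wave k \<theta> (x n) y) c"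
    and X: "x m < X" "X < x (m + 1)"
  defines "K \<equiv> gauss_rate k (X - x m)" and "r \<equiv> \<lambda>y. \<beta> m y - plane_wave k \<theta> (x m) y"
  shows "\<exists>D. (V X has_vector_derivative D) (at y) \<and> D + \<i> * k * \<theta> * V X y = conv (gauss' K) r y + \<i> * k * \<theta> * conv (gauss K) r y"
proof -
  interpret edge_traces a b k \<theta> \<sigma> f "\<lambda>n y. \<beta> n y - plane_wave k \<theta> (x n) y" c by (rule c)
  have t: "X - x m > 0" using X by simp
  have K: "Re K > 0" unfolding K_def by (rule Re_gauss_rate_pos[OF k t])
  have rd: "edecay c r" unfolding r_def by (rule r_decay)
  have V: "V X = (\<lambda>y. conv (gauss K) r y + plane_wave k \<theta> X y)"
  proof
    fix y
    have "V X y = conv (gauss K) (\<lambda>y. r y + e m y) y"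
      using V_representation[OF X, of y] by (simp add: K_def r_def e_def)
    also have "\<dots> = conv (gauss K) r y + conv (gauss K) (e m) y"
      by (rule conv_add[OF rapid_gauss[OF K] rd e_edecay])
    also have "conv (gauss K) (e m) y = plane_wave k \<theta> X y"
      unfolding K_def e_def using conv_plane_wave[OF k real _ t, of "x m" y] inc by simp
    finally show "V X y = conv (gauss K) r y + plane_wave k \<theta> X y" .
  qed
  have "(plane_wave k \<theta> X has_vector_derivative (- \<i> * k * \<theta>) * plane_wave k \<theta> X y) (at y)"
    by (rule parabolic_onD(2)[OF plane_wave_parabolic[OF k0, of UNIV]]) simp
  from has_vector_derivative_add[OF conv_gauss_has_vector_derivative[OF K rd] this]
  have "(V X has_vector_derivative conv (gauss' K) r y + (- \<i> * k * \<theta>) * plane_wave k \<theta> X y) (at y)" unfolding V .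
  moreover have "conv (gauss' K) r y + (- \<i> * k * \<theta>) * plane_wave k \<theta> X y + \<i> * k * \<theta> * V X y = conv (gauss' K) r y + \<i> * k * \<theta> * conv (gauss K) r y"
    unfolding V by (simp add: algebra_simps)
  ultimately show ?thesis by blast
qed

lemma V_deriv_edge:
  assumes c: "edge_traces a b k \<theta> \<sigma> f (\<lambda>n y. \<beta> n y - plane_wave k \<theta> (x n) y) c" and y: "y \<noteq> 0"
  shows "\<exists>D. (V (x m) has_vector_derivative D) (at y) \<and>
    D + \<i> * k * \<theta> * V (x m) y = edge_sign \<sigma> y * edge_traces.h a b k \<theta> (\<lambda>n y. \<beta> n y - plane_wave k \<theta> (x n) y) m y"
proof -
  interpret edge_traces a b k \<theta> \<sigma> f "\<lambda>n y. \<beta> n y - plane_wave k \<theta> (x n) y" c by (rule c)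
  have V: "V (x m) z = edge_sign \<sigma> z * f m z" if "z \<noteq> 0" for z using fun_cong[OF \<beta>_eq[of m], of z] that by (simp add: \<beta>_def)
  have "((\<lambda>z. edge_sign \<sigma> y * f m z) has_vector_derivative edge_sign \<sigma> y * (h m y - \<i> * k * \<theta> * f m y)) (at y)"
    by (rule has_vector_derivative_mult_right[OF f_deriv])
  then have "(V (x m) has_vector_derivative edge_sign \<sigma> y * (h m y - \<i> * k * \<theta> * f m y)) (at y)"
  proof (rule has_vector_derivative_transform_within_open)
    show "open {z. z * y > 0}" by (intro open_Collect_less continuous_intros)
    show "y \<in> {z. z * y > 0}" using y by (cases "y > 0") (auto simp: zero_less_mult_iff)
    fix z assume "z \<in> {z. z * y > 0}"
    then show "edge_sign \<sigma> y * f m z = V (x m) z" by (subst V) (auto simp: edge_sign_def zero_less_mult_iff)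
  qed
  moreover have "edge_sign \<sigma> y * (h m y - \<i> * k * \<theta> * f m y) + \<i> * k * \<theta> * V (x m) y = edge_sign \<sigma> y * h m y"
    unfolding V[OF y] by (simp add: algebra_simps)
  ultimately show ?thesis by blast
qed

end

context diffraction begin

text \<open>
  u is half the sum of the even and \<plusminus> the odd combination, and H annihilates the even
  one.
\<close>

lemma H_op_combine:
  assumes E: "(even.V X has_vector_derivative D1) (at y)" "D1 + \<i> * k * \<theta> * even.V X y = 0"
    and O: "(odd.V X has_vector_derivative D2) (at y)" and \<nu>: "\<nu> \<in> {1, 2}"
  shows "H_op k \<theta> u X y \<nu> = (- 1) ^ (\<nu> - 1) * ((D2 + \<i> * k * \<theta> * odd.V X y) / 2)"
proof -
  define z :: complex where "z = (- 1) ^ (\<nu> - 1)"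
  have u: "u X t \<nu> = (even.V X t + z * odd.V X t) / 2" for t
    using \<nu> by (auto simp: even.V_def odd.V_def z_def)
  have "((\<lambda>t. (even.V X t + z * odd.V X t) / 2) has_vector_derivative (D1 + z * D2) / 2) (at y)"
    using has_vector_derivative_mult_right[OF has_vector_derivative_add[OF E(1) has_vector_derivative_mult_right[OF O, of z]], of "1/2"]
    by simp
  then have "dy (\<lambda>X t. u X t \<nu>) X y = (D1 + z * D2) / 2"
    unfolding dy_def u by (rule vector_derivative_at)
  then have "H_op k \<theta> u X y \<nu> = ((D1 + \<i> * k * \<theta> * even.V X y) + z * (D2 + \<i> * k * \<theta> * odd.V X y)) / 2"
    unfolding H_op_def u by (simp add: algebra_simps add_divide_distrib)
  then show ?thesis unfolding E(2) z_def by simp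
qed

lemma edge_green_sheet: "edge_green a b k n X y \<nu> = (- 1) ^ (\<nu> - 1) * edge_green a b k n X y 1"
  by (simp add: edge_green_def)

lemma embedding:
  assumes nb: "(X, y) \<notin> branch_points a b" and \<nu>: "\<nu> \<in> {1, 2}"
  shows "sums_bilateral (\<lambda>n. exp (- \<i> * k * of_real (x n) * \<theta>\<^sup>2 / 2) * directivity a b k (1 - n) \<theta> * edge_green a b k n X y \<nu>)
     (H_op k \<theta> u X y \<nu>)"
proof -
  obtain m where m: "x m \<le> X" "X < x (m + 1)" using ex_strip[OF ab] by blast
  obtain c1 where T1: "edge_traces a b k \<theta> 1 even.f (\<lambda>n y. even.\<beta> n y - plane_wave k \<theta> (x n) y) c1" using even.traces by blast
  obtain c2 where T2: "edge_traces a b k \<theta> (-1) odd.f (\<lambda>n y. odd.\<beta> n y - plane_wave k \<theta> (x n) y) c2" using odd.traces by blast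
  interpret ev: edge_traces a b k \<theta> 1 even.f "\<lambda>n y. even.\<beta> n y - plane_wave k \<theta> (x n) y" c1 by (rule T1)
  interpret od: odd_traces a b k \<theta> odd.f "\<lambda>n y. odd.\<beta> n y - plane_wave k \<theta> (x n) y" c2
    unfolding odd_traces_def by (rule T2)
  define w where "w n = edge_green a b k n X y 1" for n
  define z :: complex where "z = (- 1) ^ (\<nu> - 1)"
  obtain D1 D2 where D1: "(even.V X has_vector_derivative D1) (at y)" "D1 + \<i> * k * \<theta> * even.V X y = 0"
    and D2: "(odd.V X has_vector_derivative D2) (at y)"
    and w0: "\<And>n. n > m \<Longrightarrow> w n = 0"
    and lim: "(\<lambda>N. odd.f m 0 * w m + (\<Sum>i<N. odd.f (m - 1 - int i) 0 * w (m - 1 - int i))) \<longlonglongrightarrow> (D2 + \<i> * k * \<theta> * odd.V X y) / 2"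
  proof (cases "X = x m")
    case False
    then have X: "x m < X" "X < x (m + 1)" using m by auto
    have t: "X - x m > 0" using X by simp
    obtain D1 where D1: "(even.V X has_vector_derivative D1) (at y)"
      and D1': "D1 + \<i> * k * \<theta> * even.V X y = conv (gauss' (gauss_rate k (X - x m))) (\<lambda>y. even.\<beta> m y - plane_wave k \<theta> (x m) y) y
          + \<i> * k * \<theta> * conv (gauss (gauss_rate k (X - x m))) (\<lambda>y. even.\<beta> m y - plane_wave k \<theta> (x m) y) y"
      using even.V_deriv_strip[OF T1 X] by blast
    obtain D2 where D2: "(odd.V X has_vector_derivative D2) (at y)"
      and D2': "D2 + \<i> * k * \<theta> * odd.V X y = conv (gauss' (gauss_rate k (X - x m))) (\<lambda>y. odd.\<beta> m y - plane_wave k \<theta> (x m) y) y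
          + \<i> * k * \<theta> * conv (gauss (gauss_rate k (X - x m))) (\<lambda>y. odd.\<beta> m y - plane_wave k \<theta> (x m) y) y"
      using odd.V_deriv_strip[OF T2 X] by blast
    have L0: "(\<lambda>N. 0) \<longlonglongrightarrow> D1 + \<i> * k * \<theta> * even.V X y" using ev.field_sums[OF t, of m y] unfolding D1' by simp
    have E0: "D1 + \<i> * k * \<theta> * even.V X y = 0" by (rule LIMSEQ_unique[OF L0 tendsto_const])
    note eg = od.edge_green_strip[OF X]
    have "(\<lambda>N. ((1 - (-1)) * odd.f m 0 * gauss (gauss_rate k (X - x m)) y +
      (\<Sum>i<N. (1 - (-1)) * odd.f (m - 1 - int i) 0 * conv (gauss (gauss_rate k (X - x m))) (\<lambda>y. od.s y * od.g (m - 1 - int i) i y) y)) / 2)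
      \<longlonglongrightarrow> (D2 + \<i> * k * \<theta> * odd.V X y) / 2"
      unfolding D2' by (intro tendsto_divide od.field_sums[OF t] tendsto_const) simp
    moreover have "((1 - (-1)) * odd.f m 0 * gauss (gauss_rate k (X - x m)) y +
      (\<Sum>i<N. (1 - (-1)) * odd.f (m - 1 - int i) 0 * conv (gauss (gauss_rate k (X - x m))) (\<lambda>y. od.s y * od.g (m - 1 - int i) i y) y)) / 2 =
      odd.f m 0 * w m + (\<Sum>i<N. odd.f (m - 1 - int i) 0 * w (m - 1 - int i))" for N
      unfolding w_def eg(2,3) by (simp add: add_divide_distrib sum_divide_distrib)
    ultimately have L: "(\<lambda>N. odd.f m 0 * w m + (\<Sum>i<N. odd.f (m - 1 - int i) 0 * w (m - 1 - int i))) \<longlonglongrightarrow> (D2 + \<i> * k * \<theta> * odd.V X y) / 2"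
      by (simp only:)
    have w0: "w n = 0" if "n > m" for n unfolding w_def by (rule eg(1)[OF that])
    show thesis by (rule that[OF D1 E0 D2 w0 L])
  next
    case True
    then have y: "y \<noteq> 0" using nb by (auto simp: not_branch)
    obtain D1 where D1: "(even.V X has_vector_derivative D1) (at y)"
      and D1': "D1 + \<i> * k * \<theta> * even.V X y = edge_sign 1 y * ev.h m y"
      using even.V_deriv_edge[OF T1 y, of m] True by blast
    obtain D2 where D2: "(odd.V X has_vector_derivative D2) (at y)"
      and D2': "D2 + \<i> * k * \<theta> * odd.V X y = edge_sign (-1) y * od.h m y"
      using odd.V_deriv_edge[OF T2 y, of m] True by blast
    have L0: "(\<lambda>N. 0) \<longlonglongrightarrow> ev.h m y" using ev.h_sums[of m y] by simp
    have "ev.h m y = 0" by (rule LIMSEQ_unique[OF L0 tendsto_const])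
    then have E0: "D1 + \<i> * k * \<theta> * even.V X y = 0" unfolding D1' by simp
    have "(\<lambda>N. edge_sign (-1) y * (\<Sum>i<N. (1 - (-1)) * odd.f (m - 1 - int i) 0 * od.g (m - 1 - int i) i y) / 2)
      \<longlonglongrightarrow> (D2 + \<i> * k * \<theta> * odd.V X y) / 2"
      unfolding D2' by (intro tendsto_divide tendsto_mult od.h_sums tendsto_const) simp
    moreover have "edge_sign (-1) y * (\<Sum>i<N. (1 - (-1)) * odd.f (m - 1 - int i) 0 * od.g (m - 1 - int i) i y) / 2 =
      odd.f m 0 * w m + (\<Sum>i<N. odd.f (m - 1 - int i) 0 * w (m - 1 - int i))" for N
      unfolding w_def True od.edge_green_edge(2,3)
      by (simp add: sum_distrib_left sum_divide_distrib mult_ac)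
    ultimately have L: "(\<lambda>N. odd.f m 0 * w m + (\<Sum>i<N. odd.f (m - 1 - int i) 0 * w (m - 1 - int i))) \<longlonglongrightarrow> (D2 + \<i> * k * \<theta> * odd.V X y) / 2"
      by (simp only:)
    have w0: "w n = 0" if "n > m" for n unfolding w_def True by (rule od.edge_green_edge(1)[OF that])
    show thesis by (rule that[OF D1 E0 D2 w0 L])
  qed
  have H: "H_op k \<theta> u X y \<nu> = z * ((D2 + \<i> * k * \<theta> * odd.V X y) / 2)"
    unfolding z_def by (rule H_op_combine[OF D1 D2 \<nu>])
  have t: "exp (- \<i> * k * of_real (x n) * \<theta>\<^sup>2 / 2) * directivity a b k (1 - n) \<theta> * edge_green a b k n X y \<nu> = z * (odd.f n 0 * w n)" for n
    unfolding od.directivity_eq edge_green_sheet[of n X y \<nu>] w_def z_def by (simp add: mult_ac)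
  show ?thesis
    unfolding t H
  proof (rule sums_bilateralI[of m])
    show "z * (odd.f n 0 * w n) = 0" if "n > m" for n using w0[OF that] by simp
    have "(\<lambda>N. z * (odd.f m 0 * w m + (\<Sum>i<N. odd.f (m - 1 - int i) 0 * w (m - 1 - int i)))) \<longlonglongrightarrow> z * ((D2 + \<i> * k * \<theta> * odd.V X y) / 2)"
      by (intro tendsto_mult tendsto_const lim)
    then show "(\<lambda>N. z * (odd.f m 0 * w m) + (\<Sum>i<N. z * (odd.f (m - 1 - int i) 0 * w (m - 1 - int i)))) \<longlonglongrightarrow> z * ((D2 + \<i> * k * \<theta> * odd.V X y) / 2)"
      by (simp add: distrib_left sum_distrib_left)
  qed
qed

lemma u_differentiable:
  assumes y: "y \<noteq> 0" and \<nu>: "\<nu> \<in> {1, 2}"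
  shows "\<exists>D. ((\<lambda>t. u X t \<nu>) has_vector_derivative D) (at y)"
proof -
  obtain m where m: "x m \<le> X" "X < x (m + 1)" using ex_strip[OF ab] by blast
  have "(X, y) \<in> chart_domain a b m" using m y edge_step[of m] by (auto simp: chart_domain_def)
  moreover obtain Fx Fy Fyy where "parabolic_on k (chart_domain a b m) (in_chart a b u m \<nu>) Fx Fy Fyy"
    using in_chart_parabolic[OF \<nu>] by blast
  ultimately have "(in_chart a b u m \<nu> X has_vector_derivative Fy X y) (at y)" by (rule parabolic_onD(2)[rotated])
  moreover have "in_chart a b u m \<nu> X = (\<lambda>t. u X t \<nu>)" using m by (auto simp: in_chart_def)
  ultimately show ?thesis by auto
qed

lemma H_scattered:
  assumes y: "y \<noteq> 0" and \<nu>: "\<nu> \<in> {1, 2}"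
  shows "H_op k \<theta> u X y \<nu> = H_op k \<theta> (scattered k \<theta> u) X y \<nu>"
proof -
  obtain D where D: "((\<lambda>t. u X t \<nu>) has_vector_derivative D) (at y)" using u_differentiable[OF y \<nu>] by blast
  define U where "U = - (\<i> * k * \<theta>) * u_inc k \<theta> X y \<nu>"
  have U: "((\<lambda>t. u_inc k \<theta> X t \<nu>) has_vector_derivative U) (at y)"
  proof (cases "\<nu> = 1 \<and> y > 0")
    case True
    have "(plane_wave k \<theta> X has_vector_derivative (- \<i> * k * \<theta>) * plane_wave k \<theta> X y) (at y)"
      by (rule parabolic_onD(2)[OF plane_wave_parabolic[OF k0, of UNIV]]) simp
    then have "(plane_wave k \<theta> X has_vector_derivative U) (at y)" using True by (simp add: U_def u_inc_eq)
    then show ?thesis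
      by (rule has_vector_derivative_transform_within_open[of _ _ _ "{0<..}"]) (use True in \<open>auto simp: u_inc_eq\<close>)
  next
    case False
    have "((\<lambda>t. 0) has_vector_derivative U) (at y)" using False by (auto simp: U_def u_inc_eq)
    then show ?thesis
    proof (rule has_vector_derivative_transform_within_open)
      show "open (if \<nu> = 1 then {..<0::real} else UNIV)" by simp
      show "y \<in> (if \<nu> = 1 then {..<0} else UNIV)" using False y by auto
    qed (auto simp: u_inc_eq split: if_splits)
  qed
  have "((\<lambda>t. scattered k \<theta> u X t \<nu>) has_vector_derivative D - U) (at y)"
    unfolding scattered_def by (rule has_vector_derivative_diff[OF D U])
  then show ?thesis
    unfolding H_op_def dy_def using vector_derivative_at[OF D] vector_derivative_at
    by (simp add: vector_derivative_at scattered_def U_def algebra_simps)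
qed

end

theorem mainTheorem4:
  fixes a b :: real and k \<theta> :: complex and u :: field
  assumes "0 < b" and "b < a"
    and "Re k > 0" and "Im k > 0"
    and "Re \<theta> > 0" and "k * \<theta>\<^sup>2 \<in> \<real>" and "Re (k * \<theta>\<^sup>2) > 0"
    and "\<forall>n. psi a k \<theta> n \<noteq> 0"
    and "total_field a b k \<theta> u"
  shows "\<forall>x y. \<forall>\<nu>\<in>{1, 2}. (x, y) \<notin> branch_points a b \<longrightarrow>
           (y \<noteq> 0 \<longrightarrow> H_op k \<theta> u x y \<nu> = H_op k \<theta> (scattered k \<theta> u) x y \<nu>) \<and>
           sums_bilateral
             (\<lambda>n. exp (- \<i> * k * of_real (edge a b n) * \<theta>\<^sup>2 / 2)
                  * directivity a b k (1 - n) \<theta> * edge_green a b k n x y \<nu>)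
             (H_op k \<theta> u x y \<nu>)"
proof -
  interpret diffraction a b k \<theta> u using assms by unfold_locales
  show ?thesis using H_scattered embedding by blast
qed

end
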